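(* Let the moment and boundedness assumptions of the context hold, let $Y\neq0$, and in mode (E) let the two samples be independent with $N_1/N\to\lambda\in(0,\infty]$. All limits are as $N\to\infty$. (a) $\hat K\to K$ almost surely and $\sqrt N(\hat K-K)\Rightarrow\mathcal N(0,\Sigma)$ with $\Sigma=GVG^{\top}$, where $G$ is the Jacobian of the moment map $\eta\mapsto F^{-1}Y$, given by $$dK=F^{-1}(dY-dF\,K),$$ with $dY=-du_0$, $dF=dC_0$ in mode (M), and $dY=du_1-du_0$, $dF=dC_0+dC_1$ in mode (E). With $dk_0=-\tfrac12(dK)^{\top}(u_0+u_1)-\tfrac12K^{\top}(du_0+du_1)$ (where $du_1=0$ in mode (M)), the pair $(\hat K,\hat k_0)$ is jointly asymptotically normal, $\sqrt N(\hat K-K,\hat k_0-k_0)\Rightarrow\mathcal N(0,\Sigma_{K,k_0})$ with $\Sigma_{K,k_0}=G_{(K,k_0)}VG_{(K,k_0)}^{\top}$, $G_{(K,k_0)}$ being the Jacobian of $\eta\mapsto(K,k_0)$. In mode (M) $\Sigma$ is a functional of the calibration sample's law alone; in mode (E) $\Sigma=\Sigma_0+\lambda^{-1}\Sigma_1$, the two terms coming from the two independent samples. (b) $$R(\hat K)=J(s)-(\hat K-K)^{\top}\Bigl(F-\frac{YY^{\top}}{J(s)}\Bigr)(\hat K-K)\,(1+o_p(1))=J(s)-O_p(N^{-1}).$$ Under the local-family assumption of the context with $B\neq0$, the same second-order expansion holds for the quotient $(\mathbf k^{\top}B)^2/(I\,\mathbf k^{\top}C_0\mathbf k)$, whose maximum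 over $\mathbf k\ne0$ is $\kappa(\Phi)=B^{\top}C_0^{-1}B/I$, about its maximiser $\mathbf k^*=C_0^{-1}B$: for $\mathbf k=\mathbf k^*+\mathbf d$, $\mathbf d\to0$, it equals $\kappa(\Phi)-I^{-1}\mathbf d^{\top}\bigl(C_0-BB^{\top}/(B^{\top}C_0^{-1}B)\bigr)\mathbf d\,(1+o(1))$. If $D_{\mathrm{KL}}(f_1\|f_0)<\infty$, the efficiency satisfies $$e(\hat K,\hat k_0)-e(K,k_0)=\nabla e^{\top}\begin{pmatrix}\hat K-K\\ \hat k_0-k_0\end{pmatrix}+O_p(N^{-1}),\qquad \nabla e=\frac{\theta_0}{D_{\mathrm{KL}}(f_1\|f_0)}\left[\begin{pmatrix}u_1\\1\end{pmatrix}-\frac{\mathbb E_1\Lambda^{(s)}}{\tilde{\mathbb E}_0\Lambda^{(s)}}\begin{pmatrix}\tilde{\mathbb E}_0\varphi\\1\end{pmatrix}\right].$$ The gradient $\nabla e$ vanishes if and only if $\tilde{\mathbb E}_0\varphi=u_1$ and $\tilde{\mathbb E}_0\Lambda^{(s)}=\mathbb E_1\Lambda^{(s)}$; this holds when $\theta_0\Lambda^{(s)}=\ell$, where $\ell=\ln(f_1/f_0)$, but not in general, so $e(\hat K,\hat k_0)-e(K,k_0)=O_p(N^{-1/2})$, with asymptotic variance (after scaling by $\sqrt N$) $\nabla e^{\top}\Sigma_{K,k_0}\nabla e$. (c) The relative standard error of the $s$-th diagonal entry of $\hat C_0$ (its standard deviation divided by $\mathrm{Var}_0\varphi_s$) is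 $\sqrt{(\gamma_4(\varphi_s)+2)/N}+O(N^{-1})$, where $\gamma_4(\varphi_s)$ is the excess kurtosis of $\varphi_s$ under $f_0$, which is finite. The leading term vanishes only when $\gamma_4(\varphi_s)=-2$, that is, when $\varphi_s$ takes two values with equal probability under $f_0$, and the error is then of order $N^{-1}$. (d) $\sqrt N(\hat J-J(s))\Rightarrow\mathcal N(0,\nabla J^{\top}V\nabla J)$ and $\sqrt N(\hat\theta_0-\theta_0)\Rightarrow\mathcal N(0,\nabla\theta_0^{\top}V\nabla\theta_0)$, where $\nabla J$ is the gradient of $\eta\mapsto J(s)$ obtained from $dJ=2K^{\top}dY-K^{\top}dF\,K$ composed with the mode-specific $dY,dF$ of (a), and $$\frac{\partial\theta_0}{\partial(K,k_0)}=-\frac{\theta_0}{\tilde{\mathbb E}_0[\Lambda^{(s)}]}\begin{pmatrix}\tilde{\mathbb E}_0\varphi\\1\end{pmatrix}^{\top},\qquad \nabla\theta_0=\Bigl(\frac{\partial\theta_0}{\partial(K,k_0)}\,G_{(K,k_0)}\Bigr)^{\top}-\frac{1}{\tilde{\mathbb E}_0[\Lambda^{(s)}]}\,\mathbf e,$$ with $\mathbf e$ the unit vector of the tilt coordinate $e^{\theta_0\Lambda^{(s)}}-1$ of $Z_0$. Writing $g_i=G_{(K,k_0)}^{(i)\top}(\tilde{\mathbb E}_0\varphi,1)^{\top}$ for the blocks $G^{(i)}_{(K,k_0)}$ of $G_{(K,k_0)}$ acting on the calibration-sample moments $(u_0,C_0)$ ($i=0$) and on the labelled-sample moments $(u_1,C_1)$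 ($i=1$), $Z_0^{-}$ for $Z_0$ with its tilt coordinate removed and $V_0^{-}=\mathrm{Cov}_0Z_0^{-}$, the limiting variance of $\sqrt N(\hat\theta_0-\theta_0)$ is $$\frac{1}{(\tilde{\mathbb E}_0\Lambda^{(s)})^2}\Bigl[\mathrm{Var}_0e^{\theta_0\Lambda^{(s)}}+2\theta_0\,g_0^{\top}\mathrm{Cov}_0\bigl(Z_0^{-},e^{\theta_0\Lambda^{(s)}}\bigr)+\theta_0^{2}\,g_0^{\top}V_0^{-}g_0\Bigr]+\frac{\theta_0^{2}}{\lambda(\tilde{\mathbb E}_0\Lambda^{(s)})^2}\,g_1^{\top}V_1g_1,$$ the last term being absent in mode (M).
   Context: $f_0,f_1$ are probability densities on $\mathbb R$; $\mathbb E_j,\mathrm{Var}_j,\mathrm{Cov}_j$ refer to one observation $x$ with density $f_j$, $j=0,1$. Dictionary $\Phi$: a vector $\varphi=(\varphi_1,\dots,\varphi_s)^{\top}$ of real functions. $u_j=\mathbb E_j\varphi$, $C_j=\mathrm{Cov}_j\varphi$, $F=C_0+C_1$, $Y=u_1-u_0$, $K=F^{-1}Y$, $k_0=-\tfrac12K^{\top}(u_0+u_1)$, $\Lambda^{(s)}(x)=k_0+K^{\top}\varphi(x)$, $J(s)=Y^{\top}F^{-1}Y=K^{\top}Y$. Moment assumption: every $\varphi_i$ has finite second moments under $f_0$ and $f_1$; $C_0$ is positive definite; $f_1$ vanishes wherever $f_0$ does. Boundedness assumption: there is $\varphi_{\max}<\infty$ with $|\varphi_i(x)|\le\varphi_{\max}$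 for all $i,x$. Tilt: $\theta_0$ is the unique positive root of $\mathbb E_0e^{\theta\Lambda^{(s)}}=1$ (it exists when $Y\ne0$ under these assumptions), and $\tilde{\mathbb E}_0h=\mathbb E_0[h\,e^{\theta_0\Lambda^{(s)}}]$. For a pair $(\mathbf k,c)$ near $(K,k_0)$, $e(\mathbf k,c)=\theta(\mathbf k,c)\,\mathbb E_1[c+\mathbf k^{\top}\varphi]/D_{\mathrm{KL}}(f_1\|f_0)$, where $\theta(\mathbf k,c)$ is the positive root of $\mathbb E_0e^{\theta(c+\mathbf k^{\top}\varphi)}=1$ and $D_{\mathrm{KL}}(f_1\|f_0)=\int f_1\ln(f_1/f_0)$; $\nabla e$ is its gradient at $(K,k_0)$. $R(\mathbf k)=(\mathbf k^{\top}Y)^2/(\mathbf k^{\top}F\mathbf k)$. Estimators: $x_1,\dots,x_N$ is an i.i.d. calibration sample from $f_0$; $\hat u_0,\hat C_0$ are the sample mean and sample covariance of $\varphi$ on it. Mode (M): $(\hat u_1,\hat C_1)=(u_1,C_1)$ is known exactly. Mode (E): $(\hat u_1,\hat C_1)$ are the sample mean and covariance of $\varphi$ on an independent i.i.d. sample of size $N_1$ from $f_1$. $\hat F=\hat C_0+\hat C_1$, $\hat Y=\hat u_1-\hat u_0$, $\hat K=\hat F^{-1}\hat Y$, $\hat k_0=-\tfrac12\hat K^{\top}(\hat u_0+\hat u_1)$, $\hat\Lambda=\hat k_0+\hat K^{\top}\varphi$, $\hat J=\hat K^{\top}\hat Y$, and $\hat\theta_0$ is the positive root of $N^{-1}\sum_{j\le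 N}\exp(\theta\hat\Lambda(x_j))=1$. (On events where one of these is undefined, it is given an arbitrary value.) Covariances: with $\tilde\varphi=\varphi-u_0$ under $f_0$ and $\tilde\varphi_1=\varphi-u_1$ under $f_1$, $Z_0=(\tilde\varphi,\ \mathrm{vech}(\tilde\varphi\tilde\varphi^{\top}-C_0),\ e^{\theta_0\Lambda^{(s)}}-1)$, $Z_1=(\tilde\varphi_1,\ \mathrm{vech}(\tilde\varphi_1\tilde\varphi_1^{\top}-C_1))$, $V_0=\mathrm{Cov}_0Z_0$, $V_1=\mathrm{Cov}_1Z_1$; $V=V_0$ in mode (M) and $V=\mathrm{diag}(V_0,\lambda^{-1}V_1)$ in mode (E), with $\lambda^{-1}=0$ if $\lambda=\infty$. The estimated moment vector is $\eta=(u_0,C_0)$ in mode (M) and $\eta=(u_0,C_0,u_1,C_1)$ in mode (E) (symmetric matrices in vech coordinates). Jacobians and gradients with respect to $\eta$ (namely $G$, $G_{(K,k_0)}$, $\nabla J$) are extended by a zero column, respectively zero entry, at the last ("tilt") coordinate of $Z_0$ so that they can be paired with $V$. Local-family assumption (used only in the $\kappa(\Phi)$ statement): $\{g_\theta:\theta\ge0\}$ is a family of densities with $g_0=f_0$, differentiable in quadratic mean at $\theta=0$ with score $q\in L^2(f_0)$, $\mathbb E_0q=0$, $I=\mathbb E_0q^2\in(0,\infty)$, and $f_1=g_\theta$ for some $\theta>0$; $B\in\mathbb R^s$ has entries $B_i=\mathbb E_0[(\varphi-u_0)_i\,q]$. *)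

theory Defs
  imports "HOL-Probability.Probability" "HOL-Library.Landau_Symbols"
begin

text \<open>Index pairs of the lower triangle of an \<open>s \<times> s\<close> matrix, i.e. the coordinates of \<open>vech\<close>.\<close>

typedef (overloaded) ('s::linorder) vech_ix = "{(i::'s, j::'s). j \<le> i}"
  by auto

instance vech_ix :: ("{finite,linorder}") finite
proof
  have "inj (Rep_vech_ix :: 'a vech_ix \<Rightarrow> 'a \<times> 'a)"
    by (simp add: Rep_vech_ix_inject inj_on_def)
  then show "finite (UNIV :: 'a vech_ix set)"
    using finite_imageD[of Rep_vech_ix "UNIV :: 'a vech_ix set"] by simp
qed

definition vech ::
  "real^('s::{finite,linorder})^('s::{finite,linorder}) \<Rightarrow> real^('s::{finite,linorder}) vech_ix" where
  "vech A = (\<chi> p. A $ fst (Rep_vech_ix p) $ snd (Rep_vech_ix p))"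

definition unvech ::
  "real^('s::{finite,linorder}) vech_ix \<Rightarrow> real^('s::{finite,linorder})^('s::{finite,linorder})" where
  "unvech v = (\<chi> i j. v $ Abs_vech_ix (max i j, min i j))"

type_synonym ('a, 'b) jvec = "(real, 'a + 'b) vec"

definition join :: "real^'a \<Rightarrow> real^'b \<Rightarrow> ('a, 'b) jvec" where
  "join a b = (\<chi> k. case k of Inl i \<Rightarrow> a $ i | Inr j \<Rightarrow> b $ j)"

definition part1 :: "('a, 'b::finite) jvec \<Rightarrow> real^'a" where
  "part1 v = (\<chi> i. v $ Inl i)"

definition part2 :: "('a::finite, 'b) jvec \<Rightarrow> real^'b" where
  "part2 v = (\<chi> j. v $ Inr j)"

text \<open>The pair \<open>(\<^bold>k, c)\<close> as a vector of length \<open>s + 1\<close>.\<close>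

definition pair :: "real^'s \<Rightarrow> real \<Rightarrow> ('s, unit) jvec" where
  "pair k c = join k (\<chi> _. c)"

definition block_diag ::
  "real^'a^'a \<Rightarrow> real^'b^'b \<Rightarrow> (('a, 'b) jvec, 'a + 'b) vec" where
  "block_diag A B = (\<chi> k. case k of Inl i \<Rightarrow> join (A $ i) 0 | Inr j \<Rightarrow> join 0 (B $ j))"

definition outer :: "real^'a \<Rightarrow> real^'b \<Rightarrow> real^'b^'a" where
  "outer a b = (\<chi> i j. a $ i * b $ j)"

type_synonym 's moments = "('s, 's vech_ix) jvec"
type_synonym 's moments2 = "('s + 's vech_ix, 's + 's vech_ix) jvec"

text \<open>First and second moments \<open>(u, C)\<close> of one population, with \<open>C\<close> in \<open>vech\<close> coordinates.\<close>

definition mom ::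
  "real^('s::{finite,linorder}) \<Rightarrow> real^('s::{finite,linorder})^('s::{finite,linorder}) \<Rightarrow> 's moments" where
  "mom u C = join u (vech C)"

definition mom_u ::
  "('s::{finite,linorder}) moments \<Rightarrow> real^('s::{finite,linorder})" where
  "mom_u h = part1 h"

definition mom_C ::
  "('s::{finite,linorder}) moments \<Rightarrow> real^('s::{finite,linorder})^('s::{finite,linorder})" where
  "mom_C h = unvech (part2 h)"

text \<open>Extension of a gradient with respect to the moment vector by a zero entry at the tilt
  coordinate, i.e. at the last coordinate of the first sample's block.  \<open>padM\<close> is used when only the
  moments of the first sample are estimated, \<open>padE\<close> when those of both samples are.  The matrix
  versions act on the rows (they insert a zero column).\<close>

definition padM :: "real^'m \<Rightarrow> ('m, unit) jvec" where
  "padM v = join v 0"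

definition padE :: "('m::finite, 'm) jvec \<Rightarrow> ('m + unit, 'm) jvec" where
  "padE v = join (join (part1 v) 0) (part2 v)"

definition pad_colM :: "real^'m^'r \<Rightarrow> ('m, unit) jvec^'r" where
  "pad_colM A = (\<chi> r. padM (A $ r))"

definition pad_colE :: "('m::finite, 'm) jvec^'r \<Rightarrow> ('m + unit, 'm) jvec^'r" where
  "pad_colE A = (\<chi> r. padE (A $ r))"

text \<open>The column blocks of a Jacobian with respect to the moments of the first and of the second
  sample.\<close>

definition col_block1 :: "('a, 'b::finite) jvec^'r \<Rightarrow> real^'a^'r" where
  "col_block1 A = (\<chi> r. part1 (A $ r))"

definition col_block2 :: "('a::finite, 'b) jvec^'r \<Rightarrow> real^'b^'r" where
  "col_block2 A = (\<chi> r. part2 (A $ r))"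

definition gradient ::
  "(real^'m \<Rightarrow> real) \<Rightarrow> real^'m \<Rightarrow> real^'m" where
  "gradient f x = (\<chi> i. frechet_derivative f (at x) (axis i 1))"

definition is_density :: "(real \<Rightarrow> real) \<Rightarrow> bool" where
  "is_density f \<longleftrightarrow> f \<in> borel_measurable borel \<and> (\<forall>x. 0 \<le> f x) \<and>
     (\<integral>\<^sup>+x. ennreal (f x) \<partial>lborel) = 1"

definition law :: "(real \<Rightarrow> real) \<Rightarrow> real measure" where
  "law f = density lborel (\<lambda>x. ennreal (f x))"

definition expct ::
  "(real \<Rightarrow> real) \<Rightarrow> (real \<Rightarrow> 'b::{banach,second_countable_topology}) \<Rightarrow> 'b" where
  "expct f h = (\<integral>x. h x \<partial>law f)"

definition cov ::
  "(real \<Rightarrow> real) \<Rightarrow> (real \<Rightarrow> real^'n) \<Rightarrow> real^'n^'n" where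
  "cov f h = expct f (\<lambda>x. outer (h x - expct f h) (h x - expct f h))"

definition cross_cov ::
  "(real \<Rightarrow> real) \<Rightarrow> (real \<Rightarrow> real^'n) \<Rightarrow> (real \<Rightarrow> real) \<Rightarrow> real^'n" where
  "cross_cov f h g = expct f (\<lambda>x. (g x - expct f g) *\<^sub>R (h x - expct f h))"

definition var ::
  "(real \<Rightarrow> real) \<Rightarrow> (real \<Rightarrow> real) \<Rightarrow> real" where
  "var f g = expct f (\<lambda>x. (g x - expct f g)\<^sup>2)"

definition excess_kurtosis ::
  "(real \<Rightarrow> real) \<Rightarrow> (real \<Rightarrow> real) \<Rightarrow> real" where
  "excess_kurtosis f g = expct f (\<lambda>x. (g x - expct f g) ^ 4) / (var f g)\<^sup>2 - 3"

text \<open>\<open>KL f1 f0\<close> is the Kullback-Leibler divergence of \<open>f1\<close> from \<open>f0\<close>.  The negative part of the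
  integrand is always integrable, so finiteness of the divergence is integrability; where \<open>f1\<close>
  vanishes the integrand is \<open>0\<close>.\<close>

definition KL ::
  "(real \<Rightarrow> real) \<Rightarrow> (real \<Rightarrow> real) \<Rightarrow> real" where
  "KL f1 f0 = (\<integral>x. f1 x * ln (f1 x / f0 x) \<partial>lborel)"

definition KL_finite ::
  "(real \<Rightarrow> real) \<Rightarrow> (real \<Rightarrow> real) \<Rightarrow> bool" where
  "KL_finite f1 f0 \<longleftrightarrow> integrable lborel (\<lambda>x. f1 x * ln (f1 x / f0 x))"

text \<open>\<open>K = F\<inverse> Y\<close>, \<open>k0 = - K \<bullet> (u0 + u1) / 2\<close>, \<open>J = Y \<bullet> F\<inverse> Y\<close> with \<open>F = C0 + C1\<close>, \<open>Y = u1 - u0\<close>;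
  these are used both with the population moments and with the sample moments.  For a singular
  matrix, \<^const>\<open>matrix_inv\<close> is some fixed matrix.\<close>

definition Kfun ::
  "real^'s \<Rightarrow> real^'s^'s \<Rightarrow> real^'s \<Rightarrow> real^'s^'s \<Rightarrow> real^'s" where
  "Kfun u0 C0 u1 C1 = matrix_inv (C0 + C1) *v (u1 - u0)"

definition k0fun ::
  "real^'s \<Rightarrow> real^'s^'s \<Rightarrow> real^'s \<Rightarrow> real^'s^'s \<Rightarrow> real" where
  "k0fun u0 C0 u1 C1 = - (1/2) * (Kfun u0 C0 u1 C1 \<bullet> (u0 + u1))"

definition Jfun ::
  "real^'s \<Rightarrow> real^'s^'s \<Rightarrow> real^'s \<Rightarrow> real^'s^'s \<Rightarrow> real" where
  "Jfun u0 C0 u1 C1 = (u1 - u0) \<bullet> (matrix_inv (C0 + C1) *v (u1 - u0))"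

text \<open>The same maps on the vector \<open>\<eta> = (u0, C0, u1, C1)\<close>.  The map on \<open>\<eta> = (u0, C0)\<close>, with
  \<open>(u1, C1)\<close> known, is the restriction \<open>\<lambda>\<eta>. \<dots> (join \<eta> (mom u1 C1))\<close>.\<close>

definition K_map ::
  "('s::{finite,linorder}) moments2 \<Rightarrow> real^('s::{finite,linorder})" where
  "K_map \<eta> = Kfun (mom_u (part1 \<eta>)) (mom_C (part1 \<eta>)) (mom_u (part2 \<eta>)) (mom_C (part2 \<eta>))"

definition Kk_map :: "('s::{finite,linorder}) moments2 \<Rightarrow> ('s, unit) jvec" where
  "Kk_map \<eta> = pair (K_map \<eta>)
     (k0fun (mom_u (part1 \<eta>)) (mom_C (part1 \<eta>)) (mom_u (part2 \<eta>)) (mom_C (part2 \<eta>)))"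

definition J_map :: "('s::{finite,linorder}) moments2 \<Rightarrow> real" where
  "J_map \<eta> = Jfun (mom_u (part1 \<eta>)) (mom_C (part1 \<eta>)) (mom_u (part2 \<eta>)) (mom_C (part2 \<eta>))"

definition Kpop ::
  "(real \<Rightarrow> real) \<Rightarrow> (real \<Rightarrow> real) \<Rightarrow> (real \<Rightarrow> real^'s) \<Rightarrow> real^'s" where
  "Kpop f0 f1 \<phi> = Kfun (expct f0 \<phi>) (cov f0 \<phi>) (expct f1 \<phi>) (cov f1 \<phi>)"

definition k0pop ::
  "(real \<Rightarrow> real) \<Rightarrow> (real \<Rightarrow> real) \<Rightarrow> (real \<Rightarrow> real^'s) \<Rightarrow> real" where
  "k0pop f0 f1 \<phi> = k0fun (expct f0 \<phi>) (cov f0 \<phi>) (expct f1 \<phi>) (cov f1 \<phi>)"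

definition Jpop ::
  "(real \<Rightarrow> real) \<Rightarrow> (real \<Rightarrow> real) \<Rightarrow> (real \<Rightarrow> real^'s) \<Rightarrow> real" where
  "Jpop f0 f1 \<phi> = Jfun (expct f0 \<phi>) (cov f0 \<phi>) (expct f1 \<phi>) (cov f1 \<phi>)"

definition Lam ::
  "(real \<Rightarrow> real) \<Rightarrow> (real \<Rightarrow> real) \<Rightarrow> (real \<Rightarrow> real^'s) \<Rightarrow> real \<Rightarrow> real" where
  "Lam f0 f1 \<phi> x = k0pop f0 f1 \<phi> + Kpop f0 f1 \<phi> \<bullet> \<phi> x"

text \<open>The positive root \<open>\<theta>(\<^bold>k, c)\<close>, as a function of \<open>pair \<^bold>k c\<close>.\<close>

definition theta_fun ::
  "(real \<Rightarrow> real) \<Rightarrow> (real \<Rightarrow> real^'s) \<Rightarrow> ('s, unit) jvec \<Rightarrow> real" where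
  "theta_fun f0 \<phi> z = (THE \<theta>. \<theta> > 0 \<and>
     expct f0 (\<lambda>x. exp (\<theta> * (part2 z $ () + part1 z \<bullet> \<phi> x))) = 1)"

definition theta0 ::
  "(real \<Rightarrow> real) \<Rightarrow> (real \<Rightarrow> real) \<Rightarrow> (real \<Rightarrow> real^'s) \<Rightarrow> real" where
  "theta0 f0 f1 \<phi> = (THE \<theta>. \<theta> > 0 \<and> expct f0 (\<lambda>x. exp (\<theta> * Lam f0 f1 \<phi> x)) = 1)"

definition tilt_expct ::
  "(real \<Rightarrow> real) \<Rightarrow> (real \<Rightarrow> real) \<Rightarrow> (real \<Rightarrow> real^'s) \<Rightarrow>
    (real \<Rightarrow> 'b::{banach,second_countable_topology}) \<Rightarrow> 'b" where
  "tilt_expct f0 f1 \<phi> h = expct f0 (\<lambda>x. exp (theta0 f0 f1 \<phi> * Lam f0 f1 \<phi> x) *\<^sub>R h x)"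

definition efficiency ::
  "(real \<Rightarrow> real) \<Rightarrow> (real \<Rightarrow> real) \<Rightarrow> (real \<Rightarrow> real^'s) \<Rightarrow>
    ('s, unit) jvec \<Rightarrow> real" where
  "efficiency f0 f1 \<phi> z =
     theta_fun f0 \<phi> z * expct f1 (\<lambda>x. part2 z $ () + part1 z \<bullet> \<phi> x) / KL f1 f0"

definition grad_e ::
  "(real \<Rightarrow> real) \<Rightarrow> (real \<Rightarrow> real) \<Rightarrow> (real \<Rightarrow> real^'s) \<Rightarrow>
    ('s, unit) jvec" where
  "grad_e f0 f1 \<phi> = (theta0 f0 f1 \<phi> / KL f1 f0) *\<^sub>R
     (pair (expct f1 \<phi>) 1
      - (expct f1 (Lam f0 f1 \<phi>) / tilt_expct f0 f1 \<phi> (Lam f0 f1 \<phi>)) *\<^sub>R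
          pair (tilt_expct f0 f1 \<phi> \<phi>) 1)"

definition dtheta ::
  "(real \<Rightarrow> real) \<Rightarrow> (real \<Rightarrow> real) \<Rightarrow> (real \<Rightarrow> real^'s) \<Rightarrow>
    ('s, unit) jvec" where
  "dtheta f0 f1 \<phi> = - (theta0 f0 f1 \<phi> / tilt_expct f0 f1 \<phi> (Lam f0 f1 \<phi>)) *\<^sub>R
     pair (tilt_expct f0 f1 \<phi> \<phi>) 1"

definition quotient_R ::
  "real^'s \<Rightarrow> real^'s^'s \<Rightarrow> real^'s \<Rightarrow> real" where
  "quotient_R Y F k = (k \<bullet> Y)\<^sup>2 / (k \<bullet> (F *v k))"

text \<open>\<open>Zc f \<phi>\<close> is \<open>Z1\<close> for \<open>f = f1\<close> and, for \<open>f = f0\<close>, it is \<open>Z0\<close> without its tilt coordinate.\<close>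

definition Zc ::
  "(real \<Rightarrow> real) \<Rightarrow> (real \<Rightarrow> real^('s::{finite,linorder})) \<Rightarrow> real \<Rightarrow> 's moments" where
  "Zc f \<phi> x = mom (\<phi> x - expct f \<phi>) (outer (\<phi> x - expct f \<phi>) (\<phi> x - expct f \<phi>) - cov f \<phi>)"

definition Z0 ::
  "(real \<Rightarrow> real) \<Rightarrow> (real \<Rightarrow> real) \<Rightarrow> (real \<Rightarrow> real^('s::{finite,linorder})) \<Rightarrow> real \<Rightarrow>
    ('s + 's vech_ix, unit) jvec" where
  "Z0 f0 f1 \<phi> x = join (Zc f0 \<phi> x) (\<chi> _. exp (theta0 f0 f1 \<phi> * Lam f0 f1 \<phi> x) - 1)"

definition V0 where "V0 f0 f1 \<phi> = cov f0 (Z0 f0 f1 \<phi>)"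

definition V0_minus where "V0_minus f0 \<phi> = cov f0 (Zc f0 \<phi>)"

definition V1 where "V1 f1 \<phi> = cov f1 (Zc f1 \<phi>)"

text \<open>Suffix \<open>M\<close>: \<open>(u1, C1)\<close> known; suffix \<open>E\<close>: \<open>(u1, C1)\<close> estimated from the second sample.\<close>

definition V_E where "V_E f0 f1 \<phi> linv = block_diag (V0 f0 f1 \<phi>) (linv *\<^sub>R V1 f1 \<phi>)"

definition eta where "eta f \<phi> = mom (expct f \<phi>) (cov f \<phi>)"

definition G_M where
  "G_M f0 f1 \<phi> = jacobian (\<lambda>\<eta>. K_map (join \<eta> (eta f1 \<phi>))) (at (eta f0 \<phi>))"

definition GKk_M where
  "GKk_M f0 f1 \<phi> = jacobian (\<lambda>\<eta>. Kk_map (join \<eta> (eta f1 \<phi>))) (at (eta f0 \<phi>))"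

definition gradJ_M where
  "gradJ_M f0 f1 \<phi> = gradient (\<lambda>\<eta>. J_map (join \<eta> (eta f1 \<phi>))) (eta f0 \<phi>)"

definition G_E where
  "G_E f0 f1 \<phi> = jacobian K_map (at (join (eta f0 \<phi>) (eta f1 \<phi>)))"

definition GKk_E where
  "GKk_E f0 f1 \<phi> = jacobian Kk_map (at (join (eta f0 \<phi>) (eta f1 \<phi>)))"

definition gradJ_E where
  "gradJ_E f0 f1 \<phi> = gradient J_map (join (eta f0 \<phi>) (eta f1 \<phi>))"

definition Sigma_M where
  "Sigma_M f0 f1 \<phi> =
     pad_colM (G_M f0 f1 \<phi>) ** V0 f0 f1 \<phi> ** transpose (pad_colM (G_M f0 f1 \<phi>))"

definition SigmaKk_M where
  "SigmaKk_M f0 f1 \<phi> =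
     pad_colM (GKk_M f0 f1 \<phi>) ** V0 f0 f1 \<phi> ** transpose (pad_colM (GKk_M f0 f1 \<phi>))"

definition Sigma_E where
  "Sigma_E f0 f1 \<phi> linv =
     pad_colE (G_E f0 f1 \<phi>) ** V_E f0 f1 \<phi> linv ** transpose (pad_colE (G_E f0 f1 \<phi>))"

definition SigmaKk_E where
  "SigmaKk_E f0 f1 \<phi> linv =
     pad_colE (GKk_E f0 f1 \<phi>) ** V_E f0 f1 \<phi> linv ** transpose (pad_colE (GKk_E f0 f1 \<phi>))"

definition grad_theta_M where
  "grad_theta_M f0 f1 \<phi> = transpose (pad_colM (GKk_M f0 f1 \<phi>)) *v dtheta f0 f1 \<phi>
     - (1 / tilt_expct f0 f1 \<phi> (Lam f0 f1 \<phi>)) *\<^sub>R axis (Inr ()) 1"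

definition grad_theta_E where
  "grad_theta_E f0 f1 \<phi> = transpose (pad_colE (GKk_E f0 f1 \<phi>)) *v dtheta f0 f1 \<phi>
     - (1 / tilt_expct f0 f1 \<phi> (Lam f0 f1 \<phi>)) *\<^sub>R axis (Inl (Inr ())) 1"

definition moment_assumption ::
  "(real \<Rightarrow> real) \<Rightarrow> (real \<Rightarrow> real) \<Rightarrow> (real \<Rightarrow> real^'s) \<Rightarrow> bool" where
  "moment_assumption f0 f1 \<phi> \<longleftrightarrow>
     \<phi> \<in> borel_measurable borel \<and>
     (\<forall>i. integrable (law f0) (\<lambda>x. (\<phi> x $ i)\<^sup>2) \<and> integrable (law f1) (\<lambda>x. (\<phi> x $ i)\<^sup>2)) \<and>
     (\<forall>v. v \<noteq> 0 \<longrightarrow> 0 < v \<bullet> (cov f0 \<phi> *v v)) \<and>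
     (\<forall>x. f0 x = 0 \<longrightarrow> f1 x = 0)"

definition bounded_dictionary :: "(real \<Rightarrow> real^'s) \<Rightarrow> bool" where
  "bounded_dictionary \<phi> \<longleftrightarrow> (\<exists>\<phi>max. \<forall>i x. \<bar>\<phi> x $ i\<bar> \<le> \<phi>max)"

text \<open>Differentiability in quadratic mean at \<open>\<theta> = 0\<close>, one-sided since \<open>\<theta> \<ge> 0\<close>.\<close>

definition local_family ::
  "(real \<Rightarrow> real) \<Rightarrow> (real \<Rightarrow> real) \<Rightarrow> (real \<Rightarrow> real \<Rightarrow> real) \<Rightarrow>
    (real \<Rightarrow> real) \<Rightarrow> bool" where
  "local_family f0 f1 g q \<longleftrightarrow>
     (\<forall>\<theta>\<ge>0. is_density (g \<theta>)) \<and> g 0 = f0 \<and> (\<exists>\<theta>>0. f1 = g \<theta>) \<and>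
     q \<in> borel_measurable borel \<and> integrable (law f0) (\<lambda>x. (q x)\<^sup>2) \<and>
     expct f0 q = 0 \<and> 0 < expct f0 (\<lambda>x. (q x)\<^sup>2) \<and>
     ((\<lambda>\<theta>. (\<integral>x. (sqrt (g \<theta> x) - sqrt (f0 x) - \<theta> / 2 * q x * sqrt (f0 x))\<^sup>2 \<partial>lborel) / \<theta>\<^sup>2)
        \<longlongrightarrow> 0) (at_right 0)"

definition iid_sample ::
  "'w measure \<Rightarrow> (real \<Rightarrow> real) \<Rightarrow> (nat \<Rightarrow> 'w \<Rightarrow> real) \<Rightarrow> bool" where
  "iid_sample P f X \<longleftrightarrow> prob_space.indep_vars P (\<lambda>_. borel) X UNIV \<and>
     (\<forall>j. distributed P lborel (X j) (\<lambda>x. ennreal (f x)))"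

text \<open>The second sample \<open>W\<close> from \<open>f1\<close>, independent of the first sample \<open>X\<close> (all \<open>X i\<close>, \<open>W j\<close> are
  jointly independent), of size \<open>N1 N\<close> with \<open>N1 N / N \<rightarrow> lam\<close> and \<open>0 < lam \<le> \<infinity>\<close>.\<close>

definition second_sample ::
  "'w measure \<Rightarrow> (real \<Rightarrow> real) \<Rightarrow> (nat \<Rightarrow> 'w \<Rightarrow> real) \<Rightarrow>
    (nat \<Rightarrow> 'w \<Rightarrow> real) \<Rightarrow> (nat \<Rightarrow> nat) \<Rightarrow> ereal \<Rightarrow> bool" where
  "second_sample P f1 X W N1 lam \<longleftrightarrow> iid_sample P f1 W \<and>
     prob_space.indep_vars P (\<lambda>_. borel) (case_sum X W) UNIV \<and>
     0 < lam \<and> (\<lambda>N. ereal (real (N1 N) / real N)) \<longlonglongrightarrow> lam"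

definition sample_mean ::
  "(real \<Rightarrow> real^'s) \<Rightarrow> (nat \<Rightarrow> real) \<Rightarrow> nat \<Rightarrow> real^'s" where
  "sample_mean \<phi> x N = (1 / real N) *\<^sub>R (\<Sum>j<N. \<phi> (x j))"

text \<open>Divisor \<open>N - \<delta>\<close>; the usual conventions are \<open>\<delta> = 0\<close> and \<open>\<delta> = 1\<close>.\<close>

definition sample_cov ::
  "nat \<Rightarrow> (real \<Rightarrow> real^'s) \<Rightarrow> (nat \<Rightarrow> real) \<Rightarrow> nat \<Rightarrow> real^'s^'s" where
  "sample_cov \<delta> \<phi> x N = (1 / (real N - real \<delta>)) *\<^sub>R
     (\<Sum>j<N. outer (\<phi> (x j) - sample_mean \<phi> x N) (\<phi> (x j) - sample_mean \<phi> x N))"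

definition sample_theta ::
  "(real \<Rightarrow> real^'s) \<Rightarrow> (nat \<Rightarrow> real) \<Rightarrow> nat \<Rightarrow> real^'s \<Rightarrow> real \<Rightarrow> real" where
  "sample_theta \<phi> x N k c = (THE \<theta>. \<theta> > 0 \<and>
     (1 / real N) * (\<Sum>j<N. exp (\<theta> * (c + k \<bullet> \<phi> (x j)))) = 1)"

definition std_dev :: "'w measure \<Rightarrow> ('w \<Rightarrow> real) \<Rightarrow> real" where
  "std_dev P T = sqrt (\<integral>\<omega>. (T \<omega> - (\<integral>\<omega>'. T \<omega>' \<partial>P))\<^sup>2 \<partial>P)"

definition big_op ::
  "'w measure \<Rightarrow> (nat \<Rightarrow> 'w \<Rightarrow> real) \<Rightarrow> (nat \<Rightarrow> real) \<Rightarrow> bool" where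
  "big_op P T r \<longleftrightarrow> (\<forall>N. T N \<in> borel_measurable P) \<and>
     (\<forall>\<epsilon>>0. \<exists>M. \<forall>\<^sub>F N in sequentially. measure P {\<omega> \<in> space P. \<bar>T N \<omega>\<bar> > M * \<bar>r N\<bar>} < \<epsilon>)"

text \<open>\<open>T = o\<^sub>p(S)\<close>; in particular \<open>T = S (1 + o\<^sub>p(1))\<close> is \<open>small_op P (T - S) S\<close>.\<close>

definition small_op ::
  "'w measure \<Rightarrow> (nat \<Rightarrow> 'w \<Rightarrow> real) \<Rightarrow> (nat \<Rightarrow> 'w \<Rightarrow> real) \<Rightarrow> bool" where
  "small_op P T S \<longleftrightarrow> (\<forall>N. T N \<in> borel_measurable P \<and> S N \<in> borel_measurable P) \<and>
     (\<forall>\<epsilon>>0. (\<lambda>N. measure P {\<omega> \<in> space P. \<bar>T N \<omega>\<bar> > \<epsilon> * \<bar>S N \<omega>\<bar>}) \<longlonglongrightarrow> 0)"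

definition normal_law :: "real \<Rightarrow> real \<Rightarrow> real measure" where
  "normal_law m v = (if 0 < v then density lborel (normal_density m (sqrt v)) else return borel m)"

text \<open>\<open>\<nu>\<close> is the (possibly degenerate) normal law with mean \<open>m\<close> and covariance matrix \<open>S\<close>.\<close>

definition is_mv_normal ::
  "real^'n \<Rightarrow> real^'n^'n \<Rightarrow> (real^'n) measure \<Rightarrow> bool" where
  "is_mv_normal m S \<nu> \<longleftrightarrow> sets \<nu> = sets borel \<and>
     (\<forall>t. distr \<nu> borel (\<lambda>x. t \<bullet> x) = normal_law (t \<bullet> m) (t \<bullet> (S *v t)))"

definition asymp_normal ::
  "'w measure \<Rightarrow> (nat \<Rightarrow> 'w \<Rightarrow> real) \<Rightarrow> real \<Rightarrow> bool" where
  "asymp_normal P T v \<longleftrightarrow> (\<forall>N. T N \<in> borel_measurable P) \<and>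
     weak_conv_m (\<lambda>N. distr P borel (T N)) (normal_law 0 v)"

definition asymp_mv_normal ::
  "'w measure \<Rightarrow> (nat \<Rightarrow> 'w \<Rightarrow> real^'n) \<Rightarrow> real^'n^'n \<Rightarrow> bool" where
  "asymp_mv_normal P T S \<longleftrightarrow> (\<forall>N. T N \<in> borel_measurable P) \<and>
     (\<exists>\<nu>. is_mv_normal 0 S \<nu> \<and>
        (\<forall>g :: real^'n \<Rightarrow> real. continuous_on UNIV g \<longrightarrow> bounded (range g) \<longrightarrow>
           (\<lambda>N. \<integral>\<omega>. g (T N \<omega>) \<partial>P) \<longlonglongrightarrow> (\<integral>x. g x \<partial>\<nu>)))"

end

theory Submission
  imports Defs
begin

text \<open>
  All estimators are functions of the pooled moment vector, whose deviation from the population value is a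
  sample mean of the scores \<open>Z\<^sub>0\<close>, \<open>Z\<^sub>1\<close> up to an error of smaller order than \<open>1 / sqrt N\<close>.  Differentiable
  functionals are therefore asymptotically normal by the delta method, where joint normality is reduced to
  the scalar central limit theorem by approximating bounded continuous functions by trigonometric
  polynomials.

  The root of an exponential moment equation is expanded for an arbitrary law of a vector bounded by a
  fixed constant, with an error that does not depend on the law.  Applied to the population law this gives the
  gradients of \<open>\<theta>\<close> and \<open>e\<close>; applied to the empirical law it gives the expansion of the estimated root, in
  which the fluctuation of the empirical exponential moment at \<open>\<theta>\<^sub>0\<close> is the tilt coordinate of \<open>Z\<^sub>0\<close>.

  Since \<open>K\<close> maximises \<open>R\<close>, the difference \<open>J - R(k)\<close> is the quadratic form in \<open>k - K\<close> times
  \<open>J / (k \<bullet> (F *v k))\<close>, a factor that tends to \<open>1\<close>.  The standard deviation of a sample variance is computed exactly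
  from the mixed moments of \<open>\<Sum> g\<close> and \<open>\<Sum> g\<^sup>2\<close> by recursion on the sample size.
\<close>

subsection \<open>Stochastic order symbols\<close>

text \<open>The two modes are two instances of one locale, \<open>estimation\<close>: moments of the
  labelled population that are known exactly correspond to a second score block that is identically
  zero and to the weight \<open>l = 0\<close>. Every limit theorem is thus proved once, and mode (M)
  is recovered from the first blocks of Jacobians and gradients.

  The shape of many lemmas is dictated by totality. \<open>matrix_inv\<close> at a singular matrix,
  and \<open>THE\<close> where no root or more than one exists, have a fixed but unknown value,
  while the order symbols and the limit laws require measurability for every N, even N = 0.
  Measurability of the inverse and of the root is therefore shown with these values included,
  whereas estimates are only needed almost surely from a random index on.

  Boundedness of the dictionary is used throughout: it makes all exponential moments finite, yields
  the strong law from Hoeffding's inequality and Borel-Cantelli, and gives Taylor constants that are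
  the same for all laws.\<close>

lemma (in prob_space) prob_eventually_tendsto_0:
  assumes m: "\<And>N::nat. {\<omega> \<in> space M. \<not> Q N \<omega>} \<in> events"
    and ae: "AE \<omega> in M. \<forall>\<^sub>F N in sequentially. Q N \<omega>"
  shows "(\<lambda>N. prob {\<omega> \<in> space M. \<not> Q N \<omega>}) \<longlonglongrightarrow> 0"
proof -
  let ?A = "\<lambda>N. {\<omega> \<in> space M. \<not> Q N \<omega>}"
  \<comment> \<open>The index from which \<open>Q\<close> holds depends on \<open>\<omega>\<close>,
    so no uniform bound is available; the failure indicators tend to 0 almost everywhere and are
    dominated by 1.\<close>
  have "(\<lambda>N. \<integral>\<omega>. indicator (?A N) \<omega> \<partial>M) \<longlonglongrightarrow> (\<integral>\<omega>. 0 \<partial>M :: real)"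
  proof (rule integral_dominated_convergence[where w="\<lambda>_. 1"])
    show "AE \<omega> in M. (\<lambda>N. indicator (?A N) \<omega> :: real) \<longlonglongrightarrow> 0"
      using ae
    proof eventually_elim
      case (elim \<omega>)
      then have "\<forall>\<^sub>F N in sequentially. indicator (?A N) \<omega> = (0::real)"
        by eventually_elim (auto simp: indicator_def)
      then show ?case by (rule tendsto_eventually)
    qed
  qed (use m in \<open>auto simp: indicator_def\<close>)
  then show ?thesis using m by simp
qed

abbreviation op1 :: "'w measure \<Rightarrow> (nat \<Rightarrow> 'w \<Rightarrow> real) \<Rightarrow> bool" where
  "op1 P T \<equiv> small_op P T (\<lambda>_ _. 1)"

abbreviation Op1 :: "'w measure \<Rightarrow> (nat \<Rightarrow> 'w \<Rightarrow> real) \<Rightarrow> bool" where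
  "Op1 P T \<equiv> big_op P T (\<lambda>_. 1)"

lemma op1_measurable: "op1 P T \<Longrightarrow> T N \<in> borel_measurable P"
  by (simp add: small_op_def)

lemma big_op_measurable: "big_op P T r \<Longrightarrow> T N \<in> borel_measurable P"
  by (simp add: big_op_def)

context prob_space
begin

lemma small_op_AE_eventually:
  assumes "\<And>N. T N \<in> borel_measurable M" "\<And>N. S N \<in> borel_measurable M"
    and "\<And>\<epsilon>. \<epsilon> > 0 \<Longrightarrow> AE \<omega> in M. \<forall>\<^sub>F N in sequentially. \<bar>T N \<omega>\<bar> \<le> \<epsilon> * \<bar>S N \<omega>\<bar>"
  shows "small_op M T S"
  unfolding small_op_def
proof (intro conjI allI impI)
  have [measurable]: "T N \<in> borel_measurable M" "S N \<in> borel_measurable M" for N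
    using assms by auto
  fix \<epsilon> :: real assume e: "0 < \<epsilon>"
  have "(\<lambda>N. prob {\<omega> \<in> space M. \<not> \<bar>T N \<omega>\<bar> \<le> \<epsilon> * \<bar>S N \<omega>\<bar>}) \<longlonglongrightarrow> 0"
    by (intro prob_eventually_tendsto_0 assms(3)[OF e]) measurable
  then show "(\<lambda>N. prob {\<omega> \<in> space M. \<epsilon> * \<bar>S N \<omega>\<bar> < \<bar>T N \<omega>\<bar>}) \<longlonglongrightarrow> 0"
    by (simp add: not_le)
qed (use assms in auto)

lemma op1_AE:
  assumes "\<And>N. T N \<in> borel_measurable M" "AE \<omega> in M. (\<lambda>N. T N \<omega>) \<longlonglongrightarrow> 0"
  shows "op1 M T"
proof (rule small_op_AE_eventually)
  fix \<epsilon> :: real assume e: "\<epsilon> > 0"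
  show "AE \<omega> in M. \<forall>\<^sub>F N in sequentially. \<bar>T N \<omega>\<bar> \<le> \<epsilon> * \<bar>1\<bar>"
    using assms(2)
  proof eventually_elim
    case (elim \<omega>)
    from tendstoD[OF this e] show ?case
      by (auto elim: eventually_mono)
  qed
qed (use assms in auto)

text \<open>The way first-order remainders are discarded: a null factor times a tight factor, where
  the pathwise bound has to hold only from a random index on. The event of a large remainder is
  covered by three events of small probability, one for each factor and one for failure of the
  bound.\<close>

lemma op1_bound_by_product:
  assumes mR: "\<And>N. R N \<in> borel_measurable M" and a: "op1 M a" and b: "Op1 M b"
    and bound: "AE \<omega> in M. \<forall>\<^sub>F N in sequentially. \<bar>R N \<omega>\<bar> \<le> \<bar>a N \<omega>\<bar> * \<bar>b N \<omega>\<bar>"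
  shows "op1 M R"
proof -
  have [measurable]: "a N \<in> borel_measurable M" "b N \<in> borel_measurable M"
    "R N \<in> borel_measurable M" for N
    using a b mR by (auto simp: small_op_def big_op_def)
  have "(\<lambda>N. prob {\<omega> \<in> space M. \<epsilon> < \<bar>R N \<omega>\<bar>}) \<longlonglongrightarrow> 0" if e: "\<epsilon> > 0" for \<epsilon> :: real
  proof (rule tendstoI)
    fix \<eta> :: real assume eta: "\<eta> > 0"
    obtain L where L: "\<forall>\<^sub>F N in sequentially. prob {\<omega> \<in> space M. \<bar>b N \<omega>\<bar> > L * \<bar>1\<bar>} < \<eta> / 3"
      using b eta unfolding big_op_def by (meson divide_pos_pos zero_less_numeral)
    \<comment> \<open>Chosen so that a first factor below \<open>d\<close> and a second one below
      \<open>L\<close> force the product below \<open>\<epsilon>\<close>; the added 1 keeps the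
      denominator positive.\<close>
    define d where "d = \<epsilon> / (\<bar>L\<bar> + 1)"
    have d: "d > 0" using e by (simp add: d_def)
    have "(\<lambda>N. prob {\<omega> \<in> space M. \<bar>a N \<omega>\<bar> > d * \<bar>1\<bar>}) \<longlonglongrightarrow> 0"
      using a d unfolding small_op_def by blast
    from tendstoD[OF this, of "\<eta>/3"] eta
    have A: "\<forall>\<^sub>F N in sequentially. prob {\<omega> \<in> space M. \<bar>a N \<omega>\<bar> > d} < \<eta> / 3" by simp
    have "(\<lambda>N. prob {\<omega> \<in> space M. \<not> \<bar>R N \<omega>\<bar> \<le> \<bar>a N \<omega>\<bar> * \<bar>b N \<omega>\<bar>}) \<longlonglongrightarrow> 0"
      by (intro prob_eventually_tendsto_0 bound) measurable
    from tendstoD[OF this, of "\<eta>/3"] eta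
    have B: "\<forall>\<^sub>F N in sequentially. prob {\<omega> \<in> space M. \<not> \<bar>R N \<omega>\<bar> \<le> \<bar>a N \<omega>\<bar> * \<bar>b N \<omega>\<bar>} < \<eta> / 3"
      by simp
    show "\<forall>\<^sub>F N in sequentially. dist (prob {\<omega> \<in> space M. \<epsilon> < \<bar>R N \<omega>\<bar>}) 0 < \<eta>"
      using L A B
    proof eventually_elim
      case (elim N)
      let ?A = "{\<omega> \<in> space M. \<bar>a N \<omega>\<bar> > d}" and ?L = "{\<omega> \<in> space M. \<bar>b N \<omega>\<bar> > L * \<bar>1\<bar>}"
        and ?B = "{\<omega> \<in> space M. \<not> \<bar>R N \<omega>\<bar> \<le> \<bar>a N \<omega>\<bar> * \<bar>b N \<omega>\<bar>}"
      have "{\<omega> \<in> space M. \<epsilon> < \<bar>R N \<omega>\<bar>} \<subseteq> ?A \<union> ?L \<union> ?B"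
      proof (rule ccontr)
        assume "\<not> ?thesis"
        then obtain \<omega> where "\<omega> \<in> {\<omega> \<in> space M. \<epsilon> < \<bar>R N \<omega>\<bar>}" "\<omega> \<notin> ?A \<union> ?L \<union> ?B" by blast
        then have w: "\<epsilon> < \<bar>R N \<omega>\<bar>" "\<bar>a N \<omega>\<bar> \<le> d" "\<bar>b N \<omega>\<bar> \<le> L"
          "\<bar>R N \<omega>\<bar> \<le> \<bar>a N \<omega>\<bar> * \<bar>b N \<omega>\<bar>" by auto
        have "\<bar>a N \<omega>\<bar> * \<bar>b N \<omega>\<bar> \<le> d * (\<bar>L\<bar> + 1)"
          using w d by (intro mult_mono) auto
        then show False using w by (simp add: d_def)
      qed
      then have "prob {\<omega> \<in> space M. \<epsilon> < \<bar>R N \<omega>\<bar>} \<le> prob (?A \<union> ?L \<union> ?B)"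
        by (intro finite_measure_mono) measurable
      also have "\<dots> \<le> prob (?A \<union> ?L) + prob ?B"
        by (intro measure_Un_le) measurable
      also have "\<dots> \<le> prob ?A + prob ?L + prob ?B"
        by (intro add_mono measure_Un_le order_refl) measurable
      also have "\<dots> < \<eta>" using elim by simp
      finally show ?case by (simp add: measure_nonneg)
    qed
  qed
  then show ?thesis using mR by (simp add: small_op_def)
qed

text \<open>Separates a deterministic rate from a tight sequence. With \<open>b\<close> the squared
  norm of a deviation scaled by sqrt N and the rate 1 / N it yields the second-order remainders of
  the quotient and of the efficiency.\<close>

lemma big_op_bound:
  assumes mR: "\<And>N. R N \<in> borel_measurable M" and b: "Op1 M b"
    and bound: "AE \<omega> in M. \<forall>\<^sub>F N in sequentially. \<bar>R N \<omega>\<bar> \<le> C * \<bar>b N \<omega>\<bar> * \<bar>r N\<bar>"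
  shows "big_op M R r"
proof -
  have [measurable]: "b N \<in> borel_measurable M" "R N \<in> borel_measurable M" for N
    using b mR by (auto simp: big_op_def)
  have "\<exists>L. \<forall>\<^sub>F N in sequentially. prob {\<omega> \<in> space M. \<bar>R N \<omega>\<bar> > L * \<bar>r N\<bar>} < \<eta>"
    if eta: "\<eta> > 0" for \<eta> :: real
  proof -
    obtain L where L: "\<forall>\<^sub>F N in sequentially. prob {\<omega> \<in> space M. \<bar>b N \<omega>\<bar> > L * \<bar>1\<bar>} < \<eta> / 2"
      using b eta unfolding big_op_def by (meson half_gt_zero)
    have "(\<lambda>N. prob {\<omega> \<in> space M. \<not> \<bar>R N \<omega>\<bar> \<le> C * \<bar>b N \<omega>\<bar> * \<bar>r N\<bar>}) \<longlonglongrightarrow> 0"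
      by (intro prob_eventually_tendsto_0 bound) measurable
    from tendstoD[OF this, of "\<eta>/2"] eta
    have B: "\<forall>\<^sub>F N in sequentially. prob {\<omega> \<in> space M. \<not> \<bar>R N \<omega>\<bar> \<le> C * \<bar>b N \<omega>\<bar> * \<bar>r N\<bar>} < \<eta> / 2"
      by simp
    show ?thesis
      using L B
    proof (intro exI[of _ "\<bar>C\<bar> * \<bar>L\<bar>"], eventually_elim)
      case (elim N)
      let ?L = "{\<omega> \<in> space M. \<bar>b N \<omega>\<bar> > L * \<bar>1\<bar>}"
        and ?B = "{\<omega> \<in> space M. \<not> \<bar>R N \<omega>\<bar> \<le> C * \<bar>b N \<omega>\<bar> * \<bar>r N\<bar>}"
      have "{\<omega> \<in> space M. \<bar>R N \<omega>\<bar> > \<bar>C\<bar> * \<bar>L\<bar> * \<bar>r N\<bar>} \<subseteq> ?L \<union> ?B"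
      proof (rule ccontr)
        assume "\<not> ?thesis"
        then obtain \<omega> where "\<omega> \<in> {\<omega> \<in> space M. \<bar>R N \<omega>\<bar> > \<bar>C\<bar> * \<bar>L\<bar> * \<bar>r N\<bar>}" "\<omega> \<notin> ?L \<union> ?B" by blast
        then have w: "\<bar>R N \<omega>\<bar> > \<bar>C\<bar> * \<bar>L\<bar> * \<bar>r N\<bar>" "\<bar>b N \<omega>\<bar> \<le> L"
          "\<bar>R N \<omega>\<bar> \<le> C * \<bar>b N \<omega>\<bar> * \<bar>r N\<bar>" by auto
        have "C * \<bar>b N \<omega>\<bar> * \<bar>r N\<bar> \<le> \<bar>C\<bar> * \<bar>L\<bar> * \<bar>r N\<bar>"
          using w by (intro mult_mono) auto
        then show False using w by simp
      qed
      then have "prob {\<omega> \<in> space M. \<bar>R N \<omega>\<bar> > \<bar>C\<bar> * \<bar>L\<bar> * \<bar>r N\<bar>} \<le> prob (?L \<union> ?B)"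
        by (intro finite_measure_mono) measurable
      also have "\<dots> \<le> prob ?L + prob ?B"
        by (intro measure_Un_le) measurable
      also have "\<dots> < \<eta>" using elim by simp
      finally show ?case .
    qed
  qed
  then show ?thesis using mR by (simp add: big_op_def)
qed

lemma Op1_add:
  assumes a: "Op1 M a" and b: "Op1 M b"
  shows "Op1 M (\<lambda>N \<omega>. \<bar>a N \<omega>\<bar> + \<bar>b N \<omega>\<bar>)"
proof -
  have [measurable]: "a N \<in> borel_measurable M" "b N \<in> borel_measurable M" for N
    using a b by (auto simp: big_op_def)
  have "\<exists>L. \<forall>\<^sub>F N in sequentially. prob {\<omega> \<in> space M. \<bar>\<bar>a N \<omega>\<bar> + \<bar>b N \<omega>\<bar>\<bar> > L * \<bar>1\<bar>} < \<eta>"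
    if eta: "\<eta> > 0" for \<eta> :: real
  proof -
    obtain K where K: "\<forall>\<^sub>F N in sequentially. prob {\<omega> \<in> space M. \<bar>a N \<omega>\<bar> > K * \<bar>1\<bar>} < \<eta> / 2"
      using a eta unfolding big_op_def by (meson half_gt_zero)
    obtain L where L: "\<forall>\<^sub>F N in sequentially. prob {\<omega> \<in> space M. \<bar>b N \<omega>\<bar> > L * \<bar>1\<bar>} < \<eta> / 2"
      using b eta unfolding big_op_def by (meson half_gt_zero)
    show ?thesis
      using K L
    proof (intro exI[of _ "K + L"], eventually_elim)
      case (elim N)
      let ?K = "{\<omega> \<in> space M. \<bar>a N \<omega>\<bar> > K * \<bar>1\<bar>}" and ?L = "{\<omega> \<in> space M. \<bar>b N \<omega>\<bar> > L * \<bar>1\<bar>}"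
      have "prob {\<omega> \<in> space M. \<bar>\<bar>a N \<omega>\<bar> + \<bar>b N \<omega>\<bar>\<bar> > (K + L) * \<bar>1\<bar>} \<le> prob (?K \<union> ?L)"
        by (intro finite_measure_mono) (auto, measurable)
      also have "\<dots> \<le> prob ?K + prob ?L"
        by (intro measure_Un_le) measurable
      also have "\<dots> < \<eta>" using elim by simp
      finally show ?case .
    qed
  qed
  then show ?thesis by (simp add: big_op_def)
qed

lemma Op1_const: "Op1 M (\<lambda>N \<omega>. c)"
  unfolding big_op_def by (intro conjI allI impI exI[of _ "\<bar>c\<bar>"] always_eventually) auto

lemma Op1_bound:
  assumes "\<And>N. R N \<in> borel_measurable M" "Op1 M b" "\<And>N \<omega>. \<bar>R N \<omega>\<bar> \<le> C * \<bar>b N \<omega>\<bar>"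
  shows "Op1 M R"
  by (rule big_op_bound[where C=C and b=b, OF assms(1,2)]) (simp add: assms(3) always_eventually)

lemma Op1_sum:
  assumes "finite I" "\<And>i. i \<in> I \<Longrightarrow> Op1 M (a i)"
  shows "Op1 M (\<lambda>N \<omega>. \<Sum>i\<in>I. \<bar>a i N \<omega>\<bar>)"
  using assms
proof (induction I rule: finite_induct)
  case empty
  then show ?case by (simp add: Op1_const)
next
  case (insert x F)
  then have "Op1 M (\<lambda>N \<omega>. \<bar>a x N \<omega>\<bar> + \<bar>\<Sum>i\<in>F. \<bar>a i N \<omega>\<bar>\<bar>)"
    by (intro Op1_add) auto
  with insert show ?case by simp
qed

lemma Op1_square:
  assumes a: "Op1 M a"
  shows "Op1 M (\<lambda>N \<omega>. (a N \<omega>)\<^sup>2)"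
proof -
  have [measurable]: "a N \<in> borel_measurable M" for N
    using a by (auto simp: big_op_def)
  have "\<exists>L. \<forall>\<^sub>F N in sequentially. prob {\<omega> \<in> space M. \<bar>(a N \<omega>)\<^sup>2\<bar> > L * \<bar>1\<bar>} < \<eta>"
    if eta: "\<eta> > 0" for \<eta> :: real
  proof -
    obtain L where L: "\<forall>\<^sub>F N in sequentially. prob {\<omega> \<in> space M. \<bar>a N \<omega>\<bar> > L * \<bar>1\<bar>} < \<eta>"
      using a eta unfolding big_op_def by meson
    show ?thesis
      using L
    proof (intro exI[of _ "L\<^sup>2"], eventually_elim)
      case (elim N)
      have "prob {\<omega> \<in> space M. \<bar>(a N \<omega>)\<^sup>2\<bar> > L\<^sup>2 * \<bar>1\<bar>} \<le> prob {\<omega> \<in> space M. \<bar>a N \<omega>\<bar> > L * \<bar>1\<bar>}"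
        using abs_le_square_iff[of "a N _" L]
        by (intro finite_measure_mono) (auto, smt (verit))
      with elim show ?case by simp
    qed
  qed
  then show ?thesis by (simp add: big_op_def)
qed

lemma op1_add:
  assumes a: "op1 M a" and b: "op1 M b"
  shows "op1 M (\<lambda>N \<omega>. a N \<omega> + b N \<omega>)"
proof -
  have [measurable]: "a N \<in> borel_measurable M" "b N \<in> borel_measurable M" for N
    using a b by (auto simp: small_op_def)
  have "(\<lambda>N. prob {\<omega> \<in> space M. \<bar>a N \<omega> + b N \<omega>\<bar> > \<epsilon>}) \<longlonglongrightarrow> 0" if e: "\<epsilon> > 0" for \<epsilon> :: real
  proof (rule tendsto_sandwich[OF _ _ tendsto_const])
    have "(\<lambda>N. prob {\<omega> \<in> space M. \<bar>a N \<omega>\<bar> > \<epsilon>/2 * \<bar>1\<bar>}) \<longlonglongrightarrow> 0"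
      "(\<lambda>N. prob {\<omega> \<in> space M. \<bar>b N \<omega>\<bar> > \<epsilon>/2 * \<bar>1\<bar>}) \<longlonglongrightarrow> 0"
      using a b e unfolding small_op_def by (meson half_gt_zero)+
    from tendsto_add[OF this]
    show "(\<lambda>N. prob {\<omega> \<in> space M. \<bar>a N \<omega>\<bar> > \<epsilon>/2 * \<bar>1\<bar>} + prob {\<omega> \<in> space M. \<bar>b N \<omega>\<bar> > \<epsilon>/2 * \<bar>1\<bar>})
        \<longlonglongrightarrow> 0" by simp
    have "prob {\<omega> \<in> space M. \<bar>a N \<omega> + b N \<omega>\<bar> > \<epsilon>}
        \<le> prob {\<omega> \<in> space M. \<bar>a N \<omega>\<bar> > \<epsilon>/2 * \<bar>1\<bar>} + prob {\<omega> \<in> space M. \<bar>b N \<omega>\<bar> > \<epsilon>/2 * \<bar>1\<bar>}"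
      (is "_ \<le> prob ?A + prob ?B") for N
    proof -
      have "prob {\<omega> \<in> space M. \<bar>a N \<omega> + b N \<omega>\<bar> > \<epsilon>} \<le> prob (?A \<union> ?B)"
        by (intro finite_measure_mono) (auto, measurable)
      also have "\<dots> \<le> prob ?A + prob ?B"
        by (intro measure_Un_le) measurable
      finally show ?thesis .
    qed
    then show "\<forall>\<^sub>F N in sequentially. prob {\<omega> \<in> space M. \<bar>a N \<omega> + b N \<omega>\<bar> > \<epsilon>}
        \<le> prob {\<omega> \<in> space M. \<bar>a N \<omega>\<bar> > \<epsilon>/2 * \<bar>1\<bar>} + prob {\<omega> \<in> space M. \<bar>b N \<omega>\<bar> > \<epsilon>/2 * \<bar>1\<bar>}"
      by simp
  qed simp
  then show ?thesis by (simp add: small_op_def)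
qed

lemma op1_seq_mult_Op1:
  assumes "c \<longlonglongrightarrow> 0" "Op1 M b"
  shows "op1 M (\<lambda>N \<omega>. c N * b N \<omega>)"
proof (rule op1_bound_by_product[where a="\<lambda>N _. c N" and b=b])
  show "op1 M (\<lambda>N _. c N)" using assms by (intro op1_AE) auto
qed (use assms(2) big_op_measurable[OF assms(2)] in \<open>auto simp: abs_mult\<close>)

lemma op1_compose:
  assumes "op1 M T" "filterlim n sequentially sequentially"
  shows "op1 M (\<lambda>N. T (n N))"
  unfolding small_op_def
proof (intro conjI allI impI)
  fix \<epsilon> :: real assume "\<epsilon> > 0"
  with assms(1) have "(\<lambda>N. prob {\<omega> \<in> space M. \<bar>T N \<omega>\<bar> > \<epsilon> * \<bar>1\<bar>}) \<longlonglongrightarrow> 0"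
    unfolding small_op_def by blast
  from filterlim_compose[OF this assms(2)]
  show "(\<lambda>N. prob {\<omega> \<in> space M. \<bar>T (n N) \<omega>\<bar> > \<epsilon> * \<bar>1\<bar>}) \<longlonglongrightarrow> 0" .
qed (use op1_measurable[OF assms(1)] in auto)

end

subsection \<open>Asymptotic normality\<close>

text \<open>One formula for the characteristic function covers both branches of
  \<open>normal_law\<close>: the point mass for variance 0 and, for positive variance, the image of
  the standard normal law under scaling by sqrt v.\<close>

lemma char_normal_law:
  assumes "0 \<le> v"
  shows "real_distribution (normal_law 0 v)"
    and "char (normal_law 0 v) t = complex_of_real (exp (- (v * t\<^sup>2) / 2))"
proof -
  consider "v = 0" | "v > 0" using assms by linarith
  then have "real_distribution (normal_law 0 v) \<and> char (normal_law 0 v) t = complex_of_real (exp (- (v * t\<^sup>2) / 2))"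
  proof cases
    case 1
    have "prob_space (return borel (0::real))" by (rule prob_space_return) simp
    then have "real_distribution (return borel (0::real))"
      by (auto simp: real_distribution_def real_distribution_axioms_def)
    moreover have "char (return borel (0::real)) t = 1"
      unfolding char_def by (subst integral_return) auto
    ultimately show ?thesis using 1 by (simp add: normal_law_def)
  next
    case 2
    interpret S: real_distribution std_normal_distribution by (rule real_dist_normal_dist)
    have "distributed std_normal_distribution lborel (\<lambda>x. x) (normal_density 0 1)"
      unfolding distributed_def
      by (auto simp: distr_id2 intro!: measure_eqI) 
    from S.normal_density_affine[OF this, of "sqrt v" 0] 2
    have "distributed std_normal_distribution lborel (\<lambda>x. sqrt v * x) (normal_density 0 (sqrt v))"
      by simp
    then have "distr std_normal_distribution lborel (\<lambda>x. sqrt v * x) = density lborel (normal_density 0 (sqrt v))"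
      by (simp add: distributed_def)
    then have eq: "normal_law 0 v = distr std_normal_distribution borel (\<lambda>x. sqrt v * x)"
      using 2 by (simp add: normal_law_def cong: distr_cong)
    have "char (normal_law 0 v) t = char std_normal_distribution (t * sqrt v)"
      unfolding eq char_def by (subst integral_distr) (auto simp: mult_ac)
    also have "\<dots> = complex_of_real (exp (- (v * t\<^sup>2) / 2))"
      using 2 by (simp add: char_std_normal_distribution power_mult_distrib mult_ac)
    finally show ?thesis
      unfolding eq by (auto intro!: S.real_distribution_distr)
  qed
  then show "real_distribution (normal_law 0 v)"
    "char (normal_law 0 v) t = complex_of_real (exp (- (v * t\<^sup>2) / 2))" by auto
qed

text \<open>Levy's continuity theorem in both directions. All later operations on scalar limit laws
  (scaling, Slutsky, passing to other sample sizes, independent sums) become computations with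
  characteristic functions.\<close>

lemma (in prob_space) asymp_normal_iff_char:
  assumes m: "\<And>N. T N \<in> borel_measurable M" and v: "0 \<le> v"
  shows "asymp_normal M T v \<longleftrightarrow>
    (\<forall>t. (\<lambda>N. char (distr M borel (T N)) t) \<longlonglongrightarrow> complex_of_real (exp (- (v * t\<^sup>2) / 2)))"
proof -
  have d: "real_distribution (distr M borel (T N))" for N
    using m by (rule real_distribution_distr)
  show ?thesis
    unfolding asymp_normal_def char_normal_law(2)[OF v, symmetric]
    using m levy_continuity1[OF d char_normal_law(1)[OF v], of "\<lambda>N. N"]
      levy_continuity[OF d char_normal_law(1)[OF v], of "\<lambda>N. N"] by blast
qed

lemma asymp_normal_measurable: "asymp_normal P T v \<Longrightarrow> T N \<in> borel_measurable P"
  by (simp add: asymp_normal_def)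

lemma norm_iexp_diff_le: "norm (iexp a - iexp b) \<le> \<bar>a - b\<bar>"
proof -
  have "iexp a - iexp b = iexp b * (iexp (a - b) - 1)"
    by (simp add: right_diff_distrib flip: exp_add of_real_add distrib_left)
  then have "norm (iexp a - iexp b) = norm (iexp (a - b) - 1)"
    by (simp add: norm_mult)
  also have "\<dots> \<le> \<bar>a - b\<bar>"
    using iexp_approx1[of "a - b" 0] by simp
  finally show ?thesis .
qed

context prob_space
begin

lemma char_distr_eq:
  assumes [measurable]: "T \<in> borel_measurable M"
  shows "char (distr M borel T) t = (CLINT \<omega>|M. iexp (t * T \<omega>))"
  unfolding char_def by (subst integral_distr) auto

lemma asymp_normalD_char:
  assumes "asymp_normal M T v" "0 \<le> v"
  shows "(\<lambda>N. char (distr M borel (T N)) t) \<longlonglongrightarrow> complex_of_real (exp (- (v * t\<^sup>2) / 2))"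
  using assms(1) asymp_normal_iff_char[of T v, OF asymp_normal_measurable[OF assms(1)] assms(2)] by blast

lemma asymp_normalI_char:
  assumes "\<And>N. T N \<in> borel_measurable M" "0 \<le> v"
    and "\<And>t. (\<lambda>N. char (distr M borel (T N)) t) \<longlonglongrightarrow> complex_of_real (exp (- (v * t\<^sup>2) / 2))"
  shows "asymp_normal M T v"
  using assms(3) asymp_normal_iff_char[of T v, OF assms(1,2)] by blast

text \<open>The characters of \<open>T'\<close> and \<open>T\<close> differ by at most
  \<open>\<bar>t\<bar>\<close> times the distance of the two variables, and never by more than 2;
  the second bound is used on the event where the distance is large.\<close>

lemma asymp_normal_slutsky:
  assumes T: "asymp_normal M T v" and v: "0 \<le> v"
    and D: "op1 M (\<lambda>N \<omega>. T' N \<omega> - T N \<omega>)" and T': "\<And>N. T' N \<in> borel_measurable M"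
  shows "asymp_normal M T' v"
proof -
  have [measurable]: "T N \<in> borel_measurable M" "T' N \<in> borel_measurable M" for N
    using T T' by (auto simp: asymp_normal_def)
  have "(\<lambda>N. char (distr M borel (T' N)) t - char (distr M borel (T N)) t) \<longlonglongrightarrow> 0" for t
  proof (rule tendstoI)
    fix \<eta> :: real assume eta: "\<eta> > 0"
    \<comment> \<open>The close part then contributes less than half of \<open>\<eta>\<close>; the
      bound 2 on an event of probability below a quarter of \<open>\<eta>\<close> contributes less
      than the other half.\<close>
    define e where "e = \<eta> / (2 * (\<bar>t\<bar> + 1))"
    have e: "e > 0" "\<bar>t\<bar> * e < \<eta> / 2" using eta by (auto simp: e_def field_simps)
    have "(\<lambda>N. prob {\<omega> \<in> space M. \<bar>T' N \<omega> - T N \<omega>\<bar> > e * \<bar>1\<bar>}) \<longlonglongrightarrow> 0"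
      using D e unfolding small_op_def by blast
    from tendstoD[OF this, of "\<eta>/4"] eta
    have "\<forall>\<^sub>F N in sequentially. prob {\<omega> \<in> space M. \<bar>T' N \<omega> - T N \<omega>\<bar> > e} < \<eta> / 4" by simp
    then show "\<forall>\<^sub>F N in sequentially.
      dist (char (distr M borel (T' N)) t - char (distr M borel (T N)) t) 0 < \<eta>"
    proof eventually_elim
      case (elim N)
      let ?A = "{\<omega> \<in> space M. \<bar>T' N \<omega> - T N \<omega>\<bar> > e}"
      have [measurable]: "?A \<in> events" by measurable
      have "norm (char (distr M borel (T' N)) t - char (distr M borel (T N)) t)
        = norm (CLINT \<omega>|M. iexp (t * T' N \<omega>) - iexp (t * T N \<omega>))"
        by (simp add: char_distr_eq integrable_iexp)
      also have "\<dots> \<le> (\<integral>\<omega>. norm (iexp (t * T' N \<omega>) - iexp (t * T N \<omega>)) \<partial>M)"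
        by (rule integral_norm_bound)
      also have "\<dots> \<le> (\<integral>\<omega>. \<bar>t\<bar> * e + 2 * indicator ?A \<omega> \<partial>M)"
      proof (rule integral_mono)
        show "integrable M (\<lambda>\<omega>. norm (iexp (t * T' N \<omega>) - iexp (t * T N \<omega>)))"
          by (intro integrable_norm Bochner_Integration.integrable_diff integrable_iexp) auto
        show "integrable M (\<lambda>\<omega>. \<bar>t\<bar> * e + 2 * indicator ?A \<omega>)"
          by (intro Bochner_Integration.integrable_add integrable_mult_right integrable_real_indicator)
             (auto simp: emeasure_eq_measure)
        fix \<omega> assume "\<omega> \<in> space M"
        have "norm (iexp (t * T' N \<omega>) - iexp (t * T N \<omega>)) \<le> norm (iexp (t * T' N \<omega>)) + norm (iexp (t * T N \<omega>))"
          by (rule norm_triangle_ineq4)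
        then have "norm (iexp (t * T' N \<omega>) - iexp (t * T N \<omega>)) \<le> 2" by simp
        moreover have "norm (iexp (t * T' N \<omega>) - iexp (t * T N \<omega>)) \<le> \<bar>t\<bar> * \<bar>T' N \<omega> - T N \<omega>\<bar>"
          using norm_iexp_diff_le[of "t * T' N \<omega>" "t * T N \<omega>"]
          by (simp add: abs_mult flip: right_diff_distrib)
        moreover have "\<bar>t\<bar> * \<bar>T' N \<omega> - T N \<omega>\<bar> \<le> \<bar>t\<bar> * e" if "\<omega> \<notin> ?A"
          using that \<open>\<omega> \<in> space M\<close> by (intro mult_left_mono) auto
        moreover have "0 \<le> \<bar>t\<bar> * e" using e by simp
        ultimately show "norm (iexp (t * T' N \<omega>) - iexp (t * T N \<omega>)) \<le> \<bar>t\<bar> * e + 2 * indicator ?A \<omega>"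
          by (cases "\<omega> \<in> ?A") auto
      qed
      also have "\<dots> = \<bar>t\<bar> * e + 2 * prob ?A"
        by (subst Bochner_Integration.integral_add)
           (auto simp: emeasure_eq_measure prob_space intro!: integrable_mult_right integrable_real_indicator)
      also have "\<dots> < \<eta>" using elim e by (simp add: measure_nonneg)
      finally show ?case by simp
    qed
  qed
  moreover have "(\<lambda>N. char (distr M borel (T N)) t) \<longlonglongrightarrow> complex_of_real (exp (- (v * t\<^sup>2) / 2))" for t
    by (rule asymp_normalD_char[OF T v])
  ultimately have "(\<lambda>N. (char (distr M borel (T' N)) t - char (distr M borel (T N)) t) + char (distr M borel (T N)) t)
      \<longlonglongrightarrow> 0 + complex_of_real (exp (- (v * t\<^sup>2) / 2))" for t
    by (intro tendsto_add)
  then show ?thesis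
    using v by (intro asymp_normalI_char) auto
qed

lemma asymp_normal_integral_conv:
  assumes T: "asymp_normal M T v" and v: "0 \<le> v"
    and f: "\<And>x. isCont f x" "\<And>x. norm (f x :: real) \<le> B"
  shows "(\<lambda>N. \<integral>\<omega>. f (T N \<omega>) \<partial>M) \<longlonglongrightarrow> (\<integral>x. f x \<partial>normal_law 0 v)"
proof -
  have [measurable]: "T N \<in> borel_measurable M" for N
    using T by (auto simp: asymp_normal_def)
  have [measurable]: "f \<in> borel_measurable borel"
    using f by (intro borel_measurable_continuous_onI continuous_at_imp_continuous_on) auto
  have "(\<lambda>N. integral\<^sup>L (distr M borel (T N)) f) \<longlonglongrightarrow> integral\<^sup>L (normal_law 0 v) f"
    using T f by (intro weak_conv_imp_integral_bdd_continuous_conv[OF _ char_normal_law(1)[OF v]])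
      (auto simp: asymp_normal_def)
  then show ?thesis by (subst (asm) integral_distr) auto
qed

text \<open>Tightness by a continuous cutoff: \<open>f k\<close> is 0 on [-k, k] and 1 beyond k + 1.
  Its expectation under the limit law is small for large k, weak convergence carries this to
  \<open>T N\<close>, and there it dominates the probability of exceeding k + 1.\<close>

lemma asymp_normal_Op1:
  assumes T: "asymp_normal M T v" and v: "0 \<le> v"
  shows "Op1 M T"
proof -
  have [measurable]: "T N \<in> borel_measurable M" for N
    using T by (auto simp: asymp_normal_def)
  interpret \<mu>: real_distribution "normal_law 0 v" by (rule char_normal_law(1)[OF v])
  define f :: "nat \<Rightarrow> real \<Rightarrow> real" where "f k x = min 1 (max 0 (\<bar>x\<bar> - real k))" for k x
  have fm[measurable]: "f k \<in> borel_measurable borel" for k unfolding f_def by measurable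
  have "\<exists>L. \<forall>\<^sub>F N in sequentially. prob {\<omega> \<in> space M. \<bar>T N \<omega>\<bar> > L * \<bar>1\<bar>} < \<eta>"
    if eta: "\<eta> > 0" for \<eta> :: real
  proof -
    have "(\<lambda>k. \<integral>x. f k x \<partial>normal_law 0 v) \<longlonglongrightarrow> (\<integral>x. 0 \<partial>normal_law 0 v)"
    proof (rule integral_dominated_convergence[where w="\<lambda>_. 1"])
      show "AE x in normal_law 0 v. (\<lambda>k. f k x) \<longlonglongrightarrow> 0"
      proof (rule AE_I2)
        fix x :: real
        obtain k where k: "\<bar>x\<bar> \<le> real k" using real_arch_simple by blast
        have "\<forall>\<^sub>F n in sequentially. f n x = 0"
          using eventually_ge_at_top[of k] by eventually_elim (use k in \<open>auto simp: f_def\<close>)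
        then show "(\<lambda>k. f k x) \<longlonglongrightarrow> 0" by (rule tendsto_eventually)
      qed
    qed (auto simp: f_def)
    from order_tendstoD(2)[OF this, of \<eta>] eta obtain k where k: "(\<integral>x. f k x \<partial>normal_law 0 v) < \<eta>"
      by (auto simp: eventually_sequentially)
    have "(\<lambda>N. \<integral>\<omega>. f k (T N \<omega>) \<partial>M) \<longlonglongrightarrow> (\<integral>x. f k x \<partial>normal_law 0 v)"
      by (rule asymp_normal_integral_conv[OF T v, where B=1]) (auto simp: f_def intro!: continuous_intros)
    from order_tendstoD(2)[OF this k]
    have "\<forall>\<^sub>F N in sequentially. prob {\<omega> \<in> space M. \<bar>T N \<omega>\<bar> > real (k+1) * \<bar>1\<bar>} < \<eta>"
    proof eventually_elim
      case (elim N)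
      have "prob {\<omega> \<in> space M. \<bar>T N \<omega>\<bar> > real (k+1) * \<bar>1\<bar>}
        = (\<integral>\<omega>. indicator {\<omega> \<in> space M. \<bar>T N \<omega>\<bar> > real (k+1) * \<bar>1\<bar>} \<omega> \<partial>M)" by simp
      also have "\<dots> \<le> (\<integral>\<omega>. f k (T N \<omega>) \<partial>M)"
      proof (rule integral_mono)
        show "integrable M (\<lambda>\<omega>. f k (T N \<omega>))"
          by (rule integrable_const_bound[where B=1]) (auto simp: f_def)
        show "integrable M (indicator {\<omega> \<in> space M. \<bar>T N \<omega>\<bar> > real (k+1) * \<bar>1\<bar>} :: _ \<Rightarrow> real)"
          by (intro integrable_real_indicator) (measurable, simp add: emeasure_eq_measure)
      qed (auto simp: f_def indicator_def)
      finally show ?case using elim by simp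
    qed
    then show ?thesis by blast
  qed
  then show ?thesis by (simp add: big_op_def)
qed

lemma asymp_normal_cmult:
  assumes T: "asymp_normal M T v" and v: "0 \<le> v"
  shows "asymp_normal M (\<lambda>N \<omega>. c * T N \<omega>) (c\<^sup>2 * v)"
proof -
  have [measurable]: "T N \<in> borel_measurable M" for N
    using T by (auto simp: asymp_normal_def)
  have "(\<lambda>N. char (distr M borel (T N)) t) \<longlonglongrightarrow> complex_of_real (exp (- (v * t\<^sup>2) / 2))" for t
    by (rule asymp_normalD_char[OF T v])
  from this[of "t * c" for t] show ?thesis
    using v by (intro asymp_normalI_char) (auto simp: char_distr_eq mult_ac power_mult_distrib)
qed

text \<open>The difference from scaling by the limit is a null sequence times a tight one. The lemma
  serves the factor sqrt (N / N1) of the second sample; the limit \<open>c0 = 0\<close>, which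
  arises for an infinite size ratio, is included.\<close>

lemma asymp_normal_seq_mult:
  assumes T: "asymp_normal M T v" and v: "0 \<le> v" and c: "c \<longlonglongrightarrow> (c0::real)"
  shows "asymp_normal M (\<lambda>N \<omega>. c N * T N \<omega>) (c0\<^sup>2 * v)"
proof (rule asymp_normal_slutsky[OF asymp_normal_cmult[OF T v]])
  have "op1 M (\<lambda>N \<omega>. (c N - c0) * T N \<omega>)"
    using c by (intro op1_seq_mult_Op1 asymp_normal_Op1[OF T v]) (simp add: LIM_zero)
  then show "op1 M (\<lambda>N \<omega>. c N * T N \<omega> - c0 * T N \<omega>)"
    by (simp add: left_diff_distrib)
  show "(\<lambda>\<omega>. c N * T N \<omega>) \<in> borel_measurable M" for N
    using asymp_normal_measurable[OF T] by (intro borel_measurable_times) auto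
qed (use v in auto)

lemma asymp_normal_compose:
  assumes "asymp_normal M T v" "0 \<le> v" "filterlim n sequentially sequentially"
  shows "asymp_normal M (\<lambda>N. T (n N)) v"
proof -
  have [measurable]: "T N \<in> borel_measurable M" for N
    using assms by (auto simp: asymp_normal_def)
  have "(\<lambda>N. char (distr M borel (T N)) t) \<longlonglongrightarrow> complex_of_real (exp (- (v * t\<^sup>2) / 2))" for t
    by (rule asymp_normalD_char[OF assms(1,2)])
  from filterlim_compose[OF this assms(3)] show ?thesis
    using assms(2) by (intro asymp_normalI_char) auto
qed

lemma asymp_normal_add_indep:
  assumes A: "asymp_normal M A v" "0 \<le> v" and B: "asymp_normal M B w" "0 \<le> w"
    and ind: "\<And>N. indep_var borel (A N) borel (B N)"
  shows "asymp_normal M (\<lambda>N \<omega>. A N \<omega> + B N \<omega>) (v + w)"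
proof -
  have [measurable]: "A N \<in> borel_measurable M" "B N \<in> borel_measurable M" for N
    using A B by (auto simp: asymp_normal_def)
  have "(\<lambda>N. char (distr M borel (\<lambda>\<omega>. A N \<omega> + B N \<omega>)) t)
    \<longlonglongrightarrow> complex_of_real (exp (- ((v + w) * t\<^sup>2) / 2))" for t
  proof -
    have e: "exp (- ((v + w) * t\<^sup>2) / 2) = exp (- (v * t\<^sup>2) / 2) * exp (- (w * t\<^sup>2) / 2)"
      unfolding exp_add[symmetric] by (simp add: field_simps)
    show ?thesis
      unfolding char_distr_add[OF ind] e of_real_mult
      by (intro tendsto_mult asymp_normalD_char A B)
  qed
  then show ?thesis
    using A(2) B(2) by (intro asymp_normalI_char) auto
qed

lemma asymp_normal_zero: "asymp_normal M (\<lambda>N \<omega>. 0) 0"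
  by (rule asymp_normalI_char) (auto simp: char_distr_eq prob_space simp del: distr_const)

end

subsection \<open>The Cramer--Wold device\<close>

text \<open>Each generator sees \<open>x\<close> only through one scalar
  \<open>a \<bullet> x\<close>, so its expectation is governed by a scalar limit law. The phase
  \<open>b\<close> supplies the sines, and the product-to-sum formula makes the class closed under
  multiplication.\<close>

inductive trig_poly :: "(real^'n \<Rightarrow> real) \<Rightarrow> bool" where
  cos: "trig_poly (\<lambda>x. cos (a \<bullet> x + b))"
| scale: "trig_poly f \<Longrightarrow> trig_poly (\<lambda>x. c * f x)"
| add: "trig_poly f \<Longrightarrow> trig_poly g \<Longrightarrow> trig_poly (\<lambda>x. f x + g x)"

lemma trig_poly_const: "trig_poly (\<lambda>x. c)"
  using trig_poly.scale[OF trig_poly.cos[of 0 0], of c] by simp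

lemma trig_poly_cos_mult:
  assumes "trig_poly f"
  shows "trig_poly (\<lambda>x. cos (a \<bullet> x + b) * f x)"
  using assms
proof induction
  case (cos a' b')
  have "trig_poly (\<lambda>x. (1/2) * (cos ((a - a') \<bullet> x + (b - b')) + cos ((a + a') \<bullet> x + (b + b'))))"
    by (intro trig_poly.intros)
  moreover have "(\<lambda>x. (1/2) * (cos ((a - a') \<bullet> x + (b - b')) + cos ((a + a') \<bullet> x + (b + b'))))
    = (\<lambda>x. cos (a \<bullet> x + b) * cos (a' \<bullet> x + b'))"
  proof
    fix x
    have "(a - a') \<bullet> x + (b - b') = (a \<bullet> x + b) - (a' \<bullet> x + b')"
      "(a + a') \<bullet> x + (b + b') = (a \<bullet> x + b) + (a' \<bullet> x + b')"
      by (simp_all add: inner_diff_left inner_add_left)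
    then show "(1/2) * (cos ((a - a') \<bullet> x + (b - b')) + cos ((a + a') \<bullet> x + (b + b')))
      = cos (a \<bullet> x + b) * cos (a' \<bullet> x + b')"
      by (simp only: cos_times_cos)
  qed
  ultimately show ?case by simp
next
  case (scale f c)
  from trig_poly.scale[OF this(2), of c] show ?case by (simp add: mult_ac)
next
  case (add f g)
  from trig_poly.add[OF add.IH] show ?case by (simp add: distrib_left)
qed

lemma trig_poly_mult:
  assumes "trig_poly f" "trig_poly g"
  shows "trig_poly (\<lambda>x. f x * g x)"
  using assms(1)
proof induction
  case (cos a b)
  show ?case by (rule trig_poly_cos_mult) fact
next
  case (scale f c)
  from trig_poly.scale[OF this(2), of c] show ?case by (simp add: mult_ac)
next
  case (add f g)
  from trig_poly.add[OF add.IH] show ?case by (simp add: distrib_right)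
qed

lemma trig_poly_sum:
  assumes "finite I" "\<And>i. i \<in> I \<Longrightarrow> trig_poly (f i)"
  shows "trig_poly (\<lambda>x. \<Sum>i\<in>I. f i x)"
  using assms
  by (induction I rule: finite_induct) (auto intro: trig_poly_const trig_poly.add)

text \<open>Coordinatewise sine turns a polynomial on the cube into a trigonometric polynomial on
  the whole space, since a sine is a cosine with phase - pi / 2. This makes Weierstrass
  approximation on a compact cube usable for functions on the whole space.\<close>

lemma trig_poly_real_polynomial:
  fixes p :: "real^'n \<Rightarrow> real"
  assumes "real_polynomial_function p"
  shows "trig_poly (\<lambda>x::real^'n. p (\<chi> i. sin (c * x $ i)))"
  using assms
proof induction
  case (linear f)
  interpret bounded_linear f by fact
  have "(\<lambda>x::real^'n. f (\<chi> i. sin (c * x $ i))) = (\<lambda>x. \<Sum>i\<in>UNIV. f (axis i 1) * cos ((c *\<^sub>R axis i 1) \<bullet> x + (- pi / 2)))"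
  proof
    fix x :: "real^'n"
    have "(\<chi> i. sin (c * x $ i)) = (\<Sum>i\<in>UNIV. sin (c * x $ i) *\<^sub>R axis i (1::real))"
      by (simp add: vec_eq_iff axis_def if_distrib if_distribR cong: if_cong)
    then show "f (\<chi> i. sin (c * x $ i)) = (\<Sum>i\<in>UNIV. f (axis i 1) * cos ((c *\<^sub>R axis i 1) \<bullet> x + (- pi / 2)))"
      by (simp add: sum scaleR inner_axis' cos_diff mult.commute)
  qed
  then show ?case
    by (simp only:) (intro trig_poly_sum trig_poly.scale trig_poly.cos finite)
next
  case (const c)
  then show ?case by (rule trig_poly_const)
next
  case (add f g)
  then show ?case by (intro trig_poly.add)
next
  case (mult f g)
  then show ?case by (intro trig_poly_mult)
qed

lemma trig_poly_bounded_continuous: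
  assumes "trig_poly f"
  shows "(\<exists>B. \<forall>x. \<bar>f x\<bar> \<le> B) \<and> continuous_on UNIV f"
  using assms
proof induction
  case (cos a b)
  then show ?case by (auto intro!: exI[of _ 1] continuous_intros)
next
  case (scale f c)
  then obtain B where "\<And>x. \<bar>f x\<bar> \<le> B" by auto
  then have "\<bar>c * f x\<bar> \<le> \<bar>c\<bar> * B" for x by (simp add: abs_mult mult_left_mono)
  with scale show ?case by (auto intro!: continuous_intros)
next
  case (add f g)
  then obtain B C where "\<And>x. \<bar>f x\<bar> \<le> B" "\<And>x. \<bar>g x\<bar> \<le> C" by auto
  then have "\<bar>f x + g x\<bar> \<le> B + C" for x by (meson abs_triangle_ineq add_mono order_trans)
  with add show ?case by (auto intro!: continuous_intros)
qed


context prob_space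
begin

lemma trig_poly_expectation_conv:
  fixes T :: "nat \<Rightarrow> 'a \<Rightarrow> real^'n"
  assumes an: "\<And>t. asymp_normal M (\<lambda>N \<omega>. t \<bullet> T N \<omega>) (t \<bullet> (S *v t))"
    and psd: "\<And>t. 0 \<le> t \<bullet> (S *v t)"
    and [measurable]: "\<And>N. T N \<in> borel_measurable M"
    and \<nu>: "is_mv_normal 0 S \<nu>" "prob_space \<nu>"
    and f: "trig_poly f"
  shows "(\<lambda>N. \<integral>\<omega>. f (T N \<omega>) \<partial>M) \<longlonglongrightarrow> (\<integral>x. f x \<partial>\<nu>)"
proof -
  interpret \<nu>: prob_space \<nu> by fact
  have [measurable_cong]: "sets \<nu> = sets borel" using \<nu> by (simp add: is_mv_normal_def)
  have int: "integrable M (\<lambda>\<omega>. f (T N \<omega>))" "integrable \<nu> f" if "trig_poly f" for f and N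
  proof -
    from trig_poly_bounded_continuous[OF that] obtain B where B: "\<And>x. \<bar>f x\<bar> \<le> B"
      and c: "continuous_on UNIV f" by auto
    have [measurable]: "f \<in> borel_measurable borel" using c by (rule borel_measurable_continuous_onI)
    show "integrable M (\<lambda>\<omega>. f (T N \<omega>))" "integrable \<nu> f"
      using B by (auto intro!: integrable_const_bound[where B=B] \<nu>.integrable_const_bound[where B=B])
  qed
  from f show ?thesis
  proof induction
    case (cos a b)
    have "(\<lambda>N. \<integral>\<omega>. cos (a \<bullet> T N \<omega> + b) \<partial>M) \<longlonglongrightarrow> (\<integral>x. cos (x + b) \<partial>normal_law 0 (a \<bullet> (S *v a)))"
      by (rule asymp_normal_integral_conv[OF an psd, where B=1]) auto
    also have "normal_law 0 (a \<bullet> (S *v a)) = distr \<nu> borel (\<lambda>x. a \<bullet> x)"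
      using \<nu> by (simp add: is_mv_normal_def)
    also have "(\<integral>x. cos (x + b) \<partial>distr \<nu> borel (\<lambda>x. a \<bullet> x)) = (\<integral>x. cos (a \<bullet> x + b) \<partial>\<nu>)"
      by (subst integral_distr) auto
    finally show ?case .
  next
    case (scale f c)
    then show ?case by (simp add: tendsto_mult_left)
  next
    case (add f g)
    then show ?case by (simp add: int tendsto_add)
  qed
qed

text \<open>A large ball is mapped injectively into the unit cube by coordinatewise sine. Pulling
  \<open>g\<close> back through arcsine gives a continuous function on the cube, a polynomial
  \<open>p\<close> approximates it uniformly, and \<open>p\<close> composed with sine is a
  trigonometric polynomial close to \<open>g\<close> on the ball. Outside the ball the approximant
  remains bounded, because the pullback takes only values of \<open>g\<close>; tightness makes that
  part small.\<close>

lemma cramer_wold: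
  fixes T :: "nat \<Rightarrow> 'a \<Rightarrow> real^'n"
  assumes an: "\<And>t. asymp_normal M (\<lambda>N \<omega>. t \<bullet> T N \<omega>) (t \<bullet> (S *v t))"
    and psd: "\<And>t. 0 \<le> t \<bullet> (S *v t)"
    and m[measurable]: "\<And>N. T N \<in> borel_measurable M"
    and \<nu>: "is_mv_normal 0 S \<nu>" "prob_space \<nu>"
    and g: "continuous_on UNIV g" "bounded (range (g :: real^'n \<Rightarrow> real))"
  shows "(\<lambda>N. \<integral>\<omega>. g (T N \<omega>) \<partial>M) \<longlonglongrightarrow> (\<integral>x. g x \<partial>\<nu>)"
proof (rule tendstoI)
  interpret \<nu>: prob_space \<nu> by fact
  have [measurable_cong]: "sets \<nu> = sets borel" using \<nu> by (simp add: is_mv_normal_def)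
  have [measurable]: "g \<in> borel_measurable borel" using g(1) by (rule borel_measurable_continuous_onI)
  obtain B where B: "B > 0" "\<And>x. \<bar>g x\<bar> \<le> B"
    using g(2) by (auto simp: bounded_pos)
  fix e :: real assume e: "e > 0"
  \<comment> \<open>With tail probability below \<open>d\<close> the tail costs at most 2 B d = e /
    4. Each of the two replacements of \<open>g\<close> then costs at most e / 8 + e / 4, and
    together with e / 8 for the trigonometric polynomial the total is 7 e / 8.\<close>
  define d where "d = e / (8 * B)"
  have d: "d > 0" "B * d = e / 8" using e B by (auto simp: d_def)
  have "Op1 M (\<lambda>N \<omega>. \<Sum>i\<in>UNIV. \<bar>axis i 1 \<bullet> T N \<omega>\<bar>)"
    by (intro Op1_sum asymp_normal_Op1[OF an psd]) simp
  then have "Op1 M (\<lambda>N \<omega>. norm (T N \<omega>))"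
    by (rule Op1_bound[where C=1, rotated])
      (auto simp: inner_axis' intro!: order_trans[OF norm_le_l1_cart])
  then obtain L1 where L1: "\<forall>\<^sub>F N in sequentially. prob {\<omega> \<in> space M. \<bar>norm (T N \<omega>)\<bar> > L1 * \<bar>1\<bar>} < d"
    using d unfolding big_op_def by meson
  have "(\<lambda>k. measure \<nu> {x \<in> space \<nu>. \<not> norm x \<le> real k}) \<longlonglongrightarrow> 0"
  proof (rule \<nu>.prob_eventually_tendsto_0)
    show "AE x in \<nu>. \<forall>\<^sub>F k in sequentially. norm x \<le> real k"
    proof (rule AE_I2)
      fix x :: "real^'n"
      obtain k where "norm x \<le> real k" using real_arch_simple by blast
      then show "\<forall>\<^sub>F k in sequentially. norm x \<le> real k"
        by (intro eventually_sequentiallyI[of k]) auto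
    qed
  qed measurable
  from order_tendstoD(2)[OF this d(1)] obtain k where k: "measure \<nu> {x \<in> space \<nu>. \<not> norm x \<le> real k} < d"
    by (auto simp: eventually_sequentially)
  define L where "L = max 1 (max L1 (real k))"
  have L: "L > 0" "L1 \<le> L" "real k \<le> L" by (auto simp: L_def)
  \<comment> \<open>For \<open>norm x \<le> L\<close> every coordinate of \<open>c\<close> times
    \<open>x\<close> lies in [- pi / 2, pi / 2], the range on which arcsine inverts sine.\<close>
  define c where "c = pi / (2 * L)"
  define s where "s x = (\<chi> i. sin (c * x $ i))" for x :: "real^'n"
  define G where "G y = g (\<chi> i. arcsin (y $ i) / c)" for y :: "real^'n"
  let ?C = "cbox (\<chi> i. -1) (\<chi> i. 1) :: (real^'n) set"
  have "continuous_on ?C G"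
    unfolding G_def
    by (rule continuous_on_compose2[OF g(1)])
       (auto intro!: continuous_intros simp: mem_box_cart c_def L(1) less_imp_neq[OF L(1), symmetric])
  then obtain p where p: "real_polynomial_function p" "\<And>y. y \<in> ?C \<Longrightarrow> \<bar>G y - p y\<bar> < e / 8"
    using Stone_Weierstrass_real_polynomial_function[of ?C G "e/8"] e compact_cbox by auto
  define q where "q x = p (s x)" for x
  have trig: "trig_poly q"
    unfolding q_def s_def using p(1) by (rule trig_poly_real_polynomial)
  from trig_poly_bounded_continuous[OF trig] obtain B' where B': "\<And>x. \<bar>q x\<bar> \<le> B'" and qc: "continuous_on UNIV q"
    by auto
  have [measurable]: "q \<in> borel_measurable borel" using qc by (rule borel_measurable_continuous_onI)
  have sC: "s x \<in> ?C" for x by (auto simp: s_def mem_box_cart)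
  have qG: "\<bar>G (s x) - q x\<bar> < e / 8" for x using p(2)[OF sC] by (simp add: q_def)
  have Gs: "G (s x) = g x" if "norm x \<le> L" for x
  proof -
    have "arcsin (sin (c * x $ i)) / c = x $ i" for i
    proof -
      have "\<bar>x $ i\<bar> \<le> L" using that component_le_norm_cart[of x i] by simp
      then have "\<bar>c * x $ i\<bar> \<le> pi / 2"
        using L(1) by (auto simp: c_def abs_mult field_simps)
      then have "arcsin (sin (c * x $ i)) = c * x $ i" by (intro arcsin_sin) (auto simp: abs_le_iff)
      moreover have "c > 0" using L(1) by (simp add: c_def)
      ultimately show ?thesis by simp
    qed
    then show ?thesis by (simp add: G_def s_def)
  qed
  \<comment> \<open>Stated for an arbitrary probability space because it is used twice: for
    \<open>T N\<close> under the sampling measure and for the identity under the limit law.\<close>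
  have close: "\<bar>(\<integral>\<omega>. g (U \<omega>) \<partial>Q) - (\<integral>\<omega>. q (U \<omega>) \<partial>Q)\<bar> \<le> e / 8 + 2 * B * measure Q {\<omega> \<in> space Q. \<not> norm (U \<omega>) \<le> L}"
    if "prob_space Q" and U[measurable]: "U \<in> borel_measurable Q" for Q :: "'q measure" and U
  proof -
    interpret Q: prob_space Q by fact
    let ?A = "{\<omega> \<in> space Q. \<not> norm (U \<omega>) \<le> L}"
    have i1: "integrable Q (\<lambda>\<omega>. g (U \<omega>))" "integrable Q (\<lambda>\<omega>. q (U \<omega>))"
      using B B' by (auto intro: Q.integrable_const_bound[where B=B] Q.integrable_const_bound[where B=B'])
    have i2: "integrable Q (\<lambda>\<omega>. 2 * B * indicator ?A \<omega>)"
      by (intro integrable_mult_right integrable_real_indicator) (measurable, simp add: Q.emeasure_eq_measure)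
    have "\<bar>(\<integral>\<omega>. g (U \<omega>) \<partial>Q) - (\<integral>\<omega>. q (U \<omega>) \<partial>Q)\<bar> = \<bar>\<integral>\<omega>. g (U \<omega>) - q (U \<omega>) \<partial>Q\<bar>"
      using i1 by simp
    also have "\<dots> \<le> (\<integral>\<omega>. \<bar>g (U \<omega>) - q (U \<omega>)\<bar> \<partial>Q)"
      using integral_norm_bound[of Q "\<lambda>\<omega>. g (U \<omega>) - q (U \<omega>)"] by simp
    also have "\<dots> \<le> (\<integral>\<omega>. e / 8 + 2 * B * indicator ?A \<omega> \<partial>Q)"
    proof (rule integral_mono)
      fix \<omega> assume w: "\<omega> \<in> space Q"
      have "\<bar>G (s (U \<omega>))\<bar> \<le> B" using B(2) by (simp add: G_def)
      then show "\<bar>g (U \<omega>) - q (U \<omega>)\<bar> \<le> e / 8 + 2 * B * indicator ?A \<omega>"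
        using Gs[of "U \<omega>"] qG[of "U \<omega>"] B(2)[of "U \<omega>"] w
        by (cases "norm (U \<omega>) \<le> L"; simp add: indicator_def; linarith)
    qed (use i1 i2 in auto)
    also have "\<dots> = e / 8 + 2 * B * measure Q ?A"
      using i2 by (subst Bochner_Integration.integral_add) (auto simp: Q.prob_space)
    finally show ?thesis .
  qed
  have tail: "measure \<nu> {x \<in> space \<nu>. \<not> norm x \<le> L} \<le> measure \<nu> {x \<in> space \<nu>. \<not> norm x \<le> real k}"
    using L by (intro \<nu>.finite_measure_mono) auto
  have "(\<lambda>N. \<integral>\<omega>. q (T N \<omega>) \<partial>M) \<longlonglongrightarrow> (\<integral>x. q x \<partial>\<nu>)"
    by (rule trig_poly_expectation_conv[OF an psd m \<nu> trig])
  from tendstoD[OF this, of "e/8"] e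
  have "\<forall>\<^sub>F N in sequentially. \<bar>(\<integral>\<omega>. q (T N \<omega>) \<partial>M) - (\<integral>x. q x \<partial>\<nu>)\<bar> < e / 8" by (simp add: dist_real_def)
  then show "\<forall>\<^sub>F N in sequentially. dist (\<integral>\<omega>. g (T N \<omega>) \<partial>M) (\<integral>x. g x \<partial>\<nu>) < e"
    using L1
  proof eventually_elim
    case (elim N)
    have "prob {\<omega> \<in> space M. \<not> norm (T N \<omega>) \<le> L} \<le> prob {\<omega> \<in> space M. \<bar>norm (T N \<omega>)\<bar> > L1 * \<bar>1\<bar>}"
      using L by (intro finite_measure_mono) auto
    then have "2 * B * prob {\<omega> \<in> space M. \<not> norm (T N \<omega>) \<le> L} \<le> 2 * B * d"
      using elim B by (intro mult_left_mono) auto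
    moreover have "2 * B * measure \<nu> {x \<in> space \<nu>. \<not> norm x \<le> L} \<le> 2 * B * d"
      using tail k B by (intro mult_left_mono) auto
    ultimately have "\<bar>(\<integral>\<omega>. g (T N \<omega>) \<partial>M) - (\<integral>\<omega>. q (T N \<omega>) \<partial>M)\<bar> \<le> 3 * e / 8"
      "\<bar>(\<integral>x. g x \<partial>\<nu>) - (\<integral>x. q x \<partial>\<nu>)\<bar> \<le> 3 * e / 8"
      using close[OF prob_space_axioms m[of N]] close[OF \<nu>(2), of "\<lambda>x. x"] d by auto
    with elim e show ?case by (auto simp: dist_real_def abs_if split: if_splits)
  qed
qed

end

subsection \<open>Existence of multivariate normal laws\<close>

text \<open>A Cholesky factorisation by induction on the set \<open>A\<close> of coordinates on
  which \<open>S\<close> is still supported. The pivot coordinate contributes one square and the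
  Schur complement lives on the remaining coordinates.\<close>

lemma psd_decomposition:
  fixes S :: "real^'n^'n"
  assumes "finite A" "\<And>i j. S $ i $ j = S $ j $ i" "\<And>t. 0 \<le> t \<bullet> (S *v t)"
    and "\<And>i j. i \<notin> A \<Longrightarrow> S $ i $ j = 0"
  shows "\<exists>a :: 'n \<Rightarrow> real^'n. \<forall>t. t \<bullet> (S *v t) = (\<Sum>k\<in>A. (t \<bullet> a k)\<^sup>2)"
  using assms
proof (induction A arbitrary: S rule: finite_induct)
  case empty
  then have "S = 0" by (simp add: vec_eq_iff)
  then show ?case by (simp add: matrix_vector_mult_def inner_vec_def)
next
  case (insert x F)
  note sym = insert.prems(1) and psd = insert.prems(2)
  let ?e = "axis x 1 :: real^'n"
  define r where "r = S *v ?e"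
  have r: "r $ i = S $ i $ x" for i by (simp add: r_def matrix_vector_mult_def axis_def if_distrib cong: if_cong)
  have self: "t \<bullet> (S *v u) = u \<bullet> (S *v t)" for t u
  proof -
    have "transpose S = S" by (simp add: transpose_def vec_eq_iff sym)
    then show ?thesis by (metis dot_lmul_matrix transpose_matrix_vector inner_commute)
  qed
  have er: "?e \<bullet> r = S $ x $ x" by (simp add: inner_axis' r)
  have quad: "(t - c *\<^sub>R ?e) \<bullet> (S *v (t - c *\<^sub>R ?e)) = t \<bullet> (S *v t) - 2 * c * (t \<bullet> r) + c\<^sup>2 * S $ x $ x" for t c
  proof -
    have "S *v (t - c *\<^sub>R ?e) = S *v t - c *\<^sub>R r"
      unfolding r_def by (simp only: matrix_vector_mult_diff_distrib matrix_vector_mult_scaleR)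
    moreover have "?e \<bullet> (S *v t) = t \<bullet> r" unfolding r_def by (rule self)
    ultimately show ?thesis
      by (simp only: inner_diff_left inner_diff_right inner_scaleR_left inner_scaleR_right er)
         (simp add: algebra_simps power2_eq_square)
  qed
  have "0 \<le> ?e \<bullet> (S *v ?e)" by (rule psd)
  then have "0 \<le> S $ x $ x" by (simp add: er flip: r_def)
  show ?case
  proof (cases "S $ x $ x = 0")
    case True
    have "t \<bullet> r = 0" for t
    proof (rule ccontr)
      assume "t \<bullet> r \<noteq> 0"
      \<comment> \<open>With zero pivot the shifted quadratic form is affine in the shift; this
        shift makes it equal to -1, contradicting semidefiniteness. So a zero pivot forces its whole
        row and column to vanish.\<close>
      have "0 \<le> t \<bullet> (S *v t) - 2 * ((t \<bullet> (S *v t) + 1) / (2 * (t \<bullet> r))) * (t \<bullet> r)"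
        using psd[of "t - ((t \<bullet> (S *v t) + 1) / (2 * (t \<bullet> r))) *\<^sub>R ?e"] True by (simp only: quad)
      with \<open>t \<bullet> r \<noteq> 0\<close> show False by simp
    qed
    from this[of r] have "r = 0" by simp
    then have "S $ x $ j = 0" for j using r[of j] sym[of x j] by simp
    with insert.prems(3) have "S $ i $ j = 0" if "i \<notin> F" for i j using that by (cases "i = x") auto
    with insert.IH[OF sym psd] obtain a :: "'n \<Rightarrow> real^'n" where a: "\<And>t. t \<bullet> (S *v t) = (\<Sum>k\<in>F. (t \<bullet> a k)\<^sup>2)" by blast
    have "(\<Sum>k\<in>insert x F. (t \<bullet> (a(x := 0)) k)\<^sup>2) = (\<Sum>k\<in>F. (t \<bullet> a k)\<^sup>2)" for t
      using insert.hyps by (auto intro!: sum.cong)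
    with a show ?thesis by (intro exI[of _ "a(x := 0)"]) auto
  next
    case False
    with \<open>0 \<le> S $ x $ x\<close> have pos: "S $ x $ x > 0" by simp
    \<comment> \<open>The Schur complement: subtracting the rank-one matrix of the pivot column,
      divided by the pivot, clears row and column \<open>x\<close>.\<close>
    define S' where "S' = (\<chi> i j. S $ i $ j - S $ i $ x * S $ j $ x / S $ x $ x)"
    have q': "t \<bullet> (S' *v t) = t \<bullet> (S *v t) - (t \<bullet> r)\<^sup>2 / S $ x $ x" for t
    proof -
      have "S' *v t = S *v t - ((t \<bullet> r) / S $ x $ x) *\<^sub>R r"
        by (simp add: vec_eq_iff S'_def matrix_vector_mult_def r inner_vec_def sum_subtractf
            left_diff_distrib right_diff_distrib sum_distrib_left sum_divide_distrib sum_distrib_right mult_ac)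
      then show ?thesis by (simp add: inner_diff_right power2_eq_square)
    qed
    have "0 \<le> t \<bullet> (S' *v t)" for t
    proof -
      \<comment> \<open>Among all shifts of \<open>t\<close> along the pivot axis this one minimises
        the quadratic form, and the minimum is the Schur complement at \<open>t\<close>.\<close>
      have "0 \<le> t \<bullet> (S *v t) - 2 * ((t \<bullet> r) / S $ x $ x) * (t \<bullet> r) + ((t \<bullet> r) / S $ x $ x)\<^sup>2 * S $ x $ x"
        using psd[of "t - ((t \<bullet> r) / S $ x $ x) *\<^sub>R ?e"] by (simp only: quad)
      then show ?thesis using pos unfolding q' by (simp add: power2_eq_square field_simps)
    qed
    moreover have "S' $ i $ j = S' $ j $ i" for i j using sym by (simp add: S'_def)
    moreover have "S' $ i $ j = 0" if "i \<notin> F" for i j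
      using that pos insert.prems(3) sym[of x j] by (cases "i = x") (auto simp: S'_def)
    ultimately obtain a :: "'n \<Rightarrow> real^'n" where a: "\<And>t. t \<bullet> (S' *v t) = (\<Sum>k\<in>F. (t \<bullet> a k)\<^sup>2)"
      using insert.IH[of S'] by blast
    define b where "b = a(x := (1 / sqrt (S $ x $ x)) *\<^sub>R r)"
    have "(\<Sum>k\<in>F. (t \<bullet> b k)\<^sup>2) = (\<Sum>k\<in>F. (t \<bullet> a k)\<^sup>2)" for t
      using insert.hyps by (intro sum.cong) (auto simp: b_def)
    then have "t \<bullet> (S *v t) = (\<Sum>k\<in>insert x F. (t \<bullet> b k)\<^sup>2)" for t
      using insert.hyps a[of t] q'[of t] pos by (simp add: b_def power_divide)
    then show ?thesis by blast
  qed
qed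

text \<open>The law is that of a combination of independent standard normal coordinates with the
  vectors of \<open>psd_decomposition\<close> as coefficients. The matrix need not be invertible, so
  no density is involved; the projections are identified by characteristic functions.\<close>

lemma mv_normal_exists:
  fixes S :: "real^'n^'n"
  assumes sym: "\<And>i j. S $ i $ j = S $ j $ i" and psd: "\<And>t. 0 \<le> t \<bullet> (S *v t)"
  shows "\<exists>\<nu>. is_mv_normal 0 S \<nu> \<and> prob_space \<nu>"
proof -
  obtain a :: "'n \<Rightarrow> real^'n" where a: "\<And>t. t \<bullet> (S *v t) = (\<Sum>k\<in>UNIV. (t \<bullet> a k)\<^sup>2)"
    using psd_decomposition[of UNIV S] sym psd by auto
  let ?N = "std_normal_distribution"
  define Q where "Q = Pi\<^sub>M (UNIV :: 'n set) (\<lambda>_. ?N)"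
  interpret N: real_distribution ?N by (rule real_dist_normal_dist)
  interpret Q: prob_space Q unfolding Q_def by (intro prob_space_PiM N.prob_space_axioms)
  have sQ[measurable_cong]: "sets Q = sets (Pi\<^sub>M UNIV (\<lambda>_. borel))"
    unfolding Q_def by (intro sets_PiM_cong) auto
  have comp: "distr Q borel (\<lambda>\<omega>. \<omega> i) = ?N" for i
  proof -
    have "distr Q borel (\<lambda>\<omega>. \<omega> i) = distr Q ?N (\<lambda>\<omega>. \<omega> i)" by (intro distr_cong) auto
    also have "\<dots> = ?N" unfolding Q_def by (intro distr_PiM_component N.prob_space_axioms) auto
    finally show ?thesis .
  qed
  have "Q.indep_vars (\<lambda>_. borel) (\<lambda>i \<omega>. \<omega> i) UNIV"
  proof (subst Q.indep_vars_iff_distr_eq_PiM)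
    have "distr Q (Pi\<^sub>M UNIV (\<lambda>_. borel)) (\<lambda>x. \<lambda>i\<in>UNIV. x i) = distr Q Q (\<lambda>x. x)"
      using sQ by (intro distr_cong) auto
    also have "\<dots> = Q" by simp
    finally show "distr Q (Pi\<^sub>M UNIV (\<lambda>_. borel)) (\<lambda>x. \<lambda>i\<in>UNIV. x i) = Pi\<^sub>M UNIV (\<lambda>i. distr Q borel (\<lambda>\<omega>. \<omega> i))"
      unfolding comp by (simp add: Q_def)
  qed auto
  then have ind: "Q.indep_vars (\<lambda>_. borel) (\<lambda>i \<omega>. c i * \<omega> i) UNIV" for c :: "'n \<Rightarrow> real"
    by (rule Q.indep_vars_compose2) auto
  define U :: "('n \<Rightarrow> real) \<Rightarrow> real^'n" where "U \<omega> = (\<Sum>k\<in>UNIV. \<omega> k *\<^sub>R a k)" for \<omega>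
  have U[measurable]: "U \<in> borel_measurable Q" unfolding U_def by measurable
  define \<nu> where "\<nu> = distr Q borel U"
  have "distr \<nu> borel (\<lambda>x. t \<bullet> x) = normal_law 0 (t \<bullet> (S *v t))" for t
  proof (rule Levy_uniqueness)
    have eq: "distr \<nu> borel (\<lambda>x. t \<bullet> x) = distr Q borel (\<lambda>\<omega>. \<Sum>k\<in>UNIV. (t \<bullet> a k) * \<omega> k)"
      unfolding \<nu>_def by (subst distr_distr) (auto simp: comp_def U_def inner_sum_right mult.commute)
    show "real_distribution (distr \<nu> borel (\<lambda>x. t \<bullet> x))"
      unfolding eq by (rule Q.real_distribution_distr) measurable
    show "real_distribution (normal_law 0 (t \<bullet> (S *v t)))" by (rule char_normal_law(1)[OF psd])
    show "char (distr \<nu> borel (\<lambda>x. t \<bullet> x)) = char (normal_law 0 (t \<bullet> (S *v t)))"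
    proof
      fix u
      have 1: "char (distr Q borel (\<lambda>\<omega>. c * \<omega> k)) u = complex_of_real (exp (- ((u * c)\<^sup>2 / 2)))" for c k
      proof -
        have "distr Q borel (\<lambda>\<omega>. c * \<omega> k) = distr (distr Q borel (\<lambda>\<omega>. \<omega> k)) borel (\<lambda>x. c * x)"
          by (subst distr_distr) (auto simp: comp_def)
        then have "char (distr Q borel (\<lambda>\<omega>. c * \<omega> k)) u = (CLINT x|?N. iexp (u * (c * x)))"
          unfolding comp by (simp add: N.char_distr_eq)
        also have "\<dots> = char ?N (u * c)" by (simp add: char_def mult.assoc)
        finally show ?thesis by (simp add: char_std_normal_distribution)
      qed
      have "char (distr \<nu> borel (\<lambda>x. t \<bullet> x)) u = (\<Prod>k\<in>UNIV. complex_of_real (exp (- ((u * (t \<bullet> a k))\<^sup>2 / 2))))"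
        unfolding eq by (subst Q.char_distr_sum[OF ind]) (simp only: 1)
      also have "\<dots> = complex_of_real (exp (\<Sum>k\<in>UNIV. - ((u * (t \<bullet> a k))\<^sup>2 / 2)))"
        by (simp add: exp_sum)
      also have "(\<Sum>k\<in>UNIV. - ((u * (t \<bullet> a k))\<^sup>2 / 2)) = - ((t \<bullet> (S *v t)) * u\<^sup>2) / 2"
        by (simp add: a power_mult_distrib sum_negf sum_distrib_left sum_distrib_right sum_divide_distrib mult_ac)
      finally show "char (distr \<nu> borel (\<lambda>x. t \<bullet> x)) u = char (normal_law 0 (t \<bullet> (S *v t))) u"
        by (simp add: char_normal_law(2)[OF psd])
    qed
  qed
  moreover have "prob_space \<nu>" unfolding \<nu>_def by (rule Q.prob_space_distr) measurable
  ultimately show ?thesis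
    by (intro exI[of _ \<nu>]) (simp add: is_mv_normal_def, simp add: \<nu>_def)
qed

lemma (in prob_space) asymp_mv_normalI:
  fixes T :: "nat \<Rightarrow> 'a \<Rightarrow> real^'n"
  assumes "\<And>N. T N \<in> borel_measurable M"
    and "\<And>i j. S $ i $ j = S $ j $ i" "\<And>t. 0 \<le> t \<bullet> (S *v t)"
    and "\<And>t. asymp_normal M (\<lambda>N \<omega>. t \<bullet> T N \<omega>) (t \<bullet> (S *v t))"
  shows "asymp_mv_normal M T S"
proof -
  obtain \<nu> where "is_mv_normal 0 S \<nu>" "prob_space \<nu>"
    using mv_normal_exists[of S] assms(2,3) by blast
  with cramer_wold[OF assms(4,3,1) this] assms(1) show ?thesis
    unfolding asymp_mv_normal_def by blast
qed

subsection \<open>Bounded functions of an i.i.d. sample\<close>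

lemma law_prob_space: "is_density f \<Longrightarrow> prob_space (law f)"
  unfolding law_def is_density_def by (intro prob_spaceI) (simp add: emeasure_density)

lemma sets_law[measurable_cong, simp]: "sets (law f) = sets borel"
  by (simp add: law_def)

lemma space_law[simp]: "space (law f) = UNIV"
  by (simp add: law_def)

locale bounded_iid = prob_space +
  fixes f :: "real \<Rightarrow> real" and X :: "nat \<Rightarrow> 'a \<Rightarrow> real"
  assumes dens: "is_density f" and iid: "iid_sample M f X"
begin

lemma X_measurable[measurable]: "X j \<in> borel_measurable M"
  using iid unfolding iid_sample_def distributed_def by auto

lemma X_distr: "distr M borel (X j) = law f"
proof -
  have "distr M borel (X j) = distr M lborel (X j)" by (intro distr_cong) auto
  then show ?thesis using iid by (simp add: iid_sample_def distributed_def law_def)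
qed

lemma X_expectation:
  fixes h :: "real \<Rightarrow> 'b::{banach,second_countable_topology}"
  assumes [measurable]: "h \<in> borel_measurable borel"
  shows "expectation (\<lambda>\<omega>. h (X j \<omega>)) = expct f h"
  unfolding expct_def X_distr[of j, symmetric] by (subst integral_distr) auto

lemma indep_compose:
  assumes "h \<in> borel_measurable borel"
  shows "indep_vars (\<lambda>_. borel) (\<lambda>j \<omega>. h (X j \<omega>)) UNIV"
  using iid assms unfolding iid_sample_def by (auto intro: indep_vars_compose2)

text \<open>Hoeffding's inequality bounds the deviation probabilities by a geometric sequence, so
  Borel-Cantelli applies to each threshold; the countably many thresholds 1 / (k + 1) together give
  convergence.\<close>

lemma sample_mean_AE_real:
  fixes h :: "real \<Rightarrow> real"
  assumes h[measurable]: "h \<in> borel_measurable borel" and b: "\<And>x. \<bar>h x\<bar> \<le> b"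
  shows "AE \<omega> in M. (\<lambda>N. (1 / real N) * (\<Sum>j<N. h (X j \<omega>))) \<longlonglongrightarrow> expct f h"
proof -
  \<comment> \<open>Strictly positive, so that the interval in Hoeffding's inequality is not
    degenerate and the ratio of the geometric sequence is below 1.\<close>
  define b' where "b' = b + 1"
  have b': "b' > 0" "\<bar>h x\<bar> \<le> b'" for x using b[of x] by (auto simp: b'_def)
  define m where "m = expct f h"
  have dev: "AE \<omega> in M. \<forall>\<^sub>F N in sequentially. \<bar>(1 / real N) * (\<Sum>j<N. h (X j \<omega>)) - m\<bar> < e" if e: "e > 0" for e
  proof -
    let ?A = "\<lambda>N. {\<omega> \<in> space M. \<bar>(\<Sum>j<N. h (X j \<omega>)) / real N - m\<bar> \<ge> e}"
    let ?q = "exp (- 2 * e\<^sup>2 / (b' - (- b'))\<^sup>2)"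
    have bound: "prob (?A N) \<le> 2 * ?q ^ N" if "N > 0" for N
    proof -
      have dX: "distr M borel (\<lambda>\<omega>. h (X i \<omega>)) = distr (law f) borel h" for i
        unfolding X_distr[of i, symmetric] by (subst distr_distr) (auto simp: comp_def)
      have ind: "indep_vars (\<lambda>_. borel) (\<lambda>j \<omega>. h (X j \<omega>)) {..<N}"
        by (rule indep_vars_subset[OF indep_compose[OF h]]) simp
      have ae: "AE x in M. h (X 0 x) \<in> {- b'..b'}"
        using b'(2) by (intro AE_I2) (simp add: abs_le_D1 abs_le_D2 minus_le_iff[of b'])
      interpret H: iid_interval_bounded_random_variables M "{..<N}" "\<lambda>j \<omega>. h (X j \<omega>)" "\<lambda>\<omega>. h (X 0 \<omega>)" "- b'" b'
        unfolding iid_interval_bounded_random_variables_def iid_interval_bounded_random_variables_axioms_def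
        by (intro conjI impI prob_space_axioms ind ae finite_lessThan) (simp_all only: dX, measurable)
      interpret H: Hoeffding_ineq_iid M "{..<N}" "\<lambda>j \<omega>. h (X j \<omega>)" "\<lambda>\<omega>. h (X 0 \<omega>)" "- b'" b' "expectation (\<lambda>\<omega>. h (X 0 \<omega>))"
        unfolding Hoeffding_ineq_iid_def by (rule H.iid_interval_bounded_random_variables_axioms) (rule reflexive)
      have "prob (?A N) \<le> 2 * exp (- 2 * real N * e\<^sup>2 / (b' - - b')\<^sup>2)"
        using H.Hoeffding_ineq_abs_ge'[of e] e b'(1) that
        by (simp only: X_expectation[OF h] card_lessThan m_def) (simp add: lessThan_empty_iff)
      also have "exp (- 2 * real N * e\<^sup>2 / (b' - - b')\<^sup>2) = ?q ^ N"
        by (simp flip: exp_of_nat_mult)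
      finally show ?thesis .
    qed
    have q: "norm ?q < 1" using e b' by simp
    have "AE \<omega> in M. \<forall>\<^sub>F N in sequentially. \<omega> \<in> space M - ?A N"
    proof (rule borel_cantelli_AE1)
      show "summable (\<lambda>N. prob (?A N))"
      proof (rule summable_comparison_test_ev)
        show "\<forall>\<^sub>F N in sequentially. norm (prob (?A N)) \<le> 2 * ?q ^ N"
          using eventually_gt_at_top[of 0] by eventually_elim (use bound in \<open>simp add: measure_nonneg\<close>)
        show "summable (\<lambda>N. 2 * ?q ^ N)"
          by (intro summable_mult summable_geometric q)
      qed
    qed (auto simp: emeasure_eq_measure)
    then show ?thesis by eventually_elim (auto elim!: eventually_mono)
  qed
  have "AE \<omega> in M. \<forall>k::nat. \<forall>\<^sub>F N in sequentially. \<bar>(1 / real N) * (\<Sum>j<N. h (X j \<omega>)) - m\<bar> < inverse (real (Suc k))"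
    by (subst AE_all_countable) (intro allI dev, simp)
  then show ?thesis
  proof eventually_elim
    case (elim \<omega>)
    show ?case
      unfolding m_def[symmetric]
    proof (rule tendstoI)
      fix e :: real assume "e > 0"
      then obtain k where k: "inverse (real (Suc k)) < e" using reals_Archimedean by blast
      from elim have "\<forall>\<^sub>F N in sequentially. \<bar>(1 / real N) * (\<Sum>j<N. h (X j \<omega>)) - m\<bar> < inverse (real (Suc k))" by blast
      then show "\<forall>\<^sub>F N in sequentially. dist ((1 / real N) * (\<Sum>j<N. h (X j \<omega>))) m < e"
        by eventually_elim (use k in \<open>simp add: dist_real_def\<close>)
    qed
  qed
qed

definition scaled_sum :: "(real \<Rightarrow> real) \<Rightarrow> nat \<Rightarrow> 'a \<Rightarrow> real" where
  "scaled_sum h N \<omega> = (1 / sqrt (real N)) * (\<Sum>j<N. h (X j \<omega>))"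

lemma scaled_sum_measurable[measurable]:
  assumes [measurable]: "h \<in> borel_measurable borel"
  shows "scaled_sum h N \<in> borel_measurable M"
  unfolding scaled_sum_def by measurable

text \<open>The central limit theorem covers positive variance. The degenerate case has to be
  included because the score covariance may be singular, and Cramer-Wold tests every direction;
  there \<open>h\<close> vanishes at almost every observation and the sums are almost surely
  0.\<close>

lemma scaled_sum_asymp_normal:
  assumes h[measurable]: "h \<in> borel_measurable borel" and b: "\<And>x. \<bar>h x\<bar> \<le> b" and mean: "expct f h = 0"
  shows "asymp_normal M (scaled_sum h) (expct f (\<lambda>x. (h x)\<^sup>2))"
proof -
  interpret L: prob_space "law f" by (rule law_prob_space[OF dens])
  define v where "v = expct f (\<lambda>x. (h x)\<^sup>2)"
  have sq: "(h x)\<^sup>2 \<le> b\<^sup>2" for x using power_mono[OF b[of x], of 2] by simp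
  have int: "integrable (law f) (\<lambda>x. (h x)\<^sup>2)"
    by (rule L.integrable_const_bound[where B="b\<^sup>2"]) (use sq in auto)
  have v0: "v \<ge> 0" unfolding v_def expct_def by simp
  show ?thesis
  proof (cases "v = 0")
    case True
    then have "AE x in law f. (h x)\<^sup>2 = 0"
      using int by (simp add: v_def expct_def integral_nonneg_eq_0_iff_AE)
    then have "AE x in distr M borel (X j). h x = 0" for j unfolding X_distr by simp
    then have "AE \<omega> in M. h (X j \<omega>) = 0" for j by (subst (asm) AE_distr_iff) auto
    then have "AE \<omega> in M. \<forall>j. h (X j \<omega>) = 0" by (simp add: AE_all_countable)
    then have "AE \<omega> in M. (\<lambda>N. scaled_sum h N \<omega> - 0) \<longlonglongrightarrow> 0"
      by eventually_elim (simp add: scaled_sum_def)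
    then have "op1 M (\<lambda>N \<omega>. scaled_sum h N \<omega> - 0)"
      by (intro op1_AE) auto
    from asymp_normal_slutsky[OF asymp_normal_zero _ this] True show ?thesis by (simp add: v_def)
  next
    case False
    with v0 have v: "v > 0" by simp
    have d: "distr M borel (\<lambda>\<omega>. h (X n \<omega>)) = distr (law f) borel h" for n
      unfolding X_distr[of n, symmetric] by (subst distr_distr) (auto simp: comp_def)
    have "weak_conv_m (\<lambda>n. distr M borel (\<lambda>x. (\<Sum>i<n. h (X i x)) / sqrt (n * (sqrt v)\<^sup>2))) std_normal_distribution"
    proof (rule central_limit_theorem_zero_mean[OF indep_compose[OF h] _ _ _ _ d])
      show "integrable M (\<lambda>x. (h (X n x))\<^sup>2)" for n
        by (rule integrable_const_bound[where B="b\<^sup>2"]) (use sq in auto)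
      show "expectation (\<lambda>\<omega>. h (X n \<omega>)) = 0" for n using X_expectation[OF h] mean by simp
      then show "variance (\<lambda>\<omega>. h (X n \<omega>)) = (sqrt v)\<^sup>2" for n
        using X_expectation[of "\<lambda>x. (h x)\<^sup>2" n] v by (simp add: v_def)
    qed (use v in auto)
    moreover have "std_normal_distribution = normal_law 0 1"
      by (simp add: normal_law_def)
    ultimately have "asymp_normal M (\<lambda>n x. (\<Sum>i<n. h (X i x)) / sqrt (n * (sqrt v)\<^sup>2)) 1"
      by (simp add: asymp_normal_def)
    from asymp_normal_cmult[OF this, of "sqrt v"] v
    have "asymp_normal M (\<lambda>n x. sqrt v * ((\<Sum>i<n. h (X i x)) / sqrt (n * v))) v" by simp
    also have "(\<lambda>n x. sqrt v * ((\<Sum>i<n. h (X i x)) / sqrt (n * v))) = scaled_sum h"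
      using v by (simp add: scaled_sum_def fun_eq_iff real_sqrt_mult)
    finally show ?thesis by (simp add: v_def)
  qed
qed

end

subsection \<open>Block vectors\<close>

lemma part1_join[simp]: "part1 (join a b) = a" and part2_join[simp]: "part2 (join a b) = b"
  by (simp_all add: part1_def part2_def join_def vec_eq_iff)

lemma join_parts[simp]: "join (part1 v) (part2 v) = v"
  by (simp add: part1_def part2_def join_def vec_eq_iff split: sum.split)

lemma join_nth[simp]: "join a b $ Inl i = a $ i" "join a b $ Inr j = b $ j"
  by (simp_all add: join_def)

lemma jvec_eq_iff: "v = w \<longleftrightarrow> part1 v = part1 w \<and> part2 v = part2 w"
  by (metis join_parts)

lemma part_nth[simp]: "part1 v $ i = v $ Inl i" "part2 v $ j = v $ Inr j"
  by (simp_all add: part1_def part2_def)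

lemma part_linear[simp]:
  "part1 (v + w) = part1 v + part1 w" "part2 (v + w) = part2 v + part2 w"
  "part1 (v - w) = part1 v - part1 w" "part2 (v - w) = part2 v - part2 w"
  "part1 (c *\<^sub>R v) = c *\<^sub>R part1 v" "part2 (c *\<^sub>R v) = c *\<^sub>R part2 v"
  "part1 0 = 0" "part2 0 = 0" "part1 (- v) = - part1 v" "part2 (- v) = - part2 v"
  by (simp_all add: vec_eq_iff)

lemma join_linear:
  "join a b + join c d = join (a + c) (b + d)"
  "join a b - join c d = join (a - c) (b - d)"
  "r *\<^sub>R join a b = join (r *\<^sub>R a) (r *\<^sub>R b)"
  by (simp_all add: jvec_eq_iff)

lemma part_sum: "part1 (\<Sum>i\<in>I. v i) = (\<Sum>i\<in>I. part1 (v i))" "part2 (\<Sum>i\<in>I. v i) = (\<Sum>i\<in>I. part2 (v i))"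
  by (simp_all add: vec_eq_iff)

lemma sum_UNIV_Plus:
  fixes f :: "'a::finite + 'b::finite \<Rightarrow> 'c::comm_monoid_add"
  shows "(\<Sum>k\<in>UNIV. f k) = (\<Sum>i\<in>UNIV. f (Inl i)) + (\<Sum>j\<in>UNIV. f (Inr j))"
  by (simp add: UNIV_Plus_UNIV[symmetric] sum.Plus del: UNIV_Plus_UNIV)

lemma inner_jvec:
  fixes v w :: "('a::finite, 'b::finite) jvec"
  shows "v \<bullet> w = part1 v \<bullet> part1 w + part2 v \<bullet> part2 w"
  by (simp add: inner_vec_def sum_UNIV_Plus)

lemma bounded_linear_part1: "bounded_linear (part1 :: ('a::finite,'b::finite) jvec \<Rightarrow> _)"
  and bounded_linear_part2: "bounded_linear (part2 :: ('a,'b) jvec \<Rightarrow> _)"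
  and bounded_linear_join1: "bounded_linear (\<lambda>a::real^'a. join a (0::real^'b))"
  and bounded_linear_join2: "bounded_linear (\<lambda>b::real^'b. join (0::real^'a) b)"
  unfolding linear_conv_bounded_linear[symmetric]
  by (auto intro!: linearI simp: join_linear)

lemma pair_parts[simp]: "part1 (pair k c) = k" "part2 (pair k c) $ u = c"
  by (simp_all add: pair_def)

lemma pair_eta: "pair (part1 z) (part2 z $ ()) = z"
  by (simp add: pair_def jvec_eq_iff vec_eq_iff)

lemma inner_pair: "pair k c \<bullet> pair l d = k \<bullet> l + c * d"
  by (simp add: inner_jvec pair_def) (simp add: inner_vec_def UNIV_unit)

lemma pair_linear:
  "pair k c + pair l d = pair (k + l) (c + d)" "pair k c - pair l d = pair (k - l) (c - d)"
  "r *\<^sub>R pair k c = pair (r *\<^sub>R k) (r * c)" "- pair k c = pair (- k) (- c)"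
  by (simp_all add: jvec_eq_iff pair_def vec_eq_iff)

lemma pair_eq_iff[simp]: "pair k c = pair l d \<longleftrightarrow> k = l \<and> c = d"
  by (auto simp: jvec_eq_iff pair_def vec_eq_iff)

text \<open>A sum of bounded linear images, the form to which the rules for derivatives
  apply.\<close>

lemma pair_split: "pair k c = join k 0 + c *\<^sub>R join 0 (\<chi> _. 1)"
  unfolding jvec_eq_iff by (simp add: pair_def vec_eq_iff)

subsection \<open>The \<open>vech\<close> coordinates\<close>

lemma unvech_vech:
  assumes "\<And>i j. C $ i $ j = C $ j $ i"
  shows "unvech (vech C) = C"
proof -
  have "Rep_vech_ix (Abs_vech_ix (max i j, min i j)) = (max i j, min i j)" for i j :: 'a
    by (rule Abs_vech_ix_inverse) (auto simp: max_def min_def)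
  then show ?thesis
    using assms by (simp add: unvech_def vech_def vec_eq_iff max_def min_def)
qed

lemma mom_C_mom: "(\<And>i j. C $ i $ j = C $ j $ i) \<Longrightarrow> mom_C (mom u C) = C"
  by (simp add: mom_C_def mom_def unvech_vech)

lemma mom_u_mom[simp]: "mom_u (mom u C) = u"
  by (simp add: mom_u_def mom_def)

lemma unvech_linear: "unvech (v + w) = unvech v + unvech w" "unvech (c *\<^sub>R v) = c *\<^sub>R unvech v"
  by (simp_all add: unvech_def vec_eq_iff)

lemma vech_linear: "vech (v + w) = vech v + vech w" "vech (c *\<^sub>R v) = c *\<^sub>R vech v"
  "vech (v - w) = vech v - vech w"
  by (simp_all add: vech_def vec_eq_iff)

lemma bounded_linear_mom_u: "bounded_linear mom_u"
  and bounded_linear_mom_C: "bounded_linear mom_C"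
  and bounded_linear_vech: "bounded_linear vech"
  unfolding linear_conv_bounded_linear[symmetric] mom_u_def mom_C_def
  by (auto intro!: linearI simp: unvech_linear vech_linear)

lemma mom_linear:
  "mom u C + mom v D = mom (u + v) (C + D)" "mom u C - mom v D = mom (u - v) (C - D)"
  "r *\<^sub>R mom u C = mom (r *\<^sub>R u) (r *\<^sub>R C)"
  by (simp_all add: mom_def join_linear vech_linear)

lemma outer_nth[simp]: "outer a b $ i $ j = a $ i * b $ j"
  by (simp add: outer_def)

lemma outer_mult_vec: "outer a b *v x = (b \<bullet> x) *\<^sub>R a"
  by (simp add: vec_eq_iff matrix_vector_mult_def inner_vec_def sum_distrib_left mult_ac)

subsection \<open>Matrices\<close>

lemma matrix_vector_norm_le:
  fixes A :: "real^'n^'m"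
  shows "norm (A *v x) \<le> norm A * norm x"
proof -
  have "norm (A *v x) \<le> L2_set (\<lambda>i. norm (A $ i) * norm x) UNIV"
    unfolding norm_vec_def[of "A *v x"]
    by (intro L2_set_mono) (simp_all add: matrix_vector_mul_component Cauchy_Schwarz_ineq2)
  also have "\<dots> = norm A * norm x"
    by (simp add: L2_set_right_distrib[symmetric] mult.commute norm_vec_def[of A] L2_set_left_distrib)
  finally show ?thesis .
qed

lemma bounded_bilinear_matrix_vector: "bounded_bilinear (\<lambda>(A::real^'n^'m) x. A *v x)"
proof
  show "\<exists>K. \<forall>(A::real^'n^'m) x. norm (A *v x) \<le> norm A * norm x * K"
    by (intro exI[of _ 1]) (simp add: matrix_vector_norm_le)
qed (simp_all add: vec_eq_iff matrix_vector_mult_def distrib_right distrib_left sum.distrib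
    sum_distrib_left mult_ac)

lemma matrix_inv_inverse:
  fixes A :: "real^'n^'n"
  assumes "invertible A"
  shows "A ** matrix_inv A = mat 1" "matrix_inv A ** A = mat 1"
  using someI_ex[OF assms[unfolded invertible_def]] unfolding matrix_inv_def by auto

lemma matrix_inv_solve:
  fixes A :: "real^'n^'n"
  assumes "invertible A"
  shows "A *v x = b \<longleftrightarrow> x = matrix_inv A *v b"
  using matrix_inv_inverse[OF assms] by (metis matrix_vector_mul_assoc matrix_vector_mul_lid)

text \<open>The predicate under the choice operator is identically false for every singular matrix,
  so all of them share one value. Inversion is thus constant on the singular set, which is what its
  global measurability rests on.\<close>

lemma matrix_inv_singular:
  fixes A :: "real^'n^'n"
  assumes "\<not> invertible A"
  shows "matrix_inv A = (SOME A'. False)"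
proof -
  have "(A ** A' = mat 1 \<and> A' ** A = mat 1) = False" for A'
    using assms by (auto simp: invertible_def)
  then show ?thesis unfolding matrix_inv_def by (intro arg_cong[where f=Eps] ext)
qed

text \<open>Entries of the inverse as quotients of determinants; continuity on the invertible
  matrices follows from continuity of \<open>det\<close>.\<close>

lemma matrix_inv_cramer:
  fixes A :: "real^'n^'n"
  assumes "det A \<noteq> 0"
  shows "matrix_inv A $ k $ l = det (\<chi> i j. if j = k then axis l 1 $ i else A $ i $ j) / det A"
proof -
  have "matrix_inv A *v axis l 1 = (\<chi> k. det (\<chi> i j. if j = k then axis l 1 $ i else A $ i $ j) / det A)"
    using assms cramer[OF assms] matrix_inv_solve[of A] by (auto simp: invertible_det_nz)
  moreover have "(matrix_inv A *v axis l 1) $ k = matrix_inv A $ k $ l"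
    by (simp add: matrix_vector_mul_component inner_axis)
  ultimately show ?thesis by simp
qed

lemma continuous_on_det[continuous_intros]:
  fixes f :: "'b::topological_space \<Rightarrow> real^'n^'n"
  assumes "\<And>i j. continuous_on S (\<lambda>x. f x $ i $ j)"
  shows "continuous_on S (\<lambda>x. det (f x))"
  unfolding det_def by (intro continuous_intros assms)

lemma continuous_on_matrix_inv: "continuous_on {A::real^'n^'n. det A \<noteq> 0} matrix_inv"
proof -
  have "continuous_on {A::real^'n^'n. det A \<noteq> 0} (\<lambda>A. \<chi> k l. det (\<chi> i j. if j = k then axis l 1 $ i else A $ i $ j) / det A)"
  proof (intro continuous_on_vec_lambda continuous_on_divide continuous_on_det continuous_on_id ballI)
    show "continuous_on {A::real^'n^'n. det A \<noteq> 0}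
      (\<lambda>x. (\<chi> i j. if j = k then axis l 1 $ i else x $ i $ j) $ i $ j :: real)" for k l i j
      by (cases "j = k") (auto intro!: continuous_intros)
    show "continuous_on {A::real^'n^'n. det A \<noteq> 0} (\<lambda>x. x $ i $ j)" for i j
      by (intro continuous_intros)
  qed auto
  then show ?thesis
    by (rule continuous_on_eq) (simp add: vec_eq_iff matrix_inv_cramer)
qed

lemma isCont_matrix_inv:
  fixes A :: "real^'n^'n"
  assumes "det A \<noteq> 0"
  shows "isCont matrix_inv A"
proof -
  have "continuous_on UNIV (det :: real^'n^'n \<Rightarrow> real)" by (intro continuous_intros)
  then have "open {A::real^'n^'n. det A \<noteq> 0}"
    by (rule open_Collect_neq) (intro continuous_intros)
  with continuous_on_matrix_inv assms show ?thesis
    using continuous_on_eq_continuous_at by blast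
qed

lemma matrix_inv_measurable[measurable]: "matrix_inv \<in> borel_measurable (borel :: (real^'n^'n) measure)"
proof -
  have c: "continuous_on UNIV (det :: real^'n^'n \<Rightarrow> real)" by (intro continuous_intros)
  then have "open {A::real^'n^'n. det A \<noteq> 0}"
    by (rule open_Collect_neq) (intro continuous_intros)
  then have S: "{A::real^'n^'n. det A \<noteq> 0} \<in> sets borel" by simp
  have "(\<lambda>A::real^'n^'n. if A \<in> {A. det A \<noteq> 0} then matrix_inv A else (SOME A'. False)) \<in> borel_measurable borel"
    by (rule borel_measurable_continuous_on_if[OF S continuous_on_matrix_inv]) simp
  also have "(\<lambda>A::real^'n^'n. if A \<in> {A. det A \<noteq> 0} then matrix_inv A else (SOME A'. False)) = matrix_inv"
    by (auto simp: fun_eq_iff matrix_inv_singular invertible_det_nz)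
  finally show ?thesis .
qed

lemma posdef_invertible:
  fixes A :: "real^'n^'n"
  assumes "\<And>v. v \<noteq> 0 \<Longrightarrow> 0 < v \<bullet> (A *v v)"
  shows "invertible A"
proof -
  have "\<forall>x. A *v x = 0 \<longrightarrow> x = 0" using assms by force
  then show ?thesis by (simp add: invertible_left_inverse matrix_left_invertible_ker)
qed

lemma transpose_inner: "(transpose A *v t) \<bullet> h = t \<bullet> ((A :: real^'n^'m) *v h)"
  by (simp add: dot_lmul_matrix transpose_matrix_vector)

text \<open>Turns a sandwich covariance into \<open>V\<close> evaluated at pulled-back directions,
  which is how the delta method produces limiting variances.\<close>

lemma sandwich_bilinear:
  fixes A :: "real^'m^'r" and V :: "real^'m^'m"
  shows "s \<bullet> ((A ** V ** transpose A) *v t) = (transpose A *v s) \<bullet> (V *v (transpose A *v t))"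
  by (simp only: transpose_inner matrix_vector_mul_assoc[symmetric])

lemma jacobian_mult:
  fixes f :: "real^'n \<Rightarrow> real^'m"
  assumes "(f has_derivative D) (at x)"
  shows "jacobian f (at x) *v h = D h"
proof -
  have "f differentiable (at x)" using assms by (auto simp: differentiable_def)
  then have "(f has_derivative (\<lambda>h. jacobian f (at x) *v h)) (at x)" by (simp only: jacobian_works)
  from has_derivative_unique[OF this assms] show ?thesis by metis
qed

lemma gradient_inner:
  fixes f :: "real^'n \<Rightarrow> real"
  assumes "(f has_derivative D) (at x)"
  shows "gradient f x \<bullet> h = D h"
proof -
  interpret D: bounded_linear D using assms by (rule has_derivative_bounded_linear)
  have eq: "frechet_derivative f (at x) = D" using frechet_derivative_at[OF assms] by simp
  have "h = (\<Sum>i\<in>UNIV. h $ i *\<^sub>R axis i 1)"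
    by (simp add: vec_eq_iff axis_def if_distrib if_distribR cong: if_cong)
  then have "D h = D (\<Sum>i\<in>UNIV. h $ i *\<^sub>R axis i 1)" by (rule arg_cong)
  also have "\<dots> = (\<Sum>i\<in>UNIV. h $ i * D (axis i 1))" by (simp add: D.sum D.scaleR)
  finally have "D h = (\<Sum>i\<in>UNIV. h $ i * D (axis i 1))" .
  then show ?thesis by (simp add: gradient_def eq inner_vec_def mult.commute)
qed

subsection \<open>Derivatives of the moment maps\<close>

text \<open>The second factor vanishes at \<open>x\<close>, so mere continuity of \<open>G\<close>
  suffices: the error is \<open>(G y - G x) *v B (y - x)\<close>. This avoids differentiating the
  matrix inverse.\<close>

lemma has_derivative_continuous_times_linear:
  fixes G :: "'a::real_normed_vector \<Rightarrow> real^'n^'m"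
  assumes G: "isCont G x" and B: "bounded_linear B"
  shows "((\<lambda>y. G y *v B (y - x)) has_derivative (\<lambda>h. G x *v B h)) (at x)"
proof -
  obtain C where C: "\<And>h. norm (B h) \<le> norm h * C" "C > 0" using bounded_linear.pos_bounded[OF B] by blast
  interpret bb: bounded_bilinear "\<lambda>(A::real^'n^'m) x. A *v x" by (rule bounded_bilinear_matrix_vector)
  have "((\<lambda>y. norm (G y - G x) * C) \<longlongrightarrow> 0) (at x)"
    using G by (auto intro!: tendsto_eq_intros simp: isCont_def)
  moreover have "bounded_linear (\<lambda>h. G x *v B h)"
    by (rule bounded_linear_compose[OF bb.bounded_linear_right B])
  ultimately show ?thesis
  proof (rule has_derivativeI_sandwich[OF zero_less_one, rotated 2])
    fix y assume "y \<noteq> x"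
    have "B 0 = 0" using B by (simp add: linear_simps)
    then have "norm (G y *v B (y - x) - G x *v B (x - x) - G x *v B (y - x)) = norm ((G y - G x) *v B (y - x))"
      by (simp add: bb.diff_left)
    also have "\<dots> \<le> norm (G y - G x) * norm (B (y - x))" by (rule matrix_vector_norm_le)
    also have "\<dots> \<le> norm (G y - G x) * (norm (y - x) * C)" by (intro mult_left_mono C) simp
    finally show "norm (G y *v B (y - x) - G x *v B (x - x) - G x *v B (y - x)) / norm (y - x) \<le> norm (G y - G x) * C"
      using \<open>y \<noteq> x\<close> by (simp add: divide_simps mult_ac)
  qed
qed

definition F_map ::
  "('s::{finite,linorder}) moments2 \<Rightarrow> real^('s::{finite,linorder})^('s::{finite,linorder})" where
  "F_map \<eta> = mom_C (part1 \<eta>) + mom_C (part2 \<eta>)"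

definition Y_map :: "('s::{finite,linorder}) moments2 \<Rightarrow> real^('s::{finite,linorder})" where
  "Y_map \<eta> = mom_u (part2 \<eta>) - mom_u (part1 \<eta>)"

lemma bounded_linear_F_map: "bounded_linear F_map"
  unfolding F_map_def
  by (intro bounded_linear_add bounded_linear_compose[OF bounded_linear_mom_C]
      bounded_linear_part1 bounded_linear_part2)

lemma bounded_linear_Y_map: "bounded_linear Y_map"
  unfolding Y_map_def
  by (intro bounded_linear_sub bounded_linear_compose[OF bounded_linear_mom_u]
      bounded_linear_part1 bounded_linear_part2)

lemma K_map_eq: "K_map \<eta> = matrix_inv (F_map \<eta>) *v Y_map \<eta>"
  by (simp add: K_map_def Kfun_def F_map_def Y_map_def)

lemma J_map_eq: "J_map \<eta> = Y_map \<eta> \<bullet> K_map \<eta>"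
  by (simp add: J_map_def Jfun_def K_map_eq F_map_def Y_map_def)

lemma Kk_map_eq: "Kk_map \<eta> = pair (K_map \<eta>) (- (1/2) * (K_map \<eta> \<bullet> (mom_u (part1 \<eta>) + mom_u (part2 \<eta>))))"
  by (simp add: Kk_map_def k0fun_def K_map_def)

definition dK_map :: "('s::{finite,linorder}) moments2 \<Rightarrow> ('s::{finite,linorder}) moments2 \<Rightarrow> real^('s::{finite,linorder})" where
  "dK_map \<eta> h = matrix_inv (F_map \<eta>) *v (Y_map h - F_map h *v K_map \<eta>)"

definition dKk_map :: "('s::{finite,linorder}) moments2 \<Rightarrow> ('s::{finite,linorder}) moments2 \<Rightarrow> ('s, unit) jvec" where
  "dKk_map \<eta> h = pair (dK_map \<eta> h)
    (- (1/2) * (dK_map \<eta> h \<bullet> (mom_u (part1 \<eta>) + mom_u (part2 \<eta>)))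
     - (1/2) * (K_map \<eta> \<bullet> (mom_u (part1 h) + mom_u (part2 h))))"

text \<open>Since \<open>F_map\<close> and \<open>Y_map\<close> are linear, the increment is exact:
  K at \<open>\<eta>'\<close> minus K at \<open>\<eta>\<close> is the inverse of F at
  \<open>\<eta>'\<close> applied to \<open>B (\<eta>' - \<eta>)\<close>. Only continuity of the
  inverse is then needed, and the neighbourhood serves to keep F invertible.\<close>

lemma K_map_has_derivative:
  fixes \<eta> :: "('s::{finite,linorder}) moments2"
  assumes inv: "invertible (F_map \<eta>)"
  shows "(K_map has_derivative dK_map \<eta>) (at \<eta>)"
proof -
  interpret F: bounded_linear F_map by (rule bounded_linear_F_map)
  interpret Y: bounded_linear Y_map by (rule bounded_linear_Y_map)
  interpret bb: bounded_bilinear "\<lambda>(A::real^('s::{finite,linorder})^('s::{finite,linorder})) x. A *v x" by (rule bounded_bilinear_matrix_vector)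
  define B where "B h = Y_map h - F_map h *v K_map \<eta>" for h
  have B: "bounded_linear B" unfolding B_def
    by (intro bounded_linear_sub Y.bounded_linear_axioms bounded_linear_compose[OF bb.bounded_linear_left] F.bounded_linear_axioms)
  have det: "det (F_map \<eta>) \<noteq> 0" using inv by (simp add: invertible_det_nz)
  have cont: "isCont (\<lambda>\<eta>'. matrix_inv (F_map \<eta>')) \<eta>"
    by (rule isCont_o2[OF F.isCont[OF continuous_ident] isCont_matrix_inv[OF det]])
  have "((\<lambda>\<eta>'. matrix_inv (F_map \<eta>') *v B (\<eta>' - \<eta>)) has_derivative (\<lambda>h. matrix_inv (F_map \<eta>) *v B h)) (at \<eta>)"
    by (rule has_derivative_continuous_times_linear[OF cont B])
  then have D: "((\<lambda>\<eta>'. K_map \<eta> + matrix_inv (F_map \<eta>') *v B (\<eta>' - \<eta>)) has_derivative dK_map \<eta>) (at \<eta>)"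
    unfolding dK_map_def B_def[symmetric] by (auto intro!: derivative_eq_intros)
  have "open {A::real^('s::{finite,linorder})^('s::{finite,linorder}). det A \<noteq> 0}"
    by (rule open_Collect_neq) (intro continuous_intros)+
  then have "open (F_map -` {A::real^('s::{finite,linorder})^('s::{finite,linorder}). det A \<noteq> 0})"
    by (rule open_vimage) (simp add: F.continuous_on)
  then obtain e where e: "e > 0" "\<And>\<eta>'. dist \<eta>' \<eta> < e \<Longrightarrow> det (F_map \<eta>') \<noteq> 0"
    using det by (auto simp: open_dist)
  have "K_map \<eta>' = K_map \<eta> + matrix_inv (F_map \<eta>') *v B (\<eta>' - \<eta>)" if "dist \<eta>' \<eta> < e" for \<eta>'
  proof -
    have i: "invertible (F_map \<eta>')" using e(2)[OF that] by (simp add: invertible_det_nz)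
    have "F_map \<eta> *v K_map \<eta> = Y_map \<eta>"
      using inv matrix_inv_solve[of "F_map \<eta>"] by (simp add: K_map_eq)
    then have "B (\<eta>' - \<eta>) = Y_map \<eta>' - F_map \<eta>' *v K_map \<eta>"
      by (simp add: B_def Y.diff F.diff bb.diff_left)
    moreover have "matrix_inv (F_map \<eta>') *v (F_map \<eta>' *v K_map \<eta>) = K_map \<eta>"
      using i matrix_inv_solve[of "F_map \<eta>'"] by metis
    ultimately show ?thesis by (simp add: bb.diff_right K_map_eq[of \<eta>'])
  qed
  then show ?thesis
    by (intro has_derivative_transform_within[OF D e(1)]) auto
qed

lemma Kk_map_has_derivative:
  assumes inv: "invertible (F_map \<eta>)"
  shows "(Kk_map has_derivative dKk_map \<eta>) (at \<eta>)"
proof -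
  have u: "bounded_linear (\<lambda>h. mom_u (part1 h) + mom_u (part2 h))"
    by (intro bounded_linear_add bounded_linear_compose[OF bounded_linear_mom_u]
      bounded_linear_part1 bounded_linear_part2)
  note K = K_map_has_derivative[OF inv]
  have D: "((\<lambda>\<eta>. join (K_map \<eta>) 0 + (- (1/2) * (K_map \<eta> \<bullet> (mom_u (part1 \<eta>) + mom_u (part2 \<eta>)))) *\<^sub>R join 0 (\<chi> _. 1))
    has_derivative dKk_map \<eta>) (at \<eta>)"
    unfolding dKk_map_def pair_split[of "dK_map \<eta> h" for h]
    by (rule derivative_eq_intros bounded_linear.has_derivative[OF bounded_linear_join1 K]
        bounded_linear.has_derivative[OF u has_derivative_ident] K refl)+
      (auto simp: algebra_simps)
  have eq: "Kk_map = (\<lambda>\<eta>. join (K_map \<eta>) 0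
      + (- (1/2) * (K_map \<eta> \<bullet> (mom_u (part1 \<eta>) + mom_u (part2 \<eta>)))) *\<^sub>R join 0 (\<chi> _. 1))"
    by (intro ext) (simp only: Kk_map_eq pair_split)
  show ?thesis by (subst eq) (rule D)
qed

text \<open>Symmetry moves F from K onto dK in the inner product of Y with dK, where it cancels the
  inverse inside dK; adding the term from dY doubles the coefficient of
  \<open>K_map \<eta> \<bullet> Y_map h\<close>.\<close>

lemma J_map_has_derivative:
  assumes inv: "invertible (F_map \<eta>)" and sym: "\<And>i j. F_map \<eta> $ i $ j = F_map \<eta> $ j $ i"
  shows "(J_map has_derivative (\<lambda>h. 2 * (K_map \<eta> \<bullet> Y_map h) - K_map \<eta> \<bullet> (F_map h *v K_map \<eta>))) (at \<eta>)"
proof -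
  have t: "transpose (F_map \<eta>) = F_map \<eta>" by (simp add: transpose_def vec_eq_iff sym)
  have "((\<lambda>\<eta>. Y_map \<eta> \<bullet> K_map \<eta>) has_derivative (\<lambda>h. Y_map \<eta> \<bullet> dK_map \<eta> h + Y_map h \<bullet> K_map \<eta>)) (at \<eta>)"
    by (rule has_derivative_inner[OF bounded_linear.has_derivative[OF bounded_linear_Y_map has_derivative_ident]
          K_map_has_derivative[OF inv]])
  moreover have "Y_map \<eta> \<bullet> dK_map \<eta> h = K_map \<eta> \<bullet> (Y_map h - F_map h *v K_map \<eta>)" for h
  proof -
    have "F_map \<eta> *v K_map \<eta> = Y_map \<eta>"
      using inv matrix_inv_solve[of "F_map \<eta>"] by (simp add: K_map_eq)
    then have "Y_map \<eta> \<bullet> dK_map \<eta> h = K_map \<eta> \<bullet> (F_map \<eta> *v dK_map \<eta> h)"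
      by (metis t transpose_inner)
    also have "F_map \<eta> *v dK_map \<eta> h = Y_map h - F_map h *v K_map \<eta>"
      unfolding dK_map_def using inv matrix_inv_solve[of "F_map \<eta>"] by blast
    finally show ?thesis .
  qed
  ultimately show ?thesis
    unfolding J_map_eq[abs_def] by (simp add: inner_diff_right inner_commute algebra_simps)
qed

subsection \<open>Measurability of vector-valued maps\<close>

lemma borel_measurable_vec_iff:
  fixes f :: "'a \<Rightarrow> real^'n"
  shows "f \<in> borel_measurable M \<longleftrightarrow> (\<forall>i. (\<lambda>x. f x $ i) \<in> borel_measurable M)"
  by (subst borel_measurable_euclidean_space) (auto simp: Basis_vec_def inner_axis)

lemma borel_measurable_linear:
  assumes "bounded_linear L" "f \<in> borel_measurable M"
  shows "(\<lambda>x. L (f x) :: 'b::real_normed_vector) \<in> borel_measurable M"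
  by (rule measurable_compose[OF assms(2) borel_measurable_continuous_onI[OF linear_continuous_on[OF assms(1)]]])

lemma borel_measurable_matrix_vector[measurable]:
  fixes A :: "'a \<Rightarrow> real^'n^'m"
  assumes "A \<in> borel_measurable M" "f \<in> borel_measurable M"
  shows "(\<lambda>x. A x *v f x) \<in> borel_measurable M"
  by (rule borel_measurable_continuous_Pair[OF assms])
    (rule bounded_bilinear.continuous_on[OF bounded_bilinear_matrix_vector], auto intro!: continuous_intros)

lemma borel_measurable_vec_nth[measurable (raw)]:
  fixes f :: "'a \<Rightarrow> 'b::real_normed_vector^'n"
  shows "f \<in> borel_measurable M \<Longrightarrow> (\<lambda>x. f x $ i) \<in> borel_measurable M"
  by (rule borel_measurable_linear[OF bounded_linear_vec_nth])

lemma borel_measurable_join[measurable (raw)]: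
  fixes f :: "'a \<Rightarrow> real^'m" and g :: "'a \<Rightarrow> real^'n"
  assumes "f \<in> borel_measurable M" "g \<in> borel_measurable M"
  shows "(\<lambda>x. join (f x) (g x)) \<in> borel_measurable M"
proof -
  have "(\<lambda>x. join (f x) 0 + join 0 (g x)) \<in> borel_measurable M"
    by (intro borel_measurable_add borel_measurable_linear[OF bounded_linear_join1 assms(1)]
      borel_measurable_linear[OF bounded_linear_join2 assms(2)])
  then show ?thesis by (simp add: join_linear)
qed

lemma borel_measurable_parts[measurable (raw)]:
  fixes f :: "'a \<Rightarrow> ('m::finite,'n::finite) jvec"
  assumes "f \<in> borel_measurable M"
  shows "(\<lambda>x. part1 (f x)) \<in> borel_measurable M" "(\<lambda>x. part2 (f x)) \<in> borel_measurable M"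
  by (rule borel_measurable_linear[OF bounded_linear_part1 assms])
     (rule borel_measurable_linear[OF bounded_linear_part2 assms])

lemma borel_measurable_pair[measurable (raw)]:
  fixes f :: "'a \<Rightarrow> real^'m"
  assumes "f \<in> borel_measurable M" "g \<in> borel_measurable M"
  shows "(\<lambda>x. pair (f x) (g x)) \<in> borel_measurable M"
  unfolding pair_def using assms by (intro borel_measurable_join) (auto simp: borel_measurable_vec_iff)

lemma moment_maps_measurable[measurable]:
  "K_map \<in> borel_measurable borel" "Kk_map \<in> borel_measurable borel" "J_map \<in> borel_measurable borel"
proof -
  have [measurable]: "F_map \<in> borel_measurable borel" "Y_map \<in> borel_measurable borel"
    by (auto intro!: borel_measurable_continuous_onI linear_continuous_on bounded_linear_F_map bounded_linear_Y_map)
  have [measurable]: "mom_u \<in> borel_measurable borel"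
    by (auto intro!: borel_measurable_continuous_onI linear_continuous_on bounded_linear_mom_u)
  show K[measurable]: "K_map \<in> borel_measurable borel" unfolding K_map_eq[abs_def] by measurable
  show "Kk_map \<in> borel_measurable borel" unfolding Kk_map_eq[abs_def] by measurable
  show "J_map \<in> borel_measurable borel" unfolding J_map_eq[abs_def] by measurable
qed

subsection \<open>The positive root of an exponential moment equation\<close>

lemma exp_diff_le: "exp u - exp v \<le> exp u * (u - v)" for u v :: real
proof -
  have "exp u * (1 + (v - u)) \<le> exp u * exp (v - u)"
    by (intro mult_left_mono exp_ge_add_one_self) simp
  then show ?thesis by (simp add: algebra_simps flip: exp_add)
qed

lemma exp_lipschitz:
  fixes u v C :: real
  assumes "\<bar>u\<bar> \<le> C" "\<bar>v\<bar> \<le> C"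
  shows "\<bar>exp u - exp v\<bar> \<le> exp C * \<bar>u - v\<bar>"
proof -
  have *: "exp u - exp v \<le> exp C * \<bar>u - v\<bar>" if "\<bar>u\<bar> \<le> C" for u v :: real
  proof -
    have "exp u - exp v \<le> exp u * (u - v)" by (rule exp_diff_le)
    also have "\<dots> \<le> exp u * \<bar>u - v\<bar>" by (intro mult_left_mono) auto
    also have "\<dots> \<le> exp C * \<bar>u - v\<bar>" using that by (intro mult_right_mono) auto
    finally show ?thesis .
  qed
  from *[OF assms(1), of v] *[OF assms(2), of u] show ?thesis by (simp add: abs_minus_commute abs_le_iff)
qed

lemma exp_second_order:
  fixes u v C :: real
  assumes "\<bar>u\<bar> \<le> C" "\<bar>v\<bar> \<le> C"
  shows "\<bar>exp u - exp v - exp v * (u - v)\<bar> \<le> exp C * (u - v)\<^sup>2"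
proof -
  have "exp v - exp u \<le> exp v * (v - u)" by (rule exp_diff_le)
  then have "0 \<le> exp u - exp v - exp v * (u - v)" by (simp add: algebra_simps)
  moreover have "exp u - exp v - exp v * (u - v) \<le> (exp u - exp v) * (u - v)"
    using exp_diff_le[of u v] by (simp add: algebra_simps)
  moreover have "(exp u - exp v) * (u - v) \<le> \<bar>exp u - exp v\<bar> * \<bar>u - v\<bar>"
    by (metis abs_ge_self abs_mult)
  moreover have "\<dots> \<le> (exp C * \<bar>u - v\<bar>) * \<bar>u - v\<bar>"
    by (intro mult_right_mono exp_lipschitz assms) simp
  ultimately show ?thesis by (simp add: power2_eq_square)
qed

text \<open>Convexity on the segment from 0 to \<open>u\<close>, read off from the tangent at the
  intermediate point. For strictness it is enough that the tangent inequality towards 0 is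
  strict.\<close>

lemma exp_strict_convex:
  fixes u l :: real
  assumes "0 < l" "l < 1"
  shows "exp (l * u) \<le> 1 - l + l * exp u" and "u \<noteq> 0 \<Longrightarrow> exp (l * u) < 1 - l + l * exp u"
proof -
  let ?p = "exp (l * u)"
  have "exp u - ?p \<ge> ?p * (u - l * u)" "1 - ?p \<ge> ?p * (0 - l * u)"
    using exp_diff_le[of "l * u" u] exp_diff_le[of "l * u" 0] by (simp_all add: algebra_simps)
  then have "l * (?p * (u - l * u)) \<le> l * (exp u - ?p)" "(1 - l) * (?p * (0 - l * u)) \<le> (1 - l) * (1 - ?p)"
    using assms by (simp, intro mult_left_mono) (simp_all add: mult_left_mono)
  then show "?p \<le> 1 - l + l * exp u" by (simp add: algebra_simps)
  assume u: "u \<noteq> 0"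
  have "1 - l * u < exp (- (l * u))" using u assms by (simp add: exp_minus_greater)
  then have "?p * (1 - l * u) < ?p * exp (- (l * u))" by simp
  then have "1 - ?p > ?p * (0 - l * u)" by (simp add: algebra_simps flip: exp_add)
  then have "(1 - l) * (?p * (0 - l * u)) < (1 - l) * (1 - ?p)"
    using assms by (intro mult_strict_left_mono) auto
  with \<open>l * (?p * (u - l * u)) \<le> l * (exp u - ?p)\<close> show "?p < 1 - l + l * exp u"
    by (simp add: algebra_simps)
qed

text \<open>Under the law of \<open>f0\<close> this is the population root, under the empirical
  measure the estimated one; the theory is therefore developed for a bounded variable on any
  probability space.\<close>

definition exp_root :: "'a measure \<Rightarrow> ('a \<Rightarrow> real) \<Rightarrow> real" where
  "exp_root \<mu> Y = (THE \<theta>. \<theta> > 0 \<and> (\<integral>x. exp (\<theta> * Y x) \<partial>\<mu>) = 1)"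

locale bounded_rv = prob_space \<mu> for \<mu> :: "'a measure" +
  fixes Y :: "'a \<Rightarrow> real" and b :: real
  assumes Y_measurable[measurable]: "Y \<in> borel_measurable \<mu>"
    and Y_bound: "\<And>x. x \<in> space \<mu> \<Longrightarrow> \<bar>Y x\<bar> \<le> b"
begin

definition mgf :: "real \<Rightarrow> real" where "mgf \<theta> = (\<integral>x. exp (\<theta> * Y x) \<partial>\<mu>)"

lemma b_nonneg: "0 \<le> b"
proof -
  obtain x where "x \<in> space \<mu>" using not_empty by blast
  from Y_bound[OF this] show ?thesis by simp
qed

lemma scaled_bound: "x \<in> space \<mu> \<Longrightarrow> \<bar>\<theta> * Y x\<bar> \<le> \<bar>\<theta>\<bar> * b"
  using Y_bound by (simp add: abs_mult mult_left_mono)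

lemma integrable_exp: "integrable \<mu> (\<lambda>x. exp (\<theta> * Y x))"
  by (rule integrable_const_bound[where B="exp (\<bar>\<theta>\<bar> * b)"])
     (use scaled_bound[of _ \<theta>] in \<open>auto intro!: AE_I2 simp: abs_le_iff\<close>)

lemma integrable_Y: "integrable \<mu> Y"
  by (rule integrable_const_bound[where B=b]) (use Y_bound in auto)

lemma integrable_exp_Y: "integrable \<mu> (\<lambda>x. exp (\<theta> * Y x) * Y x)"
proof (rule integrable_const_bound[where B="exp (\<bar>\<theta>\<bar> * b) * b"])
  have "\<bar>exp (\<theta> * Y x) * Y x\<bar> \<le> exp (\<bar>\<theta>\<bar> * b) * b" if "x \<in> space \<mu>" for x
    unfolding abs_mult using scaled_bound[OF that, of \<theta>] Y_bound[OF that]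
    by (intro mult_mono) (auto simp: abs_le_iff)
  then show "AE x in \<mu>. norm (exp (\<theta> * Y x) * Y x) \<le> exp (\<bar>\<theta>\<bar> * b) * b" by auto
qed auto

text \<open>The moment generating function is 1 at 0, at most 1 at \<open>r\<close>, and strictly
  convex unless \<open>Y\<close> vanishes almost everywhere, so it lies strictly below 1 in
  between.\<close>

lemma mgf_less_1:
  assumes a: "0 < a" "a < r" and r: "mgf r \<le> 1" and nz: "\<not> (AE x in \<mu>. Y x = 0)"
  shows "mgf a < 1"
proof (rule ccontr)
  assume "\<not> mgf a < 1"
  define l where "l = a / r"
  have l: "0 < l" "l < 1" "l * (r * y) = a * y" for y using a by (auto simp: l_def)
  let ?g = "\<lambda>x. 1 - l + l * exp (r * Y x) - exp (a * Y x)"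
  have int: "integrable \<mu> ?g"
    by (intro Bochner_Integration.integrable_diff Bochner_Integration.integrable_add integrable_mult_right integrable_exp) auto
  have g0: "0 \<le> ?g x" for x using exp_strict_convex(1)[OF l(1,2), of "r * Y x"] l(3) by simp
  have "(\<integral>x. ?g x \<partial>\<mu>) = 1 - l + l * mgf r - mgf a"
    by (simp add: integrable_exp mgf_def prob_space)
  also have "\<dots> \<le> 0"
  proof -
    have "l * mgf r \<le> l * 1" using r l(1) by (intro mult_left_mono) auto
    then show ?thesis using \<open>\<not> mgf a < 1\<close> by linarith
  qed
  finally have "(\<integral>x. ?g x \<partial>\<mu>) = 0" by (intro antisym integral_nonneg_AE) (use g0 in auto)
  then have "AE x in \<mu>. ?g x = 0"
    using int g0 by (subst (asm) integral_nonneg_eq_0_iff_AE) auto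
  then have "AE x in \<mu>. Y x = 0"
  proof eventually_elim
    case (elim x)
    then show ?case using exp_strict_convex(2)[OF l(1,2), of "r * Y x"] l(3) a by (cases "Y x = 0") auto
  qed
  with nz show False by simp
qed

lemma AE_zero_mgf: "AE x in \<mu>. Y x = 0 \<Longrightarrow> mgf \<theta> = 1"
proof -
  assume "AE x in \<mu>. Y x = 0"
  then have "mgf \<theta> = (\<integral>x. 1 \<partial>\<mu>)"
    unfolding mgf_def by (intro integral_cong_AE) auto
  then show ?thesis by (simp add: prob_space)
qed

text \<open>Of two distinct positive roots the smaller would lie strictly below 1. The point
  \<open>a\<close> with moment different from 1 excludes the degenerate case, in which every
  parameter is a root.\<close>

lemma exp_root_eqI:
  assumes a: "0 < a" "mgf a \<noteq> 1" and r: "0 < r" "mgf r = 1"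
  shows "exp_root \<mu> Y = r"
proof -
  have nz: "\<not> (AE x in \<mu>. Y x = 0)" using AE_zero_mgf a by blast
  show ?thesis
    unfolding exp_root_def mgf_def[symmetric]
  proof (rule the_equality)
    fix s assume s: "0 < s \<and> mgf s = 1"
    show "s = r"
      using mgf_less_1[of s r] mgf_less_1[of r s] s r nz by (cases s r rule: linorder_cases) auto
  qed (use r in auto)
qed

lemma mgf_less_1_iff:
  assumes nz: "\<not> (AE x in \<mu>. Y x = 0)" and r: "0 < r" "mgf r = 1" and a: "0 < a"
  shows "mgf a < 1 \<longleftrightarrow> a < r" and "mgf a > 1 \<longleftrightarrow> r < a"
  using mgf_less_1[of a r] mgf_less_1[of r a] assms by (cases a r rule: linorder_cases; force)+

lemma continuous_on_mgf: "continuous_on S mgf"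
proof (rule continuous_at_imp_continuous_on, rule ballI)
  fix \<theta>
  have "(mgf \<longlongrightarrow> mgf \<theta>) (at \<theta>)"
  proof (rule Lim_transform_within[OF _ zero_less_one, of "\<lambda>t. mgf \<theta> + (mgf t - mgf \<theta>)"])
    have "((\<lambda>t. mgf t - mgf \<theta>) \<longlongrightarrow> 0) (at \<theta>)"
    proof (rule Lim_null_comparison)
      show "\<forall>\<^sub>F t in at \<theta>. norm (mgf t - mgf \<theta>) \<le> exp ((\<bar>\<theta>\<bar> + 1) * b) * (\<bar>t - \<theta>\<bar> * b)"
        unfolding eventually_at
      proof (intro exI[of _ 1] conjI ballI impI)
        fix t assume t: "t \<noteq> \<theta> \<and> dist t \<theta> < 1"
        then have t': "\<bar>t\<bar> \<le> \<bar>\<theta>\<bar> + 1" unfolding dist_real_def by linarith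
        have "norm (mgf t - mgf \<theta>) = norm (\<integral>x. exp (t * Y x) - exp (\<theta> * Y x) \<partial>\<mu>)"
          by (simp add: mgf_def integrable_exp)
        also have "\<dots> \<le> (\<integral>x. norm (exp (t * Y x) - exp (\<theta> * Y x)) \<partial>\<mu>)" by (rule integral_norm_bound)
        also have "\<dots> \<le> (\<integral>x. exp ((\<bar>\<theta>\<bar> + 1) * b) * (\<bar>t - \<theta>\<bar> * b) \<partial>\<mu>)"
        proof (rule integral_mono)
          fix x assume x: "x \<in> space \<mu>"
          have "\<bar>t * Y x\<bar> \<le> (\<bar>\<theta>\<bar> + 1) * b" "\<bar>\<theta> * Y x\<bar> \<le> (\<bar>\<theta>\<bar> + 1) * b"
            using scaled_bound[OF x, of t] scaled_bound[OF x, of \<theta>] t' b_nonneg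
              mult_right_mono[of "\<bar>t\<bar>" "\<bar>\<theta>\<bar> + 1" b] mult_right_mono[of "\<bar>\<theta>\<bar>" "\<bar>\<theta>\<bar> + 1" b] by linarith+
          from exp_lipschitz[OF this]
          have "norm (exp (t * Y x) - exp (\<theta> * Y x)) \<le> exp ((\<bar>\<theta>\<bar> + 1) * b) * \<bar>(t - \<theta>) * Y x\<bar>"
            by (simp add: left_diff_distrib)
          also have "\<dots> \<le> exp ((\<bar>\<theta>\<bar> + 1) * b) * (\<bar>t - \<theta>\<bar> * b)"
            using scaled_bound[OF x, of "t - \<theta>"] by (intro mult_left_mono) auto
          finally show "norm (exp (t * Y x) - exp (\<theta> * Y x)) \<le> exp ((\<bar>\<theta>\<bar> + 1) * b) * (\<bar>t - \<theta>\<bar> * b)" .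
        qed (auto intro!: integrable_norm Bochner_Integration.integrable_diff integrable_exp)
        finally show "norm (mgf t - mgf \<theta>) \<le> exp ((\<bar>\<theta>\<bar> + 1) * b) * (\<bar>t - \<theta>\<bar> * b)"
          by (simp add: prob_space)
      qed simp
      show "((\<lambda>t. exp ((\<bar>\<theta>\<bar> + 1) * b) * (\<bar>t - \<theta>\<bar> * b)) \<longlongrightarrow> 0) (at \<theta>)"
        by (auto intro!: tendsto_eq_intros)
    qed
    then show "((\<lambda>t. mgf \<theta> + (mgf t - mgf \<theta>)) \<longlongrightarrow> mgf \<theta>) (at \<theta>)"
      using tendsto_add[OF tendsto_const, of "\<lambda>t. mgf t - mgf \<theta>" 0 "at \<theta>" "mgf \<theta>"] by simp
  qed auto
  then show "isCont mgf \<theta>" by (simp add: isCont_def)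
qed

lemma exp_root_between:
  assumes "0 < a" "a < c" "mgf a < 1" "1 < mgf c"
  shows "a < exp_root \<mu> Y \<and> exp_root \<mu> Y < c \<and> mgf (exp_root \<mu> Y) = 1"
proof -
  obtain r where r: "a \<le> r" "r \<le> c" "mgf r = 1"
    using IVT'[of mgf a 1 c] continuous_on_mgf assms by auto
  have "a \<noteq> r" "r \<noteq> c" using r assms by auto
  moreover have "exp_root \<mu> Y = r"
    using exp_root_eqI[of a r] r assms by auto
  ultimately show ?thesis using r by auto
qed

lemma mgf_small_less_1:
  assumes "(\<integral>x. Y x \<partial>\<mu>) < 0" "e > 0"
  shows "\<exists>a>0. a < e \<and> mgf a < 1"
proof -
  define m where "m = - (\<integral>x. Y x \<partial>\<mu>)"
  have m: "m > 0" using assms by (simp add: m_def)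
  define B where "B = exp b * b\<^sup>2 + 1"
  have B: "B > 0" unfolding B_def by (simp add: add_nonneg_pos)
  \<comment> \<open>\<open>a \<le> 1\<close> keeps the exponent within [-b, b];
    \<open>a \<le> m / (2 * B)\<close> limits the quadratic term, whose coefficient is below
    \<open>B\<close>, to half of the linear gain \<open>a * m\<close>; the bound e / 2 keeps
    \<open>a\<close> below \<open>e\<close>.\<close>
  define a where "a = min 1 (min (e / 2) (m / (2 * B)))"
  have a: "0 < a" "a \<le> 1" "a \<le> e / 2" "a \<le> m / (2 * B)"
    using m B assms by (auto simp: a_def)
  have "a < e" using a(3) assms by simp
  have aB: "a * B \<le> m / 2" using mult_right_mono[OF a(4), of B] B by simp
  have "mgf a \<le> (\<integral>x. 1 + a * Y x + a\<^sup>2 * (exp b * b\<^sup>2) \<partial>\<mu>)"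
    unfolding mgf_def
  proof (rule integral_mono)
    fix x assume x: "x \<in> space \<mu>"
    have "\<bar>a * Y x\<bar> \<le> b" using scaled_bound[OF x, of a] a b_nonneg
      mult_right_mono[of a 1 b] by simp
    from exp_second_order[OF this, of 0] b_nonneg
    have "exp (a * Y x) \<le> 1 + a * Y x + exp b * (a * Y x)\<^sup>2" by (simp add: abs_le_iff)
    also have "exp b * (a * Y x)\<^sup>2 \<le> a\<^sup>2 * (exp b * b\<^sup>2)"
      using power_mono[OF Y_bound[OF x], of 2] by (simp add: power_mult_distrib mult_left_mono)
    finally show "exp (a * Y x) \<le> 1 + a * Y x + a\<^sup>2 * (exp b * b\<^sup>2)" by simp
  qed (auto intro!: integrable_exp integrable_mult_right integrable_Y)
  also have "\<dots> = 1 - a * m + a\<^sup>2 * (exp b * b\<^sup>2)"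
    using integrable_Y by (simp add: m_def prob_space)
  also have "\<dots> < 1"
  proof -
    have "a\<^sup>2 * (exp b * b\<^sup>2) \<le> a * (a * B)" using a by (simp add: B_def power2_eq_square algebra_simps)
    also have "\<dots> \<le> a * (m / 2)" using a aB by (intro mult_left_mono) auto
    also have "\<dots> < a * m" using a m by simp
    finally show ?thesis by simp
  qed
  finally show ?thesis using a \<open>a < e\<close> by blast
qed

text \<open>\<open>Y\<close> exceeds some level e > 0 with probability p > 0, so the moment at c is
  at least p exp (c e), hence at least p (1 + c e), which exceeds 1 as soon as c is at least 1 / (p
  e).\<close>

lemma mgf_large_greater_1:
  assumes "\<not> (AE x in \<mu>. Y x \<le> 0)"
  shows "\<exists>c>d. mgf c > 1"
proof -
  have "\<exists>n::nat. prob {x \<in> space \<mu>. Y x > inverse (real (Suc n))} > 0"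
  proof (rule ccontr)
    assume "\<not> ?thesis"
    then have "prob {x \<in> space \<mu>. Y x > inverse (real (Suc n))} = 0" for n
      by (meson antisym_conv3 measure_nonneg not_le)
    then have "AE x in \<mu>. \<not> Y x > inverse (real (Suc n))" for n
      by (subst AE_iff_measurable[OF _ refl]) (auto simp: emeasure_eq_measure)
    then have "AE x in \<mu>. \<forall>n. \<not> Y x > inverse (real (Suc n))" by (simp add: AE_all_countable)
    then have "AE x in \<mu>. Y x \<le> 0"
    proof eventually_elim
      case (elim x)
      then show ?case using reals_Archimedean[of "Y x"] by (meson not_le)
    qed
    with assms show False by simp
  qed
  then obtain n where n: "prob {x \<in> space \<mu>. Y x > inverse (real (Suc n))} > 0" (is "prob ?A > 0") by blast
  define e where "e = inverse (real (Suc n))"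
  have e: "e > 0" by (simp add: e_def)
  define c where "c = max (\<bar>d\<bar> + 1) (1 / (prob ?A * e))"
  have "1 / (prob ?A * e) \<le> c" by (simp add: c_def)
  then have "1 \<le> prob ?A * (c * e)" using n e by (simp add: field_simps)
  have c: "c > 0" "c > d" by (auto simp: c_def)
  have "1 < prob ?A * (1 + c * e)"
    using \<open>1 \<le> prob ?A * (c * e)\<close> n by (simp add: distrib_left)
  also have "\<dots> \<le> prob ?A * exp (c * e)" using n by (intro mult_left_mono exp_ge_add_one_self) auto
  also have "\<dots> = (\<integral>x. indicator ?A x * exp (c * e) \<partial>\<mu>)" by simp
  also have "\<dots> \<le> mgf c"
    unfolding mgf_def
  proof (rule integral_mono)
    show "integrable \<mu> (\<lambda>x. indicator ?A x * exp (c * e))"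
      by (intro integrable_mult_left integrable_real_indicator) (auto simp: emeasure_eq_measure)
    show "indicator ?A x * exp (c * e) \<le> exp (c * Y x)" for x
      using c by (auto simp: indicator_def e_def)
  qed (rule integrable_exp)
  finally show ?thesis using c by blast
qed

text \<open>The function u exp u - exp u + 1 is nonnegative and zero only at u = 0. Taken at u = r Y
  and integrated at a root, its last two terms cancel and r times the tilted mean remains.
  Positivity of this mean is the nondegeneracy condition for differentiating the root.\<close>

lemma tilted_mean_pos:
  assumes r: "0 < r" "mgf r = 1" and nz: "\<not> (AE x in \<mu>. Y x = 0)"
  shows "0 < (\<integral>x. exp (r * Y x) * Y x \<partial>\<mu>)"
proof (rule ccontr)
  assume neg: "\<not> ?thesis"
  let ?g = "\<lambda>x. r * (exp (r * Y x) * Y x) - exp (r * Y x) + 1"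
  have g0: "0 \<le> ?g x" for x using exp_diff_le[of "r * Y x" 0] by (simp add: algebra_simps)
  have int: "integrable \<mu> ?g"
    by (intro Bochner_Integration.integrable_diff Bochner_Integration.integrable_add integrable_mult_right integrable_exp integrable_exp_Y) auto
  have "(\<integral>x. ?g x \<partial>\<mu>) = r * (\<integral>x. exp (r * Y x) * Y x \<partial>\<mu>) - mgf r + 1"
    by (simp add: integrable_exp integrable_exp_Y mgf_def prob_space)
  also have "\<dots> \<le> 0" using neg r by (simp add: mult_le_0_iff)
  finally have "(\<integral>x. ?g x \<partial>\<mu>) = 0" by (intro antisym integral_nonneg_AE) (use g0 in auto)
  then have "AE x in \<mu>. ?g x = 0"
    using int g0 by (subst (asm) integral_nonneg_eq_0_iff_AE) auto
  then have "AE x in \<mu>. Y x = 0"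
  proof eventually_elim
    case (elim x)
    show ?case
    proof (rule ccontr)
      assume "Y x \<noteq> 0"
      then have "1 - r * Y x < exp (- (r * Y x))" using r by (simp add: exp_minus_greater)
      then have "exp (r * Y x) * (1 - r * Y x) < exp (r * Y x) * exp (- (r * Y x))" by simp
      with elim show False by (simp add: algebra_simps flip: exp_add)
    qed
  qed
  with nz show False by simp
qed

end

text \<open>There are three cases, each recognised by countably many comparisons at rational
  parameters. If \<open>D\<close> holds, every positive parameter is a root and \<open>THE\<close>
  has the fixed value \<open>c1\<close>; if \<open>R\<close> holds, the moments bracket a unique
  root, and the root exceeds \<open>t\<close> exactly when some positive rational above
  \<open>t\<close> has moment below 1; otherwise no root exists and the value is \<open>c0\<close>.
  The alternative that \<open>H\<close> is identically 0 accounts for the empty sample.\<close>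

lemma exp_moment_root_measurable:
  fixes H :: "real \<Rightarrow> 'w \<Rightarrow> real"
  assumes H[measurable]: "\<And>\<theta>. H \<theta> \<in> borel_measurable M"
    and cases: "\<And>\<omega>. \<omega> \<in> space M \<Longrightarrow> (\<forall>\<theta>. H \<theta> \<omega> = 0) \<or>
      (\<exists>(\<mu>::'b measure) Y b. bounded_rv \<mu> Y b \<and> (\<forall>\<theta>. H \<theta> \<omega> = bounded_rv.mgf \<mu> Y \<theta>))"
  shows "(\<lambda>\<omega>. THE \<theta>. \<theta> > 0 \<and> H \<theta> \<omega> = 1) \<in> borel_measurable M"
proof -
  define f where "f \<omega> = (THE \<theta>. \<theta> > 0 \<and> H \<theta> \<omega> = 1)" for \<omega>
  define c1 where "c1 = (THE \<theta>::real. \<theta> > 0)"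
  define c0 where "c0 = (THE \<theta>::real. False)"
  define D where "D \<omega> \<longleftrightarrow> (\<forall>q::rat. 0 < q \<longrightarrow> H (of_rat q) \<omega> = 1)" for \<omega>
  define R where "R \<omega> \<longleftrightarrow> (\<exists>a::rat. \<exists>c::rat. 0 < a \<and> a < c \<and> H (of_rat a) \<omega> < 1 \<and> 1 < H (of_rat c) \<omega>)" for \<omega>
  define G where "G t \<omega> \<longleftrightarrow> (\<exists>a::rat. 0 < a \<and> t < of_rat a \<and> H (of_rat a) \<omega> < 1)" for t :: real and \<omega>
  have fD: "f \<omega> = c1" if w: "\<omega> \<in> space M" "D \<omega>" for \<omega>
  proof -
    from w(2) have "H 1 \<omega> = 1" by (auto simp: D_def dest: spec[of _ 1])
    with cases[OF w(1)] obtain \<mu> :: "'b measure" and Y b where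
      Y: "bounded_rv \<mu> Y b" "\<And>\<theta>. H \<theta> \<omega> = bounded_rv.mgf \<mu> Y \<theta>" by auto
    interpret Y: bounded_rv \<mu> Y b by fact
    have "H 2 \<omega> = 1" using w(2) by (auto simp: D_def dest: spec[of _ 2])
    \<comment> \<open>By strict convexity two distinct roots, here 1 and 2, already force the
      degenerate case.\<close>
    have "AE x in \<mu>. Y x = 0"
      using Y.mgf_less_1[of 1 2] \<open>H 1 \<omega> = 1\<close> \<open>H 2 \<omega> = 1\<close> by (auto simp: Y(2))
    then have "H \<theta> \<omega> = 1" for \<theta> by (simp add: Y(2) Y.AE_zero_mgf)
    then show ?thesis by (simp add: f_def c1_def)
  qed
  have fR: "t < f \<omega> \<longleftrightarrow> G t \<omega>" if w: "\<omega> \<in> space M" "R \<omega>" for \<omega> t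
  proof -
    from w(2) obtain a c :: rat where ac: "0 < a" "a < c" "H (of_rat a) \<omega> < 1" "1 < H (of_rat c) \<omega>"
      by (auto simp: R_def)
    with cases[OF w(1)] obtain \<mu> :: "'b measure" and Y b where
      Y: "bounded_rv \<mu> Y b" "\<And>\<theta>. H \<theta> \<omega> = bounded_rv.mgf \<mu> Y \<theta>" by force
    interpret Y: bounded_rv \<mu> Y b by fact
    have "(of_rat a :: real) < of_rat c" using ac by (simp add: of_rat_less)
    from Y.exp_root_between[OF _ this] ac
    have r: "of_rat a < exp_root \<mu> Y" "Y.mgf (exp_root \<mu> Y) = 1" by (auto simp: Y(2))
    have fr: "f \<omega> = exp_root \<mu> Y" by (simp add: f_def exp_root_def Y(2) Y.mgf_def)
    have pos: "0 < exp_root \<mu> Y" using r(1) ac(1) by (meson less_trans zero_less_of_rat_iff)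
    have nz: "\<not> (AE x in \<mu>. Y x = 0)" using Y.AE_zero_mgf ac by (metis Y(2) less_irrefl)
    show ?thesis
    proof
      assume "t < f \<omega>"
      then have "max t 0 < exp_root \<mu> Y" using pos by (simp add: fr)
      then obtain q where q: "max t 0 < of_rat q" "of_rat q < exp_root \<mu> Y" using of_rat_dense by blast
      then have "Y.mgf (of_rat q) < 1"
        using Y.mgf_less_1_iff(1)[OF nz pos r(2), of "of_rat q"] by simp
      then show "G t \<omega>" using q by (auto simp: G_def Y(2) intro!: exI[of _ q])
    next
      assume "G t \<omega>"
      then obtain q :: rat where q: "0 < q" "t < of_rat q" "Y.mgf (of_rat q) < 1" by (auto simp: G_def Y(2))
      then have "of_rat q < exp_root \<mu> Y"
        using Y.mgf_less_1_iff(1)[OF nz pos r(2), of "of_rat q"] by simp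
      with q show "t < f \<omega>" by (simp add: fr)
    qed
  qed
  have fN: "f \<omega> = c0" if w: "\<omega> \<in> space M" "\<not> R \<omega>" "\<not> D \<omega>" for \<omega>
  proof -
    have "\<not> (0 < \<theta> \<and> H \<theta> \<omega> = 1)" for \<theta>
    proof
      assume t: "0 < \<theta> \<and> H \<theta> \<omega> = 1"
      with cases[OF w(1)] obtain \<mu> :: "'b measure" and Y b where
        Y: "bounded_rv \<mu> Y b" "\<And>\<theta>. H \<theta> \<omega> = bounded_rv.mgf \<mu> Y \<theta>" by force
      interpret Y: bounded_rv \<mu> Y b by fact
      have nz: "\<not> (AE x in \<mu>. Y x = 0)" using Y.AE_zero_mgf w(3) by (auto simp: Y(2) D_def)
      obtain a where a: "0 < (of_rat a :: real)" "of_rat a < \<theta>" using of_rat_dense[of 0 \<theta>] t by auto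
      obtain c where c: "\<theta> < of_rat c" "of_rat c < \<theta> + 1" using of_rat_dense[of \<theta> "\<theta> + 1"] by auto
      have "0 < (of_rat c :: real)" using c(1) t by linarith
      then have "Y.mgf (of_rat a) < 1" "Y.mgf (of_rat c) > 1"
        using Y.mgf_less_1_iff(1)[OF nz, of \<theta> "of_rat a"] Y.mgf_less_1_iff(2)[OF nz, of \<theta> "of_rat c"] t a c
        by (simp_all add: Y(2))
      moreover have "(of_rat a :: real) < of_rat c" using a c by linarith
      ultimately have "0 < a \<and> a < c \<and> H (of_rat a) \<omega> < 1 \<and> 1 < H (of_rat c) \<omega>"
        using a by (simp add: Y(2) of_rat_less)
      then have "R \<omega>" unfolding R_def by blast
      with w(2) show False ..
    qed
    then have "(\<lambda>\<theta>. 0 < \<theta> \<and> H \<theta> \<omega> = 1) = (\<lambda>\<theta>. False)" by blast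
    then show ?thesis unfolding f_def c0_def by (rule arg_cong)
  qed
  have [measurable]: "Measurable.pred M D" "Measurable.pred M R" "Measurable.pred M (G t)" for t
    unfolding D_def R_def G_def by measurable
  have "{\<omega> \<in> space M. t < f \<omega>} \<in> sets M" for t
  proof -
    have "{\<omega> \<in> space M. t < f \<omega>} = {\<omega> \<in> space M. (D \<omega> \<and> t < c1) \<or> (\<not> D \<omega> \<and> R \<omega> \<and> G t \<omega>) \<or> (\<not> D \<omega> \<and> \<not> R \<omega> \<and> t < c0)}"
    proof (intro Collect_cong conj_cong refl)
      fix \<omega> assume w: "\<omega> \<in> space M"
      show "t < f \<omega> \<longleftrightarrow> (D \<omega> \<and> t < c1) \<or> (\<not> D \<omega> \<and> R \<omega> \<and> G t \<omega>) \<or> (\<not> D \<omega> \<and> \<not> R \<omega> \<and> t < c0)"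
        using fD[OF w] fR[OF w, of t] fN[OF w] by (cases "D \<omega>"; cases "R \<omega>") simp_all
    qed
    also have "\<dots> \<in> sets M" by measurable
    finally show ?thesis .
  qed
  then show ?thesis unfolding f_def by (simp add: borel_measurable_iff_greater)
qed

lemma norm_integral_bound:
  fixes f :: "'a \<Rightarrow> 'v::{banach,second_countable_topology}"
  assumes "prob_space \<mu>" "f \<in> borel_measurable \<mu>" "\<And>x. x \<in> space \<mu> \<Longrightarrow> norm (f x) \<le> B"
  shows "integrable \<mu> f" "norm (\<integral>x. f x \<partial>\<mu>) \<le> B"
proof -
  interpret prob_space \<mu> by fact
  show i: "integrable \<mu> f"
    by (rule integrable_const_bound[where B=B]) (use assms in auto)
  have "norm (\<integral>x. f x \<partial>\<mu>) \<le> (\<integral>x. norm (f x) \<partial>\<mu>)" by (rule integral_norm_bound)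
  also have "\<dots> \<le> (\<integral>x. B \<partial>\<mu>)" by (rule integral_mono) (use assms i in auto)
  finally show "norm (\<integral>x. f x \<partial>\<mu>) \<le> B" by (simp add: prob_space)
qed

text \<open>The error constant depends on the bounds \<open>b\<close> and \<open>c\<close> only, not
  on the law; it can therefore be used for a whole sequence of random empirical measures.\<close>

lemma exp_moment_taylor:
  fixes w w0 :: "'v::euclidean_space"
  assumes \<mu>: "prob_space \<mu>" and \<psi>[measurable]: "\<psi> \<in> borel_measurable \<mu>"
    and b: "\<And>x. x \<in> space \<mu> \<Longrightarrow> norm (\<psi> x) \<le> b" and c: "norm w \<le> c" "norm w0 \<le> c"
  shows "\<bar>(\<integral>x. exp (w \<bullet> \<psi> x) \<partial>\<mu>) - (\<integral>x. exp (w0 \<bullet> \<psi> x) \<partial>\<mu>) - (\<integral>x. exp (w0 \<bullet> \<psi> x) *\<^sub>R \<psi> x \<partial>\<mu>) \<bullet> (w - w0)\<bar>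
    \<le> exp (c * b) * b\<^sup>2 * (norm (w - w0))\<^sup>2"
proof -
  have lin: "\<bar>v \<bullet> \<psi> x\<bar> \<le> c * b" if "norm v \<le> c" "x \<in> space \<mu>" for v x
  proof -
    have "\<bar>v \<bullet> \<psi> x\<bar> \<le> norm v * norm (\<psi> x)" by (rule Cauchy_Schwarz_ineq2)
    also have "\<dots> \<le> c * b" using that b[OF that(2)] by (intro mult_mono) (auto intro: order_trans[OF norm_ge_zero])
    finally show ?thesis .
  qed
  have i1: "integrable \<mu> (\<lambda>x. exp (v \<bullet> \<psi> x))" if "norm v \<le> c" for v
    using lin[OF that] by (intro norm_integral_bound(1)[OF \<mu>, where B="exp (c * b)"]) (auto simp: abs_le_iff)
  have i2: "integrable \<mu> (\<lambda>x. exp (w0 \<bullet> \<psi> x) *\<^sub>R \<psi> x)"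
  proof (rule norm_integral_bound(1)[OF \<mu>, where B="exp (c * b) * b"])
    fix x assume x: "x \<in> space \<mu>"
    show "norm (exp (w0 \<bullet> \<psi> x) *\<^sub>R \<psi> x) \<le> exp (c * b) * b"
      using lin[OF c(2) x] b[OF x] by (simp add: mult_mono abs_le_iff)
  qed measurable
  let ?g = "\<lambda>x. exp (w \<bullet> \<psi> x) - exp (w0 \<bullet> \<psi> x) - (exp (w0 \<bullet> \<psi> x) *\<^sub>R \<psi> x) \<bullet> (w - w0)"
  have "(\<integral>x. ?g x \<partial>\<mu>) = (\<integral>x. exp (w \<bullet> \<psi> x) \<partial>\<mu>) - (\<integral>x. exp (w0 \<bullet> \<psi> x) \<partial>\<mu>) - (\<integral>x. exp (w0 \<bullet> \<psi> x) *\<^sub>R \<psi> x \<partial>\<mu>) \<bullet> (w - w0)"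
    using i1[OF c(1)] i1[OF c(2)] i2 by (simp del: inner_scaleR_left)
  moreover have "norm (\<integral>x. ?g x \<partial>\<mu>) \<le> exp (c * b) * b\<^sup>2 * (norm (w - w0))\<^sup>2"
  proof (rule norm_integral_bound(2)[OF \<mu>])
    fix x assume x: "x \<in> space \<mu>"
    have eq: "w \<bullet> \<psi> x - w0 \<bullet> \<psi> x = (w - w0) \<bullet> \<psi> x" by (simp add: inner_diff_left)
    have "\<bar>exp (w \<bullet> \<psi> x) - exp (w0 \<bullet> \<psi> x) - exp (w0 \<bullet> \<psi> x) * (w \<bullet> \<psi> x - w0 \<bullet> \<psi> x)\<bar>
      \<le> exp (c * b) * ((w - w0) \<bullet> \<psi> x)\<^sup>2"
      using exp_second_order[OF lin[OF c(1) x] lin[OF c(2) x]] by (simp only: eq)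
    also have "((w - w0) \<bullet> \<psi> x)\<^sup>2 \<le> (norm (w - w0) * b)\<^sup>2"
    proof -
      have "\<bar>(w - w0) \<bullet> \<psi> x\<bar> \<le> norm (w - w0) * norm (\<psi> x)" by (rule Cauchy_Schwarz_ineq2)
      also have "\<dots> \<le> norm (w - w0) * b" using b[OF x] by (intro mult_left_mono) auto
      finally show ?thesis by (metis abs_ge_zero power2_abs power_mono)
    qed
    finally show "norm (?g x) \<le> exp (c * b) * b\<^sup>2 * (norm (w - w0))\<^sup>2"
      unfolding eq by (simp add: power_mult_distrib inner_commute mult_ac)
  qed measurable
  ultimately show ?thesis by simp
qed

text \<open>An implicit function theorem whose constants are fixed before the measure is quantified.
  The moment equation is expanded in \<open>\<theta> *\<^sub>R z - \<theta>0 *\<^sub>R z0\<close>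
  and solved for the change of the parameter, which is possible because
  \<open>D0 \<bullet> z0\<close> is positive. A crude linear bound comes first; inserted into the
  error term it yields the quadratic bound. Neither \<open>m = 1\<close> nor \<open>D = D0\<close>
  is assumed, because an empirical law satisfies neither exactly.\<close>

lemma root_expansion:
  fixes z0 D0 :: "'v::euclidean_space"
  assumes th: "\<theta>0 > 0" and tau: "D0 \<bullet> z0 > 0" and b: "b \<ge> 0"
  shows "\<exists>C>0. \<exists>\<beta>>0. \<forall>(\<mu> :: 'a measure) \<psi> z \<theta> m D. prob_space \<mu> \<longrightarrow> \<psi> \<in> borel_measurable \<mu> \<longrightarrow>
     (\<forall>x\<in>space \<mu>. norm (\<psi> x) \<le> b) \<longrightarrow> (\<integral>x. exp (\<theta> * (z \<bullet> \<psi> x)) \<partial>\<mu>) = 1 \<longrightarrow>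
     m = (\<integral>x. exp (\<theta>0 * (z0 \<bullet> \<psi> x)) \<partial>\<mu>) \<longrightarrow> D = (\<integral>x. exp (\<theta>0 * (z0 \<bullet> \<psi> x)) *\<^sub>R \<psi> x \<partial>\<mu>) \<longrightarrow>
     \<bar>\<theta> - \<theta>0\<bar> \<le> \<beta> \<longrightarrow> norm (z - z0) \<le> \<beta> \<longrightarrow> norm (D - D0) \<le> \<beta> \<longrightarrow>
     \<bar>\<theta> - \<theta>0\<bar> \<le> C * (norm (z - z0) + \<bar>m - 1\<bar>) \<and>
     \<bar>(\<theta> - \<theta>0) * (D0 \<bullet> z0) + \<theta>0 * (D0 \<bullet> (z - z0)) + (m - 1)\<bar>
       \<le> C * (norm (z - z0) + \<bar>m - 1\<bar> + norm (D - D0)) * (norm (z - z0) + \<bar>m - 1\<bar>)"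
proof -
  define \<tau> where "\<tau> = D0 \<bullet> z0"
  have tau': "\<tau> > 0" using tau by (simp add: \<tau>_def)
  \<comment> \<open>Bounds the norms of both exponent vectors: the parameter stays below 2
    \<open>\<theta>0\<close> since \<open>\<beta> \<le> \<theta>0\<close>, and \<open>z\<close>
    stays within distance 1 of \<open>z0\<close>.\<close>
  define c where "c = 2 * \<theta>0 * (norm z0 + 1)"
  define A where "A = exp (c * b) * b\<^sup>2"
  have A: "A \<ge> 0" by (simp add: A_def)
  \<comment> \<open>Arranged so that the coefficient of \<open>norm \<Delta>\<close> in the error is
    at most \<open>\<beta> * Q\<close>.\<close>
  define Q where "Q = A * (2 * \<theta>0 + norm z0) + 1"
  have Q: "Q > 0" using A th by (simp add: Q_def add_nonneg_pos)
  \<comment> \<open>The last bound makes \<open>\<beta> * Q * norm z0\<close> at most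
    \<open>\<tau>\<close> / 2, so that the part of the error proportional to the change of the
    parameter is absorbed by the left-hand side.\<close>
  define \<beta> where "\<beta> = min (min 1 \<theta>0) (\<tau> / (2 * Q * (norm z0 + 1)))"
  have nz: "norm z0 + 1 > 0" by (simp add: add_nonneg_pos)
  have \<beta>: "\<beta> > 0" "\<beta> \<le> 1" "\<beta> \<le> \<theta>0" "\<beta> \<le> \<tau> / (2 * Q * (norm z0 + 1))"
    using th tau' Q nz by (auto simp: \<beta>_def)
  have \<beta>Q: "\<beta> * Q * norm z0 \<le> \<tau> / 2"
  proof -
    have "\<beta> * (2 * Q * (norm z0 + 1)) \<le> \<tau>"
      using \<beta>(4) Q nz by (simp add: pos_le_divide_eq)
    moreover have "\<beta> * Q * norm z0 \<le> \<beta> * Q * (norm z0 + 1)"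
      using \<beta>(1) Q by (intro mult_left_mono) auto
    moreover have "\<beta> * (2 * Q * (norm z0 + 1)) = 2 * (\<beta> * Q * (norm z0 + 1))" by simp
    ultimately show ?thesis by linarith
  qed
  define L where "L = 2 * (2 * \<theta>0 * norm D0 + 2 * \<theta>0 * Q + 1) / \<tau>"
  have L: "L > 0" using tau' th Q by (simp add: L_def add_nonneg_pos)
  define W where "W = 2 * \<theta>0 + L * norm z0"
  have W: "W > 0" using th L by (simp add: W_def add_pos_nonneg)
  define C where "C = L + A * W\<^sup>2 + W + L * norm D0"
  have C: "C > 0" "L \<le> C" "A * W\<^sup>2 + W + L * norm D0 \<le> C" using L A W by (auto simp: C_def add_nonneg_pos add_pos_nonneg)
  have main: "\<bar>\<theta> - \<theta>0\<bar> \<le> C * (norm (z - z0) + \<bar>m - 1\<bar>) \<and>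
     \<bar>(\<theta> - \<theta>0) * (D0 \<bullet> z0) + \<theta>0 * (D0 \<bullet> (z - z0)) + (m - 1)\<bar>
       \<le> C * (norm (z - z0) + \<bar>m - 1\<bar> + norm (D - D0)) * (norm (z - z0) + \<bar>m - 1\<bar>)"
    if \<mu>: "prob_space \<mu>" and \<psi>: "\<psi> \<in> borel_measurable \<mu>" "\<forall>x\<in>space \<mu>. norm (\<psi> x) \<le> b"
      and root: "(\<integral>x. exp (\<theta> * (z \<bullet> \<psi> x)) \<partial>\<mu>) = 1"
      and m: "m = (\<integral>x. exp (\<theta>0 * (z0 \<bullet> \<psi> x)) \<partial>\<mu>)" and D: "D = (\<integral>x. exp (\<theta>0 * (z0 \<bullet> \<psi> x)) *\<^sub>R \<psi> x \<partial>\<mu>)"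
      and near: "\<bar>\<theta> - \<theta>0\<bar> \<le> \<beta>" "norm (z - z0) \<le> \<beta>" "norm (D - D0) \<le> \<beta>"
    for \<mu> :: "'a measure" and \<psi> z \<theta> m D
  proof -
    define \<epsilon> \<delta> \<kappa> s where "\<epsilon> = norm (z - z0)" and "\<delta> = \<bar>\<theta> - \<theta>0\<bar>" and "\<kappa> = norm (D - D0)"
      and "s = norm (z - z0) + \<bar>m - 1\<bar>"
    have nn: "0 \<le> \<epsilon>" "0 \<le> \<delta>" "0 \<le> \<kappa>" "0 \<le> s" "\<epsilon> \<le> s" "\<bar>m - 1\<bar> \<le> s"
      by (auto simp: \<epsilon>_def \<delta>_def \<kappa>_def s_def)
    have bd: "\<epsilon> \<le> \<beta>" "\<delta> \<le> \<beta>" "\<kappa> \<le> \<beta>" using near by (auto simp: \<epsilon>_def \<delta>_def \<kappa>_def)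
    have \<theta>: "0 \<le> \<theta>" "\<theta> \<le> 2 * \<theta>0" using near(1) \<beta>(3) by (auto simp: abs_le_iff)
    define \<Delta> where "\<Delta> = \<theta> *\<^sub>R z - \<theta>0 *\<^sub>R z0"
    have \<Delta>eq: "\<Delta> = \<theta> *\<^sub>R (z - z0) + (\<theta> - \<theta>0) *\<^sub>R z0" by (simp add: \<Delta>_def algebra_simps)
    have "norm \<Delta> \<le> norm (\<theta> *\<^sub>R (z - z0)) + norm ((\<theta> - \<theta>0) *\<^sub>R z0)"
      unfolding \<Delta>eq by (rule norm_triangle_ineq)
    also have "\<dots> = \<theta> * \<epsilon> + \<delta> * norm z0" using \<theta> by (simp add: \<epsilon>_def \<delta>_def)
    also have "\<dots> \<le> 2 * \<theta>0 * \<epsilon> + \<delta> * norm z0" using \<theta> nn by (intro add_mono mult_right_mono) auto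
    finally have \<Delta>: "norm \<Delta> \<le> 2 * \<theta>0 * \<epsilon> + \<delta> * norm z0" .
    have nzz: "norm z \<le> norm z0 + 1"
      using norm_triangle_ineq[of "z - z0" z0] near(2) \<beta>(2) by simp
    have "norm (\<theta> *\<^sub>R z) \<le> c"
    proof -
      have "norm (\<theta> *\<^sub>R z) \<le> 2 * \<theta>0 * (norm z0 + 1)"
        using \<theta> nzz th by (simp add: mult_mono)
      then show ?thesis by (simp add: c_def)
    qed
    moreover have "norm (\<theta>0 *\<^sub>R z0) \<le> c"
    proof -
      have "\<theta>0 * norm z0 \<le> 2 * \<theta>0 * (norm z0 + 1)" using th by (intro mult_mono) auto
      then show ?thesis using th by (simp add: c_def)
    qed
    ultimately have T: "\<bar>1 - m - D \<bullet> \<Delta>\<bar> \<le> A * (norm \<Delta>)\<^sup>2"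
      using exp_moment_taylor[OF \<mu> \<psi>(1), of b "\<theta> *\<^sub>R z" c "\<theta>0 *\<^sub>R z0"] \<psi>(2) root
      by (simp add: m D \<Delta>_def A_def)
    have Dz: "D0 \<bullet> \<Delta> = \<theta> * (D0 \<bullet> (z - z0)) + (\<theta> - \<theta>0) * \<tau>"
      unfolding \<Delta>eq by (simp add: inner_add_right \<tau>_def)
    have D0e: "\<bar>D0 \<bullet> (z - z0)\<bar> \<le> norm D0 * \<epsilon>" unfolding \<epsilon>_def by (rule Cauchy_Schwarz_ineq2)
    have "\<bar>D \<bullet> \<Delta> - D0 \<bullet> \<Delta>\<bar> \<le> \<kappa> * norm \<Delta>"
      unfolding \<kappa>_def inner_diff_left[symmetric] by (rule Cauchy_Schwarz_ineq2)
    with T have E: "\<bar>\<theta> * (D0 \<bullet> (z - z0)) + (\<theta> - \<theta>0) * \<tau> + (m - 1)\<bar> \<le> (A * norm \<Delta> + \<kappa>) * norm \<Delta>"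
      unfolding Dz by (simp add: power2_eq_square algebra_simps)
    have "A * norm \<Delta> + \<kappa> \<le> A * (2 * \<theta>0 * \<beta> + \<beta> * norm z0) + \<beta>"
    proof -
      have "2 * \<theta>0 * \<epsilon> + \<delta> * norm z0 \<le> 2 * \<theta>0 * \<beta> + \<beta> * norm z0"
        using bd th by (intro add_mono mult_left_mono mult_right_mono) auto
      with \<Delta> have "norm \<Delta> \<le> 2 * \<theta>0 * \<beta> + \<beta> * norm z0" by linarith
      then show ?thesis using A bd by (intro add_mono mult_left_mono) auto
    qed
    also have "\<dots> = \<beta> * Q" by (simp add: Q_def algebra_simps)
    finally have small: "A * norm \<Delta> + \<kappa> \<le> \<beta> * Q" .
    have \<beta>Q0: "0 \<le> \<beta> * Q" using \<beta>(1) Q by simp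
    have "(A * norm \<Delta> + \<kappa>) * norm \<Delta> \<le> \<beta> * Q * (2 * \<theta>0 * \<epsilon> + \<delta> * norm z0)"
      by (intro mult_mono small \<Delta> \<beta>Q0) simp
    also have "\<dots> = \<beta> * (2 * \<theta>0 * Q * \<epsilon>) + (\<beta> * Q * norm z0) * \<delta>" by (simp add: algebra_simps)
    also have "\<dots> \<le> 2 * \<theta>0 * Q * \<epsilon> + \<tau> / 2 * \<delta>"
    proof (intro add_mono mult_right_mono \<beta>Q nn)
      show "\<beta> * (2 * \<theta>0 * Q * \<epsilon>) \<le> 2 * \<theta>0 * Q * \<epsilon>"
        using mult_right_mono[OF \<beta>(2), of "2 * \<theta>0 * Q * \<epsilon>"] th Q nn by simp
    qed
    finally have E2: "(A * norm \<Delta> + \<kappa>) * norm \<Delta> \<le> 2 * \<theta>0 * Q * \<epsilon> + \<tau> / 2 * \<delta>" .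
    have \<delta>\<tau>: "\<delta> * \<tau> = \<bar>(\<theta> - \<theta>0) * \<tau>\<bar>" using tau' by (simp add: \<delta>_def abs_mult)
    have t1: "\<bar>\<theta> * (D0 \<bullet> (z - z0))\<bar> \<le> 2 * \<theta>0 * (norm D0 * \<epsilon>)"
      unfolding abs_mult using \<theta> D0e th by (intro mult_mono) auto
    \<comment> \<open>The term \<open>\<tau> / 2 * \<delta>\<close> on the right is half of the
      left-hand side; moving it over gives the crude linear bound with constant
      \<open>L\<close>.\<close>
    have "\<delta> * \<tau> \<le> 2 * \<theta>0 * (norm D0 * \<epsilon>) + \<bar>m - 1\<bar> + (2 * \<theta>0 * Q * \<epsilon> + \<tau> / 2 * \<delta>)"
      unfolding \<delta>\<tau> using E E2 t1 by linarith
    then have "\<tau> / 2 * \<delta> \<le> 2 * \<theta>0 * norm D0 * \<epsilon> + 2 * \<theta>0 * Q * \<epsilon> + \<bar>m - 1\<bar>"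
      by (simp add: algebra_simps)
    also have "\<dots> \<le> 2 * \<theta>0 * norm D0 * s + 2 * \<theta>0 * Q * s + s"
      using nn th Q by (intro add_mono mult_left_mono) auto
    also have "\<dots> = \<tau> / 2 * (L * s)" using tau' by (simp add: L_def field_simps)
    finally have \<delta>L: "\<delta> \<le> L * s" using tau' by simp
    have \<Delta>W: "norm \<Delta> \<le> W * s"
    proof -
      have "2 * \<theta>0 * \<epsilon> + \<delta> * norm z0 \<le> 2 * \<theta>0 * s + (L * s) * norm z0"
        using nn th \<delta>L by (intro add_mono mult_left_mono mult_right_mono) auto
      with \<Delta> show ?thesis by (simp add: W_def algebra_simps)
    qed
    have d1: "\<bar>(\<theta> - \<theta>0) * (D0 \<bullet> (z - z0))\<bar> \<le> (L * s) * (norm D0 * s)"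
    proof -
      have "norm D0 * \<epsilon> \<le> norm D0 * s" using nn by (intro mult_left_mono) auto
      then show ?thesis unfolding abs_mult using D0e \<delta>L nn L by (intro mult_mono) (auto simp: \<delta>_def)
    qed
    have d2: "(A * norm \<Delta> + \<kappa>) * norm \<Delta> \<le> (A * (W * s) + \<kappa>) * (W * s)"
      using \<Delta>W A nn W by (intro mult_mono add_mono mult_left_mono) auto
    \<comment> \<open>Replacing the parameter by \<open>\<theta>0\<close> in the linear term costs a
      product of two small quantities, which by the crude bound is quadratic in
      \<open>s\<close>.\<close>
    have "\<bar>(\<theta> - \<theta>0) * \<tau> + \<theta>0 * (D0 \<bullet> (z - z0)) + (m - 1)\<bar>
      \<le> \<bar>\<theta> * (D0 \<bullet> (z - z0)) + (\<theta> - \<theta>0) * \<tau> + (m - 1)\<bar> + \<bar>(\<theta> - \<theta>0) * (D0 \<bullet> (z - z0))\<bar>"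
      using abs_triangle_ineq4[of "\<theta> * (D0 \<bullet> (z - z0)) + (\<theta> - \<theta>0) * \<tau> + (m - 1)" "(\<theta> - \<theta>0) * (D0 \<bullet> (z - z0))"]
      by (simp add: algebra_simps)
    also have "\<dots> \<le> (A * (W * s) + \<kappa>) * (W * s) + (L * s) * (norm D0 * s)"
      using E d1 d2 by linarith
    also have "\<dots> \<le> (A * W\<^sup>2 + W + L * norm D0) * ((s + \<kappa>) * s)"
    proof -
      have "(A * W\<^sup>2 + W + L * norm D0) * ((s + \<kappa>) * s) - ((A * (W * s) + \<kappa>) * (W * s) + (L * s) * (norm D0 * s))
        = A * W\<^sup>2 * \<kappa> * s + W * s * s + L * norm D0 * \<kappa> * s"
        by (simp add: algebra_simps power2_eq_square)
      also have "\<dots> \<ge> 0" using A W L nn by (intro add_nonneg_nonneg mult_nonneg_nonneg) auto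
      finally show ?thesis by simp
    qed
    also have "\<dots> \<le> C * ((s + \<kappa>) * s)" using C(3) nn by (intro mult_right_mono mult_nonneg_nonneg) auto
    finally have fin: "\<bar>(\<theta> - \<theta>0) * \<tau> + \<theta>0 * (D0 \<bullet> (z - z0)) + (m - 1)\<bar> \<le> C * (s + \<kappa>) * s"
      by (simp add: mult.assoc)
    have "\<delta> \<le> C * s" using \<delta>L C(2) nn by (meson mult_right_mono order_trans)
    with fin show ?thesis by (simp add: \<delta>_def s_def \<kappa>_def \<tau>_def)
  qed
  show ?thesis
    by (rule exI[of _ C], rule conjI[OF C(1)], rule exI[of _ \<beta>], rule conjI[OF \<beta>(1)]) (intro allI impI main)
qed

lemma pair_nth[simp]: "pair k c $ Inl i = k $ i" "pair k c $ Inr u = c"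
  by (simp_all add: pair_def)

subsection \<open>Expectations of bounded functions\<close>

text \<open>Bounded Borel functions: all scores are built from the dictionary by operations
  preserving this class, which settles integrability once and for all.\<close>

definition bm :: "(real \<Rightarrow> 'b::{real_normed_vector}) \<Rightarrow> bool" where
  "bm h \<longleftrightarrow> h \<in> borel_measurable borel \<and> bounded (range h)"

lemma bmI: "h \<in> borel_measurable borel \<Longrightarrow> (\<And>x. norm (h x) \<le> B) \<Longrightarrow> bm h"
  by (auto simp: bm_def bounded_iff)

lemma bm_bound: "bm h \<Longrightarrow> \<exists>B. \<forall>x. norm (h x) \<le> B"
  by (auto simp: bm_def bounded_iff)

lemma bm_measurable: "bm h \<Longrightarrow> h \<in> borel_measurable borel"
  by (simp add: bm_def)

lemma bm_const: "bm (\<lambda>x. c)"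
  by (rule bmI[where B="norm c"]) auto

lemma bm_add:
  fixes g h :: "real \<Rightarrow> 'b::{real_normed_vector,second_countable_topology}"
  assumes "bm g" "bm h" shows "bm (\<lambda>x. g x + h x)"
proof -
  obtain A B where "\<And>x. norm (g x) \<le> A" "\<And>x. norm (h x) \<le> B" using assms[THEN bm_bound] by blast
  then have "norm (g x + h x) \<le> A + B" for x by (rule norm_triangle_mono)
  then show ?thesis using assms by (intro bmI) (auto simp: bm_def)
qed

lemma bm_linear:
  fixes h :: "real \<Rightarrow> 'b::{real_normed_vector}"
  assumes "bounded_linear L" "bm h" shows "bm (\<lambda>x. L (h x))"
proof -
  obtain C where C: "\<And>v. norm (L v) \<le> norm v * C" "C > 0" using bounded_linear.pos_bounded[OF assms(1)] by blast
  obtain B where B: "\<And>x. norm (h x) \<le> B" using bm_bound[OF assms(2)] by blast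
  have "norm (L (h x)) \<le> B * C" for x
    using C(1)[of "h x"] mult_right_mono[OF B[of x], of C] C(2) by linarith
  with borel_measurable_linear[OF assms(1) bm_measurable[OF assms(2)]] show ?thesis by (rule bmI)
qed

lemma bm_scaleR:
  fixes h :: "real \<Rightarrow> 'b::{real_normed_vector,second_countable_topology}"
  assumes "bm g" "bm h" shows "bm (\<lambda>x. g x *\<^sub>R h x)"
proof -
  obtain A B where AB: "\<And>x. norm (g x) \<le> A" "\<And>x. norm (h x) \<le> B" using assms[THEN bm_bound] by blast
  have "0 \<le> A" using order_trans[OF norm_ge_zero AB(1)] .
  then have "norm (g x *\<^sub>R h x) \<le> A * B" for x using AB by (auto intro!: mult_mono)
  then show ?thesis using assms by (intro bmI borel_measurable_scaleR) (auto simp: bm_def)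
qed

lemma bm_mult: "bm g \<Longrightarrow> bm h \<Longrightarrow> bm (\<lambda>x. g x * h x :: real)"
  using bm_scaleR[of g h] by simp

lemma bm_diff:
  fixes g h :: "real \<Rightarrow> 'b::{real_normed_vector,second_countable_topology}"
  assumes "bm g" "bm h" shows "bm (\<lambda>x. g x - h x)"
  using bm_add[OF assms(1) bm_linear[OF bounded_linear_minus[OF bounded_linear_ident] assms(2)]] by simp

lemma bm_power: "bm h \<Longrightarrow> bm (\<lambda>x. h x ^ n :: real)"
  by (induction n) (auto intro: bm_const bm_mult)

lemma bm_exp: assumes "bm h" shows "bm (\<lambda>x. exp (h x :: real))"
proof -
  obtain B where B: "\<And>x. norm (h x) \<le> B" using bm_bound[OF assms] by blast
  have "norm (exp (h x)) \<le> exp B" for x using B[of x] by (simp add: abs_le_iff)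
  with bm_measurable[OF assms] show ?thesis by (intro bmI) auto
qed

lemma bm_inner: "bm h \<Longrightarrow> bm (\<lambda>x. a \<bullet> h x)" for a :: "'b::real_inner"
  by (rule bm_linear[OF bounded_linear_inner_right])

lemma bm_nth: "bm h \<Longrightarrow> bm (\<lambda>x. h x $ i)" for h :: "real \<Rightarrow> 'b::real_normed_vector^'n"
  by (rule bm_linear[OF bounded_linear_vec_nth])

lemma bm_vec:
  fixes h :: "real \<Rightarrow> real^'n"
  assumes "\<And>i. bm (\<lambda>x. h x $ i)" shows "bm h"
proof -
  have "\<forall>i. \<exists>B. \<forall>x. \<bar>h x $ i\<bar> \<le> B" using bm_bound[OF assms] by simp
  then have "\<exists>B. \<forall>i x. \<bar>h x $ i\<bar> \<le> B i" by (rule choice)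
  then obtain B where B: "\<And>i x. \<bar>h x $ i\<bar> \<le> B i" by blast
  have "norm (h x) \<le> (\<Sum>i\<in>UNIV. B i)" for x
    by (rule order_trans[OF norm_le_l1_cart sum_mono]) (rule B)
  then show ?thesis using assms by (intro bmI) (auto simp: borel_measurable_vec_iff bm_def)
qed

lemma bm_outer:
  fixes g :: "real \<Rightarrow> real^'m" and h :: "real \<Rightarrow> real^'n"
  assumes "bm g" "bm h" shows "bm (\<lambda>x. outer (g x) (h x))"
proof -
  obtain A B where AB: "\<And>x. norm (g x) \<le> A" "\<And>x. norm (h x) \<le> B" using assms[THEN bm_bound] by blast
  have A: "0 \<le> A" "0 \<le> B" using order_trans[OF norm_ge_zero AB(1)] order_trans[OF norm_ge_zero AB(2)] .
  have "norm (outer (g x) (h x)) \<le> A * B" for x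
  proof -
    have "outer (g x) (h x) $ i = g x $ i *\<^sub>R h x" for i by (simp add: vec_eq_iff)
    then have "norm (outer (g x) (h x)) = norm (g x) * norm (h x)"
      by (simp add: norm_vec_def[of "outer (g x) (h x)"] norm_vec_def[of "g x"] L2_set_left_distrib)
    with AB A show ?thesis by (simp add: mult_mono)
  qed
  moreover have "(\<lambda>x. outer (g x) (h x)) \<in> borel_measurable borel"
  proof (rule borel_measurable_continuous_Pair[OF assms[THEN bm_measurable]])
    show "continuous_on UNIV (\<lambda>x. outer (fst x :: real^'m) (snd x :: real^'n))"
      unfolding outer_def by (intro continuous_intros)
  qed
  ultimately show ?thesis by (intro bmI)
qed

lemma bm_join:
  fixes g :: "real \<Rightarrow> real^'m" and h :: "real \<Rightarrow> real^'n"
  assumes "bm g" "bm h" shows "bm (\<lambda>x. join (g x) (h x))"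
  using bm_add[OF bm_linear[OF bounded_linear_join1 assms(1)] bm_linear[OF bounded_linear_join2 assms(2)]]
  by (simp add: join_linear)

lemma bm_pair:
  fixes g :: "real \<Rightarrow> real^'m"
  shows "bm g \<Longrightarrow> bm h \<Longrightarrow> bm (\<lambda>x. pair (g x) (h x))"
  unfolding pair_def by (intro bm_join bm_vec) (auto simp: bm_nth)

lemmas bm_intros = bm_const bm_add bm_diff bm_mult bm_scaleR bm_power bm_exp bm_inner bm_nth bm_outer bm_join bm_pair

lemma bm_integrable:
  fixes h :: "real \<Rightarrow> 'b::{banach,second_countable_topology}"
  assumes "is_density f" "bm h"
  shows "integrable (law f) h"
proof -
  interpret prob_space "law f" by (rule law_prob_space[OF assms(1)])
  obtain B where "\<And>x. norm (h x) \<le> B" using bm_bound[OF assms(2)] by blast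
  with bm_measurable[OF assms(2)] show ?thesis
    by (intro integrable_const_bound[where B=B]) auto
qed

lemma expct_linear:
  fixes h :: "real \<Rightarrow> 'b::{banach,second_countable_topology}" and L :: "'b \<Rightarrow> 'c::{banach,second_countable_topology}"
  assumes "is_density f" "bm h" "bounded_linear L"
  shows "expct f (\<lambda>x. L (h x)) = L (expct f h)"
  unfolding expct_def by (rule integral_bounded_linear[OF assms(3) bm_integrable[OF assms(1,2)]])

lemma expct_add:
  fixes g h :: "real \<Rightarrow> 'b::{banach,second_countable_topology}"
  assumes "is_density f" "bm g" "bm h"
  shows "expct f (\<lambda>x. g x + h x) = expct f g + expct f h"
    and "expct f (\<lambda>x. g x - h x) = expct f g - expct f h"
  unfolding expct_def using bm_integrable[OF assms(1,2)] bm_integrable[OF assms(1,3)]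
  by (rule Bochner_Integration.integral_add, rule Bochner_Integration.integral_diff)

lemma expct_const: "is_density f \<Longrightarrow> expct f (\<lambda>x. c) = (c :: 'b::{banach,second_countable_topology})"
  unfolding expct_def using prob_space.prob_space[OF law_prob_space] by simp

lemma expct_nth:
  fixes h :: "real \<Rightarrow> 'b::euclidean_space^'n"
  assumes "is_density f" "bm h"
  shows "expct f h $ i = expct f (\<lambda>x. h x $ i)"
  by (rule expct_linear[OF assms bounded_linear_vec_nth, symmetric])

lemma expct_inner:
  fixes h :: "real \<Rightarrow> 'b::euclidean_space"
  assumes "is_density f" "bm h"
  shows "expct f (\<lambda>x. a \<bullet> h x) = a \<bullet> expct f h"
  by (rule expct_linear[OF assms bounded_linear_inner_right])

lemma expct_cmult: "is_density f \<Longrightarrow> bm h \<Longrightarrow> expct f (\<lambda>x. c * h x :: real) = c * expct f h"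
  by (rule expct_linear[OF _ _ bounded_linear_mult_right])

lemma cov_nth:
  fixes h :: "real \<Rightarrow> real^'n"
  assumes "is_density f" "bm h"
  shows "cov f h $ i $ j = expct f (\<lambda>x. (h x - expct f h) $ i * (h x - expct f h) $ j)"
proof -
  have b: "bm (\<lambda>x. outer (h x - expct f h) (h x - expct f h))" using assms(2) by (intro bm_intros)
  show ?thesis unfolding cov_def
    by (simp add: expct_nth[OF assms(1) b] expct_nth[OF assms(1) bm_nth[OF b]])
qed

lemma cov_sym:
  fixes h :: "real \<Rightarrow> real^'n"
  assumes "is_density f" "bm h"
  shows "cov f h $ i $ j = cov f h $ j $ i"
  unfolding cov_nth[OF assms] by (simp add: mult.commute)

lemma cov_quadratic:
  fixes h :: "real \<Rightarrow> real^'n"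
  assumes "is_density f" "bm h"
  shows "a \<bullet> (cov f h *v a) = expct f (\<lambda>x. (a \<bullet> (h x - expct f h))\<^sup>2)"
proof -
  have "bounded_linear (\<lambda>C::real^'n^'n. a \<bullet> (C *v a))"
    by (rule bounded_linear_compose[OF bounded_linear_inner_right
          bounded_bilinear.bounded_linear_left[OF bounded_bilinear_matrix_vector]])
  then have "expct f (\<lambda>x. a \<bullet> (outer (h x - expct f h) (h x - expct f h) *v a)) = a \<bullet> (cov f h *v a)"
    unfolding cov_def using assms by (intro expct_linear bm_intros)
  then show ?thesis by (simp add: outer_mult_vec power2_eq_square inner_commute)
qed

lemma expct_nonneg: "(\<And>x. 0 \<le> h x) \<Longrightarrow> 0 \<le> expct f (h :: real \<Rightarrow> real)"
  unfolding expct_def by (rule Bochner_Integration.integral_nonneg) auto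

lemma cov_psd:
  fixes h :: "real \<Rightarrow> real^'n"
  assumes "is_density f" "bm h"
  shows "0 \<le> a \<bullet> (cov f h *v a)"
  unfolding cov_quadratic[OF assms] by (rule expct_nonneg) simp

lemma Zc_bm: "bm \<phi> \<Longrightarrow> bm (Zc f \<phi>)"
  unfolding Zc_def mom_def by (intro bm_intros bm_linear[OF bounded_linear_vech])

lemma Zc_mean:
  assumes f: "is_density f" and \<phi>: "bm \<phi>"
  shows "expct f (Zc f \<phi>) = 0"
proof -
  have b: "bm (\<lambda>x. \<phi> x - expct f \<phi>)" "bm (\<lambda>x. outer (\<phi> x - expct f \<phi>) (\<phi> x - expct f \<phi>) - cov f \<phi>)"
    by (intro bm_intros \<phi>, intro bm_intros \<phi>)
  have e1: "expct f (\<lambda>x. \<phi> x - expct f \<phi>) = 0"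
    using f \<phi> by (simp add: expct_add bm_const expct_const)
  have e2: "expct f (\<lambda>x. outer (\<phi> x - expct f \<phi>) (\<phi> x - expct f \<phi>) - cov f \<phi>) = 0"
    by (subst expct_add(2)[OF f bm_outer[OF b(1) b(1)] bm_const]) (simp add: expct_const[OF f] cov_def)
  show ?thesis
  proof (subst jvec_eq_iff, intro conjI)
    show "part1 (expct f (Zc f \<phi>)) = part1 0"
      using expct_linear[OF f Zc_bm[OF \<phi>] bounded_linear_part1] e1 by (simp add: Zc_def mom_def)
    show "part2 (expct f (Zc f \<phi>)) = part2 0"
      using expct_linear[OF f Zc_bm[OF \<phi>] bounded_linear_part2, of f]
        expct_linear[OF f b(2) bounded_linear_vech] e2
      by (simp add: Zc_def mom_def linear_simps[OF bounded_linear_vech])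
  qed
qed

subsection \<open>Quadratic expansions of the exponential root\<close>

lemma exp_moment_lipschitz:
  fixes z z0 :: "'v::euclidean_space"
  assumes \<mu>: "prob_space \<mu>" and \<psi>[measurable]: "\<psi> \<in> borel_measurable \<mu>"
    and b: "\<And>x. x \<in> space \<mu> \<Longrightarrow> norm (\<psi> x) \<le> b" and z: "norm (z - z0) \<le> 1" and \<theta>: "0 \<le> \<theta>"
  shows "\<bar>(\<integral>x. exp (\<theta> * (z \<bullet> \<psi> x)) \<partial>\<mu>) - (\<integral>x. exp (\<theta> * (z0 \<bullet> \<psi> x)) \<partial>\<mu>)\<bar>
    \<le> exp (\<theta> * ((norm z0 + 1) * b)) * (\<theta> * b) * norm (z - z0)"
proof -
  interpret prob_space \<mu> by fact
  have nz: "norm z \<le> norm z0 + 1" using norm_triangle_ineq[of "z - z0" z0] z by simp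
  have lin: "\<bar>\<theta> * (v \<bullet> \<psi> x)\<bar> \<le> \<theta> * (c * b)" if "norm v \<le> c" "x \<in> space \<mu>" for v x c
  proof -
    have "\<bar>v \<bullet> \<psi> x\<bar> \<le> norm v * norm (\<psi> x)" by (rule Cauchy_Schwarz_ineq2)
    also have "\<dots> \<le> c * b" using that b[OF that(2)] by (intro mult_mono) (auto intro: order_trans[OF norm_ge_zero])
    finally show ?thesis using \<theta> by (simp add: abs_mult mult_left_mono)
  qed
  let ?C = "\<theta> * ((norm z0 + 1) * b)"
  have i: "integrable \<mu> (\<lambda>x. exp (\<theta> * (v \<bullet> \<psi> x)))" if "norm v \<le> norm z0 + 1" for v
    using lin[OF that] by (intro norm_integral_bound(1)[OF \<mu>, where B="exp ?C"]) (auto simp: abs_le_iff)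
  have "\<bar>\<integral>x. exp (\<theta> * (z \<bullet> \<psi> x)) - exp (\<theta> * (z0 \<bullet> \<psi> x)) \<partial>\<mu>\<bar> \<le> exp ?C * (\<theta> * b) * norm (z - z0)"
    unfolding real_norm_def[symmetric]
  proof (rule norm_integral_bound(2)[OF \<mu>])
    fix x assume x: "x \<in> space \<mu>"
    have "\<bar>exp (\<theta> * (z \<bullet> \<psi> x)) - exp (\<theta> * (z0 \<bullet> \<psi> x))\<bar> \<le> exp ?C * \<bar>\<theta> * (z \<bullet> \<psi> x) - \<theta> * (z0 \<bullet> \<psi> x)\<bar>"
      using x nz by (intro exp_lipschitz lin) auto
    also have "\<theta> * (z \<bullet> \<psi> x) - \<theta> * (z0 \<bullet> \<psi> x) = \<theta> * ((z - z0) \<bullet> \<psi> x)"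
      by (simp add: inner_diff_left right_diff_distrib)
    also have "exp ?C * \<bar>\<theta> * ((z - z0) \<bullet> \<psi> x)\<bar> \<le> exp ?C * (\<theta> * (norm (z - z0) * b))"
      by (intro mult_left_mono lin x) auto
    finally show "norm (exp (\<theta> * (z \<bullet> \<psi> x)) - exp (\<theta> * (z0 \<bullet> \<psi> x))) \<le> exp ?C * (\<theta> * b) * norm (z - z0)"
      by (simp add: mult_ac)
  qed measurable
  then show ?thesis using i[of z] i[of z0] nz by simp
qed

lemma bounded_rv_inner:
  fixes z :: "'v::euclidean_space"
  assumes "prob_space \<mu>" "\<psi> \<in> borel_measurable \<mu>" "\<And>x. x \<in> space \<mu> \<Longrightarrow> norm (\<psi> x) \<le> b"
  shows "bounded_rv \<mu> (\<lambda>x. z \<bullet> \<psi> x) (norm z * b)"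
proof -
  interpret prob_space \<mu> by fact
  show ?thesis
  proof
    show "(\<lambda>x. z \<bullet> \<psi> x) \<in> borel_measurable \<mu>" using assms(2) by measurable
    show "\<bar>z \<bullet> \<psi> x\<bar> \<le> norm z * b" if "x \<in> space \<mu>" for x
      using Cauchy_Schwarz_ineq2[of z "\<psi> x"] mult_left_mono[OF assms(3)[OF that], of "norm z"] by simp
  qed
qed

text \<open>A bracket around the root survives perturbation: the reference values at
  \<open>\<theta>0 - \<beta>\<close> and \<open>\<theta>0 + \<beta>\<close> lie strictly on either
  side of 1, and so do the perturbed ones. Since only two parameters are compared, the strong law at
  two points suffices for the empirical root. This supplies the closeness that
  \<open>root_expansion\<close> presupposes.\<close>

lemma root_localized:
  fixes z0 :: "'v::euclidean_space" and m :: "real \<Rightarrow> real"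
  assumes b: "b \<ge> 0" and \<beta>: "0 < \<beta>" "\<beta> < \<theta>0" and m: "m (\<theta>0 - \<beta>) < 1" "1 < m (\<theta>0 + \<beta>)"
  shows "\<exists>e>0. \<forall>(\<mu> :: 'a measure) \<psi> z. prob_space \<mu> \<longrightarrow> \<psi> \<in> borel_measurable \<mu> \<longrightarrow>
     (\<forall>x\<in>space \<mu>. norm (\<psi> x) \<le> b) \<longrightarrow> norm (z - z0) < e \<longrightarrow>
     (\<forall>\<theta>\<in>{\<theta>0 - \<beta>, \<theta>0 + \<beta>}. \<bar>(\<integral>x. exp (\<theta> * (z0 \<bullet> \<psi> x)) \<partial>\<mu>) - m \<theta>\<bar> < e) \<longrightarrow>
     \<bar>exp_root \<mu> (\<lambda>x. z \<bullet> \<psi> x) - \<theta>0\<bar> < \<beta> \<and> (\<integral>x. exp (exp_root \<mu> (\<lambda>x. z \<bullet> \<psi> x) * (z \<bullet> \<psi> x)) \<partial>\<mu>) = 1"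
proof -
  define g where "g = min (1 - m (\<theta>0 - \<beta>)) (m (\<theta>0 + \<beta>) - 1)"
  have g: "g > 0" "m (\<theta>0 - \<beta>) \<le> 1 - g" "1 + g \<le> m (\<theta>0 + \<beta>)" using m by (auto simp: g_def)
  define L where "L = exp ((\<theta>0 + \<beta>) * ((norm z0 + 1) * b)) * ((\<theta>0 + \<beta>) * b)"
  have L: "L \<ge> 0" using b \<beta> by (simp add: L_def)
  \<comment> \<open>Ensures \<open>e + L * e \<le> g / 2\<close>: the change of measure costs
    \<open>e\<close>, the change of \<open>z\<close> costs at most \<open>L * e\<close>, and both
    together stay below the gap \<open>g\<close>.\<close>
  define e where "e = min 1 (g / (2 * (L + 1)))"
  have e: "e > 0" "e \<le> 1" "e \<le> g / (2 * (L + 1))" using g L by (auto simp: e_def)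
  have eL: "e + L * e \<le> g / 2"
  proof -
    have "e * (2 * (L + 1)) \<le> g" using e(3) L by (simp add: pos_le_divide_eq)
    then show ?thesis by (simp add: algebra_simps)
  qed
  have "\<bar>exp_root \<mu> (\<lambda>x. z \<bullet> \<psi> x) - \<theta>0\<bar> < \<beta> \<and> (\<integral>x. exp (exp_root \<mu> (\<lambda>x. z \<bullet> \<psi> x) * (z \<bullet> \<psi> x)) \<partial>\<mu>) = 1"
    if \<mu>: "prob_space \<mu>" and \<psi>: "\<psi> \<in> borel_measurable \<mu>" "\<forall>x\<in>space \<mu>. norm (\<psi> x) \<le> b"
      and z: "norm (z - z0) < e"
      and c: "\<forall>\<theta>\<in>{\<theta>0 - \<beta>, \<theta>0 + \<beta>}. \<bar>(\<integral>x. exp (\<theta> * (z0 \<bullet> \<psi> x)) \<partial>\<mu>) - m \<theta>\<bar> < e"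
    for \<mu> :: "'a measure" and \<psi> z
  proof -
    interpret bounded_rv \<mu> "\<lambda>x. z \<bullet> \<psi> x" "norm z * b"
      by (rule bounded_rv_inner[OF \<mu>]) (use \<psi> in auto)
    have dev: "\<bar>mgf \<theta> - m \<theta>\<bar> < g" if t: "\<theta> \<in> {\<theta>0 - \<beta>, \<theta>0 + \<beta>}" for \<theta>
    proof -
      have t': "0 \<le> \<theta>" "\<theta> \<le> \<theta>0 + \<beta>" using t \<beta> by auto
      have "\<bar>mgf \<theta> - (\<integral>x. exp (\<theta> * (z0 \<bullet> \<psi> x)) \<partial>\<mu>)\<bar>
        \<le> exp (\<theta> * ((norm z0 + 1) * b)) * (\<theta> * b) * norm (z - z0)"
        unfolding mgf_def using \<psi> z e t' by (intro exp_moment_lipschitz[OF \<mu>]) auto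
      also have "\<dots> \<le> L * e"
      proof -
        have "0 \<le> (norm z0 + 1) * b" using b by simp
        then have "\<theta> * ((norm z0 + 1) * b) \<le> (\<theta>0 + \<beta>) * ((norm z0 + 1) * b)"
          using t'(2) by (rule mult_right_mono[rotated])
        then show ?thesis unfolding L_def using t' b z by (intro mult_mono) auto
      qed
      finally show ?thesis using c[rule_format, OF t] eL g(1) by linarith
    qed
    have "mgf (\<theta>0 - \<beta>) < 1" "1 < mgf (\<theta>0 + \<beta>)"
      using dev[of "\<theta>0 - \<beta>"] dev[of "\<theta>0 + \<beta>"] g by auto
    from exp_root_between[OF _ _ this] \<beta> show ?thesis by (auto simp: mgf_def abs_less_iff)
  qed
  then show ?thesis using e(1) by blast
qed

lemma GDERIV_quadraticI:
  fixes f :: "'v::real_inner \<Rightarrow> real"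
  assumes "e > 0" "\<And>z. norm (z - z0) < e \<Longrightarrow> \<bar>f z - f z0 - g \<bullet> (z - z0)\<bar> \<le> C * (norm (z - z0))\<^sup>2"
  shows "GDERIV f z0 :> g"
  unfolding gderiv_def
proof (rule has_derivativeI_sandwich[OF assms(1)])
  show "bounded_linear (\<lambda>h. h \<bullet> g)" by (rule bounded_linear_inner_left)
  fix y assume y: "y \<noteq> z0" "dist y z0 < e"
  then have "\<bar>f y - f z0 - g \<bullet> (y - z0)\<bar> \<le> C * (norm (y - z0))\<^sup>2" by (intro assms(2)) (simp add: dist_norm)
  then show "norm (f y - f z0 - (y - z0) \<bullet> g) / norm (y - z0) \<le> C * norm (y - z0)"
    using y by (simp add: divide_simps power2_eq_square inner_commute mult.assoc)
next
  show "((\<lambda>y. C * norm (y - z0)) \<longlongrightarrow> 0) (at z0)"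
    by (auto intro!: tendsto_eq_intros)
qed

subsection \<open>Population quantities\<close>

locale dictionary =
  fixes f0 f1 :: "real \<Rightarrow> real" and \<phi> :: "real \<Rightarrow> real^('s::{finite,linorder})"
  assumes dens0: "is_density f0" and dens1: "is_density f1"
    and moments: "moment_assumption f0 f1 \<phi>"
    and bdd: "bounded_dictionary \<phi>"
    and Y_nonzero: "expct f1 \<phi> - expct f0 \<phi> \<noteq> 0"
begin

abbreviation "u0 \<equiv> expct f0 \<phi>"
abbreviation "u1 \<equiv> expct f1 \<phi>"
abbreviation "C0 \<equiv> cov f0 \<phi>"
abbreviation "C1 \<equiv> cov f1 \<phi>"
abbreviation "\<eta>0 \<equiv> join (eta f0 \<phi>) (eta f1 \<phi>)"
abbreviation "K \<equiv> Kpop f0 f1 \<phi>"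
abbreviation "k0 \<equiv> k0pop f0 f1 \<phi>"
abbreviation "J \<equiv> Jpop f0 f1 \<phi>"
abbreviation "\<Lambda> \<equiv> Lam f0 f1 \<phi>"
abbreviation "\<theta>0 \<equiv> theta0 f0 f1 \<phi>"
abbreviation "tE \<equiv> tilt_expct f0 f1 \<phi> \<Lambda>"
abbreviation "tphi \<equiv> tilt_expct f0 f1 \<phi> \<phi>"
abbreviation "z0 \<equiv> pair K k0"

lemma \<phi>_bm: "bm \<phi>"
proof (rule bm_vec)
  fix i
  obtain B where "\<And>i x. \<bar>\<phi> x $ i\<bar> \<le> B" using bdd by (auto simp: bounded_dictionary_def)
  moreover have "\<phi> \<in> borel_measurable borel" using moments by (simp add: moment_assumption_def)
  ultimately show "bm (\<lambda>x. \<phi> x $ i)" by (intro bmI) auto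
qed

lemma C0_posdef: "v \<noteq> 0 \<Longrightarrow> 0 < v \<bullet> (C0 *v v)"
  using moments by (simp add: moment_assumption_def)

lemma F_posdef: "v \<noteq> 0 \<Longrightarrow> 0 < v \<bullet> ((C0 + C1) *v v)"
  using C0_posdef[of v] cov_psd[OF dens1 \<phi>_bm, of v]
  by (simp add: matrix_vector_mult_add_rdistrib inner_add_right)

lemma F_invertible: "invertible (C0 + C1)"
  by (rule posdef_invertible[OF F_posdef])

lemma eta_maps: "F_map \<eta>0 = C0 + C1" "Y_map \<eta>0 = u1 - u0" "K_map \<eta>0 = K" "Kk_map \<eta>0 = z0" "J_map \<eta>0 = J"
  by (simp_all add: F_map_def Y_map_def eta_def mom_C_mom cov_sym dens0 dens1 \<phi>_bm K_map_def Kpop_def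
      Kk_map_def k0pop_def J_map_def Jpop_def)

lemma F_K: "(C0 + C1) *v K = u1 - u0"
  using matrix_inv_solve[OF F_invertible] by (simp add: Kpop_def Kfun_def)

lemma K_nonzero: "K \<noteq> 0"
  using F_K Y_nonzero by auto

lemma J_eq: "J = K \<bullet> (u1 - u0)" "J = K \<bullet> ((C0 + C1) *v K)"
  unfolding F_K by (simp_all add: Jpop_def Jfun_def Kpop_def Kfun_def inner_commute)

lemma J_pos: "J > 0"
  unfolding J_eq(2) by (rule F_posdef[OF K_nonzero])

text \<open>The constant coordinate makes the offset an ordinary coefficient: the score with
  parameters \<open>pair k c\<close> is the inner product with \<open>\<psi> x\<close>.\<close>

definition \<psi> :: "real \<Rightarrow> ('s, unit) jvec" where "\<psi> x = pair (\<phi> x) 1"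

lemma \<psi>_bm: "bm \<psi>" unfolding \<psi>_def by (intro bm_intros \<phi>_bm)

lemma inner_\<psi>: "z \<bullet> \<psi> x = part2 z $ () + part1 z \<bullet> \<phi> x"
  by (subst pair_eta[of z, symmetric]) (simp add: \<psi>_def inner_pair)

lemma Lam_eq: "\<Lambda> x = z0 \<bullet> \<psi> x"
  by (simp add: inner_\<psi> Lam_def)

lemma Lam_bm: "bm \<Lambda>" unfolding Lam_eq[abs_def] by (intro bm_intros \<psi>_bm)

lemma k0_eq: "k0 = - (1/2) * (K \<bullet> u0 + K \<bullet> u1)"
  by (simp add: k0pop_def k0fun_def Kpop_def inner_add_right)

lemma J_diff: "J = K \<bullet> u1 - K \<bullet> u0"
  by (simp add: J_eq(1) inner_diff_right)

text \<open>The offset puts zero midway between the two class means. The negative mean under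
  \<open>f0\<close> and the positive mean under \<open>f1\<close> are the two ingredients for the
  existence of a positive root.\<close>

lemma expct_Lam: "expct f1 \<Lambda> = J / 2" "expct f0 \<Lambda> = - (J / 2)"
proof -
  have *: "expct f \<Lambda> = k0 + K \<bullet> expct f \<phi>" if f: "is_density f" for f
    unfolding Lam_def using f \<phi>_bm by (simp add: expct_add bm_intros expct_const expct_inner)
  show "expct f1 \<Lambda> = J / 2" using *[OF dens1] k0_eq J_diff by argo
  show "expct f0 \<Lambda> = - (J / 2)" using *[OF dens0] k0_eq J_diff by argo
qed

definition b :: real where "b = (SOME b. 0 \<le> b \<and> (\<forall>x. norm (\<psi> x) \<le> b))"

lemma b: "0 \<le> b" "norm (\<psi> x) \<le> b"
proof -
  obtain B where "\<And>x. norm (\<psi> x) \<le> B" using bm_bound[OF \<psi>_bm] by blast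
  then have "0 \<le> B \<and> (\<forall>x. norm (\<psi> x) \<le> B)" using order_trans[OF norm_ge_zero] by blast
  then have "0 \<le> b \<and> (\<forall>x. norm (\<psi> x) \<le> b)" unfolding b_def by (rule someI)
  then show "0 \<le> b" "norm (\<psi> x) \<le> b" by auto
qed

lemma \<psi>_measurable[measurable]: "\<psi> \<in> borel_measurable borel" by (rule bm_measurable[OF \<psi>_bm])

lemma law_rv: "bounded_rv (law f0) (\<lambda>x. z \<bullet> \<psi> x) (norm z * b)"
  by (rule bounded_rv_inner[OF law_prob_space[OF dens0]]) (auto simp: b)

sublocale L: bounded_rv "law f0" \<Lambda> "norm z0 * b"
  using law_rv[of z0] by (simp add: Lam_eq[abs_def])

lemma theta_fun_eq: "theta_fun f0 \<phi> z = exp_root (law f0) (\<lambda>x. z \<bullet> \<psi> x)"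
  by (simp add: theta_fun_def exp_root_def inner_\<psi> expct_def)

lemma theta0_eq: "\<theta>0 = exp_root (law f0) \<Lambda>"
  by (simp add: theta0_def exp_root_def expct_def)

lemma theta_fun_z0: "theta_fun f0 \<phi> z0 = \<theta>0"
  by (simp add: theta_fun_eq theta0_eq Lam_eq[abs_def])

lemma f1_AE: "AE x in law f0. P x \<Longrightarrow> AE x in law f1. P x"
proof -
  assume a: "AE x in law f0. P x"
  have m: "f0 \<in> borel_measurable borel" "f1 \<in> borel_measurable borel"
    using dens0 dens1 by (auto simp: is_density_def)
  from a have "AE x in lborel. 0 < f0 x \<longrightarrow> P x"
    unfolding law_def using m by (subst (asm) AE_density) auto
  moreover have "0 < f1 x \<Longrightarrow> 0 < f0 x" for x
    using moments dens0 by (auto simp: moment_assumption_def is_density_def less_le)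
  ultimately have "AE x in lborel. 0 < f1 x \<longrightarrow> P x" by auto
  then show ?thesis unfolding law_def using m by (subst AE_density) auto
qed

text \<open>Domination of \<open>f1\<close> by \<open>f0\<close> enters here: a score nonpositive
  almost everywhere under \<open>f0\<close> would be so under \<open>f1\<close>, where its mean is
  positive.\<close>

lemma Lam_not_nonpos: "\<not> (AE x in law f0. \<Lambda> x \<le> 0)"
proof
  assume "AE x in law f0. \<Lambda> x \<le> 0"
  from f1_AE[OF this] have "0 \<le> (\<integral>x. - \<Lambda> x \<partial>law f1)"
    by (intro integral_nonneg_AE) auto
  then have "expct f1 \<Lambda> \<le> 0" by (simp add: expct_def)
  then show False using J_pos by (simp add: expct_Lam)
qed

lemma Lam_nonzero: "\<not> (AE x in law f0. \<Lambda> x = 0)"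
  using Lam_not_nonpos eventually_mono[of "\<lambda>x. \<Lambda> x = 0" "ae_filter (law f0)" "\<lambda>x. \<Lambda> x \<le> 0"] by auto

lemma theta0: "0 < \<theta>0" "L.mgf \<theta>0 = 1"
proof -
  have "(\<integral>x. \<Lambda> x \<partial>law f0) < 0" using expct_Lam(2) J_pos by (simp add: expct_def)
  from L.mgf_small_less_1[OF this zero_less_one] obtain a where a: "0 < a" "L.mgf a < 1" by blast
  obtain c where c: "a < c" "1 < L.mgf c" using L.mgf_large_greater_1[OF Lam_not_nonpos] by blast
  from L.exp_root_between[OF a(1) c(1) a(2) c(2)] a(1) show "0 < \<theta>0" "L.mgf \<theta>0 = 1"
    by (auto simp: theta0_eq)
qed

lemma tilt_bm:
  fixes h :: "real \<Rightarrow> 'b::{real_normed_vector,second_countable_topology}"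
  shows "bm h \<Longrightarrow> bm (\<lambda>x. exp (\<theta>0 * \<Lambda> x) *\<^sub>R h x)"
  by (intro bm_intros Lam_bm)

lemma tE_pos: "tE > 0"
  using L.tilted_mean_pos[OF theta0 Lam_nonzero] by (simp add: tilt_expct_def expct_def)

lemma tilt_1: "expct f0 (\<lambda>x. exp (\<theta>0 * \<Lambda> x)) = 1"
  using theta0(2) by (simp add: L.mgf_def expct_def)

lemma tilt_\<psi>: "(\<integral>x. exp (\<theta>0 * \<Lambda> x) *\<^sub>R \<psi> x \<partial>law f0) = pair tphi 1"
proof -
  have p: "bounded_linear (part1 :: ('s, unit) jvec \<Rightarrow> _)" "bounded_linear (\<lambda>z::('s, unit) jvec. part2 z $ ())"
    by (rule bounded_linear_part1) (rule bounded_linear_compose[OF bounded_linear_vec_nth bounded_linear_part2])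
  have "part1 (expct f0 (\<lambda>x. exp (\<theta>0 * \<Lambda> x) *\<^sub>R \<psi> x)) = tphi"
    using expct_linear[OF dens0 tilt_bm[OF \<psi>_bm] p(1)] by (simp add: tilt_expct_def \<psi>_def pair_linear)
  moreover have "part2 (expct f0 (\<lambda>x. exp (\<theta>0 * \<Lambda> x) *\<^sub>R \<psi> x)) $ () = 1"
    using expct_linear[OF dens0 tilt_bm[OF \<psi>_bm] p(2)] tilt_1 by (simp add: \<psi>_def pair_linear)
  ultimately show ?thesis
    unfolding expct_def[symmetric] by (subst pair_eta[symmetric]) (simp only:)
qed

lemma tilt_z0: "pair tphi 1 \<bullet> z0 = tE"
proof -
  have "tE = expct f0 (\<lambda>x. z0 \<bullet> (exp (\<theta>0 * \<Lambda> x) *\<^sub>R \<psi> x))"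
    by (simp add: tilt_expct_def Lam_eq)
  also have "\<dots> = z0 \<bullet> pair tphi 1"
    using expct_inner[OF dens0 tilt_bm[OF \<psi>_bm]] tilt_\<psi> by (simp add: expct_def)
  finally show ?thesis by (simp add: inner_commute)
qed

lemma mgf_around: "0 < \<beta> \<Longrightarrow> \<beta> < \<theta>0 \<Longrightarrow> L.mgf (\<theta>0 - \<beta>) < 1 \<and> 1 < L.mgf (\<theta>0 + \<beta>)"
  using L.mgf_less_1_iff[OF Lam_nonzero theta0] theta0(1) by simp

lemma dtheta_eq: "dtheta f0 f1 \<phi> = - (\<theta>0 / tE) *\<^sub>R pair tphi 1"
  by (simp add: dtheta_def)

text \<open>Under the population law \<open>m\<close> is 1 and \<open>D\<close> equals
  \<open>D0\<close>, so the error in \<open>root_expansion\<close> is purely quadratic in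
  \<open>z - z0\<close>; division by the tilted mean \<open>tE\<close> turns the linearised equation
  into the gradient.\<close>

lemma theta_fun_expansion:
  "\<exists>C>0. \<exists>e>0. \<forall>z. norm (z - z0) < e \<longrightarrow>
    \<bar>theta_fun f0 \<phi> z - \<theta>0\<bar> \<le> C * norm (z - z0) \<and>
    \<bar>theta_fun f0 \<phi> z - \<theta>0 - dtheta f0 f1 \<phi> \<bullet> (z - z0)\<bar> \<le> C * (norm (z - z0))\<^sup>2"
proof -
  let ?D = "pair tphi 1"
  from root_expansion[OF theta0(1) _ b(1), of ?D z0, where 'a=real] tE_pos
  obtain C \<beta> where C: "C > 0" and \<beta>: "\<beta> > 0" and exp: "\<And>(\<mu> :: real measure) \<psi> z \<theta> m D. prob_space \<mu> \<Longrightarrow> \<psi> \<in> borel_measurable \<mu> \<Longrightarrow>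
     (\<forall>x\<in>space \<mu>. norm (\<psi> x) \<le> b) \<Longrightarrow> (\<integral>x. exp (\<theta> * (z \<bullet> \<psi> x)) \<partial>\<mu>) = 1 \<Longrightarrow>
     m = (\<integral>x. exp (\<theta>0 * (z0 \<bullet> \<psi> x)) \<partial>\<mu>) \<Longrightarrow> D = (\<integral>x. exp (\<theta>0 * (z0 \<bullet> \<psi> x)) *\<^sub>R \<psi> x \<partial>\<mu>) \<Longrightarrow>
     \<bar>\<theta> - \<theta>0\<bar> \<le> \<beta> \<Longrightarrow> norm (z - z0) \<le> \<beta> \<Longrightarrow> norm (D - ?D) \<le> \<beta> \<Longrightarrow>
     \<bar>\<theta> - \<theta>0\<bar> \<le> C * (norm (z - z0) + \<bar>m - 1\<bar>) \<and>
     \<bar>(\<theta> - \<theta>0) * (?D \<bullet> z0) + \<theta>0 * (?D \<bullet> (z - z0)) + (m - 1)\<bar>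
       \<le> C * (norm (z - z0) + \<bar>m - 1\<bar> + norm (D - ?D)) * (norm (z - z0) + \<bar>m - 1\<bar>)"
    unfolding tilt_z0 by meson
  \<comment> \<open>Below \<open>\<theta>0\<close>, so that both bracket points are positive, and at
    most \<open>\<beta>\<close>, so that a root in the bracket is within reach of the
    expansion.\<close>
  define \<beta>' where "\<beta>' = min \<beta> (\<theta>0 / 2)"
  have \<beta>': "0 < \<beta>'" "\<beta>' < \<theta>0" "\<beta>' \<le> \<beta>" using \<beta> theta0(1) by (auto simp: \<beta>'_def)
  note around = mgf_around[OF \<beta>'(1,2)]
  from root_localized[OF b(1) \<beta>'(1,2), of L.mgf z0, where 'a=real, OF conjunct1[OF around] conjunct2[OF around]]
  obtain e where e: "e > 0" and loc: "\<And>(\<mu> :: real measure) \<psi> z. prob_space \<mu> \<Longrightarrow> \<psi> \<in> borel_measurable \<mu> \<Longrightarrow>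
     (\<forall>x\<in>space \<mu>. norm (\<psi> x) \<le> b) \<Longrightarrow> norm (z - z0) < e \<Longrightarrow>
     (\<forall>\<theta>\<in>{\<theta>0 - \<beta>', \<theta>0 + \<beta>'}. \<bar>(\<integral>x. exp (\<theta> * (z0 \<bullet> \<psi> x)) \<partial>\<mu>) - L.mgf \<theta>\<bar> < e) \<Longrightarrow>
     \<bar>exp_root \<mu> (\<lambda>x. z \<bullet> \<psi> x) - \<theta>0\<bar> < \<beta>' \<and> (\<integral>x. exp (exp_root \<mu> (\<lambda>x. z \<bullet> \<psi> x) * (z \<bullet> \<psi> x)) \<partial>\<mu>) = 1"
    by meson
  have main: "\<bar>theta_fun f0 \<phi> z - \<theta>0\<bar> \<le> C * norm (z - z0) \<and>
    \<bar>(theta_fun f0 \<phi> z - \<theta>0) * tE + \<theta>0 * (?D \<bullet> (z - z0))\<bar> \<le> C * (norm (z - z0))\<^sup>2"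
    if z: "norm (z - z0) < min e \<beta>" for z
  proof -
    have r: "\<bar>theta_fun f0 \<phi> z - \<theta>0\<bar> < \<beta>'" "(\<integral>x. exp (theta_fun f0 \<phi> z * (z \<bullet> \<psi> x)) \<partial>law f0) = 1"
      unfolding theta_fun_eq using loc[of "law f0" \<psi> z] z e law_prob_space[OF dens0] b
      by (auto simp: L.mgf_def Lam_eq)
    have "1 = (\<integral>x. exp (\<theta>0 * (z0 \<bullet> \<psi> x)) \<partial>law f0)" "?D = (\<integral>x. exp (\<theta>0 * (z0 \<bullet> \<psi> x)) *\<^sub>R \<psi> x \<partial>law f0)"
      using tilt_1 tilt_\<psi> by (simp_all add: expct_def Lam_eq)
    from exp[OF law_prob_space[OF dens0] _ _ r(2) this] r(1) z \<beta> \<beta>'(3) b show ?thesis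
      by (simp add: tilt_z0 power2_eq_square mult.assoc)
  qed
  define C' where "C' = max C (C / tE)"
  have "\<bar>theta_fun f0 \<phi> z - \<theta>0\<bar> \<le> C' * norm (z - z0) \<and>
    \<bar>theta_fun f0 \<phi> z - \<theta>0 - dtheta f0 f1 \<phi> \<bullet> (z - z0)\<bar> \<le> C' * (norm (z - z0))\<^sup>2"
    if z: "norm (z - z0) < min e \<beta>" for z
  proof (intro conjI)
    have "C * norm (z - z0) \<le> C' * norm (z - z0)" by (intro mult_right_mono) (auto simp: C'_def)
    with main[OF z] show "\<bar>theta_fun f0 \<phi> z - \<theta>0\<bar> \<le> C' * norm (z - z0)" by linarith
    have "theta_fun f0 \<phi> z - \<theta>0 - dtheta f0 f1 \<phi> \<bullet> (z - z0) = ((theta_fun f0 \<phi> z - \<theta>0) * tE + \<theta>0 * (?D \<bullet> (z - z0))) / tE"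
      using tE_pos by (simp add: dtheta_eq field_simps)
    then have "\<bar>theta_fun f0 \<phi> z - \<theta>0 - dtheta f0 f1 \<phi> \<bullet> (z - z0)\<bar> \<le> C * (norm (z - z0))\<^sup>2 / tE"
      using main[OF z] tE_pos by (simp add: divide_right_mono)
    also have "\<dots> = (C / tE) * (norm (z - z0))\<^sup>2" by simp
    also have "\<dots> \<le> C' * (norm (z - z0))\<^sup>2" by (intro mult_right_mono) (auto simp: C'_def)
    finally show "\<bar>theta_fun f0 \<phi> z - \<theta>0 - dtheta f0 f1 \<phi> \<bullet> (z - z0)\<bar> \<le> C' * (norm (z - z0))\<^sup>2" .
  qed
  moreover have "C' > 0" using C by (simp add: C'_def less_max_iff_disj)
  moreover have "min e \<beta> > 0" using e \<beta> by simp
  ultimately show ?thesis by blast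
qed

lemma theta_fun_GDERIV: "GDERIV (theta_fun f0 \<phi>) z0 :> dtheta f0 f1 \<phi>"
proof -
  obtain C e where "e > 0" "\<And>z. norm (z - z0) < e \<Longrightarrow>
    \<bar>theta_fun f0 \<phi> z - \<theta>0 - dtheta f0 f1 \<phi> \<bullet> (z - z0)\<bar> \<le> C * (norm (z - z0))\<^sup>2"
    using theta_fun_expansion by blast
  then show ?thesis by (intro GDERIV_quadraticI) (auto simp: theta_fun_z0)
qed

lemma theta_fun_measurable[measurable]: "theta_fun f0 \<phi> \<in> borel_measurable borel"
proof -
  have "(\<lambda>z. THE \<theta>. \<theta> > 0 \<and> (\<integral>x. exp (\<theta> * (z \<bullet> \<psi> x)) \<partial>law f0) = 1) \<in> borel_measurable borel"
  proof (rule exp_moment_root_measurable)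
    interpret prob_space "law f0" by (rule law_prob_space[OF dens0])
    show "(\<lambda>z. \<integral>x. exp (\<theta> * (z \<bullet> \<psi> x)) \<partial>law f0) \<in> borel_measurable borel" for \<theta> by measurable
    show "(\<forall>\<theta>. (\<integral>x. exp (\<theta> * (z \<bullet> \<psi> x)) \<partial>law f0) = 0) \<or> (\<exists>(\<mu>::real measure) Y b. bounded_rv \<mu> Y b \<and>
      (\<forall>\<theta>. (\<integral>x. exp (\<theta> * (z \<bullet> \<psi> x)) \<partial>law f0) = bounded_rv.mgf \<mu> Y \<theta>))" for z
      by (intro disjI2 exI conjI allI, rule law_rv[of z], simp add: bounded_rv.mgf_def[OF law_rv[of z]])
  qed
  then show ?thesis by (simp add: theta_fun_eq[abs_def] exp_root_def)
qed

text \<open>Adding f0 - f1 to the integrand leaves the integral unchanged and makes it pointwise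
  nonnegative, with zeros only where the densities agree. Equal densities almost everywhere would
  give equal means, against \<open>Y_nonzero\<close>.\<close>

lemma KL_pos:
  assumes "KL_finite f1 f0"
  shows "KL f1 f0 > 0"
proof -
  have m[measurable]: "f0 \<in> borel_measurable borel" "f1 \<in> borel_measurable borel"
    and nn: "\<And>x. 0 \<le> f0 x" "\<And>x. 0 \<le> f1 x"
    using dens0 dens1 by (auto simp: is_density_def)
  have i: "integrable lborel f \<and> integral\<^sup>L lborel f = 1" if "is_density f" for f
  proof -
    have "has_bochner_integral lborel f 1"
      using that unfolding is_density_def by (intro has_bochner_integral_nn_integral) auto
    then show ?thesis by (simp add: has_bochner_integral_iff)
  qed
  let ?g = "\<lambda>x. f1 x * ln (f1 x / f0 x) - f1 x + f0 x"
  have g: "0 \<le> ?g x \<and> (?g x = 0 \<longrightarrow> f1 x = f0 x)" for x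
  proof (cases "f1 x = 0")
    case True
    then show ?thesis using nn by auto
  next
    case False
    then have p: "0 < f1 x" "0 < f0 x"
      using nn moments by (auto simp: moment_assumption_def less_le)
    define r where "r = f0 x / f1 x"
    have r: "r > 0" using p by (simp add: r_def)
    have "ln (f1 x / f0 x) = - ln r" using p by (simp add: r_def ln_div)
    then have eq: "?g x = f1 x * (r - 1 - ln r)" using p by (simp add: r_def field_simps)
    have "ln r \<le> r - 1" using r by (rule ln_le_minus_one)
    moreover have "r = 1" if "ln r = r - 1" using r that by (rule ln_eq_minus_one)
    ultimately show ?thesis unfolding eq using p by (auto simp: r_def)
  qed
  have int: "integrable lborel ?g" and eq: "integral\<^sup>L lborel ?g = KL f1 f0"
    using assms i[OF dens0] i[OF dens1] by (auto simp: KL_finite_def KL_def)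
  have "KL f1 f0 \<noteq> 0"
  proof
    assume "KL f1 f0 = 0"
    then have "AE x in lborel. ?g x = 0"
      using integral_nonneg_eq_0_iff_AE[OF int] g eq by simp
    then have "AE x in lborel. f1 x = f0 x" by eventually_elim (use g in blast)
    then have "law f1 = law f0" unfolding law_def by (intro density_cong) auto
    then show False using Y_nonzero by (simp add: expct_def)
  qed
  moreover have "0 \<le> integral\<^sup>L lborel ?g" using g by (intro Bochner_Integration.integral_nonneg) simp
  ultimately show ?thesis unfolding eq by simp
qed

definition w1 :: "('s, unit) jvec" where "w1 = pair u1 1"

lemma efficiency_eq: "efficiency f0 f1 \<phi> z = theta_fun f0 \<phi> z * (w1 \<bullet> z) / KL f1 f0"
proof -
  have "expct f1 (\<lambda>x. part2 z $ () + part1 z \<bullet> \<phi> x) = expct f1 (\<lambda>x. z \<bullet> \<psi> x)"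
    by (simp add: inner_\<psi>)
  also have "\<dots> = z \<bullet> expct f1 \<psi>" by (rule expct_inner[OF dens1 \<psi>_bm])
  also have "expct f1 \<psi> = w1"
  proof -
    have p: "bounded_linear (part1 :: ('s, unit) jvec \<Rightarrow> _)" "bounded_linear (\<lambda>z::('s, unit) jvec. part2 z $ ())"
      by (rule bounded_linear_part1) (rule bounded_linear_compose[OF bounded_linear_vec_nth bounded_linear_part2])
    have "part1 (expct f1 \<psi>) = u1" "part2 (expct f1 \<psi>) $ () = 1"
      using expct_linear[OF dens1 \<psi>_bm p(1)] expct_linear[OF dens1 \<psi>_bm p(2)] expct_const[OF dens1, of "1::real"]
      by (simp_all add: \<psi>_def)
    then show ?thesis unfolding w1_def by (subst pair_eta[symmetric]) (simp only:)
  qed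
  finally show ?thesis by (simp add: efficiency_def inner_commute)
qed

lemma w1_z0: "w1 \<bullet> z0 = expct f1 \<Lambda>"
proof -
  have "w1 \<bullet> z0 = K \<bullet> u1 + k0" by (simp add: w1_def inner_pair inner_commute)
  then show ?thesis unfolding expct_Lam using k0_eq J_diff by argo
qed

lemma efficiency_measurable[measurable]: "efficiency f0 f1 \<phi> \<in> borel_measurable borel"
  unfolding efficiency_eq[abs_def] by measurable

lemma grad_e_eq: "grad_e f0 f1 \<phi> = (\<theta>0 / KL f1 f0) *\<^sub>R (w1 - (expct f1 \<Lambda> / tE) *\<^sub>R pair tphi 1)"
  by (simp add: grad_e_def w1_def)

text \<open>The numerator is a product of the root and a linear form. Its product-rule remainder is
  the quadratic remainder of the root times \<open>w1 \<bullet> z0\<close>, plus the increment of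
  the root times the increment of the linear form; both are of second order.\<close>

lemma efficiency_expansion:
  "\<exists>C>0. \<exists>e>0. \<forall>z. norm (z - z0) < e \<longrightarrow>
    \<bar>efficiency f0 f1 \<phi> z - efficiency f0 f1 \<phi> z0 - grad_e f0 f1 \<phi> \<bullet> (z - z0)\<bar> \<le> C * (norm (z - z0))\<^sup>2"
proof -
  obtain C e where C: "C > 0" and e: "e > 0" and exp: "\<And>z. norm (z - z0) < e \<Longrightarrow>
    \<bar>theta_fun f0 \<phi> z - \<theta>0\<bar> \<le> C * norm (z - z0) \<and>
    \<bar>theta_fun f0 \<phi> z - \<theta>0 - dtheta f0 f1 \<phi> \<bullet> (z - z0)\<bar> \<le> C * (norm (z - z0))\<^sup>2"
    using theta_fun_expansion by blast
  define A where "A = (C * \<bar>w1 \<bullet> z0\<bar> + C * norm w1) / \<bar>KL f1 f0\<bar> + 1"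
  have "\<bar>efficiency f0 f1 \<phi> z - efficiency f0 f1 \<phi> z0 - grad_e f0 f1 \<phi> \<bullet> (z - z0)\<bar> \<le> A * (norm (z - z0))\<^sup>2"
    if z: "norm (z - z0) < e" for z
  proof -
    define t d where "t = theta_fun f0 \<phi> z - \<theta>0" and "d = z - z0"
    have zd: "z = z0 + d" and td: "theta_fun f0 \<phi> z = \<theta>0 + t" by (simp_all add: d_def t_def)
    have eq: "efficiency f0 f1 \<phi> z - efficiency f0 f1 \<phi> z0 - grad_e f0 f1 \<phi> \<bullet> d
      = ((t - dtheta f0 f1 \<phi> \<bullet> d) * (w1 \<bullet> z0) + t * (w1 \<bullet> d)) / KL f1 f0"
      unfolding efficiency_eq theta_fun_z0 td grad_e_eq dtheta_eq w1_z0[symmetric] unfolding zd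
      by (simp add: inner_add_right inner_diff_left add_divide_distrib diff_divide_distrib algebra_simps)
    have "\<bar>(t - dtheta f0 f1 \<phi> \<bullet> d) * (w1 \<bullet> z0)\<bar> \<le> (C * (norm d)\<^sup>2) * \<bar>w1 \<bullet> z0\<bar>"
      unfolding abs_mult using exp[OF z] by (intro mult_right_mono) (auto simp: t_def d_def)
    moreover have "\<bar>t * (w1 \<bullet> d)\<bar> \<le> (C * norm d) * (norm w1 * norm d)"
      unfolding abs_mult using exp[OF z] Cauchy_Schwarz_ineq2[of w1 d] C
      by (intro mult_mono) (auto simp: t_def d_def)
    ultimately have "\<bar>(t - dtheta f0 f1 \<phi> \<bullet> d) * (w1 \<bullet> z0) + t * (w1 \<bullet> d)\<bar>
      \<le> (C * \<bar>w1 \<bullet> z0\<bar> + C * norm w1) * (norm d)\<^sup>2"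
      by (simp add: algebra_simps power2_eq_square abs_le_iff)
    then have "\<bar>efficiency f0 f1 \<phi> z - efficiency f0 f1 \<phi> z0 - grad_e f0 f1 \<phi> \<bullet> d\<bar>
      \<le> (C * \<bar>w1 \<bullet> z0\<bar> + C * norm w1) * (norm d)\<^sup>2 / \<bar>KL f1 f0\<bar>"
      unfolding eq abs_divide by (rule divide_right_mono) simp
    also have "\<dots> \<le> A * (norm d)\<^sup>2" by (simp add: A_def algebra_simps)
    finally show ?thesis by (simp add: d_def)
  qed
  moreover have "A > 0" unfolding A_def using C by (intro add_nonneg_pos divide_nonneg_nonneg) auto
  ultimately show ?thesis using e by blast
qed

lemma efficiency_GDERIV: "GDERIV (efficiency f0 f1 \<phi>) z0 :> grad_e f0 f1 \<phi>"
  using efficiency_expansion by (auto intro: GDERIV_quadraticI)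

text \<open>The offset coordinate of the vector equation forces the ratio of the two means of the
  score to be 1; the remaining coordinates then say that the dictionary means agree.\<close>

lemma grad_e_eq_0_iff:
  assumes "KL_finite f1 f0"
  shows "grad_e f0 f1 \<phi> = 0 \<longleftrightarrow> tphi = u1 \<and> tE = expct f1 \<Lambda>"
proof -
  have "grad_e f0 f1 \<phi> = 0 \<longleftrightarrow> w1 = (expct f1 \<Lambda> / tE) *\<^sub>R pair tphi 1"
    using theta0(1) KL_pos[OF assms] by (simp add: grad_e_eq)
  also have "\<dots> \<longleftrightarrow> u1 = (expct f1 \<Lambda> / tE) *\<^sub>R tphi \<and> 1 = expct f1 \<Lambda> / tE"
    by (simp add: w1_def pair_linear)
  also have "\<dots> \<longleftrightarrow> tphi = u1 \<and> tE = expct f1 \<Lambda>"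
    using tE_pos by (auto simp: field_simps)
  finally show ?thesis .
qed

text \<open>The tilt weight equals f1 / f0, so tilting turns \<open>f0\<close> into
  \<open>f1\<close>; where \<open>f0\<close> vanishes \<open>f1\<close> does too. Positivity of
  \<open>f1\<close> is part of the hypothesis because \<open>ln 0 = 0\<close> would otherwise pass
  for a finite log ratio.\<close>

lemma tilt_log_ratio:
  fixes h :: "real \<Rightarrow> 'b::euclidean_space"
  assumes ae: "AE x in law f0. 0 < f1 x \<and> \<theta>0 * \<Lambda> x = ln (f1 x / f0 x)" and h: "bm h"
  shows "tilt_expct f0 f1 \<phi> h = expct f1 h"
proof -
  have m[measurable]: "f0 \<in> borel_measurable borel" "f1 \<in> borel_measurable borel"
    and nn: "\<And>x. 0 \<le> f0 x" "\<And>x. 0 \<le> f1 x"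
    using dens0 dens1 by (auto simp: is_density_def)
  have [measurable]: "\<Lambda> \<in> borel_measurable borel" "h \<in> borel_measurable borel"
    using bm_measurable[OF Lam_bm] bm_measurable[OF h] by auto
  have "AE x in lborel. 0 < f0 x \<longrightarrow> 0 < f1 x \<and> \<theta>0 * \<Lambda> x = ln (f1 x / f0 x)"
    using ae unfolding law_def by (subst (asm) AE_density) auto
  then have e: "AE x in lborel. f0 x *\<^sub>R (exp (\<theta>0 * \<Lambda> x) *\<^sub>R h x) = f1 x *\<^sub>R h x"
  proof eventually_elim
    case (elim x)
    show ?case
    proof (cases "f0 x = 0")
      case True
      then show ?thesis using moments by (simp add: moment_assumption_def)
    next
      case False
      then have p: "0 < f0 x" using nn(1)[of x] by simp
      with elim show ?thesis by (simp add: exp_ln)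
    qed
  qed
  have "tilt_expct f0 f1 \<phi> h = (\<integral>x. f0 x *\<^sub>R (exp (\<theta>0 * \<Lambda> x) *\<^sub>R h x) \<partial>lborel)"
    unfolding tilt_expct_def expct_def law_def using nn by (subst integral_density) auto
  also have "\<dots> = (\<integral>x. f1 x *\<^sub>R h x \<partial>lborel)"
    by (rule integral_cong_AE) (use e in auto)
  also have "\<dots> = expct f1 h"
    unfolding expct_def law_def using nn by (subst integral_density) auto
  finally show ?thesis .
qed

lemma grad_e_log_ratio:
  assumes "KL_finite f1 f0" "AE x in law f0. 0 < f1 x \<and> \<theta>0 * \<Lambda> x = ln (f1 x / f0 x)"
  shows "grad_e f0 f1 \<phi> = 0"
  using grad_e_eq_0_iff[OF assms(1)] tilt_log_ratio[OF assms(2) \<phi>_bm] tilt_log_ratio[OF assms(2) Lam_bm] by simp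

end

subsection \<open>Sample moments\<close>

lemma outer_norm: "norm (outer a b) = norm a * norm (b :: real^'n)" for a :: "real^'m"
proof -
  have "outer a b $ i = a $ i *\<^sub>R b" for i by (simp add: vec_eq_iff)
  then show ?thesis
    by (simp add: norm_vec_def[of "outer a b"] norm_vec_def[of a] L2_set_left_distrib)
qed

lemma borel_measurable_outer[measurable (raw)]:
  fixes g :: "'a \<Rightarrow> real^'m" and h :: "'a \<Rightarrow> real^'n"
  assumes "g \<in> borel_measurable M" "h \<in> borel_measurable M"
  shows "(\<lambda>x. outer (g x) (h x)) \<in> borel_measurable M"
proof (rule borel_measurable_continuous_Pair[OF assms])
  show "continuous_on UNIV (\<lambda>x. outer (fst x :: real^'m) (snd x :: real^'n))"
    unfolding outer_def by (intro continuous_intros)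
qed

lemma tendsto_join:
  fixes f :: "'a \<Rightarrow> real^'m" and g :: "'a \<Rightarrow> real^'n"
  assumes "(f \<longlongrightarrow> x) F" "(g \<longlongrightarrow> y) F"
  shows "((\<lambda>i. join (f i) (g i)) \<longlongrightarrow> join x y) F"
  using tendsto_add[OF bounded_linear.tendsto[OF bounded_linear_join1 assms(1)]
      bounded_linear.tendsto[OF bounded_linear_join2 assms(2)]]
  by (simp add: join_linear)

lemma sum_outer_centered:
  fixes v :: "nat \<Rightarrow> real^'n"
  assumes "N > 0"
  defines "m \<equiv> (1 / real N) *\<^sub>R (\<Sum>j<N. v j)"
  shows "(\<Sum>j<N. outer (v j - m) (v j - m)) = (\<Sum>j<N. outer (v j) (v j)) - real N *\<^sub>R outer m m"
proof -
  have s: "(\<Sum>j<N. v j $ i) = real N * m $ i" for i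
    using assms(1) by (simp add: m_def)
  have "(\<Sum>j<N. (v j $ i - m $ i) * (v j $ k - m $ k)) = (\<Sum>j<N. v j $ i * v j $ k) - real N * (m $ i * m $ k)" for i k
  proof -
    have "(\<Sum>j<N. (v j $ i - m $ i) * (v j $ k - m $ k))
      = (\<Sum>j<N. v j $ i * v j $ k) - m $ k * (\<Sum>j<N. v j $ i) - m $ i * (\<Sum>j<N. v j $ k) + real N * (m $ i * m $ k)"
      by (simp add: left_diff_distrib right_diff_distrib sum_subtractf sum.distrib sum_distrib_left sum_distrib_right mult_ac)
    then show ?thesis unfolding s by (simp add: algebra_simps)
  qed
  then show ?thesis by (simp add: vec_eq_iff)
qed

lemma sample_cov_sym: "sample_cov \<delta> \<phi> x N $ i $ j = sample_cov \<delta> \<phi> x N $ j $ i"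
  by (simp add: sample_cov_def mult.commute)

lemma norm_mom_le: "\<exists>c>0. \<forall>D. norm (mom (0::real^('s::{finite,linorder})) D) \<le> c * norm D"
proof -
  have "bounded_linear (\<lambda>D. mom (0::real^('s::{finite,linorder})) D)"
    unfolding mom_def by (rule bounded_linear_compose[OF bounded_linear_join2 bounded_linear_vech])
  from bounded_linear.pos_bounded[OF this] show ?thesis by (auto simp: mult.commute)
qed

context bounded_iid
begin

lemma sample_mean_AE:
  fixes h :: "real \<Rightarrow> real^'n"
  assumes h: "bm h"
  shows "AE \<omega> in M. (\<lambda>N. (1 / real N) *\<^sub>R (\<Sum>j<N. h (X j \<omega>))) \<longlonglongrightarrow> expct f h"
proof -
  have "AE \<omega> in M. (\<lambda>N. (1 / real N) * (\<Sum>j<N. h (X j \<omega>) $ i)) \<longlonglongrightarrow> expct f h $ i" for i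
  proof -
    obtain B where "\<And>x. norm (h x $ i) \<le> B" using bm_bound[OF bm_nth[OF h]] by blast
    then show ?thesis
      unfolding expct_nth[OF dens h] using bm_measurable[OF bm_nth[OF h]] by (intro sample_mean_AE_real) auto
  qed
  then have "AE \<omega> in M. \<forall>i. (\<lambda>N. (1 / real N) * (\<Sum>j<N. h (X j \<omega>) $ i)) \<longlonglongrightarrow> expct f h $ i"
    by (simp add: AE_all_countable)
  then show ?thesis
    by eventually_elim (auto intro!: vec_tendstoI)
qed

definition vec_sum :: "(real \<Rightarrow> real^'n) \<Rightarrow> nat \<Rightarrow> 'a \<Rightarrow> real^'n" where
  "vec_sum Z N \<omega> = (1 / sqrt (real N)) *\<^sub>R (\<Sum>j<N. Z (X j \<omega>))"

lemma vec_sum_measurable[measurable]: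
  assumes [measurable]: "Z \<in> borel_measurable borel"
  shows "vec_sum Z N \<in> borel_measurable M"
  unfolding vec_sum_def by measurable

lemma vec_sum_inner: "a \<bullet> vec_sum Z N \<omega> = scaled_sum (\<lambda>x. a \<bullet> Z x) N \<omega>"
  by (simp add: vec_sum_def scaled_sum_def inner_sum_right)

lemma vec_sum_asymp_normal:
  assumes Z: "bm Z" "expct f Z = 0"
  shows "asymp_normal M (\<lambda>N \<omega>. a \<bullet> vec_sum Z N \<omega>) (a \<bullet> (cov f Z *v a))"
proof -
  obtain B where "\<And>x. norm (a \<bullet> Z x) \<le> B" using bm_bound[OF bm_inner[OF Z(1)]] by blast
  then have "asymp_normal M (scaled_sum (\<lambda>x. a \<bullet> Z x)) (expct f (\<lambda>x. (a \<bullet> Z x)\<^sup>2))"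
    using bm_measurable[OF bm_inner[OF Z(1)]] expct_inner[OF dens Z(1), of a] Z(2)
    by (intro scaled_sum_asymp_normal) auto
  then show ?thesis
    unfolding cov_quadratic[OF dens Z(1)] Z(2) vec_sum_inner[abs_def] by simp
qed

lemma vec_sum_Op1:
  assumes Z: "bm Z" "expct f Z = 0"
  shows "Op1 M (\<lambda>N \<omega>. norm (vec_sum Z N \<omega>))"
proof -
  note [measurable] = bm_measurable[OF Z(1)]
  have "Op1 M (\<lambda>N \<omega>. \<Sum>i\<in>UNIV. \<bar>axis i 1 \<bullet> vec_sum Z N \<omega>\<bar>)"
    by (intro Op1_sum asymp_normal_Op1[OF vec_sum_asymp_normal[OF Z]] cov_psd[OF dens Z(1)]) simp
  then show ?thesis
    by (rule Op1_bound[where C=1, rotated]) (auto simp: inner_axis' intro!: order_trans[OF norm_le_l1_cart])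
qed

lemma vec_sum_mean: "sqrt (real N) *\<^sub>R ((1 / real N) *\<^sub>R (\<Sum>j<N. Z (X j \<omega>))) = vec_sum Z N \<omega>"
proof -
  have "sqrt (real N) * (1 / real N) = 1 / sqrt (real N)"
    by (cases "N = 0") (simp_all add: divide_eq_eq eq_divide_eq)
  then show ?thesis by (simp only: vec_sum_def scaleR_scaleR)
qed

definition mom_hat :: "nat \<Rightarrow> (real \<Rightarrow> real^('s::{finite,linorder})) \<Rightarrow> nat \<Rightarrow> 'a \<Rightarrow> 's moments" where
  "mom_hat \<delta> \<phi> N \<omega> = mom (sample_mean \<phi> (\<lambda>j. X j \<omega>) N) (sample_cov \<delta> \<phi> (\<lambda>j. X j \<omega>) N)"

lemma sample_mean_measurable[measurable]:
  assumes [measurable]: "\<phi> \<in> borel_measurable borel"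
  shows "(\<lambda>\<omega>. sample_mean \<phi> (\<lambda>j. X j \<omega>) N) \<in> borel_measurable M"
  unfolding sample_mean_def by measurable

lemma sample_cov_measurable[measurable]:
  assumes [measurable]: "\<phi> \<in> borel_measurable borel"
  shows "(\<lambda>\<omega>. sample_cov \<delta> \<phi> (\<lambda>j. X j \<omega>) N) \<in> borel_measurable M"
  unfolding sample_cov_def by measurable

lemma mom_hat_measurable[measurable]:
  fixes \<phi> :: "real \<Rightarrow> real^('s::{finite,linorder})"
  assumes [measurable]: "\<phi> \<in> borel_measurable borel"
  shows "mom_hat \<delta> \<phi> N \<in> borel_measurable M"
  unfolding mom_hat_def mom_def
  by (intro borel_measurable_join borel_measurable_linear[OF bounded_linear_vech] sample_mean_measurable sample_cov_measurable assms)

text \<open>Recentring at a fixed vector \<open>u\<close>. For \<open>u\<close> the population mean,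
  the first term is a sample mean of i.i.d. matrices and the second is quadratic in the error of the
  mean, hence negligible after scaling by sqrt N.\<close>

lemma sample_cov_eq:
  fixes \<phi> :: "real \<Rightarrow> real^'s"
  assumes "N > 0"
  shows "sample_cov \<delta> \<phi> x N = (real N / (real N - real \<delta>)) *\<^sub>R
    ((1 / real N) *\<^sub>R (\<Sum>j<N. outer (\<phi> (x j) - u) (\<phi> (x j) - u))
     - outer (sample_mean \<phi> x N - u) (sample_mean \<phi> x N - u))"
proof -
  have m: "(1 / real N) *\<^sub>R (\<Sum>j<N. \<phi> (x j) - u) = sample_mean \<phi> x N - u"
    using assms by (simp add: sample_mean_def sum_subtractf scaleR_diff_right sum_constant_scaleR del: sum_constant)
  show ?thesis
    using sum_outer_centered[OF assms, of "\<lambda>j. \<phi> (x j) - u"] assms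
    by (simp add: m sample_cov_def scaleR_diff_right)
qed

lemma mom_hat_AE:
  fixes \<phi> :: "real \<Rightarrow> real^('s::{finite,linorder})"
  assumes \<phi>: "bm \<phi>"
  shows "AE \<omega> in M. (\<lambda>N. mom_hat \<delta> \<phi> N \<omega>) \<longlonglongrightarrow> eta f \<phi>"
proof -
  let ?u = "expct f \<phi>"
  let ?O = "\<lambda>x. outer (\<phi> x - ?u) (\<phi> x - ?u)"
  have bO: "bm ?O" by (intro bm_intros \<phi>)
  have O: "AE \<omega> in M. \<forall>i k. (\<lambda>N. (1 / real N) * (\<Sum>j<N. ?O (X j \<omega>) $ i $ k)) \<longlonglongrightarrow> cov f \<phi> $ i $ k"
  proof -
    have "AE \<omega> in M. (\<lambda>N. (1 / real N) * (\<Sum>j<N. ?O (X j \<omega>) $ i $ k)) \<longlonglongrightarrow> cov f \<phi> $ i $ k" for i k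
    proof -
      have bik: "bm (\<lambda>x. ?O x $ i $ k)" by (intro bm_nth bO)
      obtain B where "\<And>x. norm (?O x $ i $ k) \<le> B" using bm_bound[OF bik] by blast
      from sample_mean_AE_real[OF bm_measurable[OF bik], of B] this show ?thesis
        by (simp add: cov_nth[OF dens \<phi>])
    qed
    then show ?thesis by (simp add: AE_all_countable)
  qed
  show ?thesis
    using sample_mean_AE[OF \<phi>] O
  proof eventually_elim
    case (elim \<omega>)
    have mean: "(\<lambda>N. sample_mean \<phi> (\<lambda>j. X j \<omega>) N) \<longlonglongrightarrow> ?u"
      using elim(1) by (simp add: sample_mean_def)
    have r: "(\<lambda>N. real N / (real N - real \<delta>)) \<longlonglongrightarrow> 1" by real_asymp
    have "(\<lambda>N. (real N / (real N - real \<delta>)) *\<^sub>R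
       ((1 / real N) *\<^sub>R (\<Sum>j<N. ?O (X j \<omega>)) - outer (sample_mean \<phi> (\<lambda>j. X j \<omega>) N - ?u) (sample_mean \<phi> (\<lambda>j. X j \<omega>) N - ?u)))
       \<longlonglongrightarrow> 1 *\<^sub>R (cov f \<phi> - outer (?u - ?u) (?u - ?u))"
    proof (intro tendsto_scaleR r tendsto_diff)
      show "(\<lambda>N. (1 / real N) *\<^sub>R (\<Sum>j<N. ?O (X j \<omega>))) \<longlonglongrightarrow> cov f \<phi>"
        using elim(2) by (intro vec_tendstoI) simp
      show "(\<lambda>N. outer (sample_mean \<phi> (\<lambda>j. X j \<omega>) N - ?u) (sample_mean \<phi> (\<lambda>j. X j \<omega>) N - ?u)) \<longlonglongrightarrow> outer (?u - ?u) (?u - ?u)"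
        unfolding outer_def using mean by (intro tendsto_intros)
    qed
    also have "1 *\<^sub>R (cov f \<phi> - outer (?u - ?u) (?u - ?u)) = cov f \<phi>" by (simp add: vec_eq_iff)
    finally have "(\<lambda>N. sample_cov \<delta> \<phi> (\<lambda>j. X j \<omega>) N) \<longlonglongrightarrow> cov f \<phi>"
      by (rule Lim_transform_eventually)
         (use eventually_gt_at_top[of 0] in \<open>eventually_elim, simp add: sample_cov_eq[of _ \<delta> \<phi> _ ?u]\<close>)
    with mean show ?case
      unfolding mom_hat_def eta_def mom_def
      by (intro tendsto_join bounded_linear.tendsto[OF bounded_linear_vech])
  qed
qed

text \<open>The mean block is linearised without error. In the covariance block two errors occur:
  the divisor, of relative order 1 / N, and the squared error of the mean. After scaling, the latter
  is an almost surely null sequence times the tight sequence \<open>W\<close>.\<close>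

lemma mom_hat_linearization:
  fixes \<phi> :: "real \<Rightarrow> real^('s::{finite,linorder})"
  assumes \<phi>: "bm \<phi>" and \<delta>: "\<delta> \<in> {0, 1}"
  shows "op1 M (\<lambda>N \<omega>. norm (sqrt (real N) *\<^sub>R (mom_hat \<delta> \<phi> N \<omega> - eta f \<phi>) - vec_sum (Zc f \<phi>) N \<omega>))"
proof -
  let ?u = "expct f \<phi>"
  let ?O = "\<lambda>x. outer (\<phi> x - ?u) (\<phi> x - ?u)"
  have bO: "bm ?O" by (intro bm_intros \<phi>)
  note [measurable] = bm_measurable[OF \<phi>] bm_measurable[OF Zc_bm[OF \<phi>]]
  obtain B where B: "\<And>x. norm (?O x) \<le> B" using bm_bound[OF bO] by blast
  have B0: "0 \<le> B" using order_trans[OF norm_ge_zero B] .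
  have bc: "bm (\<lambda>x. \<phi> x - ?u)" by (intro bm_intros \<phi>)
  have mc: "expct f (\<lambda>x. \<phi> x - ?u) = 0"
    using \<phi> by (simp add: expct_add bm_const expct_const dens)
  obtain B' where B': "\<And>x. norm (\<phi> x - ?u) \<le> B'" using bm_bound[OF bc] by blast
  have B'0: "0 \<le> B'" using order_trans[OF norm_ge_zero B'] .
  obtain c where c: "c > 0" "\<And>D. norm (mom (0::real^('s::{finite,linorder})) D) \<le> c * norm D"
    using norm_mom_le by blast
  have [measurable]: "mom_hat \<delta> \<phi> N \<in> borel_measurable M" "vec_sum (Zc f \<phi>) N \<in> borel_measurable M" for N
    by (rule mom_hat_measurable, measurable)
  define ut where "ut N \<omega> = sample_mean \<phi> (\<lambda>j. X j \<omega>) N - ?u" for N \<omega>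
  have ut_meas[measurable]: "ut N \<in> borel_measurable M" for N unfolding ut_def by measurable
  have ut_mean: "(1 / real N) *\<^sub>R (\<Sum>j<N. \<phi> (X j \<omega>) - ?u) = ut N \<omega>" if "N > 0" for N \<omega>
    using that by (simp add: ut_def sample_mean_def sum_subtractf scaleR_diff_right sum_constant_scaleR del: sum_constant)
  define W where "W = vec_sum (\<lambda>x. \<phi> x - ?u)"
  show ?thesis
  proof (rule op1_bound_by_product)
    show "(\<lambda>\<omega>. norm (sqrt (real N) *\<^sub>R (mom_hat \<delta> \<phi> N \<omega> - eta f \<phi>) - vec_sum (Zc f \<phi>) N \<omega>)) \<in> borel_measurable M" for N
      by measurable
    show "op1 M (\<lambda>N \<omega>. 1 / sqrt (real N) + norm (ut N \<omega>))"
    proof (rule op1_AE)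
      show "AE \<omega> in M. (\<lambda>N. 1 / sqrt (real N) + norm (ut N \<omega>)) \<longlonglongrightarrow> 0"
        using sample_mean_AE[OF \<phi>]
      proof eventually_elim
        case (elim \<omega>)
        have "(\<lambda>N. ut N \<omega>) \<longlonglongrightarrow> 0"
          unfolding ut_def sample_mean_def using tendsto_diff[OF elim tendsto_const[of ?u]] by simp
        then have "(\<lambda>N. norm (ut N \<omega>)) \<longlonglongrightarrow> 0" by (rule tendsto_norm_zero)
        moreover have "(\<lambda>N. 1 / sqrt (real N)) \<longlonglongrightarrow> 0" by real_asymp
        ultimately show ?case using tendsto_add[of "\<lambda>N. 1 / sqrt (real N)" 0 sequentially "\<lambda>N. norm (ut N \<omega>)" 0] by simp
      qed
    qed measurable
    have "Op1 M (\<lambda>N \<omega>. \<bar>2 * c * (B + B'\<^sup>2)\<bar> + \<bar>c * norm (W N \<omega>)\<bar>)"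
    proof (intro Op1_add Op1_const)
      show "Op1 M (\<lambda>N \<omega>. c * norm (W N \<omega>))"
        by (rule Op1_bound[OF _ vec_sum_Op1[OF bc mc], where C=c]) (use c in \<open>auto simp: W_def\<close>)
    qed
    then show "Op1 M (\<lambda>N \<omega>. 2 * c * (B + B'\<^sup>2) + c * norm (W N \<omega>))"
      using c B0 by (simp add: abs_mult)
    show "AE \<omega> in M. \<forall>\<^sub>F N in sequentially.
       \<bar>norm (sqrt (real N) *\<^sub>R (mom_hat \<delta> \<phi> N \<omega> - eta f \<phi>) - vec_sum (Zc f \<phi>) N \<omega>)\<bar>
       \<le> \<bar>1 / sqrt (real N) + norm (ut N \<omega>)\<bar> * \<bar>2 * c * (B + B'\<^sup>2) + c * norm (W N \<omega>)\<bar>"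
    proof (intro AE_I2)
      fix \<omega>
      show "\<forall>\<^sub>F N in sequentially.
       \<bar>norm (sqrt (real N) *\<^sub>R (mom_hat \<delta> \<phi> N \<omega> - eta f \<phi>) - vec_sum (Zc f \<phi>) N \<omega>)\<bar>
       \<le> \<bar>1 / sqrt (real N) + norm (ut N \<omega>)\<bar> * \<bar>2 * c * (B + B'\<^sup>2) + c * norm (W N \<omega>)\<bar>"
        using eventually_ge_at_top[of 2]
      proof eventually_elim
        case (elim N)
        then have N: "N > 0" "2 \<le> N" by auto
        define Mo where "Mo = (1 / real N) *\<^sub>R (\<Sum>j<N. ?O (X j \<omega>))"
        define r where "r = real N / (real N - real \<delta>)"
        define D where "D = (r - 1) *\<^sub>R (Mo - outer (ut N \<omega>) (ut N \<omega>)) - outer (ut N \<omega>) (ut N \<omega>)"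
        \<comment> \<open>For divisor N - 1 the excess is 1 / (N - 1), which is at most 2 / N
          exactly from N = 2 on.\<close>
        have r: "0 \<le> r - 1" "r - 1 \<le> 2 / real N" using N \<delta> by (auto simp: r_def field_simps)
        have cov: "sample_cov \<delta> \<phi> (\<lambda>j. X j \<omega>) N = r *\<^sub>R (Mo - outer (ut N \<omega>) (ut N \<omega>))"
          unfolding sample_cov_eq[OF N(1), of \<delta> \<phi> _ ?u] by (simp add: r_def Mo_def ut_def)
        have Mo: "norm Mo \<le> B"
        proof -
          have "norm (\<Sum>j<N. ?O (X j \<omega>)) \<le> (\<Sum>j<N. B)" by (intro sum_norm_le B)
          then show ?thesis using N by (simp add: Mo_def divide_le_eq mult.commute)
        qed
        have utB: "norm (ut N \<omega>) \<le> B'"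
        proof -
          have "norm (\<Sum>j<N. \<phi> (X j \<omega>) - ?u) \<le> (\<Sum>j<N. B')" by (intro sum_norm_le B')
          then show ?thesis using N by (simp add: ut_mean[OF N(1), symmetric] divide_le_eq mult.commute)
        qed
        have W: "W N \<omega> = sqrt (real N) *\<^sub>R ut N \<omega>"
          unfolding W_def vec_sum_mean[symmetric] ut_mean[OF N(1)] ..
        have Zm: "(1 / real N) *\<^sub>R (\<Sum>j<N. Zc f \<phi> (X j \<omega>)) = mom (ut N \<omega>) (Mo - cov f \<phi>)"
        proof -
          have s: "(\<Sum>j<N. mom (a j) (A j)) = mom (\<Sum>j<N. a j) (\<Sum>j<N. A j)" for a :: "nat \<Rightarrow> real^('s::{finite,linorder})" and A
            by (induction N) (simp_all add: mom_linear, simp add: mom_def vech_def jvec_eq_iff vec_eq_iff)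
          have "(\<Sum>j<N. Zc f \<phi> (X j \<omega>)) = mom (\<Sum>j<N. \<phi> (X j \<omega>) - ?u) (\<Sum>j<N. ?O (X j \<omega>) - cov f \<phi>)"
            unfolding Zc_def s ..
          also have "(1 / real N) *\<^sub>R \<dots> = mom (ut N \<omega>) (Mo - cov f \<phi>)"
            unfolding mom_linear ut_mean[OF N(1)] using N
            by (simp add: Mo_def sum_subtractf scaleR_diff_right sum_constant_scaleR del: sum_constant)
          finally show ?thesis .
        qed
        have "sqrt (real N) *\<^sub>R (mom_hat \<delta> \<phi> N \<omega> - eta f \<phi>) - vec_sum (Zc f \<phi>) N \<omega>
          = sqrt (real N) *\<^sub>R mom 0 D"
          unfolding vec_sum_mean[symmetric] Zm mom_hat_def eta_def cov mom_linear scaleR_diff_right[symmetric]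
          by (simp add: ut_def[symmetric] D_def scaleR_diff_left algebra_simps)
        then have "norm (sqrt (real N) *\<^sub>R (mom_hat \<delta> \<phi> N \<omega> - eta f \<phi>) - vec_sum (Zc f \<phi>) N \<omega>)
          = sqrt (real N) * norm (mom (0::real^('s::{finite,linorder})) D)" by simp
        also have "\<dots> \<le> sqrt (real N) * (c * norm D)" by (intro mult_left_mono c) simp
        also have "\<dots> \<le> sqrt (real N) * (c * ((2 / real N) * (B + B'\<^sup>2) + (norm (ut N \<omega>))\<^sup>2))"
        proof (intro mult_left_mono)
          have "norm (Mo - outer (ut N \<omega>) (ut N \<omega>)) \<le> B + B'\<^sup>2"
            using norm_triangle_ineq4[of Mo "outer (ut N \<omega>) (ut N \<omega>)"] Mo power_mono[OF utB, of 2]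
            by (simp add: outer_norm power2_eq_square)
          then have "(r - 1) * norm (Mo - outer (ut N \<omega>) (ut N \<omega>)) \<le> (2 / real N) * (B + B'\<^sup>2)"
            using r by (intro mult_mono) auto
          moreover have "norm D \<le> (r - 1) * norm (Mo - outer (ut N \<omega>) (ut N \<omega>)) + (norm (ut N \<omega>))\<^sup>2"
            unfolding D_def using norm_triangle_ineq4[of "(r - 1) *\<^sub>R (Mo - outer (ut N \<omega>) (ut N \<omega>))" "outer (ut N \<omega>) (ut N \<omega>)"] r
            by (simp add: outer_norm power2_eq_square)
          ultimately show "norm D \<le> (2 / real N) * (B + B'\<^sup>2) + (norm (ut N \<omega>))\<^sup>2" by linarith
        qed (use c in auto)
        \<comment> \<open>One factor sqrt N is spent on turning \<open>ut\<close> into the tight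
          variable \<open>W\<close>, so that a null factor remains in each summand.\<close>
        also have "\<dots> = 1 / sqrt (real N) * (2 * c * (B + B'\<^sup>2)) + norm (ut N \<omega>) * (c * norm (W N \<omega>))"
        proof -
          define q where "q = sqrt (real N)"
          have q: "q > 0" "real N = q * q" using N by (simp_all add: q_def)
          have "norm (W N \<omega>) = q * norm (ut N \<omega>)" using q(1) by (simp add: W q_def)
          then show ?thesis
            unfolding q_def[symmetric] q(2) using q(1) by (simp add: field_simps power2_eq_square)
        qed
        also have "\<dots> \<le> (1 / sqrt (real N) + norm (ut N \<omega>)) * (2 * c * (B + B'\<^sup>2) + c * norm (W N \<omega>))"
        proof -
          have "0 \<le> 1 / sqrt (real N) * (c * norm (W N \<omega>))" "0 \<le> norm (ut N \<omega>) * (2 * c * (B + B'\<^sup>2))"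
            using c B0 by auto
          then show ?thesis by (simp only: distrib_left distrib_right)
        qed
        also have "\<dots> = \<bar>1 / sqrt (real N) + norm (ut N \<omega>)\<bar> * \<bar>2 * c * (B + B'\<^sup>2) + c * norm (W N \<omega>)\<bar>"
          using c B0 by (simp add: abs_mult)
        finally show ?case by simp
      qed
    qed
  qed
qed

end

subsection \<open>The delta method for the moment vector\<close>

lemma padE_inner: "padE g \<bullet> S = g \<bullet> join (part1 (part1 S)) (part2 S)"
  by (simp add: padE_def inner_jvec)

lemma pad_colE_mult: "transpose (pad_colE A) *v t = padE (transpose A *v t)"
proof (rule vector_eq_rdot[THEN iffD1], rule allI)
  fix S
  have "pad_colE A *v S = A *v join (part1 (part1 S)) (part2 S)"
    by (simp add: vec_eq_iff matrix_vector_mul_component pad_colE_def padE_inner)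
  then show "(transpose (pad_colE A) *v t) \<bullet> S = padE (transpose A *v t) \<bullet> S"
    by (simp only: transpose_inner padE_inner)
qed

lemma has_derivative_lipschitz:
  fixes f :: "'a::real_normed_vector \<Rightarrow> 'b::real_normed_vector"
  assumes "(f has_derivative D) (at x)"
  shows "\<exists>C>0. \<exists>e>0. \<forall>y. norm (y - x) < e \<longrightarrow> norm (f y - f x) \<le> C * norm (y - x)"
proof -
  have bl: "bounded_linear D" using assms by (rule has_derivative_bounded_linear)
  then obtain C where C: "C > 0" "\<And>h. norm (D h) \<le> norm h * C" using bounded_linear.pos_bounded by blast
  obtain d where d: "d > 0" "\<And>y. norm (y - x) < d \<Longrightarrow> norm (f y - f x - D (y - x)) \<le> 1 * norm (y - x)"
    using assms unfolding has_derivative_at_alt by (meson zero_less_one)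
  have "norm (f y - f x) \<le> (C + 1) * norm (y - x)" if "norm (y - x) < d" for y
    using norm_triangle_ineq[of "f y - f x - D (y - x)" "D (y - x)"] d(2)[OF that] C(2)[of "y - x"]
    by (simp add: algebra_simps)
  then show ?thesis using d(1) C(1) by (intro exI[of _ "C + 1"] conjI exI[of _ d]) auto
qed

lemma AE_eventually_near:
  fixes T :: "nat \<Rightarrow> 'w \<Rightarrow> 'v::real_normed_vector"
  assumes "AE \<omega> in P. (\<lambda>N. T N \<omega>) \<longlonglongrightarrow> c" "e > 0"
  shows "AE \<omega> in P. \<forall>\<^sub>F N in sequentially. norm (T N \<omega> - c) < e"
  using assms(1)
proof eventually_elim
  case (elim \<omega>)
  from tendstoD[OF this assms(2)] show ?case by (simp add: dist_norm)
qed

text \<open>In j times the denominator minus the squared numerator, all terms of order 0 and 1 in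
  \<open>k - \<kappa>\<close> cancel because \<open>F *v \<kappa> = y\<close>. What is left is
  exactly j times the quadratic form, so no Taylor remainder appears.\<close>

lemma quotient_R_exact:
  fixes F :: "real^'n^'n"
  assumes sym: "\<And>i j. F $ i $ j = F $ j $ i" and FK: "F *v \<kappa> = y" and j: "j = \<kappa> \<bullet> y" "j \<noteq> 0"
    and k: "k \<bullet> (F *v k) \<noteq> 0"
  shows "quotient_R y F k = j - ((k - \<kappa>) \<bullet> ((F - (1 / j) *\<^sub>R outer y y) *v (k - \<kappa>))) * (j / (k \<bullet> (F *v k)))"
proof -
  have t: "transpose F = F" by (simp add: transpose_def vec_eq_iff sym)
  define d where "d = k - \<kappa>"
  have kd: "k = \<kappa> + d" by (simp add: d_def)
  have "\<kappa> \<bullet> (F *v d) = y \<bullet> d" using transpose_inner[of F \<kappa> d] by (simp only: t FK)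
  then have kFk: "k \<bullet> (F *v k) = j + 2 * (d \<bullet> y) + d \<bullet> (F *v d)"
    unfolding kd by (simp add: matrix_vector_right_distrib inner_add_left inner_add_right FK j(1) inner_commute)
  have ky: "k \<bullet> y = j + d \<bullet> y" unfolding kd by (simp add: inner_add_left j(1))
  have q: "d \<bullet> ((F - (1 / j) *\<^sub>R outer y y) *v d) = d \<bullet> (F *v d) - (d \<bullet> y)\<^sup>2 / j"
    by (simp add: matrix_vector_mult_diff_rdistrib scaleR_matrix_vector_assoc[symmetric] outer_mult_vec
        inner_diff_right power2_eq_square inner_commute)
  define X where "X = k \<bullet> (F *v k)"
  have X: "X \<noteq> 0" "X = j + 2 * (d \<bullet> y) + d \<bullet> (F *v d)" using k kFk by (simp_all add: X_def)
  have "(d \<bullet> (F *v d) - (d \<bullet> y)\<^sup>2 / j) * (j / X) = (d \<bullet> (F *v d) * j - (d \<bullet> y)\<^sup>2) / X"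
    using j(2) X(1) by (simp add: field_simps)
  also have "\<dots> = j - (j + d \<bullet> y)\<^sup>2 / X"
  proof -
    have "(j + d \<bullet> y)\<^sup>2 = j * X - (d \<bullet> (F *v d) * j - (d \<bullet> y)\<^sup>2)"
      unfolding X(2) by (simp add: algebra_simps power2_eq_square)
    then show ?thesis using X(1) by (simp add: diff_divide_distrib)
  qed
  finally show ?thesis
    unfolding quotient_R_def d_def[symmetric] q ky X_def[symmetric] by simp
qed

lemma block_diag_bilinear:
  "a \<bullet> (block_diag A B *v b) = part1 a \<bullet> (A *v part1 b) + part2 a \<bullet> (B *v part2 b)"
proof -
  have "part1 (block_diag A B *v b) = A *v part1 b" "part2 (block_diag A B *v b) = B *v part2 b"
    by (simp_all add: vec_eq_iff matrix_vector_mul_component block_diag_def inner_jvec)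
  then show ?thesis by (simp add: inner_jvec)
qed

context dictionary
begin

lemma F_eta_invertible: "invertible (F_map \<eta>0)"
  using F_invertible by (simp add: eta_maps)

lemmas K_der = K_map_has_derivative[OF F_eta_invertible]
lemmas Kk_der = Kk_map_has_derivative[OF F_eta_invertible]

lemma J_der: "(J_map has_derivative (\<lambda>h. 2 * (K \<bullet> Y_map h) - K \<bullet> (F_map h *v K))) (at \<eta>0)"
proof -
  have "F_map \<eta>0 $ i $ j = F_map \<eta>0 $ j $ i" for i j
    by (simp add: eta_maps cov_sym[OF dens0 \<phi>_bm, of i j] cov_sym[OF dens1 \<phi>_bm, of i j])
  from J_map_has_derivative[OF F_eta_invertible this] show ?thesis by (simp add: eta_maps)
qed

lemma Z0_bm: "bm (Z0 f0 f1 \<phi>)"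
  unfolding Z0_def by (intro bm_join Zc_bm \<phi>_bm bm_vec) (simp, intro bm_intros Lam_bm)

lemma V_E_bilinear: "v \<bullet> (V_E f0 f1 \<phi> l *v w) = part1 v \<bullet> (V0 f0 f1 \<phi> *v part1 w) + l * (part2 v \<bullet> (V1 f1 \<phi> *v part2 w))"
  by (simp add: V_E_def block_diag_bilinear scaleR_matrix_vector_assoc[symmetric])

lemma V_E_psd: "0 \<le> l \<Longrightarrow> 0 \<le> a \<bullet> (V_E f0 f1 \<phi> l *v a)"
  unfolding V_E_bilinear V0_def V1_def
  by (intro add_nonneg_nonneg mult_nonneg_nonneg cov_psd dens0 dens1 Z0_bm Zc_bm \<phi>_bm)

lemma V_E_sym: "V_E f0 f1 \<phi> l $ i $ j = V_E f0 f1 \<phi> l $ j $ i"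
  unfolding V_E_def block_diag_def V0_def V1_def
  by (auto simp: cov_sym dens0 dens1 Z0_bm Zc_bm \<phi>_bm split: sum.split)

end

text \<open>\<open>H\<close> is the pooled moment vector and \<open>S\<close> the normalised score
  sum. The first block of \<open>S\<close> has the tilt coordinate as an additional last entry;
  \<open>join (part1 (part1 s)) (part2 s)\<close> removes it, as the moments do not depend on it and
  only the estimated root does. The number \<open>l\<close> is the weight of the second sample's
  covariance.\<close>

locale estimation = dictionary f0 f1 \<phi> + bounded_iid M f0 X
  for f0 f1 :: "real \<Rightarrow> real" and \<phi> :: "real \<Rightarrow> real^('s::{finite,linorder})"
    and M :: "'w measure" and X :: "nat \<Rightarrow> 'w \<Rightarrow> real" +
  fixes H :: "nat \<Rightarrow> 'w \<Rightarrow> ('s::{finite,linorder}) moments2"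
    and S :: "nat \<Rightarrow> 'w \<Rightarrow> (('s + 's vech_ix) + unit, 's + 's vech_ix) jvec"
    and l :: real
  assumes H_measurable[measurable]: "H N \<in> borel_measurable M"
    and S_measurable[measurable]: "S N \<in> borel_measurable M"
    and l_nonneg: "0 \<le> l"
    and H_AE: "AE \<omega> in M. (\<lambda>N. H N \<omega>) \<longlonglongrightarrow> \<eta>0"
    and S_normal: "asymp_normal M (\<lambda>N \<omega>. a \<bullet> S N \<omega>) (a \<bullet> (V_E f0 f1 \<phi> l *v a))"
    and H_S: "op1 M (\<lambda>N \<omega>. norm (sqrt (real N) *\<^sub>R (H N \<omega> - \<eta>0) - join (part1 (part1 (S N \<omega>))) (part2 (S N \<omega>))))"
    and S_tilt: "part2 (part1 (S N \<omega>)) $ () = scaled_sum (\<lambda>x. exp (\<theta>0 * \<Lambda> x) - 1) N \<omega>"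
begin

abbreviation "V \<equiv> V_E f0 f1 \<phi> l"

lemma V_psd: "0 \<le> a \<bullet> (V *v a)"
  by (rule V_E_psd[OF l_nonneg])

lemma S_Op1: "Op1 M (\<lambda>N \<omega>. norm (S N \<omega>))"
proof -
  have "Op1 M (\<lambda>N \<omega>. \<Sum>i\<in>UNIV. \<bar>axis i 1 \<bullet> S N \<omega>\<bar>)"
    by (intro Op1_sum asymp_normal_Op1[OF S_normal V_psd]) simp
  then show ?thesis
    by (rule Op1_bound[where C=1, rotated]) (auto simp: inner_axis' intro!: order_trans[OF norm_le_l1_cart])
qed

lemma op1_imp_Op1: "op1 M T \<Longrightarrow> Op1 M T"
proof -
  assume T: "op1 M T"
  have "\<exists>C. \<forall>\<^sub>F N in sequentially. prob {\<omega> \<in> space M. \<bar>T N \<omega>\<bar> > C * \<bar>1\<bar>} < e" if "e > 0" for e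
  proof -
    have "(\<lambda>N. prob {\<omega> \<in> space M. \<bar>T N \<omega>\<bar> > 1 * \<bar>1\<bar>}) \<longlonglongrightarrow> 0"
      using T unfolding small_op_def by (meson zero_less_one)
    from order_tendstoD(2)[OF this that] show ?thesis by blast
  qed
  then show ?thesis using T by (simp add: small_op_def big_op_def)
qed

lemma drop_norm: "norm (join (part1 (part1 s)) (part2 s)) \<le> norm s"
  for s :: "(('s + 's vech_ix) + unit, 's + 's vech_ix) jvec"
proof -
  have "(norm (join (part1 (part1 s)) (part2 s)))\<^sup>2 \<le> (norm s)\<^sup>2"
    unfolding power2_norm_eq_inner by (simp add: inner_jvec[of s] inner_jvec[of "part1 s"] inner_jvec[of "join _ _"])
  then show ?thesis by (rule power2_le_imp_le) simp
qed

lemma H_Op1: "Op1 M (\<lambda>N \<omega>. sqrt (real N) * norm (H N \<omega> - \<eta>0))"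
proof (rule Op1_bound[OF _ Op1_add[OF op1_imp_Op1[OF H_S] S_Op1], where C=1])
  show "\<bar>sqrt (real N) * norm (H N \<omega> - \<eta>0)\<bar> \<le> 1 * \<bar>\<bar>norm (sqrt (real N) *\<^sub>R (H N \<omega> - \<eta>0) -
      join (part1 (part1 (S N \<omega>))) (part2 (S N \<omega>)))\<bar> + \<bar>norm (S N \<omega>)\<bar>\<bar>" for N \<omega>
  proof -
    let ?d = "join (part1 (part1 (S N \<omega>))) (part2 (S N \<omega>))"
    have "norm (sqrt (real N) *\<^sub>R (H N \<omega> - \<eta>0)) \<le> norm (sqrt (real N) *\<^sub>R (H N \<omega> - \<eta>0) - ?d) + norm ?d"
      using norm_triangle_ineq[of "sqrt (real N) *\<^sub>R (H N \<omega> - \<eta>0) - ?d" ?d] by simp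
    with drop_norm[of "S N \<omega>"] show ?thesis by simp
  qed
qed measurable

lemma map_Op1:
  fixes f :: "'s moments2 \<Rightarrow> 'v::euclidean_space"
  assumes f: "(f has_derivative D) (at \<eta>0)" and [measurable]: "f \<in> borel_measurable borel"
  shows "Op1 M (\<lambda>N \<omega>. sqrt (real N) * norm (f (H N \<omega>) - f \<eta>0))"
proof -
  obtain C e where C: "C > 0" and e: "e > 0" "\<And>y. norm (y - \<eta>0) < e \<Longrightarrow> norm (f y - f \<eta>0) \<le> C * norm (y - \<eta>0)"
    using has_derivative_lipschitz[OF f] by blast
  show ?thesis
  proof (rule big_op_bound[OF _ H_Op1])
    show "AE \<omega> in M. \<forall>\<^sub>F N in sequentially. \<bar>sqrt (real N) * norm (f (H N \<omega>) - f \<eta>0)\<bar>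
        \<le> C * \<bar>sqrt (real N) * norm (H N \<omega> - \<eta>0)\<bar> * \<bar>1\<bar>"
      using AE_eventually_near[OF H_AE e(1)]
    proof eventually_elim
      case (elim \<omega>)
      then show ?case
      proof eventually_elim
        case (elim N)
        from mult_left_mono[OF e(2)[OF elim], of "sqrt (real N)"] show ?case by (simp add: abs_mult mult_ac)
      qed
    qed
  qed measurable
qed

lemma map_AE:
  assumes "(f has_derivative D) (at \<eta>0)"
  shows "AE \<omega> in M. (\<lambda>N. f (H N \<omega>)) \<longlonglongrightarrow> f \<eta>0"
  using H_AE by eventually_elim (rule isCont_tendsto_compose[OF has_derivative_continuous[OF assms]])

lemma delta_op1:
  fixes f :: "'s moments2 \<Rightarrow> real"
  assumes f: "(f has_derivative D) (at \<eta>0)" and D: "\<And>h. D h = g \<bullet> h" and m[measurable]: "f \<in> borel_measurable borel"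
  shows "op1 M (\<lambda>N \<omega>. sqrt (real N) * (f (H N \<omega>) - f \<eta>0) - padE g \<bullet> S N \<omega>)"
proof -
  \<comment> \<open>The relative linearisation error. As division by zero gives 0, it vanishes at
    the base point, is continuous there, and its product with the norm reproduces the remainder
    without exception.\<close>
  define \<rho> where "\<rho> y = norm (f y - f \<eta>0 - g \<bullet> (y - \<eta>0)) / norm (y - \<eta>0)" for y
  have \<rho>m[measurable]: "\<rho> \<in> borel_measurable borel" unfolding \<rho>_def by measurable
  have "(\<rho> \<longlongrightarrow> \<rho> \<eta>0) (at \<eta>0)"
    using f unfolding has_derivative_iff_norm D \<rho>_def by simp
  then have \<rho>: "isCont \<rho> \<eta>0" by (simp add: isCont_def)
  have \<rho>0: "\<rho> \<eta>0 = 0" by (simp add: \<rho>_def)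
  have a: "op1 M (\<lambda>N \<omega>. \<rho> (H N \<omega>))"
  proof (rule op1_AE)
    show "AE \<omega> in M. (\<lambda>N. \<rho> (H N \<omega>)) \<longlonglongrightarrow> 0"
      using H_AE by eventually_elim (use isCont_tendsto_compose[OF \<rho>] \<rho>0 in force)
  qed measurable
  have 1: "op1 M (\<lambda>N \<omega>. sqrt (real N) * (f (H N \<omega>) - f \<eta>0 - g \<bullet> (H N \<omega> - \<eta>0)))"
  proof (rule op1_bound_by_product[OF _ a H_Op1])
    show "AE \<omega> in M. \<forall>\<^sub>F N in sequentially. \<bar>sqrt (real N) * (f (H N \<omega>) - f \<eta>0 - g \<bullet> (H N \<omega> - \<eta>0))\<bar>
        \<le> \<bar>\<rho> (H N \<omega>)\<bar> * \<bar>sqrt (real N) * norm (H N \<omega> - \<eta>0)\<bar>"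
    proof (intro AE_I2 always_eventually allI)
      fix \<omega> N
      have "\<bar>f (H N \<omega>) - f \<eta>0 - g \<bullet> (H N \<omega> - \<eta>0)\<bar> = \<bar>\<rho> (H N \<omega>)\<bar> * norm (H N \<omega> - \<eta>0)"
        by (cases "H N \<omega> = \<eta>0") (simp_all add: \<rho>_def)
      then show "\<bar>sqrt (real N) * (f (H N \<omega>) - f \<eta>0 - g \<bullet> (H N \<omega> - \<eta>0))\<bar>
        \<le> \<bar>\<rho> (H N \<omega>)\<bar> * \<bar>sqrt (real N) * norm (H N \<omega> - \<eta>0)\<bar>" by (simp add: abs_mult)
    qed
  qed measurable
  have 2: "op1 M (\<lambda>N \<omega>. g \<bullet> (sqrt (real N) *\<^sub>R (H N \<omega> - \<eta>0) - join (part1 (part1 (S N \<omega>))) (part2 (S N \<omega>))))"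
  proof (rule op1_bound_by_product[OF _ H_S Op1_const])
    show "AE \<omega> in M. \<forall>\<^sub>F N in sequentially.
      \<bar>g \<bullet> (sqrt (real N) *\<^sub>R (H N \<omega> - \<eta>0) - join (part1 (part1 (S N \<omega>))) (part2 (S N \<omega>)))\<bar>
      \<le> \<bar>norm (sqrt (real N) *\<^sub>R (H N \<omega> - \<eta>0) - join (part1 (part1 (S N \<omega>))) (part2 (S N \<omega>)))\<bar> * \<bar>norm g\<bar>"
    proof (intro AE_I2 always_eventually allI)
      fix \<omega> N
      show "\<bar>g \<bullet> (sqrt (real N) *\<^sub>R (H N \<omega> - \<eta>0) - join (part1 (part1 (S N \<omega>))) (part2 (S N \<omega>)))\<bar>
      \<le> \<bar>norm (sqrt (real N) *\<^sub>R (H N \<omega> - \<eta>0) - join (part1 (part1 (S N \<omega>))) (part2 (S N \<omega>)))\<bar> * \<bar>norm g\<bar>"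
        using Cauchy_Schwarz_ineq2[of g "sqrt (real N) *\<^sub>R (H N \<omega> - \<eta>0) - join (part1 (part1 (S N \<omega>))) (part2 (S N \<omega>))"]
        by (simp add: mult.commute)
    qed
  qed measurable
  have "sqrt (real N) * (f (H N \<omega>) - f \<eta>0 - g \<bullet> (H N \<omega> - \<eta>0))
      + g \<bullet> (sqrt (real N) *\<^sub>R (H N \<omega> - \<eta>0) - join (part1 (part1 (S N \<omega>))) (part2 (S N \<omega>)))
    = sqrt (real N) * (f (H N \<omega>) - f \<eta>0) - padE g \<bullet> S N \<omega>" for N \<omega>
    by (simp add: padE_inner inner_diff_right algebra_simps)
  with op1_add[OF 1 2] show ?thesis by simp
qed

lemma linear_asymp_normal:
  assumes "op1 M (\<lambda>N \<omega>. T N \<omega> - a \<bullet> S N \<omega>)" "\<And>N. T N \<in> borel_measurable M"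
  shows "asymp_normal M T (a \<bullet> (V *v a))"
  by (rule asymp_normal_slutsky[OF S_normal V_psd assms])

lemma delta_asymp_normal:
  fixes f :: "'s moments2 \<Rightarrow> real"
  assumes "(f has_derivative D) (at \<eta>0)" "\<And>h. D h = g \<bullet> h" and [measurable]: "f \<in> borel_measurable borel"
  shows "asymp_normal M (\<lambda>N \<omega>. sqrt (real N) * (f (H N \<omega>) - f \<eta>0)) (padE g \<bullet> (V *v padE g))"
  by (rule linear_asymp_normal[OF delta_op1[OF assms]]) measurable

lemma sandwich_psd: "0 \<le> t \<bullet> ((A ** V ** transpose A) *v t)"
  unfolding sandwich_bilinear by (rule V_psd)

lemma sandwich_sym: "(A ** V ** transpose A) $ i $ j = (A ** V ** transpose A) $ j $ i"
proof -
  have "transpose V = V" by (simp add: transpose_def vec_eq_iff V_E_sym)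
  then have "transpose (A ** V ** transpose A) = A ** V ** transpose A"
    by (simp add: matrix_transpose_mul matrix_mul_assoc)
  then have "transpose (A ** V ** transpose A) $ i $ j = (A ** V ** transpose A) $ i $ j" by (simp only:)
  then show ?thesis unfolding transpose_def by simp
qed

text \<open>Each projection of \<open>f\<close> is a scalar function whose gradient is the
  transposed Jacobian applied to \<open>t\<close>, so the scalar delta method and the Cramer-Wold
  device combine to the sandwich covariance.\<close>

lemma delta_asymp_mv_normal:
  fixes f :: "'s moments2 \<Rightarrow> real^'n"
  assumes f: "(f has_derivative D) (at \<eta>0)" and m[measurable]: "f \<in> borel_measurable borel"
  shows "asymp_mv_normal M (\<lambda>N \<omega>. sqrt (real N) *\<^sub>R (f (H N \<omega>) - f \<eta>0))
    (pad_colE (jacobian f (at \<eta>0)) ** V ** transpose (pad_colE (jacobian f (at \<eta>0))))"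
proof (rule asymp_mv_normalI[OF _ sandwich_sym sandwich_psd])
  fix t
  let ?G = "jacobian f (at \<eta>0)"
  have "asymp_normal M (\<lambda>N \<omega>. sqrt (real N) * (t \<bullet> f (H N \<omega>) - t \<bullet> f \<eta>0))
    (padE (transpose ?G *v t) \<bullet> (V *v padE (transpose ?G *v t)))"
  proof (rule delta_asymp_normal)
    show "((\<lambda>\<eta>. t \<bullet> f \<eta>) has_derivative (\<lambda>h. t \<bullet> D h)) (at \<eta>0)"
      by (rule bounded_linear.has_derivative[OF bounded_linear_inner_right f])
    show "t \<bullet> D h = (transpose ?G *v t) \<bullet> h" for h
      by (simp only: transpose_inner jacobian_mult[OF f])
  qed measurable
  then show "asymp_normal M (\<lambda>N \<omega>. t \<bullet> (sqrt (real N) *\<^sub>R (f (H N \<omega>) - f \<eta>0)))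
    (t \<bullet> ((pad_colE ?G ** V ** transpose (pad_colE ?G)) *v t))"
    by (simp only: sandwich_bilinear pad_colE_mult inner_scaleR_right inner_diff_right)
qed measurable

lemma K_hat_AE: "AE \<omega> in M. (\<lambda>N. K_map (H N \<omega>)) \<longlonglongrightarrow> K"
  using map_AE[OF K_der] by (simp add: eta_maps)

lemma Kk_hat_AE: "AE \<omega> in M. (\<lambda>N. Kk_map (H N \<omega>)) \<longlonglongrightarrow> z0"
  using map_AE[OF Kk_der] by (simp add: eta_maps)

lemma K_hat_normal: "asymp_mv_normal M (\<lambda>N \<omega>. sqrt (real N) *\<^sub>R (K_map (H N \<omega>) - K)) (Sigma_E f0 f1 \<phi> l)"
  using delta_asymp_mv_normal[OF K_der] by (simp add: eta_maps Sigma_E_def G_E_def)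

lemma Kk_hat_normal: "asymp_mv_normal M (\<lambda>N \<omega>. sqrt (real N) *\<^sub>R (Kk_map (H N \<omega>) - z0)) (SigmaKk_E f0 f1 \<phi> l)"
  using delta_asymp_mv_normal[OF Kk_der] by (simp add: eta_maps SigmaKk_E_def GKk_E_def)

lemma J_hat_normal: "asymp_normal M (\<lambda>N \<omega>. sqrt (real N) * (J_map (H N \<omega>) - J))
    (padE (gradJ_E f0 f1 \<phi>) \<bullet> (V *v padE (gradJ_E f0 f1 \<phi>)))"
  using delta_asymp_normal[OF J_der gradient_inner[OF J_der, symmetric]] by (simp add: eta_maps gradJ_E_def)

section \<open>Second-order loss of the quotient at the estimated direction\<close>

definition Q :: "real^('s::{finite,linorder})^('s::{finite,linorder})" where
  "Q = (C0 + C1) - (1 / J) *\<^sub>R outer (u1 - u0) (u1 - u0)"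

definition q2 :: "nat \<Rightarrow> 'w \<Rightarrow> real" where
  "q2 N \<omega> = (K_map (H N \<omega>) - K) \<bullet> (Q *v (K_map (H N \<omega>) - K))"

lemma q2_measurable[measurable]: "q2 N \<in> borel_measurable M"
  unfolding q2_def by measurable

lemma quotient_R_measurable[measurable]: "(\<lambda>\<omega>. quotient_R (u1 - u0) (C0 + C1) (K_map (H N \<omega>))) \<in> borel_measurable M"
  unfolding quotient_R_def by measurable

lemma R_factor_AE: "AE \<omega> in M. (\<lambda>N. J / (K_map (H N \<omega>) \<bullet> ((C0 + C1) *v K_map (H N \<omega>)))) \<longlonglongrightarrow> 1"
  using K_hat_AE
proof eventually_elim
  case (elim \<omega>)
  have "(\<lambda>N. J / (K_map (H N \<omega>) \<bullet> ((C0 + C1) *v K_map (H N \<omega>)))) \<longlonglongrightarrow> J / (K \<bullet> ((C0 + C1) *v K))"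
    using elim J_pos J_eq(2)
    by (intro tendsto_intros bounded_bilinear.tendsto[OF bounded_bilinear_matrix_vector]) auto
  then show ?case using J_pos J_eq(2) by simp
qed

lemma R_exact_AE: "AE \<omega> in M. \<forall>\<^sub>F N in sequentially. quotient_R (u1 - u0) (C0 + C1) (K_map (H N \<omega>))
    = J - q2 N \<omega> * (J / (K_map (H N \<omega>) \<bullet> ((C0 + C1) *v K_map (H N \<omega>))))"
  using R_factor_AE
proof eventually_elim
  case (elim \<omega>)
  have "\<forall>\<^sub>F N in sequentially. 0 < J / (K_map (H N \<omega>) \<bullet> ((C0 + C1) *v K_map (H N \<omega>)))"
    by (rule order_tendstoD(1)[OF elim]) simp
  then show ?case
  proof eventually_elim
    case (elim N)
    then have "K_map (H N \<omega>) \<bullet> ((C0 + C1) *v K_map (H N \<omega>)) \<noteq> 0" by auto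
    from quotient_R_exact[OF _ F_K J_eq(1) _ this] J_pos show ?case
      by (simp add: cov_sym[OF dens0 \<phi>_bm] cov_sym[OF dens1 \<phi>_bm] q2_def Q_def)
  qed
qed

text \<open>The error is exactly \<open>q2\<close> times a factor tending to 0, so relative
  smallness holds even where \<open>q2\<close> itself is 0.\<close>

lemma R_small_op: "small_op M (\<lambda>N \<omega>. quotient_R (u1 - u0) (C0 + C1) (K_map (H N \<omega>)) - (J - q2 N \<omega>)) q2"
proof (rule small_op_AE_eventually)
  fix \<epsilon> :: real assume e: "\<epsilon> > 0"
  show "AE \<omega> in M. \<forall>\<^sub>F N in sequentially.
    \<bar>quotient_R (u1 - u0) (C0 + C1) (K_map (H N \<omega>)) - (J - q2 N \<omega>)\<bar> \<le> \<epsilon> * \<bar>q2 N \<omega>\<bar>"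
    using R_exact_AE AE_eventually_near[OF R_factor_AE e]
  proof eventually_elim
    case (elim \<omega>)
    from elim show ?case
    proof eventually_elim
      case (elim N)
      define r where "r = J / (K_map (H N \<omega>) \<bullet> ((C0 + C1) *v K_map (H N \<omega>)))"
      have "quotient_R (u1 - u0) (C0 + C1) (K_map (H N \<omega>)) - (J - q2 N \<omega>) = q2 N \<omega> * (1 - r)"
        unfolding elim(1) r_def[symmetric] by (simp add: algebra_simps)
      moreover have "\<bar>1 - r\<bar> \<le> \<epsilon>" using elim(2) by (simp add: r_def abs_minus_commute)
      ultimately show ?case by (simp add: abs_mult mult.commute mult_right_mono)
    qed
  qed
qed measurable

lemma R_big_op: "big_op M (\<lambda>N \<omega>. quotient_R (u1 - u0) (C0 + C1) (K_map (H N \<omega>)) - J) (\<lambda>N. 1 / real N)"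
\<comment> \<open>The constant 2 bounds the factor \<open>J / (k \<bullet> (F *v k))\<close>, which
  is eventually within distance 1 of its limit 1; \<open>norm Q\<close> bounds the quadratic
  form.\<close>
proof (rule big_op_bound[OF _ Op1_square[OF map_Op1[OF K_der]], where C="2 * norm Q"])
  show "AE \<omega> in M. \<forall>\<^sub>F N in sequentially. \<bar>quotient_R (u1 - u0) (C0 + C1) (K_map (H N \<omega>)) - J\<bar>
      \<le> 2 * norm Q * \<bar>(sqrt (real N) * norm (K_map (H N \<omega>) - K_map \<eta>0))\<^sup>2\<bar> * \<bar>1 / real N\<bar>"
    using R_exact_AE AE_eventually_near[OF R_factor_AE zero_less_one]
  proof eventually_elim
    case (elim \<omega>)
    from elim eventually_gt_at_top[of 0] show ?case
    proof eventually_elim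
      case (elim N)
      define r where "r = J / (K_map (H N \<omega>) \<bullet> ((C0 + C1) *v K_map (H N \<omega>)))"
      let ?d = "K_map (H N \<omega>) - K"
      have r: "\<bar>r\<bar> \<le> 2" using elim(2) by (simp add: r_def[symmetric] abs_less_iff abs_le_iff)
      have "\<bar>q2 N \<omega>\<bar> \<le> norm ?d * (norm Q * norm ?d)"
        unfolding q2_def
        by (rule order_trans[OF Cauchy_Schwarz_ineq2 mult_left_mono[OF matrix_vector_norm_le]]) simp
      then have "\<bar>q2 N \<omega>\<bar> * \<bar>r\<bar> \<le> (norm ?d * (norm Q * norm ?d)) * 2" using r by (intro mult_mono) auto
      moreover have "\<bar>quotient_R (u1 - u0) (C0 + C1) (K_map (H N \<omega>)) - J\<bar> = \<bar>q2 N \<omega>\<bar> * \<bar>r\<bar>"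
        unfolding elim(1) r_def[symmetric] by (simp add: abs_mult)
      moreover have "2 * norm Q * \<bar>(sqrt (real N) * norm ?d)\<^sup>2\<bar> * \<bar>1 / real N\<bar> = (norm ?d * (norm Q * norm ?d)) * 2"
      proof -
        have "(sqrt (real N) * norm ?d)\<^sup>2 = real N * (norm ?d * norm ?d)"
          by (simp add: power_mult_distrib power2_eq_square[of "norm ?d"])
        then show ?thesis using elim(3) by simp
      qed
      ultimately show ?case by (simp add: eta_maps)
    qed
  qed
qed measurable

section \<open>Efficiency of the estimated score\<close>

definition e_hat :: "nat \<Rightarrow> 'w \<Rightarrow> real" where
  "e_hat N \<omega> = efficiency f0 f1 \<phi> (Kk_map (H N \<omega>)) - efficiency f0 f1 \<phi> z0"

lemma e_hat_measurable[measurable]: "e_hat N \<in> borel_measurable M"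
  unfolding e_hat_def by measurable

lemma e_hat_remainder:
  "big_op M (\<lambda>N \<omega>. e_hat N \<omega> - grad_e f0 f1 \<phi> \<bullet> (Kk_map (H N \<omega>) - z0)) (\<lambda>N. 1 / real N)"
proof -
  obtain C e where C: "C > 0" and e: "e > 0" "\<And>z. norm (z - z0) < e \<Longrightarrow>
    \<bar>efficiency f0 f1 \<phi> z - efficiency f0 f1 \<phi> z0 - grad_e f0 f1 \<phi> \<bullet> (z - z0)\<bar> \<le> C * (norm (z - z0))\<^sup>2"
    using efficiency_expansion by blast
  show ?thesis
  proof (rule big_op_bound[OF _ Op1_square[OF map_Op1[OF Kk_der]], where C=C])
    show "AE \<omega> in M. \<forall>\<^sub>F N in sequentially. \<bar>e_hat N \<omega> - grad_e f0 f1 \<phi> \<bullet> (Kk_map (H N \<omega>) - z0)\<bar>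
       \<le> C * \<bar>(sqrt (real N) * norm (Kk_map (H N \<omega>) - Kk_map \<eta>0))\<^sup>2\<bar> * \<bar>1 / real N\<bar>"
      using AE_eventually_near[OF Kk_hat_AE e(1)]
    proof eventually_elim
      case (elim \<omega>)
      from elim eventually_gt_at_top[of 0] show ?case
      proof eventually_elim
        case (elim N)
        from e(2)[OF elim(1)] elim(2) show ?case
          by (simp add: e_hat_def eta_maps power_mult_distrib)
      qed
    qed
  qed measurable
qed

lemma e_hat_normal: "asymp_normal M (\<lambda>N \<omega>. sqrt (real N) * e_hat N \<omega>)
   (grad_e f0 f1 \<phi> \<bullet> (SigmaKk_E f0 f1 \<phi> l *v grad_e f0 f1 \<phi>))"
proof -
  have "(efficiency f0 f1 \<phi> has_derivative (\<lambda>h. h \<bullet> grad_e f0 f1 \<phi>)) (at (Kk_map \<eta>0))"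
    using efficiency_GDERIV by (simp add: gderiv_def eta_maps)
  from diff_chain_at[OF Kk_der this]
  have d: "((\<lambda>\<eta>. efficiency f0 f1 \<phi> (Kk_map \<eta>)) has_derivative (\<lambda>h. dKk_map \<eta>0 h \<bullet> grad_e f0 f1 \<phi>)) (at \<eta>0)"
    by (simp add: comp_def)
  have "dKk_map \<eta>0 h \<bullet> grad_e f0 f1 \<phi> = (transpose (GKk_E f0 f1 \<phi>) *v grad_e f0 f1 \<phi>) \<bullet> h" for h
    unfolding transpose_inner GKk_E_def jacobian_mult[OF Kk_der] by (rule inner_commute)
  from delta_asymp_normal[OF d this]
  have "asymp_normal M (\<lambda>N \<omega>. sqrt (real N) * e_hat N \<omega>)
    (padE (transpose (GKk_E f0 f1 \<phi>) *v grad_e f0 f1 \<phi>) \<bullet> (V *v padE (transpose (GKk_E f0 f1 \<phi>) *v grad_e f0 f1 \<phi>)))"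
    by (simp add: e_hat_def[abs_def] eta_maps)
  then show ?thesis by (simp only: SigmaKk_E_def sandwich_bilinear pad_colE_mult)
qed

lemma e_hat_big_op: "big_op M e_hat (\<lambda>N. 1 / sqrt (real N))"
proof (rule big_op_bound[OF _ asymp_normal_Op1[OF e_hat_normal], where C=1])
  show "0 \<le> grad_e f0 f1 \<phi> \<bullet> (SigmaKk_E f0 f1 \<phi> l *v grad_e f0 f1 \<phi>)"
    unfolding SigmaKk_E_def by (rule sandwich_psd)
  show "AE \<omega> in M. \<forall>\<^sub>F N in sequentially. \<bar>e_hat N \<omega>\<bar> \<le> 1 * \<bar>sqrt (real N) * e_hat N \<omega>\<bar> * \<bar>1 / sqrt (real N)\<bar>"
  proof (intro AE_I2)
    fix \<omega>
    show "\<forall>\<^sub>F N in sequentially. \<bar>e_hat N \<omega>\<bar> \<le> 1 * \<bar>sqrt (real N) * e_hat N \<omega>\<bar> * \<bar>1 / sqrt (real N)\<bar>"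
      using eventually_gt_at_top[of 0] by eventually_elim (simp add: abs_mult)
  qed
qed measurable

section \<open>The estimated tilt parameter\<close>

definition theta_hat :: "nat \<Rightarrow> 'w \<Rightarrow> real" where
  "theta_hat N \<omega> = sample_theta \<phi> (\<lambda>j. X j \<omega>) N (part1 (Kk_map (H N \<omega>))) (part2 (Kk_map (H N \<omega>)) $ ())"

lemma theta_hat_eq: "theta_hat N \<omega> = (THE \<theta>. \<theta> > 0 \<and> (1 / real N) * (\<Sum>j<N. exp (\<theta> * (Kk_map (H N \<omega>) \<bullet> \<psi> (X j \<omega>)))) = 1)"
  by (simp add: theta_hat_def sample_theta_def inner_\<psi>)

text \<open>The uniform law on the sample indices. Sample averages become integrals, so for each
  outcome the results on roots apply to the estimated root as they stand. For N = 0 the measure is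
  unspecified, hence the separate treatment of the empty sample.\<close>

abbreviation emp :: "nat \<Rightarrow> nat measure" where "emp N \<equiv> measure_pmf (pmf_of_set {..<N})"

lemma emp_integral:
  fixes h :: "nat \<Rightarrow> 'v::{banach,second_countable_topology}"
  assumes "N > 0"
  shows "(\<integral>j. h j \<partial>emp N) = (1 / real N) *\<^sub>R (\<Sum>j<N. h j)"
proof -
  have "(\<integral>j. h j \<partial>emp N) = (\<Sum>j<N. pmf (pmf_of_set {..<N}) j *\<^sub>R h j)"
    using assms by (intro integral_measure_pmf) (auto simp: lessThan_empty_iff)
  also have "\<dots> = (\<Sum>j<N. (1 / real N) *\<^sub>R h j)"
    using assms by (intro sum.cong) (auto simp: lessThan_empty_iff indicator_def)
  finally show ?thesis by (simp add: scaleR_sum_right)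
qed

lemma emp_prob: "prob_space (emp N)" by (rule prob_space_measure_pmf)

lemma emp_root: "N > 0 \<Longrightarrow> theta_hat N \<omega> = exp_root (emp N) (\<lambda>j. Kk_map (H N \<omega>) \<bullet> \<psi> (X j \<omega>))"
  unfolding theta_hat_eq exp_root_def by (simp add: emp_integral)

lemma theta_hat_measurable[measurable]: "theta_hat N \<in> borel_measurable M"
  unfolding theta_hat_eq[abs_def]
proof (rule exp_moment_root_measurable)
  show "(\<lambda>\<omega>. (1 / real N) * (\<Sum>j<N. exp (\<theta> * (Kk_map (H N \<omega>) \<bullet> \<psi> (X j \<omega>))))) \<in> borel_measurable M" for \<theta>
    by measurable
  fix \<omega>
  show "(\<forall>\<theta>. (1 / real N) * (\<Sum>j<N. exp (\<theta> * (Kk_map (H N \<omega>) \<bullet> \<psi> (X j \<omega>)))) = 0) \<or>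
    (\<exists>(\<mu>::nat measure) Y b. bounded_rv \<mu> Y b \<and>
      (\<forall>\<theta>. (1 / real N) * (\<Sum>j<N. exp (\<theta> * (Kk_map (H N \<omega>) \<bullet> \<psi> (X j \<omega>)))) = bounded_rv.mgf \<mu> Y \<theta>))"
  proof (cases "N = 0")
    case False
    have rv: "bounded_rv (emp N) (\<lambda>j. Kk_map (H N \<omega>) \<bullet> \<psi> (X j \<omega>)) (norm (Kk_map (H N \<omega>)) * b)"
      by (rule bounded_rv_inner[OF emp_prob]) (auto simp: b)
    show ?thesis
      by (intro disjI2 exI conjI allI, rule rv) (use False in \<open>simp add: bounded_rv.mgf_def[OF rv] emp_integral\<close>)
  qed simp
qed

definition m_hat :: "real \<Rightarrow> nat \<Rightarrow> 'w \<Rightarrow> real" where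
  "m_hat \<theta> N \<omega> = (1 / real N) * (\<Sum>j<N. exp (\<theta> * (z0 \<bullet> \<psi> (X j \<omega>))))"

definition D_hat :: "nat \<Rightarrow> 'w \<Rightarrow> ('s, unit) jvec" where
  "D_hat N \<omega> = (1 / real N) *\<^sub>R (\<Sum>j<N. exp (\<theta>0 * (z0 \<bullet> \<psi> (X j \<omega>))) *\<^sub>R \<psi> (X j \<omega>))"

lemma m_hat_AE: "AE \<omega> in M. (\<lambda>N. m_hat \<theta> N \<omega>) \<longlonglongrightarrow> L.mgf \<theta>"
proof -
  have bh: "bm (\<lambda>x. exp (\<theta> * (z0 \<bullet> \<psi> x)))" by (intro bm_intros \<psi>_bm)
  obtain B where "\<And>x. norm (exp (\<theta> * (z0 \<bullet> \<psi> x))) \<le> B" using bm_bound[OF bh] by blast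
  then have "AE \<omega> in M. (\<lambda>N. (1 / real N) * (\<Sum>j<N. exp (\<theta> * (z0 \<bullet> \<psi> (X j \<omega>))))) \<longlonglongrightarrow> expct f0 (\<lambda>x. exp (\<theta> * (z0 \<bullet> \<psi> x)))"
    using bm_measurable[OF bh] by (intro sample_mean_AE_real[where b=B]) auto
  then show ?thesis by (simp add: m_hat_def L.mgf_def expct_def Lam_eq)
qed

lemma D_hat_AE: "AE \<omega> in M. (\<lambda>N. D_hat N \<omega>) \<longlonglongrightarrow> pair tphi 1"
  using sample_mean_AE[OF tilt_bm[OF \<psi>_bm]] tilt_\<psi> by (simp add: D_hat_def Lam_eq[symmetric] expct_def)

lemma tilt_S: "part2 (part1 (S N \<omega>)) $ () = sqrt (real N) * (m_hat \<theta>0 N \<omega> - 1)"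
proof (cases "N = 0")
  case False
  then have "(1 / sqrt (real N)) * real N = sqrt (real N)" by (simp add: real_div_sqrt)
  moreover have "sqrt (real N) * (1 / real N) = 1 / sqrt (real N)"
    using False by (simp add: divide_eq_eq eq_divide_eq)
  ultimately show ?thesis
    unfolding S_tilt scaled_sum_def m_hat_def
    by (simp add: sum_subtractf right_diff_distrib Lam_eq mult.assoc[symmetric] del: times_divide_eq_right times_divide_eq_left)
next
  case True
  then show ?thesis unfolding S_tilt by (simp add: scaled_sum_def)
qed

lemma tilt_axis: "axis (Inl (Inr ())) 1 \<bullet> S N \<omega> = part2 (part1 (S N \<omega>)) $ ()"
  by (simp add: inner_axis')

text \<open>The expression bounded in \<open>root_expansion\<close>, multiplied by sqrt N, with the
  empirical moment deviation written as the tilt coordinate of \<open>S\<close>.\<close>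

definition tilt_remainder :: "nat \<Rightarrow> 'w \<Rightarrow> real" where
  "tilt_remainder N \<omega> = sqrt (real N) * (theta_hat N \<omega> - \<theta>0) * tE
     + \<theta>0 * (sqrt (real N) * (pair tphi 1 \<bullet> (Kk_map (H N \<omega>) - z0))) + part2 (part1 (S N \<omega>)) $ ()"

text \<open>The bound is a product of \<open>s + \<kappa>\<close> and \<open>s\<close>. The first
  factor only has to vanish almost surely, so the strong law is enough for the empirical tilted mean
  \<open>D_hat\<close>; the second is tight after scaling, because it consists of the deviation of
  the parameters and of the tilt coordinate.\<close>

lemma tilt_remainder_op1: "op1 M tilt_remainder"
proof -
  let ?D = "pair tphi 1"
  from root_expansion[OF theta0(1) _ b(1), of ?D z0, where 'a=nat] tE_pos
  obtain C \<beta> where C: "C > 0" and \<beta>: "\<beta> > 0" and exp: "\<And>(\<mu> :: nat measure) \<psi> z \<theta> m D. prob_space \<mu> \<Longrightarrow> \<psi> \<in> borel_measurable \<mu> \<Longrightarrow>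
     (\<forall>x\<in>space \<mu>. norm (\<psi> x) \<le> b) \<Longrightarrow> (\<integral>x. exp (\<theta> * (z \<bullet> \<psi> x)) \<partial>\<mu>) = 1 \<Longrightarrow>
     m = (\<integral>x. exp (\<theta>0 * (z0 \<bullet> \<psi> x)) \<partial>\<mu>) \<Longrightarrow> D = (\<integral>x. exp (\<theta>0 * (z0 \<bullet> \<psi> x)) *\<^sub>R \<psi> x \<partial>\<mu>) \<Longrightarrow>
     \<bar>\<theta> - \<theta>0\<bar> \<le> \<beta> \<Longrightarrow> norm (z - z0) \<le> \<beta> \<Longrightarrow> norm (D - ?D) \<le> \<beta> \<Longrightarrow>
     \<bar>\<theta> - \<theta>0\<bar> \<le> C * (norm (z - z0) + \<bar>m - 1\<bar>) \<and>
     \<bar>(\<theta> - \<theta>0) * (?D \<bullet> z0) + \<theta>0 * (?D \<bullet> (z - z0)) + (m - 1)\<bar>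
       \<le> C * (norm (z - z0) + \<bar>m - 1\<bar> + norm (D - ?D)) * (norm (z - z0) + \<bar>m - 1\<bar>)"
    unfolding tilt_z0 by meson
  define \<beta>' where "\<beta>' = min \<beta> (\<theta>0 / 2)"
  have \<beta>': "0 < \<beta>'" "\<beta>' < \<theta>0" "\<beta>' \<le> \<beta>" using \<beta> theta0(1) by (auto simp: \<beta>'_def)
  note around = mgf_around[OF \<beta>'(1,2)]
  from root_localized[OF b(1) \<beta>'(1,2), of L.mgf z0, where 'a=nat, OF conjunct1[OF around] conjunct2[OF around]]
  obtain e where e: "e > 0" and loc: "\<And>(\<mu> :: nat measure) \<psi> z. prob_space \<mu> \<Longrightarrow> \<psi> \<in> borel_measurable \<mu> \<Longrightarrow>
     (\<forall>x\<in>space \<mu>. norm (\<psi> x) \<le> b) \<Longrightarrow> norm (z - z0) < e \<Longrightarrow>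
     (\<forall>\<theta>\<in>{\<theta>0 - \<beta>', \<theta>0 + \<beta>'}. \<bar>(\<integral>x. exp (\<theta> * (z0 \<bullet> \<psi> x)) \<partial>\<mu>) - L.mgf \<theta>\<bar> < e) \<Longrightarrow>
     \<bar>exp_root \<mu> (\<lambda>x. z \<bullet> \<psi> x) - \<theta>0\<bar> < \<beta>' \<and> (\<integral>x. exp (exp_root \<mu> (\<lambda>x. z \<bullet> \<psi> x) * (z \<bullet> \<psi> x)) \<partial>\<mu>) = 1"
    by meson
  let ?z = "\<lambda>N \<omega>. Kk_map (H N \<omega>)"
  define s where "s N \<omega> = norm (?z N \<omega> - z0) + \<bar>m_hat \<theta>0 N \<omega> - 1\<bar>" for N \<omega>
  define \<kappa> where "\<kappa> N \<omega> = norm (D_hat N \<omega> - ?D)" for N \<omega>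
  have [measurable]: "m_hat \<theta>0 N \<in> borel_measurable M" "D_hat N \<in> borel_measurable M" for N
    unfolding m_hat_def D_hat_def by measurable
  have [measurable]: "s N \<in> borel_measurable M" "\<kappa> N \<in> borel_measurable M" for N
    unfolding s_def \<kappa>_def by measurable
  have a: "op1 M (\<lambda>N \<omega>. s N \<omega> + \<kappa> N \<omega>)"
  proof (rule op1_AE)
    show "AE \<omega> in M. (\<lambda>N. s N \<omega> + \<kappa> N \<omega>) \<longlonglongrightarrow> 0"
      using Kk_hat_AE m_hat_AE[of \<theta>0] D_hat_AE
    proof eventually_elim
      case (elim \<omega>)
      have "(\<lambda>N. norm (?z N \<omega> - z0) + \<bar>m_hat \<theta>0 N \<omega> - 1\<bar> + norm (D_hat N \<omega> - ?D)) \<longlonglongrightarrow> norm (z0 - z0) + \<bar>1 - 1\<bar> + norm (?D - ?D)"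
        using elim unfolding theta0(2) by (intro tendsto_intros)
      then show ?case by (simp add: s_def \<kappa>_def)
    qed
  qed measurable
  have b1: "Op1 M (\<lambda>N \<omega>. C * (sqrt (real N) * s N \<omega>))"
  proof (rule Op1_bound[OF _ Op1_add[OF map_Op1[OF Kk_der] S_Op1], where C=C])
    fix N \<omega>
    have "sqrt (real N) * s N \<omega> = sqrt (real N) * norm (?z N \<omega> - z0) + \<bar>part2 (part1 (S N \<omega>)) $ ()\<bar>"
      unfolding tilt_S by (simp add: s_def distrib_left abs_mult)
    also have "\<bar>part2 (part1 (S N \<omega>)) $ ()\<bar> \<le> norm (S N \<omega>)"
      using component_le_norm_cart[of "S N \<omega>" "Inl (Inr ())"] by simp
    finally show "\<bar>C * (sqrt (real N) * s N \<omega>)\<bar> \<le> C * \<bar>\<bar>sqrt (real N) * norm (Kk_map (H N \<omega>) - Kk_map \<eta>0)\<bar> + \<bar>norm (S N \<omega>)\<bar>\<bar>"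
      using C by (simp add: abs_mult s_def eta_maps)
  qed measurable
  show ?thesis
  proof (rule op1_bound_by_product[OF _ a b1])
    show "tilt_remainder N \<in> borel_measurable M" for N unfolding tilt_remainder_def by measurable
    show "AE \<omega> in M. \<forall>\<^sub>F N in sequentially. \<bar>tilt_remainder N \<omega>\<bar> \<le> \<bar>s N \<omega> + \<kappa> N \<omega>\<bar> * \<bar>C * (sqrt (real N) * s N \<omega>)\<bar>"
      using AE_eventually_near[OF Kk_hat_AE e] AE_eventually_near[OF Kk_hat_AE \<beta>] AE_eventually_near[OF D_hat_AE \<beta>]
        AE_eventually_near[OF m_hat_AE[of "\<theta>0 - \<beta>'"] e] AE_eventually_near[OF m_hat_AE[of "\<theta>0 + \<beta>'"] e]
    proof eventually_elim
      case (elim \<omega>)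
      from elim eventually_gt_at_top[of 0] show ?case
      proof eventually_elim
        case (elim N)
        have N: "N > 0" by (rule elim)
        note int = emp_integral[OF N]
        have r: "\<bar>theta_hat N \<omega> - \<theta>0\<bar> < \<beta>'" "(\<integral>j. exp (theta_hat N \<omega> * (?z N \<omega> \<bullet> \<psi> (X j \<omega>))) \<partial>emp N) = 1"
          unfolding emp_root[OF N] using loc[OF emp_prob, of "\<lambda>j. \<psi> (X j \<omega>)" N "?z N \<omega>"] elim b
          by (auto simp: int m_hat_def)
        have i: "m_hat \<theta>0 N \<omega> = (\<integral>j. exp (\<theta>0 * (z0 \<bullet> \<psi> (X j \<omega>))) \<partial>emp N)"
          "D_hat N \<omega> = (\<integral>j. exp (\<theta>0 * (z0 \<bullet> \<psi> (X j \<omega>))) *\<^sub>R \<psi> (X j \<omega>) \<partial>emp N)"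
          by (simp_all add: int m_hat_def D_hat_def)
        have "\<bar>(theta_hat N \<omega> - \<theta>0) * (?D \<bullet> z0) + \<theta>0 * (?D \<bullet> (?z N \<omega> - z0)) + (m_hat \<theta>0 N \<omega> - 1)\<bar>
          \<le> C * (s N \<omega> + \<kappa> N \<omega>) * s N \<omega>"
          unfolding s_def \<kappa>_def
          using exp[OF emp_prob _ _ r(2) i] r(1) elim \<beta>'(3) b by simp
        from mult_left_mono[OF this, of "sqrt (real N)"]
        have "\<bar>sqrt (real N) * ((theta_hat N \<omega> - \<theta>0) * (?D \<bullet> z0) + \<theta>0 * (?D \<bullet> (?z N \<omega> - z0)) + (m_hat \<theta>0 N \<omega> - 1))\<bar>
          \<le> sqrt (real N) * (C * (s N \<omega> + \<kappa> N \<omega>) * s N \<omega>)" by (simp add: abs_mult)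
        moreover have "tilt_remainder N \<omega> = sqrt (real N) * ((theta_hat N \<omega> - \<theta>0) * (?D \<bullet> z0) + \<theta>0 * (?D \<bullet> (?z N \<omega> - z0)) + (m_hat \<theta>0 N \<omega> - 1))"
          unfolding tilt_remainder_def tilt_S tilt_z0 by (simp add: algebra_simps)
        moreover have "sqrt (real N) * (C * (s N \<omega> + \<kappa> N \<omega>) * s N \<omega>) = \<bar>s N \<omega> + \<kappa> N \<omega>\<bar> * \<bar>C * (sqrt (real N) * s N \<omega>)\<bar>"
          using C by (simp add: s_def \<kappa>_def abs_mult)
        ultimately show ?case by simp
      qed
    qed
  qed
qed

lemma grad_theta_inner: "grad_theta_E f0 f1 \<phi> \<bullet> S N \<omega>
  = - (\<theta>0 / tE) * (padE (transpose (GKk_E f0 f1 \<phi>) *v pair tphi 1) \<bullet> S N \<omega>) - part2 (part1 (S N \<omega>)) $ () / tE"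
  unfolding grad_theta_E_def dtheta_eq pad_colE_mult inner_diff_left inner_scaleR_left tilt_axis padE_inner
  by (simp only: matrix_vector_mult_scaleR inner_scaleR_left) simp

text \<open>The linearised root equation is divided by \<open>tE\<close>, and its parameter
  deviation is replaced by a linear function of \<open>S\<close> through the delta method. The tilt
  coordinate and the moments are thus treated jointly, including their correlation.\<close>

lemma theta_hat_normal: "asymp_normal M (\<lambda>N \<omega>. sqrt (real N) * (theta_hat N \<omega> - \<theta>0))
   (grad_theta_E f0 f1 \<phi> \<bullet> (V *v grad_theta_E f0 f1 \<phi>))"
proof (rule linear_asymp_normal)
  let ?D = "pair tphi 1" and ?g = "transpose (GKk_E f0 f1 \<phi>) *v pair tphi 1"
  have 1: "op1 M (\<lambda>N \<omega>. sqrt (real N) * (?D \<bullet> Kk_map (H N \<omega>) - ?D \<bullet> Kk_map \<eta>0) - padE ?g \<bullet> S N \<omega>)"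
  proof (rule delta_op1)
    show "((\<lambda>\<eta>. ?D \<bullet> Kk_map \<eta>) has_derivative (\<lambda>h. ?D \<bullet> dKk_map \<eta>0 h)) (at \<eta>0)"
      by (rule bounded_linear.has_derivative[OF bounded_linear_inner_right Kk_der])
    show "?D \<bullet> dKk_map \<eta>0 h = ?g \<bullet> h" for h
      by (simp only: transpose_inner GKk_E_def jacobian_mult[OF Kk_der])
  qed measurable
  have 2: "op1 M (\<lambda>N \<omega>. c * T N \<omega>)" if "op1 M T" for c T
    by (rule op1_bound_by_product[OF _ that Op1_const, of _ c]) (auto simp: abs_mult mult.commute intro!: borel_measurable_times op1_measurable[OF that])
  from op1_add[OF 2[OF tilt_remainder_op1, of "1 / tE"] 2[OF 1, of "- (\<theta>0 / tE)"]]
  show "op1 M (\<lambda>N \<omega>. sqrt (real N) * (theta_hat N \<omega> - \<theta>0) - grad_theta_E f0 f1 \<phi> \<bullet> S N \<omega>)"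
  proof (rule back_subst[of "op1 M"], intro ext)
    fix N \<omega>
    show "1 / tE * tilt_remainder N \<omega> + - (\<theta>0 / tE) * (sqrt (real N) * (?D \<bullet> Kk_map (H N \<omega>) - ?D \<bullet> Kk_map \<eta>0) - padE ?g \<bullet> S N \<omega>)
      = sqrt (real N) * (theta_hat N \<omega> - \<theta>0) - grad_theta_E f0 f1 \<phi> \<bullet> S N \<omega>"
      unfolding grad_theta_inner tilt_remainder_def using tE_pos
      by (simp add: eta_maps inner_diff_right field_simps del: part_nth)
  qed
qed measurable

end

subsection \<open>The variance of a sample variance\<close>

context bounded_iid
begin

definition bv :: "('a \<Rightarrow> real) \<Rightarrow> bool" where
  "bv h \<longleftrightarrow> h \<in> borel_measurable M \<and> (\<exists>B. \<forall>\<omega>. \<bar>h \<omega>\<bar> \<le> B)"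

lemma bv_integrable: assumes "bv h" shows "integrable M h"
proof -
  obtain B where "\<And>\<omega>. \<bar>h \<omega>\<bar> \<le> B" using assms by (auto simp: bv_def)
  then show ?thesis using assms by (intro integrable_const_bound[where B=B]) (auto simp: bv_def)
qed

lemma bv_const: "bv (\<lambda>\<omega>. c)"
  unfolding bv_def by (intro conjI exI[of _ "\<bar>c\<bar>"]) auto

lemma bv_add: assumes "bv g" "bv h" shows "bv (\<lambda>\<omega>. g \<omega> + h \<omega>)"
proof -
  obtain A B where "\<And>\<omega>. \<bar>g \<omega>\<bar> \<le> A" "\<And>\<omega>. \<bar>h \<omega>\<bar> \<le> B" using assms by (auto simp: bv_def)
  then have "\<bar>g \<omega> + h \<omega>\<bar> \<le> A + B" for \<omega> by (meson abs_triangle_ineq add_mono order_trans)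
  then show ?thesis using assms by (auto simp: bv_def)
qed

lemma bv_mult: assumes "bv g" "bv h" shows "bv (\<lambda>\<omega>. g \<omega> * h \<omega>)"
proof -
  obtain A B where AB: "\<And>\<omega>. \<bar>g \<omega>\<bar> \<le> A" "\<And>\<omega>. \<bar>h \<omega>\<bar> \<le> B" using assms by (auto simp: bv_def)
  have "0 \<le> A" using order_trans[OF abs_ge_zero AB(1)] .
  then have "\<bar>g \<omega> * h \<omega>\<bar> \<le> A * B" for \<omega> unfolding abs_mult using AB by (auto intro!: mult_mono)
  then show ?thesis using assms by (auto simp: bv_def)
qed

lemma bv_power: "bv h \<Longrightarrow> bv (\<lambda>\<omega>. h \<omega> ^ n)"
  by (induction n) (auto intro: bv_const bv_mult)

lemma bv_sum: "(\<And>j. j \<in> I \<Longrightarrow> bv (h j)) \<Longrightarrow> bv (\<lambda>\<omega>. \<Sum>j\<in>I. h j \<omega>)"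
  by (induction I rule: infinite_finite_induct) (auto intro: bv_const bv_add)

lemma bv_sample: assumes "bm h" shows "bv (\<lambda>\<omega>. h (X j \<omega>))"
proof -
  obtain B where "\<And>x. norm (h x) \<le> B" using bm_bound[OF assms] by blast
  moreover have "(\<lambda>\<omega>. h (X j \<omega>)) \<in> borel_measurable M"
    using bm_measurable[OF assms] by measurable
  ultimately show ?thesis by (auto simp: bv_def)
qed

text \<open>A function of the first N observations is independent of the next one, so the factor
  \<open>q\<close> splits off. Passing to a function of the restricted sample puts the statement
  into the form required for independence of disjoint blocks.\<close>

lemma expectation_next:
  assumes F[measurable]: "F \<in> borel_measurable (Pi\<^sub>M {..<N} (\<lambda>_. borel))" and q: "bm q"
    and FX: "bv (\<lambda>\<omega>. F (restrict (\<lambda>j. X j \<omega>) {..<N}))"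
  shows "expectation (\<lambda>\<omega>. F (restrict (\<lambda>j. X j \<omega>) {..<N}) * q (X N \<omega>))
    = expectation (\<lambda>\<omega>. F (restrict (\<lambda>j. X j \<omega>) {..<N})) * expct f q"
proof -
  note [measurable] = bm_measurable[OF q]
  have "indep_vars (\<lambda>_. borel) X UNIV" using iid by (simp add: iid_sample_def)
  then have "indep_var (Pi\<^sub>M {..<N} (\<lambda>_. borel)) (\<lambda>\<omega>. restrict (\<lambda>j. X j \<omega>) {..<N})
    (Pi\<^sub>M {N} (\<lambda>_. borel)) (\<lambda>\<omega>. restrict (\<lambda>j. X j \<omega>) {N})"
    by (rule indep_var_restrict) auto
  from indep_var_compose[OF this F, of "\<lambda>x. q (x N)" borel]
  have "indep_var borel (\<lambda>\<omega>. F (restrict (\<lambda>j. X j \<omega>) {..<N})) borel (\<lambda>\<omega>. q (X N \<omega>))"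
    by (simp add: comp_def)
  from indep_var_lebesgue_integral[OF this bv_integrable[OF FX] bv_integrable[OF bv_sample[OF q]]]
  show ?thesis by (simp add: X_expectation bm_measurable[OF q])
qed

context
  fixes g :: "real \<Rightarrow> real"
  assumes g: "bm g" and g_mean: "expct f g = 0"
begin

private definition T where "T N \<omega> = (\<Sum>j<N. g (X j \<omega>))"
private definition S where "S N \<omega> = (\<Sum>j<N. (g (X j \<omega>))\<^sup>2)"
text \<open>Mixed moments of the sum and the sum of squares. In the recursion on N the system closes
  for weights a + 2 c up to 4: the moments that are never computed occur only multiplied by the zero
  mean of \<open>g\<close>.\<close>

private definition A where "A a c N = expectation (\<lambda>\<omega>. T N \<omega> ^ a * S N \<omega> ^ c)"
private definition \<sigma> where "\<sigma> = expct f (\<lambda>x. (g x)\<^sup>2)"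
private definition \<mu>4 where "\<mu>4 = expct f (\<lambda>x. (g x) ^ 4)"

private lemma bv_TS: "bv (T N)" "bv (S N)" "bv (\<lambda>\<omega>. g (X N \<omega>))"
  unfolding T_def S_def by (intro bv_sum bv_power bv_sample g)+

private lemma bvs: "bv (\<lambda>\<omega>. T N \<omega> ^ a * S N \<omega> ^ c)" "bv (\<lambda>\<omega>. T N \<omega> ^ a * S N \<omega> ^ c * g (X N \<omega>) ^ d)"
  by (intro bv_mult bv_power bv_TS)+

private lemma E_next: "expectation (\<lambda>\<omega>. T N \<omega> ^ a * S N \<omega> ^ c * g (X N \<omega>) ^ d) = A a c N * expct f (\<lambda>x. g x ^ d)"
proof -
  note [measurable] = bm_measurable[OF g]
  define F where "F x = (\<Sum>j<N. g (x j)) ^ a * (\<Sum>j<N. (g (x j))\<^sup>2) ^ c" for x :: "nat \<Rightarrow> real"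
  have F: "F \<in> borel_measurable (Pi\<^sub>M {..<N} (\<lambda>_. borel))" unfolding F_def by measurable
  have e: "F (restrict (\<lambda>j. X j \<omega>) {..<N}) = T N \<omega> ^ a * S N \<omega> ^ c" for \<omega>
    by (simp add: F_def T_def S_def)
  from expectation_next[OF F bm_power[OF g, of d]] show ?thesis
    unfolding e using bvs by (simp add: A_def)
qed

private lemma sq: "expct f (\<lambda>x. g x * g x) = \<sigma>" by (simp add: \<sigma>_def power2_eq_square)

private lemma E_const: "expct f (\<lambda>x. 1) = (1::real)" by (rule expct_const[OF dens])

private lemma TS_Suc: "T (Suc N) \<omega> = T N \<omega> + g (X N \<omega>)" "S (Suc N) \<omega> = S N \<omega> + (g (X N \<omega>))\<^sup>2"
  by (simp_all add: T_def S_def)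

text \<open>The list encodes a polynomial as monomials: coefficient, power of the sum, power of the
  sum of squares, power of the next observation. Each induction step and the final variance reduce
  to one polynomial identity checked by simplification.\<close>

private lemma E4:
  assumes "\<And>\<omega>. h \<omega> = (\<Sum>(k, a, c, d)\<leftarrow>L. k * (T N \<omega> ^ a * S N \<omega> ^ c * g (X N \<omega>) ^ d))"
  shows "expectation h = (\<Sum>(k, a, c, d)\<leftarrow>L. k * (A a c N * expct f (\<lambda>x. g x ^ d)))"
proof -
  have "integrable M (\<lambda>\<omega>. \<Sum>(k, a, c, d)\<leftarrow>L. k * (T N \<omega> ^ a * S N \<omega> ^ c * g (X N \<omega>) ^ d)) \<and>
    expectation (\<lambda>\<omega>. \<Sum>(k, a, c, d)\<leftarrow>L. k * (T N \<omega> ^ a * S N \<omega> ^ c * g (X N \<omega>) ^ d))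
    = (\<Sum>(k, a, c, d)\<leftarrow>L. k * (A a c N * expct f (\<lambda>x. g x ^ d)))"
  proof (induction L)
    case (Cons p L)
    obtain k a c d where p: "p = (k, a, c, d)" by (cases p) auto
    have i: "integrable M (\<lambda>\<omega>. k * (T N \<omega> ^ a * S N \<omega> ^ c * g (X N \<omega>) ^ d))"
      by (intro integrable_mult_right bv_integrable bvs)
    have "expectation (\<lambda>\<omega>. k * (T N \<omega> ^ a * S N \<omega> ^ c * g (X N \<omega>) ^ d)) = k * (A a c N * expct f (\<lambda>x. g x ^ d))"
      by (simp add: E_next)
    with i Cons show ?case by (simp add: p)
  qed simp
  moreover have "h = (\<lambda>\<omega>. \<Sum>(k, a, c, d)\<leftarrow>L. k * (T N \<omega> ^ a * S N \<omega> ^ c * g (X N \<omega>) ^ d))"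
    using assms by (intro ext)
  ultimately show ?thesis by simp
qed

private lemma A_0: "A a c 0 = 0 ^ a * 0 ^ c" by (simp add: A_def T_def S_def prob_space)

private lemma A_00: "A 0 0 N = 1" by (simp add: A_def prob_space)

private lemma A_10: "A 1 0 N = 0"
proof (induction N)
  case (Suc N)
  have "A 1 0 (Suc N) = (\<Sum>(k, a, c, d)\<leftarrow>[(1,1,0,0),(1,0,0,1)]. k * (A a c N * expct f (\<lambda>x. g x ^ d)))"
    unfolding A_def[of 1 0 "Suc N"] by (rule E4) (simp add: TS_Suc)
  with Suc show ?case by (simp add: g_mean E_const)
qed (simp add: A_0)

private lemma A_20: "A 2 0 N = real N * \<sigma>"
proof (induction N)
  case (Suc N)
  have "A 2 0 (Suc N) = (\<Sum>(k, a, c, d)\<leftarrow>[(1,2,0,0),(2,1,0,1),(1,0,0,2)]. k * (A a c N * expct f (\<lambda>x. g x ^ d)))"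
    unfolding A_def[of 2 0 "Suc N"] by (rule E4) (simp add: TS_Suc power2_eq_square algebra_simps)
  with Suc show ?case by (simp add: g_mean E_const A_00 A_10 \<sigma>_def[symmetric] algebra_simps)
qed (simp add: A_0)

private lemma A_01: "A 0 1 N = real N * \<sigma>"
proof (induction N)
  case (Suc N)
  have "A 0 1 (Suc N) = (\<Sum>(k, a, c, d)\<leftarrow>[(1,0,1,0),(1,0,0,2)]. k * (A a c N * expct f (\<lambda>x. g x ^ d)))"
    unfolding A_def[of 0 1 "Suc N"] by (rule E4) (simp add: TS_Suc)
  with Suc show ?case by (simp add: E_const A_00 \<sigma>_def[symmetric] algebra_simps)
qed (simp add: A_0)

private lemma A_02: "A 0 2 N = real N * \<mu>4 + real N * (real N - 1) * \<sigma>\<^sup>2"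
proof (induction N)
  case (Suc N)
  have "A 0 2 (Suc N) = (\<Sum>(k, a, c, d)\<leftarrow>[(1,0,2,0),(2,0,1,2),(1,0,0,4)]. k * (A a c N * expct f (\<lambda>x. g x ^ d)))"
    unfolding A_def[of 0 2 "Suc N"] by (rule E4) (simp add: TS_Suc power2_eq_square power4_eq_xxxx algebra_simps)
  with Suc show ?case
    by (simp add: E_const A_00 A_01[simplified] \<sigma>_def[symmetric] \<mu>4_def[symmetric] sq algebra_simps power2_eq_square)
qed (simp add: A_0)

private lemma A_21: "A 2 1 N = real N * \<mu>4 + real N * (real N - 1) * \<sigma>\<^sup>2"
proof (induction N)
  case (Suc N)
  have "A 2 1 (Suc N) = (\<Sum>(k, a, c, d)\<leftarrow>[(1,2,1,0),(2,1,1,1),(1,0,1,2),(1,2,0,2),(2,1,0,3),(1,0,0,4)].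
      k * (A a c N * expct f (\<lambda>x. g x ^ d)))"
    unfolding A_def[of 2 1 "Suc N"]
    by (rule E4) (simp add: TS_Suc power2_eq_square power3_eq_cube power4_eq_xxxx algebra_simps)
  with Suc show ?case
    by (simp add: E_const A_00 A_01[simplified] A_10[simplified] A_20 g_mean \<sigma>_def[symmetric] \<mu>4_def[symmetric] sq algebra_simps power2_eq_square)
qed (simp add: A_0)

private lemma A_40: "A 4 0 N = real N * \<mu>4 + 3 * real N * (real N - 1) * \<sigma>\<^sup>2"
proof (induction N)
  case (Suc N)
  have "A 4 0 (Suc N) = (\<Sum>(k, a, c, d)\<leftarrow>[(1,4,0,0),(4,3,0,1),(6,2,0,2),(4,1,0,3),(1,0,0,4)].
      k * (A a c N * expct f (\<lambda>x. g x ^ d)))"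
    unfolding A_def[of 4 0 "Suc N"]
    by (rule E4) (simp add: TS_Suc power2_eq_square power3_eq_cube power4_eq_xxxx algebra_simps)
  with Suc show ?case
    by (simp add: E_const A_00 A_10[simplified] A_20 g_mean \<sigma>_def[symmetric] \<mu>4_def[symmetric] sq algebra_simps power2_eq_square)
qed (simp add: A_0)

text \<open>\<open>W\<close> is the sum of squares about the sample mean. Its square is a
  combination of the moments of types (0,2), (2,1) and (4,0), for which the recursion has closed
  forms.\<close>

lemma sum_of_squares_variance:
  assumes N: "N > 0"
  defines "W \<equiv> \<lambda>\<omega>. (\<Sum>j<N. (g (X j \<omega>))\<^sup>2) - (\<Sum>j<N. g (X j \<omega>))\<^sup>2 / real N"
  shows "expectation (\<lambda>\<omega>. (W \<omega> - expectation W)\<^sup>2)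
    = ((real N - 1)\<^sup>2 * (expct f (\<lambda>x. (g x) ^ 4) - (expct f (\<lambda>x. (g x)\<^sup>2))\<^sup>2)
       + 2 * (real N - 1) * (expct f (\<lambda>x. (g x)\<^sup>2))\<^sup>2) / real N"
proof -
  have W: "W \<omega> = S N \<omega> - (T N \<omega>)\<^sup>2 / real N" for \<omega> by (simp add: W_def S_def T_def)
  have "expectation W = (\<Sum>(k, a, c, d)\<leftarrow>[(1,0,1,0),(- 1 / real N,2,0,0)]. k * (A a c N * expct f (\<lambda>x. g x ^ d)))"
    by (rule E4) (simp add: W)
  then have E1: "expectation W = (real N - 1) * \<sigma>"
    using N by (simp add: E_const A_01[simplified] A_20 field_simps)
  have "expectation (\<lambda>\<omega>. (W \<omega> - expectation W)\<^sup>2) = (\<Sum>(k, a, c, d)\<leftarrow>[(1,0,2,0),(- 2 / real N,2,1,0),(1 / (real N)\<^sup>2,4,0,0),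
      (- 2 * expectation W,0,1,0),(2 * expectation W / real N,2,0,0),((expectation W)\<^sup>2,0,0,0)].
      k * (A a c N * expct f (\<lambda>x. g x ^ d)))"
    by (rule E4) (use N in \<open>simp add: W power2_eq_square power4_eq_xxxx field_simps\<close>)
  also have "\<dots> = A 0 2 N - 2 / real N * A 2 1 N + A 4 0 N / (real N)\<^sup>2 - 2 * expectation W * A 0 1 N
      + 2 * expectation W / real N * A 2 0 N + (expectation W)\<^sup>2"
    by (simp add: E_const A_00)
  also have "\<dots> = ((real N - 1)\<^sup>2 * (\<mu>4 - \<sigma>\<^sup>2) + 2 * (real N - 1) * \<sigma>\<^sup>2) / real N"
    unfolding E1 A_02 A_21 A_40 A_01 A_20 using N by (simp add: field_simps power2_eq_square)
  finally show ?thesis by (simp add: \<mu>4_def \<sigma>_def)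
qed

end

lemma sample_variance_std_dev:
  fixes \<phi> :: "real \<Rightarrow> real^('s::{finite,linorder})"
  assumes \<phi>: "bm \<phi>" and \<delta>: "\<delta> \<in> {0, 1}" and N: "2 \<le> N"
  shows "std_dev M (\<lambda>\<omega>. sample_cov \<delta> \<phi> (\<lambda>j. X j \<omega>) N $ i $ i)
    = sqrt (((real N - 1)\<^sup>2 * (expct f (\<lambda>x. (\<phi> x $ i - expct f \<phi> $ i) ^ 4) - (expct f (\<lambda>x. (\<phi> x $ i - expct f \<phi> $ i)\<^sup>2))\<^sup>2)
       + 2 * (real N - 1) * (expct f (\<lambda>x. (\<phi> x $ i - expct f \<phi> $ i)\<^sup>2))\<^sup>2) / real N) / (real N - real \<delta>)"
proof -
  define g where "g x = \<phi> x $ i - expct f \<phi> $ i" for x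
  have g: "bm g" unfolding g_def by (intro bm_intros \<phi>)
  have gm: "expct f g = 0"
    unfolding g_def using dens \<phi> by (simp add: expct_add bm_nth bm_const expct_const expct_nth)
  define W where "W \<omega> = (\<Sum>j<N. (g (X j \<omega>))\<^sup>2) - (\<Sum>j<N. g (X j \<omega>))\<^sup>2 / real N" for \<omega>
  define r where "r = 1 / (real N - real \<delta>)"
  have N0: "N > 0" using N by simp
  have cov: "sample_cov \<delta> \<phi> (\<lambda>j. X j \<omega>) N $ i $ i = r * W \<omega>" for \<omega>
  proof -
    have m: "sample_mean \<phi> (\<lambda>j. X j \<omega>) N $ i - expct f \<phi> $ i = (\<Sum>j<N. g (X j \<omega>)) / real N"
      using N by (simp add: sample_mean_def g_def sum_subtractf field_simps)
    have "sample_cov \<delta> \<phi> (\<lambda>j. X j \<omega>) N $ i $ i = (real N / (real N - real \<delta>)) *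
      ((\<Sum>j<N. (g (X j \<omega>))\<^sup>2) / real N - (sample_mean \<phi> (\<lambda>j. X j \<omega>) N $ i - expct f \<phi> $ i)\<^sup>2)"
      unfolding sample_cov_eq[OF N0, of \<delta> \<phi> _ "expct f \<phi>"] by (simp add: g_def power2_eq_square)
    also have "\<dots> = (1 / (real N - real \<delta>)) * (real N * ((\<Sum>j<N. (g (X j \<omega>))\<^sup>2) / real N - ((\<Sum>j<N. g (X j \<omega>)) / real N)\<^sup>2))"
      unfolding m by simp
    also have "real N * ((\<Sum>j<N. (g (X j \<omega>))\<^sup>2) / real N - ((\<Sum>j<N. g (X j \<omega>)) / real N)\<^sup>2) = W \<omega>"
      using N by (simp add: W_def field_simps power2_eq_square)
    finally show ?thesis by (simp add: r_def)
  qed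
  define E where "E = expectation (\<lambda>\<omega>. (W \<omega> - expectation W)\<^sup>2)"
  have r: "r > 0" using N \<delta> by (auto simp: r_def)
  have "expectation (\<lambda>\<omega>. (r * W \<omega> - expectation (\<lambda>\<omega>. r * W \<omega>))\<^sup>2) = r\<^sup>2 * E"
    by (simp add: E_def right_diff_distrib[symmetric] power_mult_distrib)
  then have "std_dev M (\<lambda>\<omega>. sample_cov \<delta> \<phi> (\<lambda>j. X j \<omega>) N $ i $ i) = r * sqrt E"
    unfolding std_dev_def cov using r by (simp add: real_sqrt_mult)
  then show ?thesis
    unfolding E_def W_def[abs_def] sum_of_squares_variance[OF g gm N0] by (simp add: g_def r_def)
qed

end

subsection \<open>The relative standard error of a sample variance\<close>

text \<open>The error factors into (N - 1) / (N - \<open>\<delta>\<close>), which differs from 1 by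
  at most 1 / N, and the root of (\<open>\<gamma>\<close> + 2) / N + 2 / (N (N - 1)). By
  subadditivity of the root the second summand adds at most \<open>c N\<close>, of exact order 1 /
  N, and it is all that remains when the first vanishes.\<close>

lemma relative_standard_error_asymptotics:
  fixes \<gamma> :: real and \<delta> :: nat and rse :: "nat \<Rightarrow> real"
  assumes \<gamma>: "0 \<le> \<gamma> + 2" and \<delta>: "\<delta> \<in> {0, 1}"
    and rse: "\<And>N. 2 \<le> N \<Longrightarrow> rse N = sqrt (((real N - 1)\<^sup>2 * (\<gamma> + 2) + 2 * (real N - 1)) / real N) / (real N - real \<delta>)"
  shows "(\<lambda>N. rse N - sqrt ((\<gamma> + 2) / real N)) \<in> O(\<lambda>N. 1 / real N)"
    and "\<gamma> = - 2 \<Longrightarrow> rse \<in> \<Theta>(\<lambda>N. 1 / real N)"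
proof -
  define c where "c N = sqrt (2 / (real N * (real N - 1)))" for N :: nat
  define f where "f N = (real N - 1) / (real N - real \<delta>)" for N :: nat
  have form: "rse N = f N * sqrt ((\<gamma> + 2) / real N + 2 / (real N * (real N - 1)))" if N: "2 \<le> N" for N
  proof -
    have "((real N - 1)\<^sup>2 * (\<gamma> + 2) + 2 * (real N - 1)) / real N
      = (real N - 1)\<^sup>2 * ((\<gamma> + 2) / real N + 2 / (real N * (real N - 1)))"
      using N by (simp add: field_simps power2_eq_square)
    then have "sqrt (((real N - 1)\<^sup>2 * (\<gamma> + 2) + 2 * (real N - 1)) / real N)
      = (real N - 1) * sqrt ((\<gamma> + 2) / real N + 2 / (real N * (real N - 1)))"
      using N by (simp add: real_sqrt_mult)
    then show ?thesis using rse[OF N] by (simp add: f_def)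
  qed
  have f: "1 / 2 \<le> f N" "f N \<le> 1" "1 - f N \<le> 1 / real N" if N: "2 \<le> N" for N
    using N \<delta> by (auto simp: f_def field_simps)
  have c: "1 / real N \<le> c N" "c N \<le> 2 / real N" if N: "2 \<le> N" for N
  proof -
    have "(1 / real N)\<^sup>2 \<le> 2 / (real N * (real N - 1))" "2 / (real N * (real N - 1)) \<le> (2 / real N)\<^sup>2"
      using N by (simp_all add: field_simps power2_eq_square)
    then show "1 / real N \<le> c N" "c N \<le> 2 / real N"
      unfolding c_def by (auto intro: real_le_rsqrt real_le_lsqrt simp: N)
  qed
  show "(\<lambda>N. rse N - sqrt ((\<gamma> + 2) / real N)) \<in> O(\<lambda>N. 1 / real N)"
  \<comment> \<open>The 2 comes from \<open>c N \<le> 2 / N\<close>, the root from the factor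
    \<open>f N\<close>, whose distance from 1 multiplies the leading term.\<close>
  proof (rule bigoI[where c="2 + sqrt (\<gamma> + 2)"])
    show "\<forall>\<^sub>F N in sequentially. norm (rse N - sqrt ((\<gamma> + 2) / real N)) \<le> (2 + sqrt (\<gamma> + 2)) * norm (1 / real N)"
      using eventually_ge_at_top[of 2]
    proof eventually_elim
      case (elim N)
      let ?a = "(\<gamma> + 2) / real N" and ?b = "2 / (real N * (real N - 1))"
      have ab: "0 \<le> ?a" "0 \<le> ?b" using elim \<gamma> by auto
      have s: "sqrt ?a \<le> sqrt (?a + ?b)" "sqrt (?a + ?b) \<le> sqrt ?a + c N"
        using ab sqrt_add_le_add_sqrt[OF ab] by (auto simp: c_def)
      have sa: "sqrt ?a \<le> sqrt (\<gamma> + 2)"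
        using elim \<gamma> mult_left_mono[of 1 "real N" "\<gamma> + 2"] by (intro real_sqrt_le_mono) (simp add: divide_le_eq)
      have "rse N - sqrt ?a \<le> c N"
      proof -
        have "f N * sqrt (?a + ?b) \<le> 1 * sqrt (?a + ?b)" using f[OF elim] ab by (intro mult_right_mono) auto
        then show ?thesis using form[OF elim] s by simp
      qed
      moreover have "sqrt ?a - rse N \<le> 1 / real N * sqrt (\<gamma> + 2)"
      proof -
        have "f N * sqrt ?a \<le> f N * sqrt (?a + ?b)" using f[OF elim] s by (intro mult_left_mono) auto
        then have "sqrt ?a - rse N \<le> (1 - f N) * sqrt ?a" unfolding form[OF elim] by (simp add: algebra_simps)
        also have "\<dots> \<le> 1 / real N * sqrt (\<gamma> + 2)" using f[OF elim] sa ab by (intro mult_mono) auto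
        finally show ?thesis .
      qed
      moreover have "0 \<le> 1 / real N * sqrt (\<gamma> + 2)" "0 \<le> 2 / real N" using \<gamma> by auto
      ultimately have "\<bar>rse N - sqrt ?a\<bar> \<le> 2 / real N + 1 / real N * sqrt (\<gamma> + 2)"
        using c(2)[OF elim] by (simp only: abs_le_iff) linarith
      then show ?case by (simp add: algebra_simps)
    qed
  qed
  show "rse \<in> \<Theta>(\<lambda>N. 1 / real N)" if "\<gamma> = - 2"
  proof (rule bigthetaI')
    show "\<forall>\<^sub>F N in sequentially. 1 / 2 * norm (1 / real N) \<le> norm (rse N) \<and> norm (rse N) \<le> 2 * norm (1 / real N)"
      using eventually_ge_at_top[of 2]
    proof eventually_elim
      case (elim N)
      have eq: "rse N = f N * c N" using form[OF elim] that by (simp add: c_def)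
      have "1 / 2 * (1 / real N) \<le> f N * c N" "f N * c N \<le> 1 * (2 / real N)"
        using f[OF elim] c[OF elim] elim by (intro mult_mono; simp)+
      then show ?case unfolding eq by (simp add: abs_le_iff)
    qed
  qed auto
qed

section \<open>Minimal kurtosis and symmetric two-point laws\<close>

lemma expct_cong_AE:
  fixes g h :: "real \<Rightarrow> 'b::{banach,second_countable_topology}"
  assumes [measurable]: "g \<in> borel_measurable borel" "h \<in> borel_measurable borel"
    and ae: "AE x in law f. g x = h x"
  shows "expct f g = expct f h"
  unfolding expct_def by (rule integral_cong_AE[OF _ _ ae]) auto

context dictionary
begin

lemma variance_moments:
  fixes i
  defines "g \<equiv> \<lambda>x. \<phi> x $ i - u0 $ i"
  shows "bm g" "expct f0 g = 0" "var f0 (\<lambda>x. \<phi> x $ i) = expct f0 (\<lambda>x. (g x)\<^sup>2)" "0 < var f0 (\<lambda>x. \<phi> x $ i)"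
    "excess_kurtosis f0 (\<lambda>x. \<phi> x $ i) + 2
      = (expct f0 (\<lambda>x. (g x) ^ 4) - (var f0 (\<lambda>x. \<phi> x $ i))\<^sup>2) / (var f0 (\<lambda>x. \<phi> x $ i))\<^sup>2"
proof -
  show g: "bm g" unfolding g_def by (intro bm_intros \<phi>_bm)
  show "expct f0 g = 0"
    unfolding g_def using dens0 \<phi>_bm by (simp add: expct_add bm_nth bm_const expct_const expct_nth)
  have u: "expct f0 (\<lambda>x. \<phi> x $ i) = u0 $ i" by (rule expct_nth[OF dens0 \<phi>_bm, symmetric])
  show v: "var f0 (\<lambda>x. \<phi> x $ i) = expct f0 (\<lambda>x. (g x)\<^sup>2)" by (simp add: var_def u g_def)
  have "0 < axis i 1 \<bullet> (C0 *v axis i 1)" by (rule C0_posdef) (simp add: axis_eq_0_iff)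
  also have "\<dots> = expct f0 (\<lambda>x. (g x)\<^sup>2)"
    unfolding cov_quadratic[OF dens0 \<phi>_bm] by (simp add: inner_axis' g_def)
  finally show pos: "0 < var f0 (\<lambda>x. \<phi> x $ i)" by (simp add: v)
  show "excess_kurtosis f0 (\<lambda>x. \<phi> x $ i) + 2
      = (expct f0 (\<lambda>x. (g x) ^ 4) - (var f0 (\<lambda>x. \<phi> x $ i))\<^sup>2) / (var f0 (\<lambda>x. \<phi> x $ i))\<^sup>2"
    unfolding excess_kurtosis_def u g_def using pos by (simp add: field_simps)
qed

text \<open>Because the mean of the squared deviation is \<open>s\<close>, the kurtosis measured
  from -2 is the variance of the squared deviation over \<open>s\<^sup>2\<close>; it is nonnegative,
  and zero only if the squared deviation is almost surely constant.\<close>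

lemma kurtosis_square_deviation:
  fixes i
  defines "g \<equiv> \<lambda>x. \<phi> x $ i - u0 $ i" and "s \<equiv> var f0 (\<lambda>x. \<phi> x $ i)"
  shows "excess_kurtosis f0 (\<lambda>x. \<phi> x $ i) + 2 = expct f0 (\<lambda>x. ((g x)\<^sup>2 - s)\<^sup>2) / s\<^sup>2"
    and "0 \<le> excess_kurtosis f0 (\<lambda>x. \<phi> x $ i) + 2"
    and "excess_kurtosis f0 (\<lambda>x. \<phi> x $ i) = - 2 \<longleftrightarrow> (AE x in law f0. (g x)\<^sup>2 = s)"
proof -
  have vm: "bm g" "s = expct f0 (\<lambda>x. (g x)\<^sup>2)" "0 < s"
    "excess_kurtosis f0 (\<lambda>x. \<phi> x $ i) + 2 = (expct f0 (\<lambda>x. (g x) ^ 4) - s\<^sup>2) / s\<^sup>2"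
    using variance_moments[of i] by (simp_all only: g_def s_def)
  have "expct f0 (\<lambda>x. ((g x)\<^sup>2 - s)\<^sup>2) = expct f0 (\<lambda>x. g x ^ 4 - 2 * s * (g x)\<^sup>2 + s\<^sup>2)"
    by (rule arg_cong[where f="expct f0"]) (simp add: fun_eq_iff power2_eq_square power4_eq_xxxx algebra_simps)
  also have "\<dots> = expct f0 (\<lambda>x. g x ^ 4) - s\<^sup>2"
    using vm(1) vm(2)[symmetric] by (simp add: expct_add dens0 bm_intros expct_cmult expct_const power2_eq_square[of s])
  finally have e: "expct f0 (\<lambda>x. ((g x)\<^sup>2 - s)\<^sup>2) = expct f0 (\<lambda>x. g x ^ 4) - s\<^sup>2" .
  show k: "excess_kurtosis f0 (\<lambda>x. \<phi> x $ i) + 2 = expct f0 (\<lambda>x. ((g x)\<^sup>2 - s)\<^sup>2) / s\<^sup>2"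
    unfolding e by (rule vm(4))
  show "0 \<le> excess_kurtosis f0 (\<lambda>x. \<phi> x $ i) + 2"
    unfolding k by (intro divide_nonneg_nonneg expct_nonneg) auto
  have "excess_kurtosis f0 (\<lambda>x. \<phi> x $ i) = - 2 \<longleftrightarrow> expct f0 (\<lambda>x. ((g x)\<^sup>2 - s)\<^sup>2) = 0"
    using k vm(3) by (metis add_eq_0_iff2 add.right_inverse divide_eq_0_iff less_irrefl power_eq_0_iff neg_eq_iff_add_eq_0)
  also have "\<dots> \<longleftrightarrow> (AE x in law f0. (g x)\<^sup>2 = s)"
    unfolding expct_def using vm(1)
    by (subst integral_nonneg_eq_0_iff_AE) (auto intro!: bm_integrable[OF dens0] bm_intros)
  finally show "excess_kurtosis f0 (\<lambda>x. \<phi> x $ i) = - 2 \<longleftrightarrow> (AE x in law f0. (g x)\<^sup>2 = s)" .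
qed

text \<open>A constant squared deviation leaves two values symmetric about the mean, and the zero
  mean of the deviation equates their probabilities. Conversely, two atoms of mass 1/2 exhaust the
  law, the mean is their midpoint, and the squared deviation is constant.\<close>

lemma kurtosis_two_point:
  "excess_kurtosis f0 (\<lambda>x. \<phi> x $ i) = - 2 \<longleftrightarrow>
    (\<exists>a b. a \<noteq> b \<and> measure (law f0) {x. \<phi> x $ i = a} = 1/2 \<and> measure (law f0) {x. \<phi> x $ i = b} = 1/2)"
proof -
  define g where "g = (\<lambda>x. \<phi> x $ i - u0 $ i)"
  define s where "s = var f0 (\<lambda>x. \<phi> x $ i)"
  have vm: "bm g" "expct f0 g = 0" "s = expct f0 (\<lambda>x. (g x)\<^sup>2)" "0 < s"
    using variance_moments[of i] by (simp_all only: g_def s_def)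
  have ks: "excess_kurtosis f0 (\<lambda>x. \<phi> x $ i) = - 2 \<longleftrightarrow> (AE x in law f0. (g x)\<^sup>2 = s)"
    using kurtosis_square_deviation(3)[of i] by (simp only: g_def s_def)
  have [measurable]: "\<phi> \<in> borel_measurable borel" by (rule bm_measurable[OF \<phi>_bm])
  let ?E = "\<lambda>a. {x. \<phi> x $ i = a}"
  have E[measurable]: "?E a \<in> sets (law f0)" for a
  proof -
    have "{x \<in> space borel. \<phi> x $ i = a} \<in> sets borel" by measurable
    then show ?thesis by simp
  qed
  have ind: "expct f0 (indicator (?E a)) = measure (law f0) (?E a)" for a
    unfolding expct_def by simp
  have bi: "bm (indicator (?E a) :: real \<Rightarrow> real)" for a
    using E[of a] by (intro bmI[where B=1]) (auto simp: indicator_def)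
  show ?thesis
  proof
    assume "excess_kurtosis f0 (\<lambda>x. \<phi> x $ i) = - 2"
    then have ae: "AE x in law f0. (g x)\<^sup>2 = s" by (simp add: ks)
    define r where "r = sqrt s"
    have r: "r > 0" "s = r\<^sup>2" using vm(4) by (simp_all add: r_def)
    let ?a = "u0 $ i + r" and ?b = "u0 $ i - r"
    have two: "AE x in law f0. \<phi> x $ i = ?a \<or> \<phi> x $ i = ?b"
      using ae by eventually_elim (auto simp: r(2) g_def power2_eq_iff)
    have gi: "AE x in law f0. g x = r * indicator (?E ?a) x - r * indicator (?E ?b) x"
      using two by eventually_elim (use r in \<open>auto simp: g_def\<close>)
    have [measurable]: "g \<in> borel_measurable borel" by (rule bm_measurable[OF vm(1)])
    have "expct f0 g = expct f0 (\<lambda>x. r * indicator (?E ?a) x - r * indicator (?E ?b) x)"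
      by (rule expct_cong_AE[OF _ _ gi]) auto
    also have "\<dots> = r * measure (law f0) (?E ?a) - r * measure (law f0) (?E ?b)"
      using bi by (simp add: expct_add dens0 bm_intros expct_cmult ind)
    finally have m: "measure (law f0) (?E ?a) = measure (law f0) (?E ?b)" using vm(2) r by simp
    have "measure (law f0) (?E ?a \<union> ?E ?b) = 1"
      by (rule L.prob_eq_1[THEN iffD2]) (use two in auto)
    moreover have "measure (law f0) (?E ?a \<union> ?E ?b) = measure (law f0) (?E ?a) + measure (law f0) (?E ?b)"
      using r by (intro L.finite_measure_Union) auto
    ultimately have "measure (law f0) (?E ?a) = 1/2" "measure (law f0) (?E ?b) = 1/2" using m by auto
    moreover have "?a \<noteq> ?b" using r by simp
    ultimately show "\<exists>a b. a \<noteq> b \<and> measure (law f0) (?E a) = 1/2 \<and> measure (law f0) (?E b) = 1/2" by blast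
  next
    assume "\<exists>a b. a \<noteq> b \<and> measure (law f0) (?E a) = 1/2 \<and> measure (law f0) (?E b) = 1/2"
    then obtain a b where ab: "a \<noteq> b" "measure (law f0) (?E a) = 1/2" "measure (law f0) (?E b) = 1/2" by blast
    have "measure (law f0) (?E a \<union> ?E b) = measure (law f0) (?E a) + measure (law f0) (?E b)"
      using ab by (intro L.finite_measure_Union) auto
    then have "AE x in law f0. x \<in> ?E a \<union> ?E b"
      using ab by (intro L.prob_eq_1[THEN iffD1]) auto
    then have two: "AE x in law f0. \<phi> x $ i = a \<or> \<phi> x $ i = b" by simp
    have \<phi>i: "AE x in law f0. \<phi> x $ i = a * indicator (?E a) x + b * indicator (?E b) x"
      using two by eventually_elim (use ab in auto)
    have "u0 $ i = expct f0 (\<lambda>x. \<phi> x $ i)" by (rule expct_nth[OF dens0 \<phi>_bm])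
    also have "\<dots> = expct f0 (\<lambda>x. a * indicator (?E a) x + b * indicator (?E b) x)"
      by (rule expct_cong_AE[OF _ _ \<phi>i]) auto
    also have "\<dots> = a * measure (law f0) (?E a) + b * measure (law f0) (?E b)"
      using bi by (simp add: expct_add dens0 bm_intros expct_cmult ind)
    also have "\<dots> = (a + b) / 2" by (simp add: ab(2,3) add_divide_distrib)
    finally have u: "u0 $ i = (a + b) / 2" .
    have sq: "AE x in law f0. (g x)\<^sup>2 = ((a - b) / 2)\<^sup>2"
      using two
    proof eventually_elim
      case (elim x)
      then have "g x = (a - b) / 2 \<or> g x = - ((a - b) / 2)" by (auto simp: g_def u field_simps)
      then show ?case by (metis power2_minus)
    qed
    have [measurable]: "g \<in> borel_measurable borel" by (rule bm_measurable[OF vm(1)])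
    have "s = expct f0 (\<lambda>x. ((a - b) / 2)\<^sup>2)"
      unfolding vm(3) by (rule expct_cong_AE[OF _ _ sq]) auto
    also have "\<dots> = ((a - b) / 2)\<^sup>2" by (rule expct_const[OF dens0])
    finally show "excess_kurtosis f0 (\<lambda>x. \<phi> x $ i) = - 2" unfolding ks using sq by simp
  qed
qed

end

subsection \<open>Local families\<close>

text \<open>The quotient is \<open>quotient_R\<close> for \<open>C\<close> and \<open>B\<close> up
  to the factor 1 / I, so the exact identity applies at \<open>kst\<close>. Maximality is
  semidefiniteness of \<open>Q\<close>, and the relative error is again a scalar factor tending to
  1.\<close>

lemma quotient_maximum_expansion:
  fixes C :: "real^'n^'n" and B :: "real^'n" and I :: real
  assumes sym: "\<And>i j. C $ i $ j = C $ j $ i" and pos: "\<And>v. v \<noteq> 0 \<Longrightarrow> 0 < v \<bullet> (C *v v)"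
    and I: "0 < I" and B: "B \<noteq> 0"
  defines "quot \<equiv> \<lambda>k. (k \<bullet> B)\<^sup>2 / (I * (k \<bullet> (C *v k)))" and "kst \<equiv> matrix_inv C *v B"
    and "\<kappa> \<equiv> (B \<bullet> (matrix_inv C *v B)) / I"
    and "Q \<equiv> C - (1 / (B \<bullet> (matrix_inv C *v B))) *\<^sub>R outer B B"
  shows "kst \<noteq> 0" "quot kst = \<kappa>" "\<And>k. k \<noteq> 0 \<Longrightarrow> quot k \<le> \<kappa>"
    "(\<lambda>d. quot (kst + d) - (\<kappa> - (d \<bullet> (Q *v d)) / I)) \<in> o[at 0](\<lambda>d. (d \<bullet> (Q *v d)) / I)"
proof -
  have CK: "C *v kst = B"
    using matrix_inv_solve[OF posdef_invertible[OF pos]] by (simp add: kst_def)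
  show k0: "kst \<noteq> 0" using CK B by auto
  define j where "j = kst \<bullet> B"
  have j: "j > 0" using pos[OF k0] by (simp add: j_def CK)
  have jB: "B \<bullet> (matrix_inv C *v B) = j" by (simp add: j_def kst_def inner_commute)
  have \<kappa>: "\<kappa> = j / I" by (simp add: \<kappa>_def jB)
  have quot: "quot k = quotient_R B C k / I" for k by (simp add: quot_def quotient_R_def mult.commute)
  have Q: "Q = C - (1 / j) *\<^sub>R outer B B" by (simp add: Q_def jB)
  have exact: "quotient_R B C k = j - ((k - kst) \<bullet> (Q *v (k - kst))) * (j / (k \<bullet> (C *v k)))" if "k \<noteq> 0" for k
    unfolding Q using quotient_R_exact[OF sym CK j_def] j pos[OF that] by simp
  have t: "transpose C = C" by (simp add: transpose_def vec_eq_iff sym[symmetric])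
  have Qd: "d \<bullet> (Q *v d) = d \<bullet> (C *v d) - (d \<bullet> B)\<^sup>2 / j" for d
    unfolding Q by (simp add: matrix_vector_mult_diff_rdistrib scaleR_matrix_vector_assoc[symmetric] outer_mult_vec
        inner_diff_right power2_eq_square inner_commute)
  have Qpsd: "0 \<le> d \<bullet> (Q *v d)" for d
  proof -
    \<comment> \<open>The coefficient of the C-orthogonal projection of \<open>d\<close> on
      \<open>kst\<close>; \<open>Q\<close> at \<open>d\<close> is \<open>C\<close> at the residual,
      hence nonnegative.\<close>
    define r where "r = (d \<bullet> B) / j"
    have kd: "kst \<bullet> (C *v d) = d \<bullet> B" using transpose_inner[of C kst d] by (simp only: t CK inner_commute)
    have "0 \<le> (d - r *\<^sub>R kst) \<bullet> (C *v (d - r *\<^sub>R kst))"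
      using pos[of "d - r *\<^sub>R kst"] by (cases "d - r *\<^sub>R kst = 0") auto
    also have "\<dots> = d \<bullet> (C *v d) - 2 * r * (d \<bullet> B) + r\<^sup>2 * j"
      by (simp add: matrix_vector_mult_diff_distrib matrix_vector_mult_scaleR CK inner_diff_left inner_diff_right kd
          j_def power2_eq_square algebra_simps)
    also have "\<dots> = d \<bullet> (Q *v d)" unfolding Qd using j by (simp add: r_def power2_eq_square field_simps)
    finally show ?thesis .
  qed
  have Q0: "0 \<bullet> (Q *v 0) = 0" by simp
  show "quot kst = \<kappa>" unfolding quot exact[OF k0] \<kappa> by simp
  show "quot k \<le> \<kappa>" if "k \<noteq> 0" for k
  proof -
    have "0 \<le> ((k - kst) \<bullet> (Q *v (k - kst))) * (j / (k \<bullet> (C *v k)))"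
      using Qpsd j pos[OF that] by (intro mult_nonneg_nonneg) auto
    then show ?thesis unfolding quot exact[OF that] \<kappa> using I by (intro divide_right_mono) auto
  qed
  have lim: "((\<lambda>d. j / ((kst + d) \<bullet> (C *v (kst + d)))) \<longlongrightarrow> 1) (at 0)"
  proof -
    have "((\<lambda>d. j / ((kst + d) \<bullet> (C *v (kst + d)))) \<longlongrightarrow> j / ((kst + 0) \<bullet> (C *v (kst + 0)))) (at 0)"
      using j by (intro tendsto_intros bounded_bilinear.tendsto[OF bounded_bilinear_matrix_vector]) (simp add: CK j_def)
    then show ?thesis using j by (simp add: CK j_def)
  qed
  have nz: "\<forall>\<^sub>F d in at 0. kst + d \<noteq> 0"
  proof -
    have "((\<lambda>d. kst + d) \<longlongrightarrow> kst + 0) (at 0)" by (intro tendsto_intros)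
    then show ?thesis using k0 by (intro tendsto_imp_eventually_ne) auto
  qed
  show "(\<lambda>d. quot (kst + d) - (\<kappa> - (d \<bullet> (Q *v d)) / I)) \<in> o[at 0](\<lambda>d. (d \<bullet> (Q *v d)) / I)"
  proof (rule landau_o.smallI)
    fix c :: real assume c: "c > 0"
    from tendstoD[OF lim c] nz
    show "\<forall>\<^sub>F d in at 0. norm (quot (kst + d) - (\<kappa> - (d \<bullet> (Q *v d)) / I)) \<le> c * norm ((d \<bullet> (Q *v d)) / I)"
    proof eventually_elim
      case (elim d)
      define r where "r = j / ((kst + d) \<bullet> (C *v (kst + d)))"
      have "quot (kst + d) - (\<kappa> - (d \<bullet> (Q *v d)) / I) = ((d \<bullet> (Q *v d)) / I) * (1 - r)"
        unfolding quot exact[OF elim(2)] \<kappa> r_def[symmetric] by (simp add: diff_divide_distrib algebra_simps)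
      moreover have "\<bar>1 - r\<bar> \<le> c" using elim(1) by (simp add: dist_real_def r_def abs_minus_commute)
      ultimately show ?case
        by (simp only: real_norm_def abs_mult mult.commute[of _ "\<bar>1 - r\<bar>"] mult_right_mono abs_ge_zero)
    qed
  qed
qed

subsection \<open>A dictionary with non-vanishing efficiency gradient\<close>

text \<open>The labelled density lives on a cell where the dictionary vanishes, whereas every tilt of the
  background keeps charging all cells; hence the tilted and the labelled means differ.\<close>

lemma grad_e_nonzero_example:
  "\<exists>f0 f1 (\<phi> :: real \<Rightarrow> real^('s::{finite,linorder})).
     is_density f0 \<and> is_density f1 \<and> moment_assumption f0 f1 \<phi> \<and> bounded_dictionary \<phi> \<and>
     expct f1 \<phi> - expct f0 \<phi> \<noteq> 0 \<and> KL_finite f1 f0 \<and> grad_e f0 f1 \<phi> \<noteq> 0"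
proof -
  define n where "n = CARD('s)"
  obtain h :: "'s \<Rightarrow> nat" where h: "bij_betw h UNIV {0..<n}"
    using ex_bij_betw_finite_nat[of "UNIV :: 's set"] by (auto simp: n_def)
  have hinj: "h i = h k \<longleftrightarrow> i = k" for i k using h by (auto simp: bij_betw_def inj_on_def)
  have hn: "h i < n" for i using h by (auto simp: bij_betw_def)
  \<comment> \<open>The numbering \<open>h\<close> assigns to the coordinates the unit intervals [1,
    2) to [n, n + 1); [0, 1) is left for the labelled density.\<close>
  define cell where "cell i = {real (h i) + 1 ..< real (h i) + 1 + 1}" for i
  define f0 :: "real \<Rightarrow> real" where "f0 x = indicator {0 ..< real n + 1} x / (real n + 1)" for x :: real
  define f1 :: "real \<Rightarrow> real" where "f1 x = indicator {0 ..< 1} x" for x :: real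
  define \<phi> :: "real \<Rightarrow> real^('s::{finite,linorder})" where "\<phi> x = (\<chi> i. indicator (cell i) x)" for x :: real
  have [measurable]: "cell i \<in> sets borel" for i by (simp add: cell_def)
  have [measurable]: "f0 \<in> borel_measurable borel" "f1 \<in> borel_measurable borel"
    unfolding f0_def f1_def by measurable
  have d0: "is_density f0"
  proof -
    have "(\<integral>\<^sup>+x. ennreal (f0 x) \<partial>lborel) = (\<integral>\<^sup>+x. ennreal (1 / (real n + 1)) * indicator {0 ..< real n + 1} x \<partial>lborel)"
      by (intro nn_integral_cong) (auto simp: f0_def indicator_def)
    also have "\<dots> = ennreal (1 / (real n + 1)) * ennreal (real n + 1)"
      by (subst nn_integral_cmult_indicator) auto
    also have "\<dots> = 1" by (subst ennreal_mult[symmetric]) auto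
    finally show ?thesis by (simp add: is_density_def f0_def)
  qed
  have d1: "is_density f1"
    by (simp add: is_density_def f1_def ennreal_indicator)
  have \<phi>b: "bm \<phi>"
    by (rule bm_vec, rule bmI[where B=1]) (auto simp: \<phi>_def indicator_def)
  have cell_sub: "cell i \<subseteq> {0 ..< real n + 1}" for i using hn[of i] by (auto simp: cell_def)
  have cell_val: "\<phi> x = axis i 1" if "x \<in> cell i" for x i
  proof -
    have "x \<notin> cell k" if "k \<noteq> i" for k
    proof
      assume "x \<in> cell k"
      with \<open>x \<in> cell i\<close> have "real (h k) < real (h i) + 1" "real (h i) < real (h k) + 1" by (auto simp: cell_def)
      then have "h k = h i" by linarith
      with that hinj show False by simp
    qed
    with that show ?thesis by (auto simp: \<phi>_def vec_eq_iff axis_def)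
  qed
  have zero_val: "\<phi> x = 0" if "x \<in> {0 ..< 1}" for x
    using that by (auto simp: \<phi>_def vec_eq_iff cell_def)
  \<comment> \<open>The background density is positive on the whole support, so an almost sure
    property must hold at some point of every unit interval in it.\<close>
  have witness: "\<exists>x\<in>{a ..< a + 1}. R x" if ae: "AE x in law f0. R x" and sub: "{a ..< a + 1} \<subseteq> {0 ..< real n + 1}" for a R
  proof (rule ccontr)
    assume no: "\<not> (\<exists>x\<in>{a ..< a + 1}. R x)"
    have "AE x in lborel. 0 < f0 x \<longrightarrow> R x"
      using ae unfolding law_def by (subst (asm) AE_density) auto
    then have "AE x in lborel. x \<notin> {a ..< a + 1}"
      by eventually_elim (use no sub in \<open>auto simp: f0_def\<close>)
    then have "emeasure lborel {a ..< a + 1} = 0"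
      by (subst (asm) AE_iff_measurable[of "{a ..< a + 1}"]) auto
    moreover have "emeasure lborel {a ..< a + 1} = 1" by simp
    ultimately show False by simp
  qed
  have pd: "0 < v \<bullet> (cov f0 \<phi> *v v)" if "v \<noteq> 0" for v
  proof (rule ccontr)
    assume "\<not> ?thesis"
    then have "expct f0 (\<lambda>x. (v \<bullet> (\<phi> x - expct f0 \<phi>))\<^sup>2) = 0"
      using cov_psd[OF d0 \<phi>b, of v] cov_quadratic[OF d0 \<phi>b, of v] by simp
    then have "AE x in law f0. (v \<bullet> (\<phi> x - expct f0 \<phi>))\<^sup>2 = 0"
      unfolding expct_def
      by (subst (asm) integral_nonneg_eq_0_iff_AE) (auto intro!: bm_integrable[OF d0] bm_intros \<phi>b)
    then have ae: "AE x in law f0. v \<bullet> \<phi> x = v \<bullet> expct f0 \<phi>" by (simp add: inner_diff_right)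
    obtain x where "x \<in> {0 ..< 0 + 1}" "v \<bullet> \<phi> x = v \<bullet> expct f0 \<phi>"
      using witness[OF ae, of 0] by auto
    then have z: "v \<bullet> expct f0 \<phi> = 0" using zero_val by simp
    \<comment> \<open>On cell i the dictionary is the i-th unit vector, on [0, 1) it is 0; the
      almost sure constant value of \<open>v \<bullet> \<phi> x\<close> is therefore both
      \<open>v $ i\<close> and 0.\<close>
    have "v $ i = 0" for i
    proof -
      have "{real (h i) + 1 ..< real (h i) + 1 + 1} \<subseteq> {0 ..< real n + 1}" using hn[of i] by auto
      from witness[OF ae this] obtain x where x: "x \<in> cell i" "v \<bullet> \<phi> x = v \<bullet> expct f0 \<phi>"
        by (auto simp only: cell_def)
      then show ?thesis using z cell_val[OF x(1)] by (simp add: inner_axis)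
    qed
    with that show False by (simp add: vec_eq_iff)
  qed
  have m: "moment_assumption f0 f1 \<phi>"
    unfolding moment_assumption_def
  proof (intro conjI allI impI pd)
    show "\<phi> \<in> borel_measurable borel" by (rule bm_measurable[OF \<phi>b])
    show "integrable (law f0) (\<lambda>x. (\<phi> x $ i)\<^sup>2)" "integrable (law f1) (\<lambda>x. (\<phi> x $ i)\<^sup>2)" for i
      by (intro bm_integrable d0 d1 bm_intros \<phi>b)+
    show "f1 x = 0" if "f0 x = 0" for x using that by (auto simp: f0_def f1_def indicator_def split: if_splits)
  qed
  have bd: "bounded_dictionary \<phi>"
    unfolding bounded_dictionary_def by (intro exI[of _ 1]) (auto simp: \<phi>_def indicator_def)
  have u1: "expct f1 \<phi> = 0"
  proof -
    have "AE x in law f1. \<phi> x = 0"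
      unfolding law_def by (subst AE_density) (auto simp: f1_def indicator_def zero_val)
    then have "expct f1 \<phi> = (\<integral>x. 0 \<partial>law f1)"
      unfolding expct_def using bm_measurable[OF \<phi>b] by (intro integral_cong_AE) auto
    then show ?thesis by simp
  qed
  \<comment> \<open>Used with the weight 1 for the background mean and with the exponential weight
    for the tilted mean.\<close>
  have pos: "0 < expct f0 (\<lambda>x. w x * \<phi> x $ i)" if w: "bm w" "\<And>x. 0 < w x" for w i
  proof -
    have "expct f0 (\<lambda>x. w x * \<phi> x $ i) \<noteq> 0"
    proof
      assume "expct f0 (\<lambda>x. w x * \<phi> x $ i) = 0"
      moreover have "integrable (law f0) (\<lambda>x. w x * \<phi> x $ i)"
        by (intro bm_integrable d0 bm_intros \<phi>b w(1))
      moreover have "0 \<le> w x * \<phi> x $ i" for x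
        using w(2)[THEN less_imp_le] by (simp add: \<phi>_def)
      ultimately have "AE x in law f0. w x * \<phi> x $ i = 0"
        unfolding expct_def by (subst (asm) integral_nonneg_eq_0_iff_AE) auto
      then have ae: "AE x in law f0. \<phi> x $ i = 0" by eventually_elim (use w(2) in \<open>simp add: less_imp_neq[symmetric]\<close>)
      have "{real (h i) + 1 ..< real (h i) + 1 + 1} \<subseteq> {0 ..< real n + 1}" using hn[of i] by auto
      from witness[OF ae this] obtain x where x: "x \<in> cell i" "\<phi> x $ i = 0"
        by (auto simp only: cell_def)
      then show False using cell_val[OF x(1)] by simp
    qed
    moreover have "0 \<le> expct f0 (\<lambda>x. w x * \<phi> x $ i)"
      using w(2)[THEN less_imp_le] by (intro expct_nonneg) (auto simp: \<phi>_def)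
    ultimately show ?thesis by simp
  qed
  obtain i :: 's where True by simp
  have Y: "expct f1 \<phi> - expct f0 \<phi> \<noteq> 0"
  proof
    assume "expct f1 \<phi> - expct f0 \<phi> = 0"
    then have "expct f0 \<phi> $ i = 0" by (simp add: u1)
    then show False using pos[of "\<lambda>_. 1" i] by (simp add: expct_nth[OF d0 \<phi>b] bm_const)
  qed
  have kl: "KL_finite f1 f0"
  proof -
    have "(\<lambda>x. f1 x * ln (f1 x / f0 x)) = (\<lambda>x. ln (real n + 1) * indicator {0 ..< 1} x)"
      by (auto simp: f0_def f1_def indicator_def fun_eq_iff)
    then show ?thesis unfolding KL_finite_def by simp
  qed
  interpret dictionary f0 f1 \<phi>
    by standard (fact d0 d1 m bd Y)+
  have "tilt_expct f0 f1 \<phi> \<phi> $ i > 0"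
  proof -
    have "bm (\<lambda>x. exp (\<theta>0 * \<Lambda> x))" by (intro bm_intros Lam_bm)
    from pos[OF this] show ?thesis
      unfolding tilt_expct_def expct_nth[OF d0 tilt_bm[OF \<phi>b]] by simp
  qed
  then have "grad_e f0 f1 \<phi> \<noteq> 0"
    using grad_e_eq_0_iff[OF kl] u1 by auto
  with d0 d1 m bd Y kl show ?thesis by blast
qed

subsection \<open>Asymptotic covariances\<close>

lemma matrix_eq_bilinear:
  fixes A B :: "real^'n^'m"
  assumes "\<And>s t. s \<bullet> (A *v t) = s \<bullet> (B *v t)"
  shows "A = B"
  unfolding matrix_eq using assms by (blast intro: vector_eq_ldot[THEN iffD1])

lemma col_block1_mult: "col_block1 A *v h = A *v join h 0"
  by (simp add: vec_eq_iff matrix_vector_mul_component col_block1_def inner_jvec)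

lemma part_transpose_mult:
  "part1 (transpose A *v t) = transpose (col_block1 A) *v t"
  "part2 (transpose A *v t) = transpose (col_block2 A) *v t"
  by (simp_all add: vec_eq_iff vector_matrix_mult_def col_block1_def col_block2_def)

lemma pad_colM_mult: "transpose (pad_colM A) *v t = padM (transpose A *v t)"
proof -
  have "part1 (transpose (pad_colM A) *v t) = transpose A *v t" "part2 (transpose (pad_colM A) *v t) = 0"
    by (simp_all add: vec_eq_iff vector_matrix_mult_def pad_colM_def padM_def)
  then show ?thesis by (simp only: jvec_eq_iff padM_def part1_join part2_join)
qed

lemma part1_padE: "part1 (padE g) = padM (part1 g)" and part2_padE: "part2 (padE g) = part2 g"
  by (simp_all add: padE_def padM_def)

lemma has_derivative_join:
  assumes "(f has_derivative D) (at (join a b))"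
  shows "((\<lambda>\<eta>. f (join \<eta> b)) has_derivative (\<lambda>h. D (join h 0))) (at a)"
proof -
  have "((\<lambda>\<eta>. join \<eta> 0 + join 0 b) has_derivative (\<lambda>h. join h 0)) (at a)"
    by (intro has_derivative_add_const bounded_linear_imp_has_derivative bounded_linear_join1)
  then have "((\<lambda>\<eta>. join \<eta> b) has_derivative (\<lambda>h. join h 0)) (at a)" by (simp add: join_linear)
  from diff_chain_at[OF this assms] show ?thesis by (simp add: comp_def)
qed

text \<open>Freezing the second block keeps the corresponding columns, so each mode (M) Jacobian is
  the first column block of the mode (E) one.\<close>

lemma jacobian_join:
  fixes f :: "('a::finite, 'b::finite) jvec \<Rightarrow> real^'m"
  assumes "(f has_derivative D) (at (join a b))"
  shows "jacobian (\<lambda>\<eta>. f (join \<eta> b)) (at a) = col_block1 (jacobian f (at (join a b)))"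
  unfolding matrix_eq col_block1_mult jacobian_mult[OF assms] jacobian_mult[OF has_derivative_join[OF assms]] by simp

lemma gradient_join:
  fixes f :: "('a::finite, 'b::finite) jvec \<Rightarrow> real"
  assumes "(f has_derivative D) (at (join a b))"
  shows "gradient (\<lambda>\<eta>. f (join \<eta> b)) a = part1 (gradient f (join a b))"
proof (rule vector_eq_rdot[THEN iffD1], rule allI)
  fix h
  have "part1 (gradient f (join a b)) \<bullet> h = gradient f (join a b) \<bullet> join h 0" by (simp add: inner_jvec)
  then show "gradient (\<lambda>\<eta>. f (join \<eta> b)) a \<bullet> h = part1 (gradient f (join a b)) \<bullet> h"
    by (simp only: gradient_inner[OF assms] gradient_inner[OF has_derivative_join[OF assms]])
qed

lemma mom_0[simp]: "mom_u 0 = 0" "mom_C 0 = 0"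
  by (simp_all add: mom_u_def mom_C_def unvech_def vec_eq_iff)

lemma expct_law_cong: "law f = law g \<Longrightarrow> expct f h = expct g h"
  by (simp add: expct_def)

lemma cov_law_cong: "law f = law g \<Longrightarrow> cov f h = cov g h"
  by (simp add: cov_def expct_def)

text \<open>Makes precise that in mode (M) the covariance is a functional of the calibration law:
  the labelled density enters, also through the tilt parameter, only by its known mean and
  covariance.\<close>

lemma Sigma_M_law_cong:
  assumes "law f0' = law f0" "expct f1' \<phi> = expct f1 \<phi>" "cov f1' \<phi> = cov f1 \<phi>"
  shows "Sigma_M f0' f1' \<phi> = Sigma_M f0 f1 \<phi>"
  unfolding Sigma_M_def G_M_def V0_def Z0_def Zc_def eta_def theta0_def Lam_def[abs_def] Kpop_def k0pop_def
    assms(2,3) expct_law_cong[OF assms(1)] cov_law_cong[OF assms(1)] ..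

context dictionary
begin

lemma Z0_mean: "expct f0 (Z0 f0 f1 \<phi>) = 0"
proof -
  have 1: "part1 (expct f0 (Z0 f0 f1 \<phi>)) = expct f0 (\<lambda>x. part1 (Z0 f0 f1 \<phi> x))"
    by (rule expct_linear[OF dens0 Z0_bm bounded_linear_part1, symmetric])
  have 2: "part2 (expct f0 (Z0 f0 f1 \<phi>)) $ () = expct f0 (\<lambda>x. part2 (Z0 f0 f1 \<phi> x) $ ())"
    by (rule expct_linear[OF dens0 Z0_bm bounded_linear_compose[OF bounded_linear_vec_nth bounded_linear_part2], symmetric])
  have b: "bm (\<lambda>x. exp (\<theta>0 * \<Lambda> x))" by (intro bm_intros Lam_bm)
  have "part1 (expct f0 (Z0 f0 f1 \<phi>)) = 0"
    unfolding 1 by (simp add: Z0_def Zc_mean[OF dens0 \<phi>_bm])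
  moreover have "part2 (expct f0 (Z0 f0 f1 \<phi>)) $ () = 0"
    unfolding 2 using b by (simp add: Z0_def expct_add dens0 bm_const expct_const tilt_1 del: part_nth)
  ultimately show ?thesis by (simp add: jvec_eq_iff vec_eq_iff[of "part2 _"] del: part_nth)
qed

lemma V0_block: "V0 f0 f1 \<phi> $ Inl i $ Inl j = V0_minus f0 \<phi> $ i $ j"
  unfolding V0_def V0_minus_def cov_nth[OF dens0 Z0_bm] cov_nth[OF dens0 Zc_bm[OF \<phi>_bm]]
    Z0_mean Zc_mean[OF dens0 \<phi>_bm] by (simp add: Z0_def)

lemma V0_padM: "padM v \<bullet> (V0 f0 f1 \<phi> *v padM w) = v \<bullet> (V0_minus f0 \<phi> *v w)"
proof -
  have row: "part1 (V0 f0 f1 \<phi> $ Inl i) = V0_minus f0 \<phi> $ i" for i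
    by (simp add: vec_eq_iff V0_block)
  have "part1 (V0 f0 f1 \<phi> *v padM w) = V0_minus f0 \<phi> *v w"
    by (simp add: vec_eq_iff matrix_vector_mul_component padM_def inner_jvec row)
  then show ?thesis by (simp add: padM_def inner_jvec)
qed

text \<open>Both parts of the score are centred, the tilt coordinate because
  \<open>\<theta>0\<close> solves the moment equation, so the quadratic form is a second moment and
  splits by expanding the square. The subtracted 1 is the mean of the exponential, which brings in
  \<open>var\<close> and \<open>cross_cov\<close>.\<close>

lemma V0_quadratic:
  "a \<bullet> (V0 f0 f1 \<phi> *v a) = part1 a \<bullet> (V0_minus f0 \<phi> *v part1 a)
     + 2 * part2 a $ () * (part1 a \<bullet> cross_cov f0 (Zc f0 \<phi>) (\<lambda>x. exp (\<theta>0 * \<Lambda> x)))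
     + (part2 a $ ())\<^sup>2 * var f0 (\<lambda>x. exp (\<theta>0 * \<Lambda> x))"
proof -
  define t where "t = part2 a $ ()"
  define T where "T x = exp (\<theta>0 * \<Lambda> x) - 1" for x
  define p where "p x = part1 a \<bullet> Zc f0 \<phi> x" for x
  have bT: "bm T" unfolding T_def by (intro bm_intros Lam_bm)
  have bp: "bm p" unfolding p_def by (intro bm_intros Zc_bm \<phi>_bm)
  have "a \<bullet> (V0 f0 f1 \<phi> *v a) = expct f0 (\<lambda>x. (p x + t * T x)\<^sup>2)"
    unfolding V0_def cov_quadratic[OF dens0 Z0_bm] Z0_mean
    by (simp add: Z0_def inner_jvec p_def t_def T_def inner_vec_def[of "part2 a"] UNIV_unit)
  also have "\<dots> = expct f0 (\<lambda>x. (p x)\<^sup>2 + (2 * t) * (T x * p x) + t\<^sup>2 * (T x)\<^sup>2)"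
    by (rule arg_cong[where f="expct f0"]) (simp add: fun_eq_iff power2_eq_square algebra_simps)
  also have "\<dots> = expct f0 (\<lambda>x. (p x)\<^sup>2) + (2 * t) * expct f0 (\<lambda>x. T x * p x) + t\<^sup>2 * expct f0 (\<lambda>x. (T x)\<^sup>2)"
    using bT bp by (simp only: expct_add dens0 bm_intros expct_cmult)
  also have "expct f0 (\<lambda>x. (p x)\<^sup>2) = part1 a \<bullet> (V0_minus f0 \<phi> *v part1 a)"
    unfolding V0_minus_def cov_quadratic[OF dens0 Zc_bm[OF \<phi>_bm]] Zc_mean[OF dens0 \<phi>_bm] by (simp add: p_def)
  also have "expct f0 (\<lambda>x. (T x)\<^sup>2) = var f0 (\<lambda>x. exp (\<theta>0 * \<Lambda> x))"
    unfolding var_def tilt_1 T_def ..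
  also have "expct f0 (\<lambda>x. T x * p x) = part1 a \<bullet> cross_cov f0 (Zc f0 \<phi>) (\<lambda>x. exp (\<theta>0 * \<Lambda> x))"
  proof -
    have "bm (\<lambda>x. T x *\<^sub>R Zc f0 \<phi> x)" by (intro bm_intros bT Zc_bm \<phi>_bm)
    from expct_inner[OF dens0 this, of "part1 a"] show ?thesis
      unfolding cross_cov_def tilt_1 Zc_mean[OF dens0 \<phi>_bm] by (simp add: p_def T_def)
  qed
  finally show ?thesis by (simp only: t_def)
qed

lemma G_M_eq: "G_M f0 f1 \<phi> = col_block1 (G_E f0 f1 \<phi>)"
  unfolding G_M_def G_E_def by (rule jacobian_join[OF K_der])

lemma GKk_M_eq: "GKk_M f0 f1 \<phi> = col_block1 (GKk_E f0 f1 \<phi>)"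
  unfolding GKk_M_def GKk_E_def by (rule jacobian_join[OF Kk_der])

lemma gradJ_M_eq: "gradJ_M f0 f1 \<phi> = part1 (gradJ_E f0 f1 \<phi>)"
  unfolding gradJ_M_def gradJ_E_def by (rule gradient_join[OF J_der])

lemma Sigma_E_blocks:
  "Sigma_E f0 f1 \<phi> l = col_block1 (G_E f0 f1 \<phi>) ** V0_minus f0 \<phi> ** transpose (col_block1 (G_E f0 f1 \<phi>))
     + l *\<^sub>R (col_block2 (G_E f0 f1 \<phi>) ** V1 f1 \<phi> ** transpose (col_block2 (G_E f0 f1 \<phi>)))"
  by (rule matrix_eq_bilinear)
    (simp only: Sigma_E_def sandwich_bilinear pad_colE_mult V_E_bilinear part1_padE part2_padE V0_padM part_transpose_mult
      matrix_vector_mult_add_rdistrib inner_add_right scaleR_matrix_vector_assoc[symmetric] inner_scaleR_right)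

lemma Sigma_M_blocks:
  "Sigma_M f0 f1 \<phi> = G_M f0 f1 \<phi> ** V0_minus f0 \<phi> ** transpose (G_M f0 f1 \<phi>)"
  by (rule matrix_eq_bilinear) (simp only: Sigma_M_def sandwich_bilinear pad_colM_mult V0_padM)

text \<open>At weight 0 the contribution of the second sample disappears; with its analogues below,
  this carries the results of \<open>estimation\<close> over to mode (M).\<close>

lemma Sigma_M_eq: "Sigma_M f0 f1 \<phi> = Sigma_E f0 f1 \<phi> 0"
  by (simp add: Sigma_M_blocks Sigma_E_blocks G_M_eq)

lemma SigmaKk_M_eq: "SigmaKk_M f0 f1 \<phi> = SigmaKk_E f0 f1 \<phi> 0"
  by (rule matrix_eq_bilinear)
    (simp only: SigmaKk_M_def SigmaKk_E_def sandwich_bilinear pad_colM_mult pad_colE_mult V_E_bilinear part1_padE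
      GKk_M_eq part_transpose_mult mult_zero_left add_0_right)

lemma gradJ_M_variance:
  "padM (gradJ_M f0 f1 \<phi>) \<bullet> (V0 f0 f1 \<phi> *v padM (gradJ_M f0 f1 \<phi>))
    = padE (gradJ_E f0 f1 \<phi>) \<bullet> (V_E f0 f1 \<phi> 0 *v padE (gradJ_E f0 f1 \<phi>))"
  by (simp only: V_E_bilinear part1_padE gradJ_M_eq mult_zero_left add_0_right)

lemma part1_axis: "part1 (axis (Inl i) c) = axis i c" "part2 (axis (Inl i) c) = 0"
  by (simp_all add: vec_eq_iff axis_def)

lemma grad_theta_M_eq: "grad_theta_M f0 f1 \<phi> = part1 (grad_theta_E f0 f1 \<phi>)"
  by (simp only: grad_theta_M_def grad_theta_E_def pad_colM_mult pad_colE_mult part_linear part1_padE part1_axis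
      GKk_M_eq part_transpose_mult)

lemma grad_theta_M_variance:
  "grad_theta_M f0 f1 \<phi> \<bullet> (V0 f0 f1 \<phi> *v grad_theta_M f0 f1 \<phi>)
    = grad_theta_E f0 f1 \<phi> \<bullet> (V_E f0 f1 \<phi> 0 *v grad_theta_E f0 f1 \<phi>)"
  by (simp only: V_E_bilinear grad_theta_M_eq mult_zero_left add_0_right)

text \<open>In the calibration block the gradient is \<open>- (\<theta>0 / tE) *\<^sub>R g0\<close>
  on the moments and -1 / \<open>tE\<close> on the tilt coordinate. The equal signs are the reason
  for the plus sign of the cross term.\<close>

lemma grad_theta_E_variance:
  fixes l
  defines "g0 \<equiv> transpose (col_block1 (GKk_E f0 f1 \<phi>)) *v pair tphi 1"
    and "g1 \<equiv> transpose (col_block2 (GKk_E f0 f1 \<phi>)) *v pair tphi 1"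
  shows "grad_theta_E f0 f1 \<phi> \<bullet> (V_E f0 f1 \<phi> l *v grad_theta_E f0 f1 \<phi>) =
          (1 / tE\<^sup>2) *
            (var f0 (\<lambda>x. exp (\<theta>0 * \<Lambda> x))
             + 2 * \<theta>0 * (g0 \<bullet> cross_cov f0 (Zc f0 \<phi>) (\<lambda>x. exp (\<theta>0 * \<Lambda> x)))
             + \<theta>0\<^sup>2 * (g0 \<bullet> (V0_minus f0 \<phi> *v g0)))
          + \<theta>0\<^sup>2 * l / tE\<^sup>2 * (g1 \<bullet> (V1 f1 \<phi> *v g1))"
proof -
  let ?G = "grad_theta_E f0 f1 \<phi>" and ?c = "- (\<theta>0 / tE)"
  have G: "?G = ?c *\<^sub>R padE (transpose (GKk_E f0 f1 \<phi>) *v pair tphi 1) - (1 / tE) *\<^sub>R axis (Inl (Inr ())) 1"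
    unfolding grad_theta_E_def dtheta_eq pad_colE_mult matrix_vector_mult_scaleR
    by (simp add: padE_def join_linear)
  have p2: "part2 ?G = ?c *\<^sub>R g1"
    unfolding G part_linear part2_padE part1_axis part_transpose_mult g1_def by simp
  have p1: "part1 ?G = ?c *\<^sub>R padM g0 - (1 / tE) *\<^sub>R axis (Inr ()) 1"
    unfolding G part_linear part1_padE part1_axis part_transpose_mult g0_def by simp
  have p11: "part1 (part1 ?G) = ?c *\<^sub>R g0"
    unfolding p1 part_linear by (simp add: padM_def vec_eq_iff axis_def)
  have p12: "part2 (part1 ?G) $ () = - (1 / tE)"
    unfolding p1 by (simp add: padM_def axis_def)
  show ?thesis
    unfolding V_E_bilinear V0_quadratic p11 p12 p2 matrix_vector_mult_scaleR inner_scaleR_left inner_scaleR_right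
    using tE_pos by (simp add: field_simps power2_eq_square)
qed

end

subsection \<open>The two calibration modes\<close>

locale calibration = dictionary f0 f1 \<phi> + bounded_iid M f0 X
  for f0 f1 :: "real \<Rightarrow> real" and \<phi> :: "real \<Rightarrow> real^('s::{finite,linorder})"
    and M :: "'w measure" and X :: "nat \<Rightarrow> 'w \<Rightarrow> real" +
  fixes \<delta> :: nat
  assumes \<delta>: "\<delta> \<in> {0, 1}"
begin

lemma vec_sum_Z0_parts:
  "part1 (vec_sum (Z0 f0 f1 \<phi>) N \<omega>) = vec_sum (Zc f0 \<phi>) N \<omega>"
  "part2 (vec_sum (Z0 f0 f1 \<phi>) N \<omega>) $ () = scaled_sum (\<lambda>x. exp (\<theta>0 * \<Lambda> x) - 1) N \<omega>"
proof -
  show "part1 (vec_sum (Z0 f0 f1 \<phi>) N \<omega>) = vec_sum (Zc f0 \<phi>) N \<omega>"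
    by (simp add: vec_sum_def part_sum Z0_def)
  show "part2 (vec_sum (Z0 f0 f1 \<phi>) N \<omega>) $ () = scaled_sum (\<lambda>x. exp (\<theta>0 * \<Lambda> x) - 1) N \<omega>"
    by (simp add: vec_sum_def scaled_sum_def part_sum Z0_def del: part_nth)
qed

lemma calibration_sum_normal:
  "asymp_normal M (\<lambda>N \<omega>. c \<bullet> vec_sum (Z0 f0 f1 \<phi>) N \<omega>) (c \<bullet> (V0 f0 f1 \<phi> *v c))"
  unfolding V0_def by (rule vec_sum_asymp_normal[OF Z0_bm Z0_mean])

lemma \<phi>_borel[measurable]: "\<phi> \<in> borel_measurable borel"
  by (rule bm_measurable[OF \<phi>_bm])

lemma Z0_borel[measurable]: "Z0 f0 f1 \<phi> \<in> borel_measurable borel"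
  by (rule bm_measurable[OF Z0_bm])

lemma Zc_borel[measurable]: "Zc f \<phi> \<in> borel_measurable borel"
  by (rule bm_measurable[OF Zc_bm[OF \<phi>_bm]])

text \<open>The second block of the moment vector is constant and its score is 0, so all
  requirements reduce to statements on the calibration sample.\<close>

theorem known_population:
  "estimation f0 f1 \<phi> M X (\<lambda>N \<omega>. join (mom_hat \<delta> \<phi> N \<omega>) (eta f1 \<phi>))
     (\<lambda>N \<omega>. join (vec_sum (Z0 f0 f1 \<phi>) N \<omega>) 0) 0"
proof
  fix N
  show "(\<lambda>\<omega>. join (mom_hat \<delta> \<phi> N \<omega>) (eta f1 \<phi>)) \<in> borel_measurable M"
    by (intro borel_measurable_join mom_hat_measurable) auto
  show "(\<lambda>\<omega>. join (vec_sum (Z0 f0 f1 \<phi>) N \<omega>) 0) \<in> borel_measurable M"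
    by (intro borel_measurable_join vec_sum_measurable) auto
  fix \<omega>
  show "part2 (part1 (join (vec_sum (Z0 f0 f1 \<phi>) N \<omega>) 0)) $ () = scaled_sum (\<lambda>x. exp (\<theta>0 * \<Lambda> x) - 1) N \<omega>"
    by (simp only: part1_join vec_sum_Z0_parts)
next
  show "AE \<omega> in M. (\<lambda>N. join (mom_hat \<delta> \<phi> N \<omega>) (eta f1 \<phi>)) \<longlonglongrightarrow> \<eta>0"
    using mom_hat_AE[OF \<phi>_bm, of \<delta>] by eventually_elim (intro tendsto_join tendsto_const)
next
  fix c :: "(('s + 's vech_ix) + unit, 's + 's vech_ix) jvec"
  show "asymp_normal M (\<lambda>N \<omega>. c \<bullet> join (vec_sum (Z0 f0 f1 \<phi>) N \<omega>) 0) (c \<bullet> (V_E f0 f1 \<phi> 0 *v c))"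
    using calibration_sum_normal[of "part1 c"] by (simp add: inner_jvec[of c] V_E_bilinear)
next
  show "op1 M (\<lambda>N \<omega>. norm (sqrt (real N) *\<^sub>R (join (mom_hat \<delta> \<phi> N \<omega>) (eta f1 \<phi>) - \<eta>0) -
      join (part1 (part1 (join (vec_sum (Z0 f0 f1 \<phi>) N \<omega>) (0 :: real^('s + 's vech_ix)))))
        (part2 (join (vec_sum (Z0 f0 f1 \<phi>) N \<omega>) 0))))"
  proof (rule op1_bound_by_product[OF _ mom_hat_linearization[OF \<phi>_bm \<delta>] Op1_const[of 1]])
    have eq: "norm (sqrt (real N) *\<^sub>R (join (mom_hat \<delta> \<phi> N \<omega>) (eta f1 \<phi>) - \<eta>0) -
      join (part1 (part1 (join (vec_sum (Z0 f0 f1 \<phi>) N \<omega>) (0 :: real^('s + 's vech_ix)))))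
        (part2 (join (vec_sum (Z0 f0 f1 \<phi>) N \<omega>) 0)))
      = norm (sqrt (real N) *\<^sub>R (mom_hat \<delta> \<phi> N \<omega> - eta f0 \<phi>) - vec_sum (Zc f0 \<phi>) N \<omega>)" for N \<omega>
      by (simp add: join_linear vec_sum_Z0_parts norm_eq_sqrt_inner inner_jvec[of "join _ _"])
    show "(\<lambda>\<omega>. norm (sqrt (real N) *\<^sub>R (join (mom_hat \<delta> \<phi> N \<omega>) (eta f1 \<phi>) - \<eta>0) -
      join (part1 (part1 (join (vec_sum (Z0 f0 f1 \<phi>) N \<omega>) (0 :: real^('s + 's vech_ix)))))
        (part2 (join (vec_sum (Z0 f0 f1 \<phi>) N \<omega>) 0)))) \<in> borel_measurable M" for N
      unfolding eq by (rule op1_measurable[OF mom_hat_linearization[OF \<phi>_bm \<delta>]])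
    show "AE \<omega> in M. \<forall>\<^sub>F N in sequentially.
      \<bar>norm (sqrt (real N) *\<^sub>R (join (mom_hat \<delta> \<phi> N \<omega>) (eta f1 \<phi>) - \<eta>0) -
      join (part1 (part1 (join (vec_sum (Z0 f0 f1 \<phi>) N \<omega>) (0 :: real^('s + 's vech_ix)))))
        (part2 (join (vec_sum (Z0 f0 f1 \<phi>) N \<omega>) 0)))\<bar>
      \<le> \<bar>norm (sqrt (real N) *\<^sub>R (mom_hat \<delta> \<phi> N \<omega> - eta f0 \<phi>) - vec_sum (Zc f0 \<phi>) N \<omega>)\<bar> * \<bar>1\<bar>"
      unfolding eq by (intro AE_I2 always_eventually) simp
  qed
qed simp

end

text \<open>Converting the limit of N1 / N into that of N / N1 treats finite and infinite ratios
  alike: the inverse of infinity is 0, which is the convention for the weight.\<close>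

lemma sample_size_ratio:
  fixes n :: "nat \<Rightarrow> nat"
  assumes "0 < lam" "(\<lambda>N. ereal (real (n N) / real N)) \<longlonglongrightarrow> lam"
  shows "filterlim n sequentially sequentially"
    and "(\<lambda>N. real N / real (n N)) \<longlonglongrightarrow> real_of_ereal (inverse lam)"
    and "0 \<le> real_of_ereal (inverse lam)"
proof -
  \<comment> \<open>Any positive real below the limit is an eventual lower bound for N1 / N, which
    forces N1 to tend to infinity.\<close>
  obtain c where c: "0 < ereal c" "ereal c < lam" using ereal_dense2[OF assms(1)] by blast
  have "\<forall>\<^sub>F N in sequentially. ereal c < ereal (real (n N) / real N)"
    by (rule order_tendstoD(1)[OF assms(2) c(2)])
  then have "\<forall>\<^sub>F N in sequentially. c * real N \<le> real (n N)"
    using eventually_gt_at_top[of 0] by eventually_elim (simp add: field_simps)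
  moreover have "filterlim (\<lambda>N. c * real N) at_top sequentially"
    using c by (intro filterlim_tendsto_pos_mult_at_top[OF tendsto_const] filterlim_real_sequentially) auto
  ultimately have "filterlim (\<lambda>N. real (n N)) at_top sequentially" by (rule filterlim_at_top_mono[rotated])
  then show "filterlim n sequentially sequentially" by (simp add: filterlim_sequentially_iff_filterlim_real)
  have inv: "inverse (real (n N) / real N) = real N / real (n N)" for N by (simp add: inverse_eq_divide)
  show "(\<lambda>N. real N / real (n N)) \<longlonglongrightarrow> real_of_ereal (inverse lam)"
  proof (cases lam)
    case (real r)
    then have "(\<lambda>N. inverse (real (n N) / real N)) \<longlonglongrightarrow> inverse r"
      using assms by (intro tendsto_inverse) auto
    then show ?thesis using real assms(1) by (simp add: inv)
  next
    case PInf
    then have "(\<lambda>N. inverse (real (n N) / real N)) \<longlonglongrightarrow> 0"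
      using assms by (intro tendsto_inverse_0_at_top) (simp add: tendsto_PInfty_eq_at_top)
    then show ?thesis using PInf by (simp add: inv)
  qed (use assms in auto)
  show "0 \<le> real_of_ereal (inverse lam)" using assms(1) by (cases lam) auto
qed

lemma norm_join_le: "norm (join v w) \<le> norm v + norm w"
proof -
  have n: "norm (join v 0) = norm v" "norm (join 0 w) = norm w"
    by (simp_all add: norm_eq_sqrt_inner inner_jvec[of "join _ _"])
  have "join v w = join v 0 + join 0 w" by (simp add: join_linear)
  then show ?thesis using norm_triangle_ineq[of "join v 0" "join 0 w"] by (simp only: n)
qed

locale two_samples = calibration f0 f1 \<phi> M X \<delta>
  for f0 f1 :: "real \<Rightarrow> real" and \<phi> :: "real \<Rightarrow> real^('s::{finite,linorder})"
    and M :: "'w measure" and X :: "nat \<Rightarrow> 'w \<Rightarrow> real" and \<delta> +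
  fixes W :: "nat \<Rightarrow> 'w \<Rightarrow> real" and n :: "nat \<Rightarrow> nat" and lam :: ereal
  assumes second: "second_sample M f1 X W n lam"
begin

sublocale W: bounded_iid M f1 W
  using second dens1 by unfold_locales (simp_all add: second_sample_def)

definition linv :: real where "linv = real_of_ereal (inverse lam)"

lemma n_lim: "filterlim n sequentially sequentially" "(\<lambda>N. real N / real (n N)) \<longlonglongrightarrow> linv" "0 \<le> linv"
  using sample_size_ratio[of lam n] second by (simp_all add: second_sample_def linv_def)

text \<open>Converts the normalisation of the second sample's sums by sqrt N1 into the common
  normalisation by sqrt N.\<close>

definition ratio :: "nat \<Rightarrow> real" where "ratio N = sqrt (real N / real (n N))"

lemma ratio_lim: "ratio \<longlonglongrightarrow> sqrt linv"
  unfolding ratio_def by (intro tendsto_real_sqrt n_lim)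

lemma Wsum_normal:
  "asymp_normal M (\<lambda>N \<omega>. ratio N * (c \<bullet> W.vec_sum (Zc f1 \<phi>) (n N) \<omega>)) (linv * (c \<bullet> (V1 f1 \<phi> *v c)))"
proof -
  have psd: "0 \<le> c \<bullet> (cov f1 (Zc f1 \<phi>) *v c)" by (rule cov_psd[OF dens1 Zc_bm[OF \<phi>_bm]])
  have "asymp_normal M (\<lambda>N \<omega>. c \<bullet> W.vec_sum (Zc f1 \<phi>) N \<omega>) (c \<bullet> (cov f1 (Zc f1 \<phi>) *v c))"
    by (rule W.vec_sum_asymp_normal[OF Zc_bm[OF \<phi>_bm] Zc_mean[OF dens1 \<phi>_bm]])
  from asymp_normal_seq_mult[OF asymp_normal_compose[OF this psd n_lim(1)] psd ratio_lim]
  show ?thesis using n_lim(3) by (simp add: V1_def)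
qed

text \<open>Joint independence of the family indexed by the disjoint sum gives independence of the
  two blocks, and each sum is a measurable function of its block.\<close>

lemma sums_independent:
  assumes [measurable]: "g \<in> borel_measurable borel" "h \<in> borel_measurable borel"
  shows "indep_var borel (\<lambda>\<omega>. c * (\<Sum>j<N. g (X j \<omega>))) borel (\<lambda>\<omega>. d * (\<Sum>j<m. h (W j \<omega>) :: real))"
proof -
  let ?A = "Inl ` {..<N} :: (nat + nat) set" and ?B = "Inr ` {..<m} :: (nat + nat) set"
  have "indep_vars (\<lambda>_. borel) (case_sum X W) UNIV" using second by (simp add: second_sample_def)
  then have ind: "indep_var (Pi\<^sub>M ?A (\<lambda>_. borel)) (\<lambda>\<omega>. restrict (\<lambda>i. case_sum X W i \<omega>) ?A)
      (Pi\<^sub>M ?B (\<lambda>_. borel)) (\<lambda>\<omega>. restrict (\<lambda>i. case_sum X W i \<omega>) ?B)"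
    by (rule indep_var_restrict) auto
  have m: "(\<lambda>x. c * (\<Sum>j<N. g (x (Inl j)))) \<in> borel_measurable (Pi\<^sub>M ?A (\<lambda>_. borel))"
    "(\<lambda>x. d * (\<Sum>j<m. h (x (Inr j)))) \<in> borel_measurable (Pi\<^sub>M ?B (\<lambda>_. borel))"
    by measurable
  from indep_var_compose[OF ind m] show ?thesis by (simp add: comp_def)
qed

definition pooled_moments where "pooled_moments N \<omega> = join (mom_hat \<delta> \<phi> N \<omega>) (W.mom_hat \<delta> \<phi> (n N) \<omega>)"
definition pooled_sum where "pooled_sum N \<omega> = join (vec_sum (Z0 f0 f1 \<phi>) N \<omega>) (ratio N *\<^sub>R W.vec_sum (Zc f1 \<phi>) (n N) \<omega>)"

text \<open>For each N the two score sums are independent, so their limiting variances add. The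
  linearisation error of the second sample is o_p(1) along the sizes N1 and stays so after
  multiplication by \<open>ratio N\<close>, which is bounded because it converges.\<close>

theorem estimated_population: "estimation f0 f1 \<phi> M X pooled_moments pooled_sum linv"
proof
  fix N
  show "pooled_moments N \<in> borel_measurable M"
    unfolding pooled_moments_def by (intro borel_measurable_join mom_hat_measurable W.mom_hat_measurable \<phi>_borel)
  show "pooled_sum N \<in> borel_measurable M"
    unfolding pooled_sum_def by (intro borel_measurable_join borel_measurable_scaleR borel_measurable_const
        vec_sum_measurable W.vec_sum_measurable Z0_borel Zc_borel)
  fix \<omega>
  show "part2 (part1 (pooled_sum N \<omega>)) $ () = scaled_sum (\<lambda>x. exp (\<theta>0 * \<Lambda> x) - 1) N \<omega>"
    by (simp only: pooled_sum_def part1_join vec_sum_Z0_parts)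
next
  show "0 \<le> linv" by (rule n_lim)
next
  show "AE \<omega> in M. (\<lambda>N. pooled_moments N \<omega>) \<longlonglongrightarrow> \<eta>0"
    using mom_hat_AE[OF \<phi>_bm, of \<delta>] W.mom_hat_AE[OF \<phi>_bm, of \<delta>]
    unfolding pooled_moments_def by eventually_elim (intro tendsto_join filterlim_compose[OF _ n_lim(1)])
next
  fix c :: "(('s + 's vech_ix) + unit, 's + 's vech_ix) jvec"
  have "asymp_normal M (\<lambda>N \<omega>. part1 c \<bullet> vec_sum (Z0 f0 f1 \<phi>) N \<omega> + ratio N * (part2 c \<bullet> W.vec_sum (Zc f1 \<phi>) (n N) \<omega>))
    (part1 c \<bullet> (V0 f0 f1 \<phi> *v part1 c) + linv * (part2 c \<bullet> (V1 f1 \<phi> *v part2 c)))"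
  proof (rule asymp_normal_add_indep[OF calibration_sum_normal _ Wsum_normal])
    show "0 \<le> part1 c \<bullet> (V0 f0 f1 \<phi> *v part1 c)" unfolding V0_def by (rule cov_psd[OF dens0 Z0_bm])
    show "0 \<le> linv * (part2 c \<bullet> (V1 f1 \<phi> *v part2 c))"
      unfolding V1_def by (intro mult_nonneg_nonneg n_lim cov_psd dens1 Zc_bm \<phi>_bm)
    fix N
    have "(\<lambda>x. part1 c \<bullet> Z0 f0 f1 \<phi> x) \<in> borel_measurable borel" "(\<lambda>x. part2 c \<bullet> Zc f1 \<phi> x) \<in> borel_measurable borel"
      by measurable
    from sums_independent[OF this, of "1 / sqrt (real N)" N "ratio N * (1 / sqrt (real (n N)))" "n N"]
    show "indep_var borel (\<lambda>\<omega>. part1 c \<bullet> vec_sum (Z0 f0 f1 \<phi>) N \<omega>)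
      borel (\<lambda>\<omega>. ratio N * (part2 c \<bullet> W.vec_sum (Zc f1 \<phi>) (n N) \<omega>))"
      by (simp only: vec_sum_inner W.vec_sum_inner scaled_sum_def W.scaled_sum_def mult.assoc)
  qed
  then show "asymp_normal M (\<lambda>N \<omega>. c \<bullet> pooled_sum N \<omega>) (c \<bullet> (V_E f0 f1 \<phi> linv *v c))"
    by (simp add: inner_jvec[of c] pooled_sum_def V_E_bilinear)
next
  let ?d0 = "\<lambda>N \<omega>. sqrt (real N) *\<^sub>R (mom_hat \<delta> \<phi> N \<omega> - eta f0 \<phi>) - vec_sum (Zc f0 \<phi>) N \<omega>"
  let ?d1 = "\<lambda>N \<omega>. sqrt (real N) *\<^sub>R (W.mom_hat \<delta> \<phi> N \<omega> - eta f1 \<phi>) - W.vec_sum (Zc f1 \<phi>) N \<omega>"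
  have d1: "op1 M (\<lambda>N \<omega>. ratio N * norm (?d1 (n N) \<omega>))"
  proof -
    obtain B where B: "\<And>N. \<bar>ratio N\<bar> \<le> B"
      using convergent_imp_Bseq[OF convergentI[OF ratio_lim]] by (auto simp: Bseq_def)
    note o = op1_compose[OF W.mom_hat_linearization[OF \<phi>_bm \<delta>] n_lim(1)]
    show ?thesis
    proof (rule op1_bound_by_product[OF _ o Op1_const[of B]])
      show "(\<lambda>\<omega>. ratio N * norm (?d1 (n N) \<omega>)) \<in> borel_measurable M" for N
        by (intro borel_measurable_times borel_measurable_const op1_measurable[OF o])
      have "\<bar>ratio N * norm (?d1 (n N) \<omega>)\<bar> \<le> \<bar>norm (?d1 (n N) \<omega>)\<bar> * \<bar>B\<bar>" for N \<omega>
        using order_trans[OF B[of N] abs_ge_self] unfolding abs_mult mult.commute[of "\<bar>ratio N\<bar>"]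
        by (rule mult_left_mono) simp
      then show "AE \<omega> in M. \<forall>\<^sub>F N in sequentially. \<bar>ratio N * norm (?d1 (n N) \<omega>)\<bar> \<le> \<bar>norm (?d1 (n N) \<omega>)\<bar> * \<bar>B\<bar>"
        by (intro AE_I2 always_eventually allI)
    qed
  qed
  show "op1 M (\<lambda>N \<omega>. norm (sqrt (real N) *\<^sub>R (pooled_moments N \<omega> - \<eta>0) - join (part1 (part1 (pooled_sum N \<omega>))) (part2 (pooled_sum N \<omega>))))"
  proof (rule op1_bound_by_product[OF _ op1_add[OF mom_hat_linearization[OF \<phi>_bm \<delta>] d1] Op1_const[of 1]])
    have eq: "sqrt (real N) *\<^sub>R (pooled_moments N \<omega> - \<eta>0) - join (part1 (part1 (pooled_sum N \<omega>))) (part2 (pooled_sum N \<omega>))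
      = join (?d0 N \<omega>) (sqrt (real N) *\<^sub>R (W.mom_hat \<delta> \<phi> (n N) \<omega> - eta f1 \<phi>) - ratio N *\<^sub>R W.vec_sum (Zc f1 \<phi>) (n N) \<omega>)" for N \<omega>
      by (simp add: join_linear vec_sum_Z0_parts pooled_moments_def pooled_sum_def)
    show "(\<lambda>\<omega>. norm (sqrt (real N) *\<^sub>R (pooled_moments N \<omega> - \<eta>0) - join (part1 (part1 (pooled_sum N \<omega>))) (part2 (pooled_sum N \<omega>)))) \<in> borel_measurable M" for N
      unfolding pooled_moments_def pooled_sum_def by measurable
    \<comment> \<open>For an empty second sample the ratio is 0 by the division convention and the
      identity sqrt N = \<open>ratio N\<close> times sqrt (n N) fails; almost all sizes are
      positive.\<close>
    have "\<forall>\<^sub>F N in sequentially. 0 < n N"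
      by (rule eventually_compose_filterlim[OF eventually_gt_at_top n_lim(1)])
    then show "AE \<omega> in M. \<forall>\<^sub>F N in sequentially.
      \<bar>norm (sqrt (real N) *\<^sub>R (pooled_moments N \<omega> - \<eta>0) - join (part1 (part1 (pooled_sum N \<omega>))) (part2 (pooled_sum N \<omega>)))\<bar>
      \<le> \<bar>norm (?d0 N \<omega>) + ratio N * norm (?d1 (n N) \<omega>)\<bar> * \<bar>1\<bar>"
    proof (intro AE_I2, eventually_elim)
      case (elim \<omega> N)
      have r: "sqrt (real N) = ratio N * sqrt (real (n N))" "0 \<le> ratio N"
        using elim by (simp_all add: ratio_def real_sqrt_divide)
      have "sqrt (real N) *\<^sub>R (W.mom_hat \<delta> \<phi> (n N) \<omega> - eta f1 \<phi>) - ratio N *\<^sub>R W.vec_sum (Zc f1 \<phi>) (n N) \<omega>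
        = ratio N *\<^sub>R ?d1 (n N) \<omega>"
        by (simp only: r(1) scaleR_scaleR[symmetric] scaleR_diff_right)
      then have "norm (sqrt (real N) *\<^sub>R (pooled_moments N \<omega> - \<eta>0) - join (part1 (part1 (pooled_sum N \<omega>))) (part2 (pooled_sum N \<omega>)))
        \<le> norm (?d0 N \<omega>) + ratio N * norm (?d1 (n N) \<omega>)"
        unfolding eq using norm_join_le[of "?d0 N \<omega>" "ratio N *\<^sub>R ?d1 (n N) \<omega>"] r(2) by simp
      then show ?case by simp
    qed
  qed
qed

end

text \<open>The \<open>vech\<close> coordinates keep only one triangle of a matrix, so symmetry is
  what makes reading the covariances back lossless.\<close>

lemma moment_maps_mom:
  assumes "\<And>i j. A $ i $ j = A $ j $ i" "\<And>i j. B $ i $ j = B $ j $ i"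
  shows "K_map (join (mom u A) (mom v B)) = Kfun u A v B"
    and "Kk_map (join (mom u A) (mom v B)) = pair (Kfun u A v B) (k0fun u A v B)"
    and "J_map (join (mom u A) (mom v B)) = Kfun u A v B \<bullet> (v - u)"
  by (simp_all add: Kk_map_def K_map_def J_map_def Jfun_def Kfun_def mom_C_mom[of A, OF assms(1)] mom_C_mom[of B, OF assms(2)] inner_commute)

context dictionary
begin

lemma known_population_derivatives:
  defines "dK \<equiv> \<lambda>h. matrix_inv (C0 + C1) *v (- mom_u h - mom_C h *v K)"
  shows "((\<lambda>\<eta>. K_map (join \<eta> (eta f1 \<phi>))) has_derivative dK) (at (eta f0 \<phi>))"
    and "((\<lambda>\<eta>. Kk_map (join \<eta> (eta f1 \<phi>))) has_derivative
      (\<lambda>h. pair (dK h) (- (1/2) * (dK h \<bullet> (u0 + u1)) - (1/2) * (K \<bullet> mom_u h)))) (at (eta f0 \<phi>))"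
    and "((\<lambda>\<eta>. J_map (join \<eta> (eta f1 \<phi>))) has_derivative
         (\<lambda>h. 2 * (K \<bullet> (- mom_u h)) - K \<bullet> (mom_C h *v K))) (at (eta f0 \<phi>))"
  using has_derivative_join[OF K_der] has_derivative_join[OF Kk_der] has_derivative_join[OF J_der]
  unfolding dK_def dK_map_def dKk_map_def eta_maps
  by (simp_all add: Y_map_def F_map_def eta_def)

lemma moment_map_derivatives:
  defines "dY \<equiv> \<lambda>h. mom_u (part2 h) - mom_u (part1 h)"
    and "dF \<equiv> \<lambda>h. mom_C (part1 h) + mom_C (part2 h)"
  defines "dK \<equiv> \<lambda>h. matrix_inv (C0 + C1) *v (dY h - dF h *v K)"
  shows "(K_map has_derivative dK) (at \<eta>0)"
    and "(Kk_map has_derivative (\<lambda>h. pair (dK h) (- (1/2) * (dK h \<bullet> (u0 + u1))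
      - (1/2) * (K \<bullet> (mom_u (part1 h) + mom_u (part2 h)))))) (at \<eta>0)"
    and "(J_map has_derivative (\<lambda>h. 2 * (K \<bullet> dY h) - K \<bullet> (dF h *v K))) (at \<eta>0)"
  using K_der Kk_der J_der
  unfolding dK_def dY_def dF_def dK_map_def[abs_def] dKk_map_def[abs_def] eta_maps
  by (simp_all add: Y_map_def F_map_def eta_def)

end

lemma (in calibration) sample_cov_relative_error:
  fixes i
  defines "\<gamma> \<equiv> excess_kurtosis f0 (\<lambda>x. \<phi> x $ i)"
    and "rse \<equiv> \<lambda>N. std_dev M (\<lambda>\<omega>. sample_cov \<delta> \<phi> (\<lambda>j. X j \<omega>) N $ i $ i) / var f0 (\<lambda>x. \<phi> x $ i)"
  shows "(\<lambda>N. rse N - sqrt ((\<gamma> + 2) / real N)) \<in> O(\<lambda>N. 1 / real N)"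
    and "\<gamma> = - 2 \<Longrightarrow> rse \<in> \<Theta>(\<lambda>N. 1 / real N)"
proof -
  define s where "s = var f0 (\<lambda>x. \<phi> x $ i)"
  define m where "m = expct f0 (\<lambda>x. (\<phi> x $ i - u0 $ i) ^ 4)"
  have vm: "s = expct f0 (\<lambda>x. (\<phi> x $ i - u0 $ i)\<^sup>2)" "0 < s" "\<gamma> + 2 = (m - s\<^sup>2) / s\<^sup>2"
    using variance_moments[of i] by (simp_all only: s_def m_def \<gamma>_def)
  have \<gamma>: "0 \<le> \<gamma> + 2" using kurtosis_square_deviation(2)[of i] by (simp only: \<gamma>_def)
  have m: "m - s\<^sup>2 = s\<^sup>2 * (\<gamma> + 2)" using vm(2) unfolding vm(3) by simp
  have "rse N = sqrt (((real N - 1)\<^sup>2 * (\<gamma> + 2) + 2 * (real N - 1)) / real N) / (real N - real \<delta>)" if N: "2 \<le> N" for N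
  proof -
    have "rse N = sqrt (((real N - 1)\<^sup>2 * (m - s\<^sup>2) + 2 * (real N - 1) * s\<^sup>2) / real N) / (real N - real \<delta>) / s"
      unfolding rse_def sample_variance_std_dev[OF \<phi>_bm \<delta> N] m_def[symmetric] vm(1)[symmetric] s_def[symmetric] ..
    also have "((real N - 1)\<^sup>2 * (m - s\<^sup>2) + 2 * (real N - 1) * s\<^sup>2) / real N
      = s\<^sup>2 * (((real N - 1)\<^sup>2 * (\<gamma> + 2) + 2 * (real N - 1)) / real N)"
      unfolding m by (simp add: algebra_simps)
    finally have "rse N = sqrt (s\<^sup>2 * (((real N - 1)\<^sup>2 * (\<gamma> + 2) + 2 * (real N - 1)) / real N)) / (real N - real \<delta>) / s" .
    moreover have "sqrt (s\<^sup>2 * c) = s * sqrt c" for c using vm(2) by (simp add: real_sqrt_mult)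
    ultimately show ?thesis using vm(2) by (simp only:) simp
  qed
  from relative_standard_error_asymptotics[OF \<gamma> \<delta> this]
  show "(\<lambda>N. rse N - sqrt ((\<gamma> + 2) / real N)) \<in> O(\<lambda>N. 1 / real N)"
    "\<gamma> = - 2 \<Longrightarrow> rse \<in> \<Theta>(\<lambda>N. 1 / real N)" by blast+
qed

lemma (in calibration) moment_maps_sample:
  "K_map (join (mom_hat \<delta> \<phi> N \<omega>) (eta f1 \<phi>))
    = Kfun (sample_mean \<phi> (\<lambda>j. X j \<omega>) N) (sample_cov \<delta> \<phi> (\<lambda>j. X j \<omega>) N) u1 C1"
  "Kk_map (join (mom_hat \<delta> \<phi> N \<omega>) (eta f1 \<phi>))
    = pair (Kfun (sample_mean \<phi> (\<lambda>j. X j \<omega>) N) (sample_cov \<delta> \<phi> (\<lambda>j. X j \<omega>) N) u1 C1)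
        (k0fun (sample_mean \<phi> (\<lambda>j. X j \<omega>) N) (sample_cov \<delta> \<phi> (\<lambda>j. X j \<omega>) N) u1 C1)"
  "J_map (join (mom_hat \<delta> \<phi> N \<omega>) (eta f1 \<phi>))
    = Kfun (sample_mean \<phi> (\<lambda>j. X j \<omega>) N) (sample_cov \<delta> \<phi> (\<lambda>j. X j \<omega>) N) u1 C1 \<bullet> (u1 - sample_mean \<phi> (\<lambda>j. X j \<omega>) N)"
  unfolding mom_hat_def eta_def by (rule moment_maps_mom[OF sample_cov_sym cov_sym[OF dens1 \<phi>_bm]])+

lemma (in two_samples) moment_maps_pooled:
  "K_map (pooled_moments N \<omega>)
    = Kfun (sample_mean \<phi> (\<lambda>j. X j \<omega>) N) (sample_cov \<delta> \<phi> (\<lambda>j. X j \<omega>) N)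
        (sample_mean \<phi> (\<lambda>j. W j \<omega>) (n N)) (sample_cov \<delta> \<phi> (\<lambda>j. W j \<omega>) (n N))"
  "Kk_map (pooled_moments N \<omega>)
    = pair (Kfun (sample_mean \<phi> (\<lambda>j. X j \<omega>) N) (sample_cov \<delta> \<phi> (\<lambda>j. X j \<omega>) N)
        (sample_mean \<phi> (\<lambda>j. W j \<omega>) (n N)) (sample_cov \<delta> \<phi> (\<lambda>j. W j \<omega>) (n N)))
      (k0fun (sample_mean \<phi> (\<lambda>j. X j \<omega>) N) (sample_cov \<delta> \<phi> (\<lambda>j. X j \<omega>) N)
        (sample_mean \<phi> (\<lambda>j. W j \<omega>) (n N)) (sample_cov \<delta> \<phi> (\<lambda>j. W j \<omega>) (n N)))"
  "J_map (pooled_moments N \<omega>)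
    = Kfun (sample_mean \<phi> (\<lambda>j. X j \<omega>) N) (sample_cov \<delta> \<phi> (\<lambda>j. X j \<omega>) N)
        (sample_mean \<phi> (\<lambda>j. W j \<omega>) (n N)) (sample_cov \<delta> \<phi> (\<lambda>j. W j \<omega>) (n N))
        \<bullet> (sample_mean \<phi> (\<lambda>j. W j \<omega>) (n N) - sample_mean \<phi> (\<lambda>j. X j \<omega>) N)"
  unfolding pooled_moments_def mom_hat_def W.mom_hat_def by (rule moment_maps_mom[OF sample_cov_sym sample_cov_sym])+

theorem theorem6p1:
  fixes f0 f1 :: "real \<Rightarrow> real"
    and \<phi> :: "real \<Rightarrow> real^('s::{finite,linorder})"
    and P :: "'w measure"
    and X W :: "nat \<Rightarrow> 'w \<Rightarrow> real"
    and N1 :: "nat \<Rightarrow> nat"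
    and lam :: ereal
    and \<delta> :: nat
    and g :: "real \<Rightarrow> real \<Rightarrow> real"
    and q :: "real \<Rightarrow> real"
  defines "u0 \<equiv> expct f0 \<phi>" and "u1 \<equiv> expct f1 \<phi>"
    and "C0 \<equiv> cov f0 \<phi>" and "C1 \<equiv> cov f1 \<phi>"
    and "F \<equiv> cov f0 \<phi> + cov f1 \<phi>" and "Y \<equiv> expct f1 \<phi> - expct f0 \<phi>"
    and "K \<equiv> Kpop f0 f1 \<phi>" and "k0 \<equiv> k0pop f0 f1 \<phi>" and "J \<equiv> Jpop f0 f1 \<phi>"
    and "\<Lambda> \<equiv> Lam f0 f1 \<phi>" and "\<theta>0 \<equiv> theta0 f0 f1 \<phi>"
    and "tE \<equiv> tilt_expct f0 f1 \<phi> (Lam f0 f1 \<phi>)"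
    and "tphi \<equiv> tilt_expct f0 f1 \<phi> \<phi>"
    and "e \<equiv> efficiency f0 f1 \<phi>"
    and "B \<equiv> expct f0 (\<lambda>x. q x *\<^sub>R (\<phi> x - expct f0 \<phi>))"
    and "I \<equiv> expct f0 (\<lambda>x. (q x)\<^sup>2)"
    and "linv \<equiv> real_of_ereal (inverse lam)"
    and "uh0 \<equiv> \<lambda>N \<omega>. sample_mean \<phi> (\<lambda>j. X j \<omega>) N"
    and "Ch0 \<equiv> \<lambda>N \<omega>. sample_cov \<delta> \<phi> (\<lambda>j. X j \<omega>) N"
    and "uh1 \<equiv> \<lambda>N \<omega>. sample_mean \<phi> (\<lambda>j. W j \<omega>) (N1 N)"
    and "Ch1 \<equiv> \<lambda>N \<omega>. sample_cov \<delta> \<phi> (\<lambda>j. W j \<omega>) (N1 N)"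
  defines "KM \<equiv> \<lambda>N \<omega>. Kfun (uh0 N \<omega>) (Ch0 N \<omega>) u1 C1"
    and "kM \<equiv> \<lambda>N \<omega>. k0fun (uh0 N \<omega>) (Ch0 N \<omega>) u1 C1"
    and "KE \<equiv> \<lambda>N \<omega>. Kfun (uh0 N \<omega>) (Ch0 N \<omega>) (uh1 N \<omega>) (Ch1 N \<omega>)"
    and "kE \<equiv> \<lambda>N \<omega>. k0fun (uh0 N \<omega>) (Ch0 N \<omega>) (uh1 N \<omega>) (Ch1 N \<omega>)"
  defines "JM \<equiv> \<lambda>N \<omega>. KM N \<omega> \<bullet> (u1 - uh0 N \<omega>)"
    and "JE \<equiv> \<lambda>N \<omega>. KE N \<omega> \<bullet> (uh1 N \<omega> - uh0 N \<omega>)"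
    and "\<theta>M \<equiv> \<lambda>N \<omega>. sample_theta \<phi> (\<lambda>j. X j \<omega>) N (KM N \<omega>) (kM N \<omega>)"
    and "\<theta>E \<equiv> \<lambda>N \<omega>. sample_theta \<phi> (\<lambda>j. X j \<omega>) N (KE N \<omega>) (kE N \<omega>)"
  assumes dens: "is_density f0" "is_density f1"
    and moments: "moment_assumption f0 f1 \<phi>"
    and bdd: "bounded_dictionary \<phi>"
    and Y: "Y \<noteq> 0"
    and \<delta>: "\<delta> \<in> {0, 1}"
    and P: "prob_space P"
    and X: "iid_sample P f0 X"
  shows
    \<comment> \<open>(b), (d): quantities not depending on the mode\<close>
    "(local_family f0 f1 g q \<and> B \<noteq> 0 \<longrightarrow>
        (let quot = (\<lambda>k. (k \<bullet> B)\<^sup>2 / (I * (k \<bullet> (C0 *v k))));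
             kst = matrix_inv C0 *v B;
             \<kappa> = (B \<bullet> (matrix_inv C0 *v B)) / I;
             Q = C0 - (1 / (B \<bullet> (matrix_inv C0 *v B))) *\<^sub>R outer B B
         in kst \<noteq> 0 \<and> quot kst = \<kappa> \<and> (\<forall>k. k \<noteq> 0 \<longrightarrow> quot k \<le> \<kappa>) \<and>
            (\<lambda>d. quot (kst + d) - (\<kappa> - (d \<bullet> (Q *v d)) / I)) \<in> o[at 0](\<lambda>d. (d \<bullet> (Q *v d)) / I)))
     \<and>
     (KL_finite f1 f0 \<longrightarrow>
        GDERIV e (pair K k0) :> grad_e f0 f1 \<phi> \<and>
        (grad_e f0 f1 \<phi> = 0 \<longleftrightarrow> tphi = u1 \<and> tE = expct f1 \<Lambda>) \<and>
        ((AE x in law f0. 0 < f1 x \<and> \<theta>0 * \<Lambda> x = ln (f1 x / f0 x)) \<longrightarrow> grad_e f0 f1 \<phi> = 0))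
     \<and>
     (\<exists>f0' f1' (\<phi>' :: real \<Rightarrow> real^('s::{finite,linorder})).
        is_density f0' \<and> is_density f1' \<and> moment_assumption f0' f1' \<phi>' \<and>
        bounded_dictionary \<phi>' \<and> expct f1' \<phi>' - expct f0' \<phi>' \<noteq> 0 \<and>
        KL_finite f1' f0' \<and> grad_e f0' f1' \<phi>' \<noteq> 0)
     \<and>
     GDERIV (theta_fun f0 \<phi>) (pair K k0) :> dtheta f0 f1 \<phi>
     \<and>
     \<comment> \<open>(c)\<close>
     (\<forall>i. let \<gamma> = excess_kurtosis f0 (\<lambda>x. \<phi> x $ i);
              rse = (\<lambda>N. std_dev P (\<lambda>\<omega>. Ch0 N \<omega> $ i $ i) / var f0 (\<lambda>x. \<phi> x $ i))
          in integrable (law f0) (\<lambda>x. (\<phi> x $ i - u0 $ i) ^ 4) \<and> 0 < var f0 (\<lambda>x. \<phi> x $ i) \<and>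
             (\<lambda>N. rse N - sqrt ((\<gamma> + 2) / real N)) \<in> O(\<lambda>N. 1 / real N) \<and>
             (\<forall>N>0. sqrt ((\<gamma> + 2) / real N) = 0 \<longleftrightarrow> \<gamma> = - 2) \<and>
             (\<gamma> = - 2 \<longleftrightarrow> (\<exists>a b. a \<noteq> b \<and> measure (law f0) {x. \<phi> x $ i = a} = 1/2 \<and>
                                          measure (law f0) {x. \<phi> x $ i = b} = 1/2)) \<and>
             (\<gamma> = - 2 \<longrightarrow> rse \<in> \<Theta>(\<lambda>N. 1 / real N)))
     \<and>
     \<comment> \<open>mode (M)\<close>
     (\<comment> \<open>(a)\<close>
      (AE \<omega> in P. (\<lambda>N. KM N \<omega>) \<longlonglongrightarrow> K) \<and>
      (let dK = (\<lambda>h. matrix_inv F *v (- mom_u h - mom_C h *v K));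
           dk0 = (\<lambda>h. - (1/2) * (dK h \<bullet> (u0 + u1)) - (1/2) * (K \<bullet> mom_u h))
       in ((\<lambda>\<eta>. K_map (join \<eta> (eta f1 \<phi>))) has_derivative dK) (at (eta f0 \<phi>)) \<and>
          ((\<lambda>\<eta>. Kk_map (join \<eta> (eta f1 \<phi>))) has_derivative (\<lambda>h. pair (dK h) (dk0 h)))
             (at (eta f0 \<phi>))) \<and>
      asymp_mv_normal P (\<lambda>N \<omega>. sqrt (real N) *\<^sub>R (KM N \<omega> - K)) (Sigma_M f0 f1 \<phi>) \<and>
      asymp_mv_normal P (\<lambda>N \<omega>. sqrt (real N) *\<^sub>R (pair (KM N \<omega>) (kM N \<omega>) - pair K k0))
        (SigmaKk_M f0 f1 \<phi>) \<and>
      Sigma_M f0 f1 \<phi> = G_M f0 f1 \<phi> ** V0_minus f0 \<phi> ** transpose (G_M f0 f1 \<phi>) \<and>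
      (\<forall>f0' f1'. law f0' = law f0 \<and> expct f1' \<phi> = u1 \<and> cov f1' \<phi> = C1 \<longrightarrow>
         Sigma_M f0' f1' \<phi> = Sigma_M f0 f1 \<phi>) \<and>
      \<comment> \<open>(b)\<close>
      (let Q = F - (1 / J) *\<^sub>R outer Y Y;
           q2 = (\<lambda>N \<omega>. (KM N \<omega> - K) \<bullet> (Q *v (KM N \<omega> - K)))
       in small_op P (\<lambda>N \<omega>. quotient_R Y F (KM N \<omega>) - (J - q2 N \<omega>)) q2) \<and>
      big_op P (\<lambda>N \<omega>. quotient_R Y F (KM N \<omega>) - J) (\<lambda>N. 1 / real N) \<and>
      (KL_finite f1 f0 \<longrightarrow>
         (let eM = (\<lambda>N \<omega>. e (pair (KM N \<omega>) (kM N \<omega>)) - e (pair K k0))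
          in big_op P (\<lambda>N \<omega>. eM N \<omega> - grad_e f0 f1 \<phi> \<bullet> (pair (KM N \<omega>) (kM N \<omega>) - pair K k0))
               (\<lambda>N. 1 / real N) \<and>
             big_op P eM (\<lambda>N. 1 / sqrt (real N)) \<and>
             asymp_normal P (\<lambda>N \<omega>. sqrt (real N) * eM N \<omega>)
               (grad_e f0 f1 \<phi> \<bullet> (SigmaKk_M f0 f1 \<phi> *v grad_e f0 f1 \<phi>)))) \<and>
      \<comment> \<open>(d)\<close>
      ((\<lambda>\<eta>. J_map (join \<eta> (eta f1 \<phi>))) has_derivative
         (\<lambda>h. 2 * (K \<bullet> (- mom_u h)) - K \<bullet> (mom_C h *v K))) (at (eta f0 \<phi>)) \<and>
      asymp_normal P (\<lambda>N \<omega>. sqrt (real N) * (JM N \<omega> - J))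
        (padM (gradJ_M f0 f1 \<phi>) \<bullet> (V0 f0 f1 \<phi> *v padM (gradJ_M f0 f1 \<phi>))) \<and>
      asymp_normal P (\<lambda>N \<omega>. sqrt (real N) * (\<theta>M N \<omega> - \<theta>0))
        (grad_theta_M f0 f1 \<phi> \<bullet> (V0 f0 f1 \<phi> *v grad_theta_M f0 f1 \<phi>)) \<and>
      (let g0 = transpose (GKk_M f0 f1 \<phi>) *v pair tphi 1
       in grad_theta_M f0 f1 \<phi> \<bullet> (V0 f0 f1 \<phi> *v grad_theta_M f0 f1 \<phi>) =
          (1 / tE\<^sup>2) *
            (var f0 (\<lambda>x. exp (\<theta>0 * \<Lambda> x))
             + 2 * \<theta>0 * (g0 \<bullet> cross_cov f0 (Zc f0 \<phi>) (\<lambda>x. exp (\<theta>0 * \<Lambda> x)))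
             + \<theta>0\<^sup>2 * (g0 \<bullet> (V0_minus f0 \<phi> *v g0)))))
     \<and>
     \<comment> \<open>mode (E)\<close>
     (second_sample P f1 X W N1 lam \<longrightarrow>
      \<comment> \<open>(a)\<close>
      (AE \<omega> in P. (\<lambda>N. KE N \<omega>) \<longlonglongrightarrow> K) \<and>
      (let dY = (\<lambda>h. mom_u (part2 h) - mom_u (part1 h));
           dF = (\<lambda>h. mom_C (part1 h) + mom_C (part2 h));
           dK = (\<lambda>h. matrix_inv F *v (dY h - dF h *v K));
           dk0 = (\<lambda>h. - (1/2) * (dK h \<bullet> (u0 + u1))
                       - (1/2) * (K \<bullet> (mom_u (part1 h) + mom_u (part2 h))))
       in (K_map has_derivative dK) (at (join (eta f0 \<phi>) (eta f1 \<phi>))) \<and>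
          (Kk_map has_derivative (\<lambda>h. pair (dK h) (dk0 h)))
             (at (join (eta f0 \<phi>) (eta f1 \<phi>))) \<and>
          (J_map has_derivative (\<lambda>h. 2 * (K \<bullet> dY h) - K \<bullet> (dF h *v K)))
             (at (join (eta f0 \<phi>) (eta f1 \<phi>)))) \<and>
      asymp_mv_normal P (\<lambda>N \<omega>. sqrt (real N) *\<^sub>R (KE N \<omega> - K)) (Sigma_E f0 f1 \<phi> linv) \<and>
      asymp_mv_normal P (\<lambda>N \<omega>. sqrt (real N) *\<^sub>R (pair (KE N \<omega>) (kE N \<omega>) - pair K k0))
        (SigmaKk_E f0 f1 \<phi> linv) \<and>
      (let G0 = col_block1 (G_E f0 f1 \<phi>); G1 = col_block2 (G_E f0 f1 \<phi>)
       in Sigma_E f0 f1 \<phi> linv =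
            G0 ** V0_minus f0 \<phi> ** transpose G0 + linv *\<^sub>R (G1 ** V1 f1 \<phi> ** transpose G1)) \<and>
      \<comment> \<open>(b)\<close>
      (let Q = F - (1 / J) *\<^sub>R outer Y Y;
           q2 = (\<lambda>N \<omega>. (KE N \<omega> - K) \<bullet> (Q *v (KE N \<omega> - K)))
       in small_op P (\<lambda>N \<omega>. quotient_R Y F (KE N \<omega>) - (J - q2 N \<omega>)) q2) \<and>
      big_op P (\<lambda>N \<omega>. quotient_R Y F (KE N \<omega>) - J) (\<lambda>N. 1 / real N) \<and>
      (KL_finite f1 f0 \<longrightarrow>
         (let eE = (\<lambda>N \<omega>. e (pair (KE N \<omega>) (kE N \<omega>)) - e (pair K k0))
          in big_op P (\<lambda>N \<omega>. eE N \<omega> - grad_e f0 f1 \<phi> \<bullet> (pair (KE N \<omega>) (kE N \<omega>) - pair K k0))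
               (\<lambda>N. 1 / real N) \<and>
             big_op P eE (\<lambda>N. 1 / sqrt (real N)) \<and>
             asymp_normal P (\<lambda>N \<omega>. sqrt (real N) * eE N \<omega>)
               (grad_e f0 f1 \<phi> \<bullet> (SigmaKk_E f0 f1 \<phi> linv *v grad_e f0 f1 \<phi>)))) \<and>
      \<comment> \<open>(d)\<close>
      asymp_normal P (\<lambda>N \<omega>. sqrt (real N) * (JE N \<omega> - J))
        (padE (gradJ_E f0 f1 \<phi>) \<bullet> (V_E f0 f1 \<phi> linv *v padE (gradJ_E f0 f1 \<phi>))) \<and>
      asymp_normal P (\<lambda>N \<omega>. sqrt (real N) * (\<theta>E N \<omega> - \<theta>0))
        (grad_theta_E f0 f1 \<phi> \<bullet> (V_E f0 f1 \<phi> linv *v grad_theta_E f0 f1 \<phi>)) \<and>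
      (let g0 = transpose (col_block1 (GKk_E f0 f1 \<phi>)) *v pair tphi 1;
           g1 = transpose (col_block2 (GKk_E f0 f1 \<phi>)) *v pair tphi 1
       in grad_theta_E f0 f1 \<phi> \<bullet> (V_E f0 f1 \<phi> linv *v grad_theta_E f0 f1 \<phi>) =
          (1 / tE\<^sup>2) *
            (var f0 (\<lambda>x. exp (\<theta>0 * \<Lambda> x))
             + 2 * \<theta>0 * (g0 \<bullet> cross_cov f0 (Zc f0 \<phi>) (\<lambda>x. exp (\<theta>0 * \<Lambda> x)))
             + \<theta>0\<^sup>2 * (g0 \<bullet> (V0_minus f0 \<phi> *v g0)))
          + \<theta>0\<^sup>2 * linv / tE\<^sup>2 * (g1 \<bullet> (V1 f1 \<phi> *v g1))))"
proof -
  interpret Cal: calibration f0 f1 \<phi> P X \<delta>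
    using dens moments bdd Y \<delta> P X
    by (simp add: calibration_def calibration_axioms_def dictionary_def bounded_iid_def bounded_iid_axioms_def Y_def)
  let ?H = "\<lambda>N \<omega>. join (Cal.mom_hat \<delta> \<phi> N \<omega>) (eta f1 \<phi>)"
  interpret EM: estimation f0 f1 \<phi> P X ?H "\<lambda>N \<omega>. join (Cal.vec_sum (Z0 f0 f1 \<phi>) N \<omega>) 0" 0
    by (rule Cal.known_population)
  note population = u0_def u1_def C0_def C1_def F_def Y_def K_def k0_def J_def \<Lambda>_def \<theta>0_def tE_def tphi_def e_def
  have KM: "KM N \<omega> = K_map (?H N \<omega>)" for N \<omega>
    by (simp only: Cal.moment_maps_sample KM_def uh0_def Ch0_def population)
  \<comment> \<open>Stated with \<open>K_map\<close> in the first component, since as a rewrite rule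
    it meets the pair after \<open>KM\<close> has been replaced.\<close>
  have kM: "pair (K_map (?H N \<omega>)) (kM N \<omega>) = Kk_map (?H N \<omega>)" for N \<omega>
    by (simp only: Cal.moment_maps_sample kM_def uh0_def Ch0_def population)
  have JM: "JM N \<omega> = J_map (?H N \<omega>)" for N \<omega>
    by (simp only: JM_def KM_def Cal.moment_maps_sample uh0_def Ch0_def population)
  have \<theta>M: "\<theta>M N \<omega> = EM.theta_hat N \<omega>" for N \<omega>
    by (simp only: \<theta>M_def EM.theta_hat_def kM[symmetric] KM pair_parts)
  show ?thesis
  proof (rule conjI[OF _ conjI[OF _ conjI[OF _ conjI[OF _ conjI[OF _ conjI]]]]], goal_cases)
    case 1
    show ?case
      unfolding Let_def population(3) using quotient_maximum_expansion[of "cov f0 \<phi>" I B]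
      by (auto simp: I_def local_family_def cov_sym[OF Cal.dens0 Cal.\<phi>_bm] Cal.C0_posdef)
  next
    case 2
    show ?case
      unfolding population
      using Cal.efficiency_GDERIV Cal.grad_e_eq_0_iff Cal.grad_e_log_ratio by blast
  next
    case 3
    show ?case
      by (rule grad_e_nonzero_example)
  next
    case 4
    show ?case
      unfolding population by (rule Cal.theta_fun_GDERIV)
  next
    case 5
    show ?case
      unfolding Let_def Ch0_def population
    proof (rule allI, intro conjI)
      fix i
      let ?\<gamma> = "excess_kurtosis f0 (\<lambda>x. \<phi> x $ i)"
      show "integrable (law f0) (\<lambda>x. (\<phi> x $ i - expct f0 \<phi> $ i) ^ 4)"
        by (intro bm_integrable Cal.dens0 bm_intros Cal.\<phi>_bm)
      show "\<forall>N>0. sqrt ((?\<gamma> + 2) / real N) = 0 \<longleftrightarrow> ?\<gamma> = - 2"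
        by (simp add: add_eq_0_iff2)
    qed (rule Cal.variance_moments(4), rule Cal.sample_cov_relative_error(1), rule Cal.kurtosis_two_point,
        rule impI, rule Cal.sample_cov_relative_error(2), assumption)
  next
    case 6
    show ?case
      unfolding Let_def KM kM JM \<theta>M population
    proof (intro conjI impI allI)
      show "Sigma_M f0' f1' \<phi> = Sigma_M f0 f1 \<phi>"
        if "law f0' = law f0 \<and> expct f1' \<phi> = expct f1 \<phi> \<and> cov f1' \<phi> = cov f1 \<phi>" for f0' f1'
        using that by (intro Sigma_M_law_cong) auto
      show "Sigma_M f0 f1 \<phi> = G_M f0 f1 \<phi> ** V0_minus f0 \<phi> ** transpose (G_M f0 f1 \<phi>)"
        by (rule Cal.Sigma_M_blocks)
    \<comment> \<open>What remains are the results of \<open>estimation\<close> at weight 0; the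
      rewriting expresses each mode (M) covariance, gradient and variance by its mode (E)
      counterpart at that weight, where the second-sample term vanishes.\<close>
    qed (use Cal.known_population_derivatives EM.K_hat_AE EM.K_hat_normal EM.Kk_hat_normal EM.R_small_op EM.R_big_op
        EM.e_hat_remainder EM.e_hat_big_op EM.e_hat_normal EM.J_hat_normal EM.theta_hat_normal
        Cal.grad_theta_E_variance[of 0]
        in \<open>simp_all only: Cal.Sigma_M_eq Cal.SigmaKk_M_eq Cal.gradJ_M_variance Cal.grad_theta_M_variance
          EM.Q_def EM.q2_def[abs_def] EM.e_hat_def[abs_def] Cal.GKk_M_eq mult_zero_left mult_zero_right div_0 add_0_right\<close>)
  next
    case 7
    show ?case
    proof (rule impI, goal_cases)
      case 1
      then interpret two: two_samples f0 f1 \<phi> P X \<delta> W N1 lam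
        by unfold_locales
      interpret EE: estimation f0 f1 \<phi> P X two.pooled_moments two.pooled_sum two.linv
        by (rule two.estimated_population)
      have linv: "linv = two.linv" by (simp only: linv_def two.linv_def)
      have KE: "KE N \<omega> = K_map (two.pooled_moments N \<omega>)" for N \<omega>
        by (simp only: two.moment_maps_pooled KE_def uh0_def Ch0_def uh1_def Ch1_def)
      have kE: "pair (K_map (two.pooled_moments N \<omega>)) (kE N \<omega>) = Kk_map (two.pooled_moments N \<omega>)" for N \<omega>
        by (simp only: two.moment_maps_pooled kE_def uh0_def Ch0_def uh1_def Ch1_def)
      have JE: "JE N \<omega> = J_map (two.pooled_moments N \<omega>)" for N \<omega>
        by (simp only: JE_def KE_def two.moment_maps_pooled uh0_def Ch0_def uh1_def Ch1_def)
      have \<theta>E: "\<theta>E N \<omega> = EE.theta_hat N \<omega>" for N \<omega>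
        by (simp only: \<theta>E_def EE.theta_hat_def kE[symmetric] KE pair_parts)
      show ?case
        unfolding Let_def KE kE JE \<theta>E linv population
      proof (intro conjI impI)
      qed (use Cal.moment_map_derivatives EE.K_hat_AE EE.K_hat_normal EE.Kk_hat_normal EE.R_small_op EE.R_big_op
          EE.e_hat_remainder EE.e_hat_big_op EE.e_hat_normal EE.J_hat_normal EE.theta_hat_normal
          Cal.grad_theta_E_variance Cal.Sigma_E_blocks
          in \<open>simp_all only: EE.Q_def EE.q2_def[abs_def] EE.e_hat_def[abs_def]\<close>)
    qed
  qed
qed

end
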